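(* Let $x_0\in\partial\Omega$ (possibly $x_0=\infty$). Fix $x_1\in X$ and define $d_{x_0}\colon X^*\to[0,1]$ as follows: if $x_0\ne\infty$, then $d_{x_0}(x)=\min\{d(x,x_0),1\}$ for $x\ne\infty$ and $d_{x_0}(\infty)=1$; if $x_0=\infty$, then $d_\infty(x)=\exp(-d(x,x_1))$ for $x\ne\infty$ and $d_\infty(\infty)=0$. Then the following are equivalent: (a) The point $x_0$ is regular. (b) $\lim_{\Omega\ni y\to x_0}\overline P_\Omega d_{x_0}(y)=0$. (c) $\limsup_{\Omega\ni y\to x_0}\overline P_\Omega f(y)\le f(x_0)$ for all $f\colon\partial\Omega\to[-\infty,\infty)$ that are bounded from above on $\partial\Omega$ and upper semicontinuous at $x_0$. (d) $\lim_{\Omega\ni y\to x_0}\overline P_\Omega f(y)=f(x_0)$ for all $f\colon\partial\Omega\to\mathbb R$ that are bounded on $\partial\Omega$ and continuous at $x_0$. (e) $\limsup_{\Omega\ni y\to x_0}\overline P_\Omega f(y)\le f(x_0)$ for all $f\in C(\partial\Omega)$.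
   Context: Setting. $1<p<\infty$, and $(X,d,\mu)$ is a complete metric space with a positive complete Borel measure $\mu$ (defined on the completion of the Borel $\sigma$-algebra) such that $0<\mu(B)<\infty$ for every ball $B\subset X$. Balls are $B(x,r)=\{y\in X:d(x,y)<r\}$, and $\lambda B(x,r)=B(x,\lambda r)$. The measure is doubling: there is $C\ge1$ with $\mu(2B)\le C\mu(B)$ for all balls $B$. $X$ supports a $p$-Poincaré inequality: there are $C>0$, $\lambda\ge1$ such that, with $f_B=\mu(B)^{-1}\int_B f\,d\mu$, $\frac1{\mu(B)}\int_B|f-f_B|\,d\mu\le C\,\mathrm{diam}(B)\bigl(\frac1{\mu(\lambda B)}\int_{\lambda B}g^p\,d\mu\bigr)^{1/p}$ for all balls $B$, all integrable $f$ on $X$ and all $p$-weak upper gradients $g$ of $f$. $\Omega\subset X$ is a nonempty, possibly unbounded, open set with $C_p(X\setminus\Omega)>0$. Function spaces. A measurable $g\colon X\to[0,\infty]$ is a $p$-weak upper gradient of $f\colon X\to[-\infty,\infty]$ if $|f(\gamma(0))-f(\gamma(l_\gamma))|\le\int_\gamma g\,ds$ (left side read as $\infty$ if one of its terms is infinite) for $p$-almost every nonconstant rectifiable curve $\gamma\colon[0,l_\gamma]\to X$ (parametrized by arc length), i.e. for all curves except a family $\Gamma$ for which there is $0\le\rho\in L^p(X)$ with $\int_\gamma\rho\,ds=\infty$ for every $\gamma\in\Gamma$. $D^p(X)$ is the set of everywhere defined measurable extended real-valued functions having a $p$-weak upper gradient in $L^p(X)$; $N^{1,p}(X)$ is the set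 of everywhere defined extended real-valued $f\in L^p(X)$ with $\|f\|_{N^{1,p}(X)}=(\int_X|f|^p\,d\mu+\inf_g\int_Xg^p\,d\mu)^{1/p}<\infty$, infimum over all $p$-weak upper gradients $g$ of $f$. For measurable $A\subset X$, $D^p(A)$ is defined by regarding $A$ as a metric measure space. $g_f$ is the minimal (a.e. smallest) $p$-weak upper gradient of $f$. The capacity is $C_p(E)=\inf\|f\|^p_{N^{1,p}(X)}$ over $f\in N^{1,p}(X)$ with $f\ge1$ on $E$. $D^p_0(E)=\{f|_E:f\in D^p(X),\ f=0\text{ in }X\setminus E\}$. Superharmonic functions. For nonempty open $V\subset X$ with $C_p(X\setminus V)>0$ and $f\in D^p(V)$, the $p$-harmonic extension $H_Vf$ is the unique continuous function $u\in D^p(V)$ with $u-f\in D^p_0(V)$ minimizing $\int_Vg_v^p\,d\mu$ among all $v\in D^p(V)$ with $v-f\in D^p_0(V)$. $u\colon\Omega\to(-\infty,\infty]$ is superharmonic in $\Omega$ if (i) $u$ is lower semicontinuous; (ii) $u$ is not identically $\infty$ in any component of $\Omega$; (iii) for every nonempty open $V$ with $\overline V$ a compact subset of $\Omega$ and every Lipschitz function $v$ on $\overline V$ with $v\le u$ on $\partial V$, we have $H_Vv\le u$ in $V$. Boundary convention. If $\Omega$ is unbounded, then the point $\infty$ belongs to $\partial\Omega$; topological notions are understood in the one-point compactification $X^*=X\cup\{\infty\}$. Functions in $C(\partial\Omega)$ are real-valued. Regularity. For $f\colon\partial\Omega\to[-\infty,\infty]$, the upper Perron solution is $\overline P_\Omega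 f(x)=\inf_u u(x)$, $x\in\Omega$, infimum over all superharmonic $u$ in $\Omega$ that are bounded from below and satisfy $\liminf_{\Omega\ni y\to x}u(y)\ge f(x)$ for all $x\in\partial\Omega$. For a function defined on a larger set, such as $d_{x_0}$, its restriction to $\partial\Omega$ is used. A point $x_0\in\partial\Omega$ is regular if $\lim_{\Omega\ni y\to x_0}\overline P_\Omega f(y)=f(x_0)$ for all $f\in C(\partial\Omega)$. *)

theory Defs
  imports "HOL-Analysis.Analysis"
begin

section \<open>Metric measure spaces\<close>

text \<open>The metric space \<open>X\<close> is the type \<open>'a\<close>.  A function on a set \<open>A \<subseteq> X\<close> is represented by a
  function on \<open>'a\<close> of which only the values on \<open>A\<close> are used.\<close>

definition complete_borel_measure :: "'a::topological_space measure \<Rightarrow> bool" where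
  "complete_borel_measure \<mu> \<longleftrightarrow> (\<exists>\<nu>. sets \<nu> = sets borel \<and> \<mu> = completion \<nu>)"

definition positive_finite_on_balls :: "'a::metric_space measure \<Rightarrow> bool" where
  "positive_finite_on_balls \<mu> \<longleftrightarrow>
     (\<forall>x r. 0 < r \<longrightarrow> 0 < emeasure \<mu> (ball x r) \<and> emeasure \<mu> (ball x r) < \<infinity>)"

definition doubling_measure :: "'a::metric_space measure \<Rightarrow> bool" where
  "doubling_measure \<mu> \<longleftrightarrow>
     (\<exists>C::real. 1 \<le> C \<and>
        (\<forall>x r. 0 < r \<longrightarrow> emeasure \<mu> (ball x (2 * r)) \<le> ennreal C * emeasure \<mu> (ball x r)))"

text \<open>Real power on \<open>[0,\<infinity>]\<close>, intended for positive exponents.\<close>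

definition epowr :: "ennreal \<Rightarrow> real \<Rightarrow> ennreal" where
  "epowr x a = (if x = \<infinity> then \<infinity> else ennreal (enn2real x powr a))"


section \<open>Curves\<close>

definition curve_length :: "(real \<Rightarrow> 'a::metric_space) \<Rightarrow> real \<Rightarrow> real \<Rightarrow> ennreal" where
  "curve_length \<gamma> a b =
     (SUP (n, s) \<in> {(n::nat, s). (\<forall>i\<le>n. s i \<in> {a..b}) \<and> (\<forall>i<n. s i \<le> s (Suc i))}.
        \<Sum>i<n. ennreal (dist (\<gamma> (s i)) (\<gamma> (s (Suc i)))))"

text \<open>A nonconstant rectifiable curve \<open>\<gamma> : [0,l] \<rightarrow> A\<close> parametrized by arc length is a pair
  \<open>(l, \<gamma>)\<close>; the values of \<open>\<gamma>\<close> outside \<open>[0,l]\<close> are irrelevant.\<close>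

definition arclength_curves :: "'a::metric_space set \<Rightarrow> (real \<times> (real \<Rightarrow> 'a)) set" where
  "arclength_curves A =
     {(l, \<gamma>). 0 < l \<and> continuous_on {0..l} \<gamma> \<and> \<gamma> ` {0..l} \<subseteq> A \<and>
             (\<forall>t\<in>{0..l}. curve_length \<gamma> 0 t = ennreal t)}"

text \<open>If \<open>g \<circ> \<gamma>\<close> is not measurable, this is a lower integral.  For \<open>\<mu>\<close>-measurable \<open>g\<close> this
  happens only on a \<open>p\<close>-exceptional family of curves, so the notions below are not affected.\<close>

definition curve_integral :: "real \<Rightarrow> (real \<Rightarrow> 'a) \<Rightarrow> ('a \<Rightarrow> ennreal) \<Rightarrow> ennreal" where
  "curve_integral l \<gamma> g = (\<integral>\<^sup>+t\<in>{0..l}. g (\<gamma> t) \<partial>lborel)"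


section \<open>Weak upper gradients and Newtonian spaces\<close>

text \<open>The parameter \<open>A\<close> is the set that is regarded as a metric measure space.\<close>

definition nonneg_Lp :: "real \<Rightarrow> 'a measure \<Rightarrow> 'a set \<Rightarrow> ('a \<Rightarrow> ennreal) \<Rightarrow> bool" where
  "nonneg_Lp p \<mu> A \<rho> \<longleftrightarrow>
     \<rho> \<in> borel_measurable (restrict_space \<mu> A) \<and>
     (\<integral>\<^sup>+x. epowr (\<rho> x) p \<partial>restrict_space \<mu> A) < \<infinity>"

definition p_exceptional ::
    "real \<Rightarrow> 'a::metric_space measure \<Rightarrow> 'a set \<Rightarrow> (real \<times> (real \<Rightarrow> 'a)) set \<Rightarrow> bool" where
  "p_exceptional p \<mu> A \<Gamma> \<longleftrightarrow>
     (\<exists>\<rho>. nonneg_Lp p \<mu> A \<rho> \<and> (\<forall>(l, \<gamma>)\<in>\<Gamma>. curve_integral l \<gamma> \<rho> = \<infinity>))"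

definition jump :: "ereal \<Rightarrow> ereal \<Rightarrow> ennreal" where
  "jump a b = (if \<bar>a\<bar> = \<infinity> \<or> \<bar>b\<bar> = \<infinity> then \<infinity>
               else ennreal \<bar>real_of_ereal a - real_of_ereal b\<bar>)"

definition weak_upper_gradient ::
    "real \<Rightarrow> 'a::metric_space measure \<Rightarrow> 'a set \<Rightarrow> ('a \<Rightarrow> ereal) \<Rightarrow> ('a \<Rightarrow> ennreal) \<Rightarrow> bool" where
  "weak_upper_gradient p \<mu> A f g \<longleftrightarrow>
     g \<in> borel_measurable (restrict_space \<mu> A) \<and>
     (\<exists>\<Gamma>. p_exceptional p \<mu> A \<Gamma> \<and>
        (\<forall>(l, \<gamma>)\<in>arclength_curves A - \<Gamma>. jump (f (\<gamma> 0)) (f (\<gamma> l)) \<le> curve_integral l \<gamma> g))"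

definition Dp :: "real \<Rightarrow> 'a::metric_space measure \<Rightarrow> 'a set \<Rightarrow> ('a \<Rightarrow> ereal) \<Rightarrow> bool" where
  "Dp p \<mu> A f \<longleftrightarrow>
     f \<in> borel_measurable (restrict_space \<mu> A) \<and>
     (\<exists>g. nonneg_Lp p \<mu> A g \<and> weak_upper_gradient p \<mu> A f g)"

definition Dp0 :: "real \<Rightarrow> 'a::metric_space measure \<Rightarrow> 'a set \<Rightarrow> ('a \<Rightarrow> ereal) \<Rightarrow> bool" where
  "Dp0 p \<mu> E f \<longleftrightarrow>
     (\<exists>h. Dp p \<mu> UNIV h \<and> (\<forall>x\<in>- E. h x = 0) \<and> (\<forall>x\<in>E. h x = f x))"

text \<open>Minimality is among the \<open>p\<close>-weak upper gradients in \<open>L\<^sup>p\<close>: without this restriction the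
  a.e. infimum may be smaller (on the real line, \<open>\<epsilon> g\<close> is an upper gradient of every real-valued
  function whenever \<open>g\<close> is nonnegative, a.e. finite and has infinite integral over every interval).\<close>

definition minimal_weak_upper_gradient ::
    "real \<Rightarrow> 'a::metric_space measure \<Rightarrow> 'a set \<Rightarrow> ('a \<Rightarrow> ereal) \<Rightarrow> ('a \<Rightarrow> ennreal)" where
  "minimal_weak_upper_gradient p \<mu> A f =
     (SOME g. nonneg_Lp p \<mu> A g \<and> weak_upper_gradient p \<mu> A f g \<and>
        (\<forall>g'. nonneg_Lp p \<mu> A g' \<and> weak_upper_gradient p \<mu> A f g' \<longrightarrow>
              (AE x in restrict_space \<mu> A. g x \<le> g' x)))"

definition N1p_norm :: "real \<Rightarrow> 'a::metric_space measure \<Rightarrow> ('a \<Rightarrow> ereal) \<Rightarrow> ennreal" where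
  "N1p_norm p \<mu> f =
     epowr ((\<integral>\<^sup>+x. epowr (e2ennreal \<bar>f x\<bar>) p \<partial>\<mu>) +
            (INF g\<in>{g. weak_upper_gradient p \<mu> UNIV f g}. \<integral>\<^sup>+x. epowr (g x) p \<partial>\<mu>)) (1 / p)"

definition N1p :: "real \<Rightarrow> 'a::metric_space measure \<Rightarrow> ('a \<Rightarrow> ereal) \<Rightarrow> bool" where
  "N1p p \<mu> f \<longleftrightarrow> f \<in> borel_measurable \<mu> \<and> N1p_norm p \<mu> f < \<infinity>"

definition capacity :: "real \<Rightarrow> 'a::metric_space measure \<Rightarrow> 'a set \<Rightarrow> ennreal" where
  "capacity p \<mu> E = (INF f\<in>{f. N1p p \<mu> f \<and> (\<forall>x\<in>E. 1 \<le> f x)}. epowr (N1p_norm p \<mu> f) p)"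

text \<open>In the Poincare inequality the integrable functions are extended real-valued; they are finite
  almost everywhere, so \<open>real_of_ereal\<close> does not change the mean value.\<close>

definition mean_value :: "'a measure \<Rightarrow> 'a set \<Rightarrow> ('a \<Rightarrow> ereal) \<Rightarrow> real" where
  "mean_value \<mu> B f = (LINT x:B|\<mu>. real_of_ereal (f x)) / measure \<mu> B"

definition supports_Poincare :: "real \<Rightarrow> 'a::metric_space measure \<Rightarrow> bool" where
  "supports_Poincare p \<mu> \<longleftrightarrow>
     (\<exists>(C::real) (\<tau>::real). 0 < C \<and> 1 \<le> \<tau> \<and>
        (\<forall>x r f g. 0 < r \<and>
           f \<in> borel_measurable \<mu> \<and> (\<integral>\<^sup>+y. e2ennreal \<bar>f y\<bar> \<partial>\<mu>) < \<infinity> \<and>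
           weak_upper_gradient p \<mu> UNIV f g \<longrightarrow>
           (\<integral>\<^sup>+y\<in>ball x r. e2ennreal \<bar>f y - ereal (mean_value \<mu> (ball x r) f)\<bar> \<partial>\<mu>)
               / emeasure \<mu> (ball x r)
           \<le> ennreal (C * diameter (ball x r)) *
              epowr ((\<integral>\<^sup>+y\<in>ball x (\<tau> * r). epowr (g y) p \<partial>\<mu>) / emeasure \<mu> (ball x (\<tau> * r)))
                    (1 / p)))"


section \<open>Superharmonic functions\<close>

definition p_energy :: "real \<Rightarrow> 'a::metric_space measure \<Rightarrow> 'a set \<Rightarrow> ('a \<Rightarrow> ereal) \<Rightarrow> ennreal" where
  "p_energy p \<mu> V v =
     (\<integral>\<^sup>+x. epowr (minimal_weak_upper_gradient p \<mu> V v x) p \<partial>restrict_space \<mu> V)"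

definition is_p_harmonic_extension ::
    "real \<Rightarrow> 'a::metric_space measure \<Rightarrow> 'a set \<Rightarrow> ('a \<Rightarrow> ereal) \<Rightarrow> ('a \<Rightarrow> real) \<Rightarrow> bool" where
  "is_p_harmonic_extension p \<mu> V f u \<longleftrightarrow>
     continuous_on V u \<and> Dp p \<mu> V (\<lambda>x. ereal (u x)) \<and> Dp0 p \<mu> V (\<lambda>x. ereal (u x) - f x) \<and>
     (\<forall>v. Dp p \<mu> V v \<and> Dp0 p \<mu> V (\<lambda>x. v x - f x) \<longrightarrow>
          p_energy p \<mu> V (\<lambda>x. ereal (u x)) \<le> p_energy p \<mu> V v)"

text \<open>The value \<open>0\<close> outside \<open>V\<close> is a normalization that makes the function on \<open>V\<close> a unique object
  of type \<open>'a \<Rightarrow> real\<close>.\<close>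

definition p_harmonic_extension ::
    "real \<Rightarrow> 'a::metric_space measure \<Rightarrow> 'a set \<Rightarrow> ('a \<Rightarrow> ereal) \<Rightarrow> ('a \<Rightarrow> real)" where
  "p_harmonic_extension p \<mu> V f =
     (THE u. is_p_harmonic_extension p \<mu> V f u \<and> (\<forall>x\<in>- V. u x = 0))"

definition superharmonic ::
    "real \<Rightarrow> 'a::metric_space measure \<Rightarrow> 'a set \<Rightarrow> ('a \<Rightarrow> ereal) \<Rightarrow> bool" where
  "superharmonic p \<mu> \<Omega> u \<longleftrightarrow>
     (\<forall>x\<in>\<Omega>. u x \<noteq> -\<infinity>) \<and>
     (\<forall>x\<in>\<Omega>. u x \<le> Liminf (at x within \<Omega>) u) \<and>
     (\<forall>W\<in>components \<Omega>. \<exists>x\<in>W. u x \<noteq> \<infinity>) \<and>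
     (\<forall>V (v::'a \<Rightarrow> real) L.
        open V \<and> V \<noteq> {} \<and> compact (closure V) \<and> closure V \<subseteq> \<Omega> \<and>
        L-lipschitz_on (closure V) v \<and> (\<forall>x\<in>frontier V. ereal (v x) \<le> u x) \<longrightarrow>
        (\<forall>x\<in>V. ereal (p_harmonic_extension p \<mu> V (\<lambda>y. ereal (v y)) x) \<le> u x))"


section \<open>Boundary and Perron solutions\<close>

text \<open>The one-point compactification \<open>X\<^sup>* = X \<union> {\<infinity>}\<close> is modelled on \<open>'a option\<close>, with \<open>None\<close>
  for \<open>\<infinity>\<close>.\<close>

abbreviation Xstar :: "'a::metric_space option topology" where
  "Xstar \<equiv> Alexandroff_compactification euclidean"

definition boundary :: "'a::metric_space set \<Rightarrow> 'a option set" where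
  "boundary \<Omega> = Some ` frontier \<Omega> \<union> (if bounded \<Omega> then {} else {None})"

text \<open>The filter \<open>\<Omega> \<ni> y \<rightarrow> x\<close> for \<open>x \<in> X\<^sup>*\<close>.\<close>

definition approach :: "'a::metric_space set \<Rightarrow> 'a option \<Rightarrow> 'a filter" where
  "approach \<Omega> x = filtercomap Some (atin_within Xstar x (Some ` \<Omega>))"

definition upper_Perron ::
    "real \<Rightarrow> 'a::metric_space measure \<Rightarrow> 'a set \<Rightarrow> ('a option \<Rightarrow> ereal) \<Rightarrow> 'a \<Rightarrow> ereal" where
  "upper_Perron p \<mu> \<Omega> f x =
     (INF u\<in>{u. superharmonic p \<mu> \<Omega> u \<and> (\<exists>m::real. \<forall>y\<in>\<Omega>. ereal m \<le> u y) \<and>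
                (\<forall>z\<in>boundary \<Omega>. f z \<le> Liminf (approach \<Omega> z) u)}. u x)"

definition continuous_on_boundary :: "'a::metric_space set \<Rightarrow> ('a option \<Rightarrow> real) \<Rightarrow> bool" where
  "continuous_on_boundary \<Omega> f \<longleftrightarrow> continuous_map (subtopology Xstar (boundary \<Omega>)) euclideanreal f"

definition regular_point ::
    "real \<Rightarrow> 'a::metric_space measure \<Rightarrow> 'a set \<Rightarrow> 'a option \<Rightarrow> bool" where
  "regular_point p \<mu> \<Omega> x0 \<longleftrightarrow>
     (\<forall>f. continuous_on_boundary \<Omega> f \<longrightarrow>
        (upper_Perron p \<mu> \<Omega> (\<lambda>z. ereal (f z)) \<longlongrightarrow> ereal (f x0)) (approach \<Omega> x0))"

fun dist_fun :: "'a::metric_space \<Rightarrow> 'a option \<Rightarrow> 'a option \<Rightarrow> real" where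
  "dist_fun x1 (Some x0) (Some x) = min (dist x x0) 1"
| "dist_fun x1 (Some x0) None = 1"
| "dist_fun x1 None (Some x) = exp (- dist x x1)"
| "dist_fun x1 None None = 0"

end

theory Submission
  imports Defs
begin

text \<open>The equivalences rest on two properties of superharmonic functions.  First, \<open>a u + c\<close> is superharmonic
  for \<open>a > 0\<close>; as \<open>d\<close> is bounded away from \<open>0\<close> outside any neighbourhood of \<open>x0\<close>, a boundary function \<open>f\<close> as
  in (c) is at most \<open>a d + c\<close> with \<open>c\<close> close to \<open>f x0\<close>, and (b) implies (c).  Second, if the boundary values of
  \<open>u\<close> dominate \<open>f\<close> and those of \<open>w\<close> dominate \<open>- f\<close>, then \<open>0 \<le> u + w\<close>: on the boundary of a relatively
  compact open set there is a Lipschitz function between \<open>- w - \<epsilon>\<close> and \<open>u\<close>, to be extended harmonically.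
  So the upper Perron solution of \<open>f\<close> is bounded from below by minus that of \<open>- f\<close>, and upper estimates
  for both give limits.

  All this needs that the harmonic extension of a Lipschitz function exists, is unique and commutes with affine
  maps.  Existence follows by the direct method and uniqueness from strict convexity and the positive capacity
  of the complement; the continuity required in the definition is De Giorgi's theorem, whose ingredients are a
  Caccioppoli inequality and a weak Sobolev inequality that follows from doubling and the Poincare inequality.\<close>

section \<open>Gradients on an interval\<close>

text \<open>The obstacle is that superharmonicity is tested with
  \<open>p_harmonic_extension\<close>, a definite description: until it is known to denote a
  continuous minimizer, the comparison condition cannot be evaluated at all. This is why interior
  regularity theory enters a statement about Perron solutions. Two devices carry it. Gradients are
  put into an integral form that holds on every subcurve of each curve outside one exceptional
  family; sums, products, maxima and limits of functions are then treated as functions of one real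
  variable. In De Giorgi's iteration the Sobolev estimate has the same exponent p on both sides. The
  gain usually drawn from a higher exponent is drawn from radii that shrink like 4^-j, while the
  levels and balls change only like 2^-j; the decay of measure already obtained supplies the density
  bound that the estimate requires at these small radii.\<close>

abbreviation nnint :: "real set => (real => ennreal) => ennreal" where
  "nnint S G \<equiv> \<integral>\<^sup>+t\<in>S. G t \<partial>lborel"

abbreviation borel_on :: "'a::topological_space set => ('a => ennreal) => bool" where
  "borel_on S G \<equiv> (\<lambda>t. G t * indicator S t) \<in> borel_measurable borel"

text \<open>An integral form of: \<open>F\<close> is absolutely continuous on [0,l] with |F'| \<le>
  \<open>G\<close> almost everywhere. Measurability is asked of \<open>G\<close> only on the
  interval, because a curve is continuous only there.\<close>

definition igrad :: "real => (real => real) => (real => ennreal) => bool" where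
  "igrad l F G \<longleftrightarrow>
     borel_on {0..l} G \<and>
     nnint {0..l} G < \<infinity> \<and>
     (\<forall>s t. 0 \<le> s --> s \<le> t --> t \<le> l --> ennreal \<bar>F s - F t\<bar> \<le> nnint {s..t} G)"

lemma igradD:
  assumes "igrad l F G"
  shows "borel_on {0..l} G"
    and "nnint {0..l} G < \<infinity>"
    and "\<And>s t. 0 \<le> s ==> s \<le> t ==> t \<le> l ==> ennreal \<bar>F s - F t\<bar> \<le> nnint {s..t} G"
  using assms unfolding igrad_def by auto

lemma set_borel_subinterval:
  fixes G :: "real => ennreal"
  assumes "borel_on {0..l} G" "0 \<le> s" "t \<le> l"
  shows "borel_on {s..t} G"
proof -
  have "(\<lambda>\<tau>. (G \<tau> * indicator {0..l} \<tau>) * indicator {s..t} \<tau>) \<in> borel_measurable borel"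
    using assms(1) by measurable
  moreover have "(G \<tau> * indicator {0..l} \<tau>) * indicator {s..t} \<tau> = G \<tau> * indicator {s..t} \<tau>" for \<tau>
    using assms by (auto simp: indicator_def)
  ultimately show ?thesis by simp
qed

lemma set_nn_integral_interval_split:
  fixes G :: "real => ennreal"
  assumes m: "borel_on {0..l} G" and "0 \<le> a" "a \<le> b" "b \<le> c" "c \<le> l"
  shows "nnint {a..c} G = nnint {a..b} G + nnint {b..c} G"
proof -
  have "nnint {a..c} G
      = (\<integral>\<^sup>+\<tau>. G \<tau> * indicator {a..b} \<tau> + G \<tau> * indicator {b..c} \<tau> \<partial>lborel)"
  proof (rule nn_integral_cong_AE)
    have "AE \<tau> in lborel. \<tau> \<noteq> b" by (rule AE_lborel_singleton)
    then show "AE \<tau> in lborel. G \<tau> * indicator {a..c} \<tau> = G \<tau> * indicator {a..b} \<tau> + G \<tau> * indicator {b..c} \<tau>"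
      by eventually_elim (use assms in \<open>auto simp: indicator_def\<close>)
  qed
  also have "\<dots> = nnint {a..b} G + nnint {b..c} G"
    using set_borel_subinterval[OF m, of a b] set_borel_subinterval[OF m, of b c] assms
    by (intro nn_integral_add) auto
  finally show ?thesis .
qed

text \<open>The intervals between \<open>x n\<close> and \<open>a\<close> shrink to the null set
  {a}, and \<open>G\<close> is integrable on [0,l], so the integrals of \<open>G\<close> over them
  tend to 0.\<close>

lemma igrad_continuous:
  assumes g: "igrad l F G"
  shows "continuous_on {0..l} F"
  unfolding continuous_on_sequentially
proof (intro allI ballI impI, elim conjE)
  fix x a assume a: "a \<in> {0..l}" and x: "\<forall>n. x n \<in> {0..l}" and lim: "x \<longlonglongrightarrow> a"
  let ?I = "\<lambda>n. {min (x n) a..max (x n) a}"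
  have m: "(\<lambda>\<tau>. G \<tau> * indicator (?I n) \<tau>) \<in> borel_measurable lborel" for n
    using set_borel_subinterval[OF igradD(1)[OF g], of "min (x n) a" "max (x n) a"] a x by auto
  have "(\<lambda>n. \<integral>\<^sup>+\<tau>\<in>?I n. G \<tau> \<partial>lborel) \<longlonglongrightarrow> (\<integral>\<^sup>+\<tau>. 0 \<partial>(lborel::real measure))"
  proof (rule nn_integral_dominated_convergence)
    show "(\<lambda>\<tau>. G \<tau> * indicator (?I n) \<tau>) \<in> borel_measurable lborel" for n by (rule m)
    show "(\<lambda>\<tau>. G \<tau> * indicator {0..l} \<tau>) \<in> borel_measurable lborel" using igradD(1)[OF g] by simp
    show "nnint {0..l} G < \<infinity>" by (rule igradD(2)[OF g])
    show "AE \<tau> in lborel. G \<tau> * indicator (?I n) \<tau> \<le> G \<tau> * indicator {0..l} \<tau>" for n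
      using a x by (intro AE_I2) (auto simp: indicator_def dest: spec[of _ n])
    have "AE \<tau> in lborel. \<tau> \<noteq> a" by (rule AE_lborel_singleton)
    then show "AE \<tau> in lborel. (\<lambda>n. G \<tau> * indicator (?I n) \<tau>) \<longlonglongrightarrow> 0"
    proof eventually_elim
      fix \<tau> assume "\<tau> \<noteq> a"
      then have "eventually (\<lambda>n. dist (x n) a < dist \<tau> a) sequentially"
        using lim by (auto simp: tendsto_iff)
      then have "eventually (\<lambda>n. G \<tau> * indicator (?I n) \<tau> = 0) sequentially"
        by eventually_elim (auto simp: indicator_def dist_real_def)
      then show "(\<lambda>n. G \<tau> * indicator (?I n) \<tau>) \<longlonglongrightarrow> 0" by (simp add: tendsto_eventually)
    qed
  qed auto
  then have *: "(\<lambda>n. \<integral>\<^sup>+\<tau>\<in>?I n. G \<tau> \<partial>lborel) \<longlonglongrightarrow> 0" by simp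
  have "ennreal \<bar>F (x n) - F a\<bar> \<le> (\<integral>\<^sup>+\<tau>\<in>?I n. G \<tau> \<partial>lborel)" for n
  proof (cases "x n \<le> a")
    case True
    then show ?thesis using igradD(3)[OF g, of "x n" a] a x by (auto simp: min_def max_def)
  next
    case False
    then show ?thesis using igradD(3)[OF g, of a "x n"] a x by (auto simp: min_def max_def abs_minus_commute)
  qed
  then have "(\<lambda>n. ennreal \<bar>F (x n) - F a\<bar>) \<longlonglongrightarrow> 0"
    by (intro tendsto_sandwich[OF _ _ tendsto_const *]) auto
  then have "(\<lambda>n. \<bar>F (x n) - F a\<bar>) \<longlonglongrightarrow> 0"
    using tendsto_ennreal_iff[of "\<lambda>n. \<bar>F (x n) - F a\<bar>" sequentially 0] by simp
  then have "(\<lambda>n. F (x n) - F a) \<longlonglongrightarrow> 0" by (simp add: tendsto_rabs_zero_iff)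
  then show "(F \<circ> x) \<longlonglongrightarrow> F a" by (simp add: LIM_zero_iff o_def)
qed

section \<open>Calculus rules from a local gradient inequality\<close>

lemma ennreal_le_all_scaled:
  fixes x k q :: ennreal
  assumes "q < \<infinity>" and "\<And>e::real. 0 < e ==> x \<le> k + ennreal e * q"
  shows "x \<le> k"
proof (rule ennreal_le_epsilon)
  fix e :: real assume "0 < e"
  obtain r where r: "0 \<le> r" "q = ennreal r" using assms(1) by (cases q) auto
  \<comment> \<open>Dividing by r + 1 instead of r covers \<open>q\<close> = 0.\<close>
  have "x \<le> k + ennreal (e / (r + 1)) * q" using assms(2)[of "e/(r+1)"] r \<open>0 < e\<close> by auto
  also have "ennreal (e / (r + 1)) * q = ennreal (e * r / (r + 1))"
    using r \<open>0 < e\<close> by (simp add: ennreal_mult'[symmetric])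
  also have "\<dots> \<le> ennreal e" using r \<open>0 < e\<close> by (auto simp: field_simps intro!: ennreal_leI)
  finally show "x \<le> k + ennreal e" by (simp add: add_left_mono)
qed

text \<open>A local form of the gradient inequality with an arbitrarily small error suffices, by the bisection
  principle.  All rules of the calculus below are reduced to this.\<close>

lemma igrad_local:
  fixes K Q :: "real => ennreal"
  assumes K: "borel_on {0..l} K"
    and Kf: "nnint {0..l} K < \<infinity>"
    and Q: "borel_on {0..l} Q"
    and Qf: "nnint {0..l} Q < \<infinity>"
    and loc: "\<And>\<tau> e::real. 0 \<le> \<tau> ==> \<tau> \<le> l ==> 0 < e ==> \<exists>d>0. \<forall>s t. 0 \<le> s --> s \<le> \<tau> --> \<tau> \<le> t --> t \<le> l --> t - s < d -->
        ennreal \<bar>H s - H t\<bar> \<le> nnint {s..t} K + ennreal e * nnint {s..t} Q"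
  shows "igrad l H K"
  unfolding igrad_def
proof (intro conjI allI impI K Kf)
  fix s t :: real assume st: "0 \<le> s" "s \<le> t" "t \<le> l"
  show "ennreal \<bar>H s - H t\<bar> \<le> nnint {s..t} K"
  proof (rule ennreal_le_all_scaled)
    have "nnint {s..t} Q \<le> nnint {0..l} Q"
      using st by (intro nn_integral_mono) (auto simp: indicator_def)
    then show "nnint {s..t} Q < \<infinity>" using Qf by auto
    fix e :: real assume e: "0 < e"
    define P where "P a b \<longleftrightarrow> (0 \<le> a --> a \<le> b --> b \<le> l --> ennreal \<bar>H a - H b\<bar> \<le>
       nnint {a..b} K + ennreal e * nnint {a..b} Q)" for a b
    \<comment> \<open>Both the integral of \<open>K\<close> and the error term are additive over
      adjacent intervals, so the local bound spreads to [s,t] without the error factor e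
      growing.\<close>
    have "P s t"
      using st(2)
    proof (induction rule: Bolzano)
      case (trans a b c)
      show ?case unfolding P_def
      proof (intro impI)
        assume ac: "0 \<le> a" "a \<le> c" "c \<le> l"
        have "ennreal \<bar>H a - H c\<bar> \<le> ennreal (\<bar>H a - H b\<bar> + \<bar>H b - H c\<bar>)" by (intro ennreal_leI) linarith
        also have "\<dots> = ennreal \<bar>H a - H b\<bar> + ennreal \<bar>H b - H c\<bar>" by simp
        also have "\<dots> \<le> (nnint {a..b} K + ennreal e * nnint {a..b} Q) +
            (nnint {b..c} K + ennreal e * nnint {b..c} Q)"
          using trans ac unfolding P_def by (intro add_mono) auto
        also have "\<dots> = nnint {a..c} K + ennreal e * nnint {a..c} Q"
          using set_nn_integral_interval_split[OF K, of a b c] set_nn_integral_interval_split[OF Q, of a b c] trans ac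
          by (simp add: algebra_simps)
        finally show "ennreal \<bar>H a - H c\<bar> \<le> \<dots>" .
      qed
    next
      case (local x)
      obtain d where d: "d > 0" "\<And>s t. 0 \<le> s ==> s \<le> x ==> x \<le> t ==> t \<le> l ==> t - s < d ==>
        ennreal \<bar>H s - H t\<bar> \<le> nnint {s..t} K + ennreal e * nnint {s..t} Q"
        using loc[of x e] local st e by auto
      then show ?case unfolding P_def by (intro exI[of _ d]) auto
    qed
    then show "ennreal \<bar>H s - H t\<bar> \<le> nnint {s..t} K + ennreal e * nnint {s..t} Q"
      using st unfolding P_def by auto
  qed
qed

lemma continuous_times_borel:
  fixes G :: "real => ennreal"
  assumes "borel_on S G" "continuous_on S \<alpha>" "S \<in> sets borel"
  shows "(\<lambda>t. ennreal (\<alpha> t) * G t * indicator S t) \<in> borel_measurable borel"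
proof -
  have "(\<lambda>t. ennreal (indicator S t *\<^sub>R \<alpha> t) * (G t * indicator S t)) \<in> borel_measurable borel"
    using borel_measurable_continuous_on_indicator[OF assms(3,2)] assms(1) by measurable
  moreover have "ennreal (indicator S t *\<^sub>R \<alpha> t) * (G t * indicator S t) = ennreal (\<alpha> t) * G t * indicator S t" for t
    by (auto simp: indicator_def)
  ultimately show ?thesis by simp
qed

lemma set_nn_integral_bounded_times:
  fixes G :: "real => ennreal"
  assumes "borel_on S G"
    "nnint S G < \<infinity>" "\<And>t. t \<in> S ==> \<alpha> t \<le> (C::real)"
  shows "nnint S (\<lambda>\<tau>. ennreal (\<alpha> \<tau>) * G \<tau>) < \<infinity>"
proof -
  have "nnint S (\<lambda>\<tau>. ennreal (\<alpha> \<tau>) * G \<tau>) \<le> (\<integral>\<^sup>+\<tau>. ennreal C * (G \<tau> * indicator S \<tau>) \<partial>lborel)"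
    using assms(3) by (intro nn_integral_mono) (auto simp: indicator_def intro!: mult_right_mono ennreal_leI)
  also have "\<dots> = ennreal C * nnint S G"
    using assms(1) by (intro nn_integral_cmult) auto
  also have "\<dots> < \<infinity>" using assms(2) by (simp add: ennreal_mult_less_top)
  finally show ?thesis .
qed

text \<open>Common source of the rules for sums, products and smooth compositions: a linearization
  at \<tau> with coefficients \<open>\<alpha> \<tau>\<close> and \<open>\<beta> \<tau>\<close>. By
  continuity these are close to the coefficients at nearby points, and the difference times the
  integral of \<open>GA + GB\<close> is the error that \<open>igrad_local\<close> tolerates.\<close>

lemma igrad_chain:
  fixes \<alpha> \<beta> :: "real => real"
  assumes A: "igrad l A GA" and B: "igrad l B GB"
    and \<alpha>: "continuous_on {0..l} \<alpha>" "\<And>t. t \<in> {0..l} ==> 0 \<le> \<alpha> t"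
    and \<beta>: "continuous_on {0..l} \<beta>" "\<And>t. t \<in> {0..l} ==> 0 \<le> \<beta> t"
    and loc: "\<And>\<tau> e::real. 0 \<le> \<tau> ==> \<tau> \<le> l ==> 0 < e ==> \<exists>d>0. \<forall>s t. 0 \<le> s --> s \<le> \<tau> --> \<tau> \<le> t --> t \<le> l --> t - s < d -->
        \<bar>H s - H t\<bar> \<le> (\<alpha> \<tau> + e) * \<bar>A s - A t\<bar> + (\<beta> \<tau> + e) * \<bar>B s - B t\<bar>"
  shows "igrad l H (\<lambda>t. ennreal (\<alpha> t) * GA t + ennreal (\<beta> t) * GB t)"
proof -
  note mA = igradD(1)[OF A] and mB = igradD(1)[OF B]
  have maA: "(\<lambda>t. ennreal (\<alpha> t) * GA t * indicator {0..l} t) \<in> borel_measurable borel"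
    by (rule continuous_times_borel[OF mA \<alpha>(1)]) auto
  have mbB: "(\<lambda>t. ennreal (\<beta> t) * GB t * indicator {0..l} t) \<in> borel_measurable borel"
    by (rule continuous_times_borel[OF mB \<beta>(1)]) auto
  have sumI: "nnint {s..t} (\<lambda>\<tau>. (X \<tau> + Y \<tau>)) = nnint {s..t} X + nnint {s..t} Y"
    if "borel_on {0..l} X"
       "borel_on {0..l} Y" "0 \<le> s" "t \<le> l" for X Y :: "real => ennreal" and s t
    using set_borel_subinterval[OF that(1), of s t] set_borel_subinterval[OF that(2), of s t] that
    by (simp add: distrib_right nn_integral_add)
  have bd: "\<exists>C. \<forall>t\<in>{0..l}. f t \<le> C" if "continuous_on {0..l} f" for f :: "real => real"
  proof -
    have "bounded (f ` {0..l})" by (rule compact_imp_bounded[OF compact_continuous_image[OF that]]) auto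
    then show ?thesis unfolding bounded_iff by (auto intro: order_trans[OF abs_ge_self])
  qed
  obtain Ca where Ca: "\<And>t. t \<in> {0..l} ==> \<alpha> t \<le> Ca" using bd[OF \<alpha>(1)] by metis
  obtain Cb where Cb: "\<And>t. t \<in> {0..l} ==> \<beta> t \<le> Cb" using bd[OF \<beta>(1)] by metis
  have fa: "nnint {0..l} (\<lambda>\<tau>. ennreal (\<alpha> \<tau>) * GA \<tau>) < \<infinity>"
    by (rule set_nn_integral_bounded_times[OF mA igradD(2)[OF A] Ca])
  have fb: "nnint {0..l} (\<lambda>\<tau>. ennreal (\<beta> \<tau>) * GB \<tau>) < \<infinity>"
    by (rule set_nn_integral_bounded_times[OF mB igradD(2)[OF B] Cb])
  show ?thesis
  proof (cases "0 \<le> l")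
    case False
    then show ?thesis by (simp add: igrad_def)
  next
    case l0: True
    show ?thesis
    proof (rule igrad_local[where Q = "\<lambda>t. GA t + GB t"])
      show "(\<lambda>t. (ennreal (\<alpha> t) * GA t + ennreal (\<beta> t) * GB t) * indicator {0..l} t) \<in> borel_measurable borel"
        using maA mbB by (simp add: distrib_right)
      show "nnint {0..l} (\<lambda>\<tau>. (ennreal (\<alpha> \<tau>) * GA \<tau> + ennreal (\<beta> \<tau>) * GB \<tau>)) < \<infinity>"
        using sumI[OF maA mbB, of 0 l] fa fb by auto
      show "(\<lambda>t. (GA t + GB t) * indicator {0..l} t) \<in> borel_measurable borel"
        using mA mB by (simp add: distrib_right)
      show "nnint {0..l} (\<lambda>\<tau>. (GA \<tau> + GB \<tau>)) < \<infinity>"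
        using sumI[OF mA mB, of 0 l] igradD(2)[OF A] igradD(2)[OF B] by auto
      fix \<tau> e :: real assume \<tau>: "0 \<le> \<tau>" "\<tau> \<le> l" and e: "0 < e"
      have "\<exists>d>0. \<forall>t\<in>{0..l}. dist t \<tau> < d --> dist (\<alpha> t) (\<alpha> \<tau>) < e/2"
        using \<alpha>(1) \<tau> e unfolding continuous_on_iff by (metis atLeastAtMost_iff half_gt_zero)
      then obtain da where da: "da > 0" "\<And>t. t \<in> {0..l} ==> \<bar>t - \<tau>\<bar> < da ==> \<bar>\<alpha> t - \<alpha> \<tau>\<bar> < e/2"
        by (auto simp: dist_real_def)
      have "\<exists>d>0. \<forall>t\<in>{0..l}. dist t \<tau> < d --> dist (\<beta> t) (\<beta> \<tau>) < e/2"
        using \<beta>(1) \<tau> e unfolding continuous_on_iff by (metis atLeastAtMost_iff half_gt_zero)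
      then obtain db where db: "db > 0" "\<And>t. t \<in> {0..l} ==> \<bar>t - \<tau>\<bar> < db ==> \<bar>\<beta> t - \<beta> \<tau>\<bar> < e/2"
        by (auto simp: dist_real_def)
      obtain dh where dh: "dh > 0" "\<And>s t. 0 \<le> s ==> s \<le> \<tau> ==> \<tau> \<le> t ==> t \<le> l ==> t - s < dh ==>
        \<bar>H s - H t\<bar> \<le> (\<alpha> \<tau> + e/2) * \<bar>A s - A t\<bar> + (\<beta> \<tau> + e/2) * \<bar>B s - B t\<bar>"
        using loc[of \<tau> "e/2"] \<tau> e by auto
      define d where "d = min dh (min da db)"
      have key: "ennreal \<bar>H s - H t\<bar> \<le> nnint {s..t} (\<lambda>\<tau>. (ennreal (\<alpha> \<tau>) * GA \<tau> + ennreal (\<beta> \<tau>) * GB \<tau>)) +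
           ennreal e * nnint {s..t} (\<lambda>\<tau>. (GA \<tau> + GB \<tau>))"
        if st: "0 \<le> s" "s \<le> \<tau>" "\<tau> \<le> t" "t \<le> l" "t - s < d" for s t
      proof -
        \<comment> \<open>One half of e comes from \<open>loc\<close>, the other from the variation
          of the coefficient over [s,t].\<close>
        have one: "ennreal (f \<tau> + e/2) * ennreal \<bar>X s - X t\<bar> \<le>
             nnint {s..t} (\<lambda>\<sigma>. ennreal (f \<sigma>) * GX \<sigma>) + ennreal e * nnint {s..t} GX"
          if X: "igrad l X GX" and f: "continuous_on {0..l} f" "\<And>t. t \<in> {0..l} ==> 0 \<le> f t"
            and df: "\<And>t. t \<in> {0..l} ==> \<bar>t - \<tau>\<bar> < d ==> \<bar>f t - f \<tau>\<bar> < e/2" for X GX and f :: "real => real"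
        proof -
          have "ennreal (f \<tau> + e/2) * ennreal \<bar>X s - X t\<bar> \<le> ennreal (f \<tau> + e/2) * nnint {s..t} GX"
            using igradD(3)[OF X, of s t] st by (intro mult_left_mono) auto
          also have "\<dots> = nnint {s..t} (\<lambda>\<sigma>. ennreal (f \<tau> + e/2) * GX \<sigma>)"
            using set_borel_subinterval[OF igradD(1)[OF X], of s t] st
            by (simp add: nn_integral_cmult[symmetric] mult.assoc)
          also have "\<dots> \<le> (\<integral>\<^sup>+\<sigma>. (ennreal (f \<sigma>) * GX \<sigma>) * indicator {s..t} \<sigma> + ennreal e * (GX \<sigma> * indicator {s..t} \<sigma>) \<partial>lborel)"
          proof (intro nn_integral_mono)
            fix \<sigma>
            show "ennreal (f \<tau> + e/2) * GX \<sigma> * indicator {s..t} \<sigma> \<le>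
                ennreal (f \<sigma>) * GX \<sigma> * indicator {s..t} \<sigma> + ennreal e * (GX \<sigma> * indicator {s..t} \<sigma>)"
            proof (cases "\<sigma> \<in> {s..t}")
              case True
              then have "\<bar>f \<sigma> - f \<tau>\<bar> < e/2" using df[of \<sigma>] st by auto
              then have "ennreal (f \<tau> + e/2) \<le> ennreal (f \<sigma> + e)" by (intro ennreal_leI) linarith
              also have "\<dots> = ennreal (f \<sigma>) + ennreal e" using f(2)[of \<sigma>] True st e by simp
              finally show ?thesis using True by (simp add: distrib_right[symmetric] mult_right_mono)
            qed auto
          qed
          also have "\<dots> = nnint {s..t} (\<lambda>\<sigma>. ennreal (f \<sigma>) * GX \<sigma>) + ennreal e * nnint {s..t} GX"
            using set_borel_subinterval[OF igradD(1)[OF X], of s t]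
              set_borel_subinterval[OF continuous_times_borel[OF igradD(1)[OF X] f(1)], of s t] st
            by (simp add: nn_integral_add nn_integral_cmult)
          finally show ?thesis .
        qed
        have "ennreal \<bar>H s - H t\<bar> \<le> ennreal ((\<alpha> \<tau> + e/2) * \<bar>A s - A t\<bar> + (\<beta> \<tau> + e/2) * \<bar>B s - B t\<bar>)"
          using dh(2)[of s t] st by (intro ennreal_leI) (auto simp: d_def)
        also have "\<dots> = ennreal (\<alpha> \<tau> + e/2) * ennreal \<bar>A s - A t\<bar> + ennreal (\<beta> \<tau> + e/2) * ennreal \<bar>B s - B t\<bar>"
          using \<alpha>(2)[of \<tau>] \<beta>(2)[of \<tau>] \<tau> e by (simp add: ennreal_mult)
        also have "\<dots> \<le> (nnint {s..t} (\<lambda>\<sigma>. ennreal (\<alpha> \<sigma>) * GA \<sigma>) + ennreal e * nnint {s..t} GA) +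
             (nnint {s..t} (\<lambda>\<sigma>. ennreal (\<beta> \<sigma>) * GB \<sigma>) + ennreal e * nnint {s..t} GB)"
          using da db by (intro add_mono one A B \<alpha> \<beta>) (auto simp: d_def)
        also have "\<dots> = nnint {s..t} (\<lambda>\<tau>. (ennreal (\<alpha> \<tau>) * GA \<tau> + ennreal (\<beta> \<tau>) * GB \<tau>)) +
           ennreal e * nnint {s..t} (\<lambda>\<tau>. (GA \<tau> + GB \<tau>))"
          using sumI[OF maA mbB, of s t] sumI[OF mA mB, of s t] st by (simp add: algebra_simps)
        finally show ?thesis .
      qed
      show "\<exists>d>0. \<forall>s t. 0 \<le> s --> s \<le> \<tau> --> \<tau> \<le> t --> t \<le> l --> t - s < d --> ennreal \<bar>H s - H t\<bar> \<le>
         nnint {s..t} (\<lambda>\<tau>. (ennreal (\<alpha> \<tau>) * GA \<tau> + ennreal (\<beta> \<tau>) * GB \<tau>)) +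
           ennreal e * nnint {s..t} (\<lambda>\<tau>. (GA \<tau> + GB \<tau>))"
        using key da(1) db(1) dh(1) by (intro exI[of _ d]) (auto simp: d_def)
    qed
  qed
qed

text \<open>The increments pass to the limit pointwise, the integrals by dominated convergence.
  Hence the functions must converge everywhere, the gradients only almost everywhere.\<close>

lemma igrad_limit:
  assumes H: "\<And>n. igrad l (H n) (K n)"
    and lim: "\<And>t. t \<in> {0..l} ==> (\<lambda>n. H n t) \<longlonglongrightarrow> H' t"
    and Klim: "AE t in lborel. t \<in> {0..l} --> (\<lambda>n. K n t) \<longlonglongrightarrow> K' t"
    and K': "borel_on {0..l} K'"
    and W: "borel_on {0..l} W" "nnint {0..l} W < \<infinity>"
    and dom: "\<And>n t. t \<in> {0..l} ==> K n t \<le> W t"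
  shows "igrad l H' K'"
proof -
  have ae: "AE t in lborel. t \<in> {0..l} --> K' t \<le> W t"
    using Klim by eventually_elim (meson LIMSEQ_le_const2 dom)
  have fin: "nnint {0..l} K' < \<infinity>"
  proof -
    have "nnint {0..l} K' \<le> nnint {0..l} W"
      using ae by (intro nn_integral_mono_AE) (auto simp: indicator_def elim: eventually_mono)
    then show ?thesis using W(2) by auto
  qed
  show ?thesis unfolding igrad_def
  proof (intro conjI allI impI K' fin)
    fix s t :: real assume st: "0 \<le> s" "s \<le> t" "t \<le> l"
    have "(\<lambda>n. \<integral>\<^sup>+\<tau>\<in>{s..t}. K n \<tau> \<partial>lborel) \<longlonglongrightarrow> nnint {s..t} K'"
    proof (rule nn_integral_dominated_convergence)
      show "(\<lambda>\<tau>. K n \<tau> * indicator {s..t} \<tau>) \<in> borel_measurable lborel" for n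
        using set_borel_subinterval[OF igradD(1)[OF H], of s t n] st by simp
      show "(\<lambda>\<tau>. K' \<tau> * indicator {s..t} \<tau>) \<in> borel_measurable lborel"
        using set_borel_subinterval[OF K', of s t] st by simp
      show "(\<lambda>\<tau>. W \<tau> * indicator {0..l} \<tau>) \<in> borel_measurable lborel" using W by simp
      show "AE \<tau> in lborel. K n \<tau> * indicator {s..t} \<tau> \<le> W \<tau> * indicator {0..l} \<tau>" for n
        using dom st by (intro AE_I2) (auto simp: indicator_def)
      show "AE \<tau> in lborel. (\<lambda>n. K n \<tau> * indicator {s..t} \<tau>) \<longlonglongrightarrow> K' \<tau> * indicator {s..t} \<tau>"
        using Klim st by (auto simp: indicator_def elim: eventually_mono)
    qed (rule W)
    moreover have "(\<lambda>n. ennreal \<bar>H n s - H n t\<bar>) \<longlonglongrightarrow> ennreal \<bar>H' s - H' t\<bar>"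
      using lim[of s] lim[of t] st by (intro tendsto_ennrealI tendsto_rabs tendsto_diff) auto
    ultimately show "ennreal \<bar>H' s - H' t\<bar> \<le> nnint {s..t} K'"
      using igradD(3)[OF H] st by (meson LIMSEQ_le)
  qed
qed


lemma igrad_cong:
  assumes "\<And>t. t \<in> {0..l} ==> F t = F' t" "\<And>t. t \<in> {0..l} ==> G t = G' t"
  shows "igrad l F G \<longleftrightarrow> igrad l F' G'"
proof -
  have *: "(\<lambda>t. G t * indicator {0..l} t) = (\<lambda>t. G' t * indicator {0..l} t)"
    using assms by (auto simp: indicator_def fun_eq_iff)
  have **: "nnint {s..t} G = nnint {s..t} G'" if "0 \<le> s" "t \<le> l" for s t
    using assms that by (intro nn_integral_cong) (auto simp: indicator_def)
  show ?thesis unfolding igrad_def *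
    by (intro conj_cong refl all_cong imp_cong) (auto simp: ** assms)
qed

lemma igrad_contraction:
  assumes g: "igrad l F G" and "0 \<le> c" "\<And>s t. s \<in> {0..l} ==> t \<in> {0..l} ==> \<bar>H s - H t\<bar> \<le> c * \<bar>F s - F t\<bar>"
  shows "igrad l H (\<lambda>t. ennreal c * G t)"
  unfolding igrad_def
proof (intro conjI allI impI)
  have m2: "(\<lambda>t. ennreal c * (G t * indicator {0..l} t)) \<in> borel_measurable borel"
    using igradD(1)[OF g] by measurable
  then show "(\<lambda>t. ennreal c * G t * indicator {0..l} t) \<in> borel_measurable borel" by (simp add: mult.assoc)
  have i: "nnint {s..t} (\<lambda>\<tau>. ennreal c * G \<tau>) = ennreal c * nnint {s..t} G" if "0 \<le> s" "t \<le> l" for s t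
    using set_borel_subinterval[OF igradD(1)[OF g], of s t] that by (simp add: mult.assoc nn_integral_cmult)
  show "nnint {0..l} (\<lambda>\<tau>. ennreal c * G \<tau>) < \<infinity>"
    using i[of 0 l] igradD(2)[OF g] by (simp add: ennreal_mult_less_top)
  fix s t :: real assume st: "0 \<le> s" "s \<le> t" "t \<le> l"
  have "ennreal \<bar>H s - H t\<bar> \<le> ennreal (c * \<bar>F s - F t\<bar>)" using assms(3)[of s t] st by (intro ennreal_leI) auto
  also have "\<dots> = ennreal c * ennreal \<bar>F s - F t\<bar>" using assms(2) by (simp add: ennreal_mult)
  also have "\<dots> \<le> ennreal c * nnint {s..t} G" by (intro mult_left_mono igradD(3)[OF g st]) auto
  finally show "ennreal \<bar>H s - H t\<bar> \<le> nnint {s..t} (\<lambda>\<tau>. ennreal c * G \<tau>)" using i st by simp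
qed

lemma tendsto_ennreal_times:
  fixes c :: ennreal
  assumes "(a \<longlongrightarrow> x) F" "c < top"
  shows "((\<lambda>n. ennreal (a n) * c) \<longlongrightarrow> ennreal x * c) F"
  using ennreal_tendsto_cmult[OF assms(2) tendsto_ennrealI[OF assms(1)]] by (simp add: mult.commute)

lemma igrad_const: "igrad l (\<lambda>_. c) (\<lambda>_. 0)"
  by (simp add: igrad_def)

lemma igrad_add:
  assumes "igrad l A GA" "igrad l B GB"
  shows "igrad l (\<lambda>t. A t + B t) (\<lambda>t. GA t + GB t)"
proof -
  have "igrad l (\<lambda>t. A t + B t) (\<lambda>t. ennreal ((\<lambda>_. 1) t) * GA t + ennreal ((\<lambda>_. 1) t) * GB t)"
  proof (rule igrad_chain[OF assms])
    fix \<tau> e :: real assume "0 < e"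
    show "\<exists>d>0. \<forall>s t. 0 \<le> s --> s \<le> \<tau> --> \<tau> \<le> t --> t \<le> l --> t - s < d -->
        \<bar>A s + B s - (A t + B t)\<bar> \<le> (1 + e) * \<bar>A s - A t\<bar> + (1 + e) * \<bar>B s - B t\<bar>"
    proof (intro exI[of _ 1] conjI allI impI)
      fix s t
      have "\<bar>A s + B s - (A t + B t)\<bar> \<le> \<bar>A s - A t\<bar> + \<bar>B s - B t\<bar>" by linarith
      also have "\<dots> \<le> (1 + e) * \<bar>A s - A t\<bar> + (1 + e) * \<bar>B s - B t\<bar>"
        using \<open>0 < e\<close> by (intro add_mono) (auto simp: mult_le_cancel_right1)
      finally show "\<bar>A s + B s - (A t + B t)\<bar> \<le> (1 + e) * \<bar>A s - A t\<bar> + (1 + e) * \<bar>B s - B t\<bar>" .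
    qed simp
  qed auto
  then show ?thesis by simp
qed

lemma continuous_on_interval_delta:
  fixes f :: "real => real"
  assumes "continuous_on {0..l} f" "\<tau> \<in> {0..l}" "0 < e"
  obtains d where "d > 0" "\<And>t. t \<in> {0..l} ==> \<bar>t - \<tau>\<bar> < d ==> \<bar>f t - f \<tau>\<bar> < e"
  using assms unfolding continuous_on_iff by (metis dist_real_def)

lemma igrad_mult:
  assumes A: "igrad l A GA" and B: "igrad l B GB"
  shows "igrad l (\<lambda>t. A t * B t) (\<lambda>t. ennreal \<bar>B t\<bar> * GA t + ennreal \<bar>A t\<bar> * GB t)"
proof (rule igrad_chain[OF A B])
  note cA = igrad_continuous[OF A] and cB = igrad_continuous[OF B]
  show "continuous_on {0..l} (\<lambda>t. \<bar>B t\<bar>)" "continuous_on {0..l} (\<lambda>t. \<bar>A t\<bar>)"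
    using cA cB by (auto intro: continuous_intros)
  fix \<tau> e :: real assume \<tau>: "0 \<le> \<tau>" "\<tau> \<le> l" and e: "0 < e"
  obtain da where da: "da > 0" "\<And>t. t \<in> {0..l} ==> \<bar>t - \<tau>\<bar> < da ==> \<bar>A t - A \<tau>\<bar> < e"
    using continuous_on_interval_delta[OF cA, of \<tau> e] \<tau> e by auto
  obtain db where db: "db > 0" "\<And>t. t \<in> {0..l} ==> \<bar>t - \<tau>\<bar> < db ==> \<bar>B t - B \<tau>\<bar> < e"
    using continuous_on_interval_delta[OF cB, of \<tau> e] \<tau> e by auto
  show "\<exists>d>0. \<forall>s t. 0 \<le> s --> s \<le> \<tau> --> \<tau> \<le> t --> t \<le> l --> t - s < d -->
        \<bar>A s * B s - A t * B t\<bar> \<le> (\<bar>B \<tau>\<bar> + e) * \<bar>A s - A t\<bar> + (\<bar>A \<tau>\<bar> + e) * \<bar>B s - B t\<bar>"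
  proof (intro exI[of _ "min da db"] conjI allI impI)
    fix s t assume st: "0 \<le> s" "s \<le> \<tau>" "\<tau> \<le> t" "t \<le> l" "t - s < min da db"
    have 1: "\<bar>A t\<bar> \<le> \<bar>A \<tau>\<bar> + e" using da(2)[of t] st by auto
    have 2: "\<bar>B s\<bar> \<le> \<bar>B \<tau>\<bar> + e" using db(2)[of s] st by auto
    have "A s * B s - A t * B t = B s * (A s - A t) + A t * (B s - B t)" by algebra
    then have "\<bar>A s * B s - A t * B t\<bar> \<le> \<bar>B s * (A s - A t)\<bar> + \<bar>A t * (B s - B t)\<bar>" by (simp only: abs_triangle_ineq)
    also have "\<dots> = \<bar>B s\<bar> * \<bar>A s - A t\<bar> + \<bar>A t\<bar> * \<bar>B s - B t\<bar>" by (simp add: abs_mult)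
    also have "\<dots> \<le> (\<bar>B \<tau>\<bar> + e) * \<bar>A s - A t\<bar> + (\<bar>A \<tau>\<bar> + e) * \<bar>B s - B t\<bar>"
      using 1 2 by (intro add_mono mult_right_mono) auto
    finally show "\<bar>A s * B s - A t * B t\<bar> \<le> (\<bar>B \<tau>\<bar> + e) * \<bar>A s - A t\<bar> + (\<bar>A \<tau>\<bar> + e) * \<bar>B s - B t\<bar>" .
  qed (use da db in auto)
qed auto

lemma mean_value_between:
  fixes \<phi> \<phi>' :: "real => real"
  assumes "\<And>x. (\<phi> has_real_derivative \<phi>' x) (at x)"
  obtains z where "min a b \<le> z" "z \<le> max a b" "\<phi> a - \<phi> b = \<phi>' z * (a - b)"
proof (cases a b rule: linorder_cases)
  case less
  then obtain z where "z > a" "z < b" "\<phi> b - \<phi> a = (b - a) * \<phi>' z" using MVT2[of a b \<phi> \<phi>'] assms by auto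
  then show ?thesis by (intro that[of z]) (auto simp: algebra_simps)
next
  case equal then show ?thesis using that[of a] by auto
next
  case greater
  then obtain z where "z > b" "z < a" "\<phi> a - \<phi> b = (a - b) * \<phi>' z" using MVT2[of b a \<phi> \<phi>'] assms by auto
  then show ?thesis by (intro that[of z]) (auto simp: algebra_simps)
qed

text \<open>The derivative of B + \<phi>(A - B) is the convex combination of A' and B' with weight
  \<phi>'. If \<phi> is a smooth approximation of max x 0, the function approximates max A B, and
  the weight decides which of the two gradients is seen.\<close>

lemma igrad_blend:
  assumes A: "igrad l A GA" and B: "igrad l B GB"
    and \<phi>: "\<And>x. (\<phi> has_real_derivative \<phi>' x) (at x)" "continuous_on UNIV \<phi>'"
      "\<And>x. 0 \<le> \<phi>' x" "\<And>x. \<phi>' x \<le> 1"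
  shows "igrad l (\<lambda>t. B t + \<phi> (A t - B t))
     (\<lambda>t. ennreal (\<phi>' (A t - B t)) * GA t + ennreal (1 - \<phi>' (A t - B t)) * GB t)"
proof (rule igrad_chain[OF A B])
  have cD: "continuous_on {0..l} (\<lambda>t. A t - B t)"
    using igrad_continuous[OF A] igrad_continuous[OF B] by (intro continuous_intros)
  show c: "continuous_on {0..l} (\<lambda>t. \<phi>' (A t - B t))"
    by (rule continuous_on_compose2[OF \<phi>(2) cD]) auto
  then show "continuous_on {0..l} (\<lambda>t. 1 - \<phi>' (A t - B t))" by (intro continuous_intros)
  show "0 \<le> \<phi>' (A t - B t)" "0 \<le> 1 - \<phi>' (A t - B t)" for t using \<phi> by auto
  fix \<tau> e :: real assume \<tau>: "0 \<le> \<tau>" "\<tau> \<le> l" and e: "0 < e"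
  define D where "D t = A t - B t" for t
  obtain \<eta> where \<eta>: "\<eta> > 0" "\<And>x. \<bar>x - D \<tau>\<bar> < \<eta> ==> \<bar>\<phi>' x - \<phi>' (D \<tau>)\<bar> < e"
    using \<phi>(2) e unfolding continuous_on_iff dist_real_def by (metis UNIV_I)
  obtain d where d: "d > 0" "\<And>t. t \<in> {0..l} ==> \<bar>t - \<tau>\<bar> < d ==> \<bar>D t - D \<tau>\<bar> < \<eta>"
    using continuous_on_interval_delta[OF cD, of \<tau> \<eta>] \<tau> \<eta> unfolding D_def by auto
  show "\<exists>d>0. \<forall>s t. 0 \<le> s --> s \<le> \<tau> --> \<tau> \<le> t --> t \<le> l --> t - s < d -->
      \<bar>B s + \<phi> (A s - B s) - (B t + \<phi> (A t - B t))\<bar>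
      \<le> (\<phi>' (A \<tau> - B \<tau>) + e) * \<bar>A s - A t\<bar> + (1 - \<phi>' (A \<tau> - B \<tau>) + e) * \<bar>B s - B t\<bar>"
  proof (intro exI[of _ d] conjI allI impI d(1))
    fix s t assume st: "0 \<le> s" "s \<le> \<tau>" "\<tau> \<le> t" "t \<le> l" "t - s < d"
    obtain z where z: "min (D s) (D t) \<le> z" "z \<le> max (D s) (D t)" "\<phi> (D s) - \<phi> (D t) = \<phi>' z * (D s - D t)"
      using mean_value_between[OF \<phi>(1)] .
    have "\<bar>D s - D \<tau>\<bar> < \<eta>" "\<bar>D t - D \<tau>\<bar> < \<eta>" using d(2)[of s] d(2)[of t] st by auto
    then have "\<bar>z - D \<tau>\<bar> < \<eta>" using z by (auto simp: min_def max_def split: if_splits)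
    then have z': "\<bar>\<phi>' z - \<phi>' (D \<tau>)\<bar> < e" by (rule \<eta>)
    have "B s + \<phi> (A s - B s) - (B t + \<phi> (A t - B t)) = B s - B t + (\<phi> (D s) - \<phi> (D t))"
      by (simp add: D_def)
    also have "\<dots> = \<phi>' z * (A s - A t) + (1 - \<phi>' z) * (B s - B t)"
      unfolding z(3) by (simp add: D_def algebra_simps)
    finally have "\<bar>B s + \<phi> (A s - B s) - (B t + \<phi> (A t - B t))\<bar> \<le> \<bar>\<phi>' z * (A s - A t)\<bar> + \<bar>(1 - \<phi>' z) * (B s - B t)\<bar>"
      by (simp only: abs_triangle_ineq)
    also have "\<dots> = \<phi>' z * \<bar>A s - A t\<bar> + (1 - \<phi>' z) * \<bar>B s - B t\<bar>" using \<phi>(3,4)[of z] by (simp add: abs_mult)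
    also have "\<dots> \<le> (\<phi>' (D \<tau>) + e) * \<bar>A s - A t\<bar> + (1 - \<phi>' (D \<tau>) + e) * \<bar>B s - B t\<bar>"
      using z' by (intro add_mono mult_right_mono) auto
    finally show "\<bar>B s + \<phi> (A s - B s) - (B t + \<phi> (A t - B t))\<bar>
      \<le> (\<phi>' (A \<tau> - B \<tau>) + e) * \<bar>A s - A t\<bar> + (1 - \<phi>' (A \<tau> - B \<tau>) + e) * \<bar>B s - B t\<bar>" by (simp add: D_def)
  qed
qed

lemma igrad_C1:
  assumes A: "igrad l A GA" and \<phi>: "\<And>x. (\<phi> has_real_derivative \<phi>' x) (at x)" "continuous_on UNIV \<phi>'"
  shows "igrad l (\<lambda>t. \<phi> (A t)) (\<lambda>t. ennreal \<bar>\<phi>' (A t)\<bar> * GA t)"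
proof -
  have "igrad l (\<lambda>t. \<phi> (A t)) (\<lambda>t. ennreal \<bar>\<phi>' (A t)\<bar> * GA t + ennreal ((\<lambda>_. 0) t) * GA t)"
  proof (rule igrad_chain[OF A A])
    note cA = igrad_continuous[OF A]
    show "continuous_on {0..l} (\<lambda>t. \<bar>\<phi>' (A t)\<bar>)"
      by (intro continuous_intros continuous_on_compose2[OF \<phi>(2) cA]) auto
    fix \<tau> e :: real assume \<tau>: "0 \<le> \<tau>" "\<tau> \<le> l" and e: "0 < e"
    obtain \<eta> where \<eta>: "\<eta> > 0" "\<And>x. \<bar>x - A \<tau>\<bar> < \<eta> ==> \<bar>\<phi>' x - \<phi>' (A \<tau>)\<bar> < e"
      using \<phi>(2) e unfolding continuous_on_iff dist_real_def by (metis UNIV_I)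
    obtain d where d: "d > 0" "\<And>t. t \<in> {0..l} ==> \<bar>t - \<tau>\<bar> < d ==> \<bar>A t - A \<tau>\<bar> < \<eta>"
      using continuous_on_interval_delta[OF cA, of \<tau> \<eta>] \<tau> \<eta> by auto
    show "\<exists>d>0. \<forall>s t. 0 \<le> s --> s \<le> \<tau> --> \<tau> \<le> t --> t \<le> l --> t - s < d -->
      \<bar>\<phi> (A s) - \<phi> (A t)\<bar> \<le> (\<bar>\<phi>' (A \<tau>)\<bar> + e) * \<bar>A s - A t\<bar> + (0 + e) * \<bar>A s - A t\<bar>"
    proof (intro exI[of _ d] conjI allI impI d(1))
      fix s t assume st: "0 \<le> s" "s \<le> \<tau>" "\<tau> \<le> t" "t \<le> l" "t - s < d"
      obtain z where z: "min (A s) (A t) \<le> z" "z \<le> max (A s) (A t)" "\<phi> (A s) - \<phi> (A t) = \<phi>' z * (A s - A t)"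
        using mean_value_between[OF \<phi>(1)] .
      have "\<bar>A s - A \<tau>\<bar> < \<eta>" "\<bar>A t - A \<tau>\<bar> < \<eta>" using d(2)[of s] d(2)[of t] st by auto
      then have "\<bar>z - A \<tau>\<bar> < \<eta>" using z by (auto simp: min_def max_def split: if_splits)
      then have "\<bar>\<phi>' z - \<phi>' (A \<tau>)\<bar> < e" by (rule \<eta>)
      then have "\<bar>\<phi>' z\<bar> \<le> \<bar>\<phi>' (A \<tau>)\<bar> + e" by linarith
      then have "\<bar>\<phi> (A s) - \<phi> (A t)\<bar> \<le> (\<bar>\<phi>' (A \<tau>)\<bar> + e) * \<bar>A s - A t\<bar>"
        unfolding z(3) abs_mult by (intro mult_right_mono) auto
      then show "\<bar>\<phi> (A s) - \<phi> (A t)\<bar> \<le> (\<bar>\<phi>' (A \<tau>)\<bar> + e) * \<bar>A s - A t\<bar> + (0 + e) * \<bar>A s - A t\<bar>"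
        using e by (simp add: add_increasing2)
    qed
  qed auto
  then show ?thesis by simp
qed

text \<open>The sharp gradient of a maximum comes from the smooth approximations
  \<open>(x - \<delta> + sqrt ((x - \<delta>)\<^sup>2 + \<delta>\<^sup>4)) / 2\<close> of \<open>max x 0\<close>; the shift by \<open>\<delta>\<close> makes the derivatives
  at \<open>0\<close> tend to \<open>0\<close>.\<close>

lemma igrad_max:
  assumes A: "igrad l A GA" and B: "igrad l B GB"
  shows "igrad l (\<lambda>t. max (A t) (B t)) (\<lambda>t. if B t < A t then GA t else GB t)"
proof -
  define \<delta> where "\<delta> n = 1 / real (Suc n)" for n
  define q where "q n x = sqrt ((x - \<delta> n)\<^sup>2 + \<delta> n ^ 4)" for n x
  define \<phi> where "\<phi> n x = (x - \<delta> n + q n x) / 2" for n x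
  define \<phi>' where "\<phi>' n x = (1 + (x - \<delta> n) / q n x) / 2" for n x
  have \<delta>: "\<delta> n > 0" for n by (simp add: \<delta>_def)
  have \<delta>lim: "\<delta> \<longlonglongrightarrow> 0" unfolding \<delta>_def using LIMSEQ_inverse_real_of_nat by (simp add: inverse_eq_divide)
  have pos: "(x - \<delta> n)\<^sup>2 + \<delta> n ^ 4 > 0" for n x using \<delta>[of n] by (intro add_nonneg_pos) auto
  have qpos: "q n x > 0" for n x using pos by (simp add: q_def)
  have qge: "\<bar>x - \<delta> n\<bar> \<le> q n x" for n x
  proof -
    have "sqrt ((x - \<delta> n)\<^sup>2) \<le> q n x" unfolding q_def using \<delta>[of n] by (intro real_sqrt_le_mono) auto
    then show ?thesis by simp
  qed
  have deriv: "(\<phi> n has_real_derivative \<phi>' n x) (at x)" for n x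
    unfolding \<phi>_def q_def \<phi>'_def using pos[of x n] \<delta>[of n]
    by (auto intro!: derivative_eq_intros simp: field_simps)
  have cont: "continuous_on UNIV (\<phi>' n)" for n
  proof -
    have "continuous_on UNIV (q n)" unfolding q_def by (intro continuous_intros)
    then show ?thesis unfolding \<phi>'_def using qpos[of n] by (intro continuous_intros) (auto simp: less_imp_neq[symmetric])
  qed
  have b: "\<bar>(x - \<delta> n) / q n x\<bar> \<le> 1" for n x using qge[of x n] qpos[of n x] by (simp add: divide_simps)
  have b0: "0 \<le> \<phi>' n x" "\<phi>' n x \<le> 1" for n x
  proof -
    have "0 \<le> (1 + w) / 2 \<and> (1 + w) / 2 \<le> 1" if "\<bar>w\<bar> \<le> 1" for w :: real using that by auto
    from this[OF b[of x n]] show "0 \<le> \<phi>' n x" "\<phi>' n x \<le> 1" by (auto simp: \<phi>'_def)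
  qed
  have qlim: "(\<lambda>n. q n x) \<longlonglongrightarrow> \<bar>x\<bar>" for x
  proof -
    have "(\<lambda>n. q n x) \<longlonglongrightarrow> sqrt ((x - 0)\<^sup>2 + 0 ^ 4)"
      unfolding q_def using \<delta>lim by (intro tendsto_intros)
    then show ?thesis by simp
  qed
  have lim: "(\<lambda>n. \<phi> n x) \<longlonglongrightarrow> max x 0" for x
  proof -
    have "(\<lambda>n. \<phi> n x) \<longlonglongrightarrow> (x - 0 + \<bar>x\<bar>) / 2"
      unfolding \<phi>_def using qlim \<delta>lim by (intro tendsto_intros) auto
    moreover have "(x - 0 + \<bar>x\<bar>) / 2 = max x 0" by auto
    ultimately show ?thesis by simp
  qed
  have lim0: "(\<lambda>n. \<phi>' n 0) \<longlonglongrightarrow> 0"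
  proof -
    \<comment> \<open>Smoothing by \<delta>^4 is of lower order than the shift by \<delta>; with
      \<delta>^2 in its place the derivatives at 0 would tend to (1 - 1/sqrt 2)/2 instead of
      0.\<close>
    have e: "\<phi>' n 0 = (1 - 1 / sqrt (1 + (\<delta> n)\<^sup>2)) / 2" for n
    proof -
      have "(0 - \<delta> n)\<^sup>2 + \<delta> n ^ 4 = (\<delta> n)\<^sup>2 * (1 + (\<delta> n)\<^sup>2)" by (simp add: power2_eq_square algebra_simps power4_eq_xxxx)
      then have "q n 0 = \<delta> n * sqrt (1 + (\<delta> n)\<^sup>2)" unfolding q_def using \<delta>[of n] by (simp add: real_sqrt_mult)
      then show ?thesis unfolding \<phi>'_def using \<delta>[of n] by (simp add: field_simps)
    qed
    have "(\<lambda>n. (1 - 1 / sqrt (1 + (\<delta> n)\<^sup>2)) / 2) \<longlonglongrightarrow> (1 - 1 / sqrt (1 + 0\<^sup>2)) / 2"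
      using \<delta>lim by (intro tendsto_intros) auto
    then show ?thesis by (subst e) simp
  qed
  have lim': "(\<lambda>n. \<phi>' n x) \<longlonglongrightarrow> (if 0 < x then 1 else 0)" for x
  proof (cases "x = 0")
    case False
    have "(\<lambda>n. \<phi>' n x) \<longlonglongrightarrow> (1 + (x - 0) / \<bar>x\<bar>) / 2"
      unfolding \<phi>'_def using qlim \<delta>lim False by (intro tendsto_intros) auto
    then show ?thesis using False by (auto split: if_splits)
  qed (use lim0 in auto)
  let ?K = "\<lambda>n t. ennreal (\<phi>' n (A t - B t)) * GA t + ennreal (1 - \<phi>' n (A t - B t)) * GB t"
  have Kn: "igrad l (\<lambda>t. B t + \<phi> n (A t - B t)) (?K n)" for n
    by (rule igrad_blend[OF A B deriv cont b0])
  have W: "igrad l (\<lambda>t. A t + B t) (\<lambda>t. GA t + GB t)" by (rule igrad_add[OF A B])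
  show ?thesis
  proof (rule igrad_limit[OF Kn _ _ _ igradD(1)[OF W] igradD(2)[OF W]])
    show "(\<lambda>n. B t + \<phi> n (A t - B t)) \<longlonglongrightarrow> max (A t) (B t)" for t
    proof -
      have "(\<lambda>n. B t + \<phi> n (A t - B t)) \<longlonglongrightarrow> B t + max (A t - B t) 0" by (intro tendsto_intros lim)
      then show ?thesis by (simp add: max_def split: if_splits)
    qed
    show "?K n t \<le> GA t + GB t" for n t
    proof -
      have "ennreal (\<phi>' n (A t - B t)) * GA t \<le> 1 * GA t" "ennreal (1 - \<phi>' n (A t - B t)) * GB t \<le> 1 * GB t"
        using b0 by (intro mult_right_mono; simp)+
      then show ?thesis by (simp add: add_mono)
    qed
    \<comment> \<open>Where a gradient is infinite, its product with a positive coefficient tending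
      to 0 stays infinite; this happens only on a null set.\<close>
    have fin: "AE t in lborel. t \<in> {0..l} --> G t \<noteq> \<infinity>" if "igrad l X G" for X G
    proof -
      have "AE t in lborel. G t * indicator {0..l} t \<noteq> \<infinity>"
        using igradD(1,2)[OF that] by (intro nn_integral_noteq_infinite) auto
      then show ?thesis by eventually_elim (auto simp: indicator_def)
    qed
    show "AE t in lborel. t \<in> {0..l} --> (\<lambda>n. ?K n t) \<longlonglongrightarrow> (if B t < A t then GA t else GB t)"
      using fin[OF A] fin[OF B]
    proof eventually_elim
      case (elim t)
      show ?case
      proof
        assume t: "t \<in> {0..l}"
        define c :: real where "c = (if 0 < A t - B t then 1 else 0)"
        have "(\<lambda>n. ?K n t) \<longlonglongrightarrow> ennreal c * GA t + ennreal (1 - c) * GB t"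
          using lim'[of "A t - B t"] elim t unfolding c_def[symmetric]
          by (intro tendsto_add tendsto_ennreal_times tendsto_diff tendsto_const) (auto simp: less_top)
        then show "(\<lambda>n. ?K n t) \<longlonglongrightarrow> (if B t < A t then GA t else GB t)" by (auto simp: c_def)
      qed
    qed
    have cA: "continuous_on {0..l} A" and cB: "continuous_on {0..l} B"
      using igrad_continuous A B by auto
    have "(\<lambda>t. indicator {0..l} t *\<^sub>R (A t - B t)) \<in> borel_measurable borel"
      using cA cB by (intro borel_measurable_continuous_on_indicator continuous_intros) auto
    then have "(\<lambda>t. if 0 < indicator {0..l} t *\<^sub>R (A t - B t) then GA t * indicator {0..l} t else GB t * indicator {0..l} t) \<in> borel_measurable borel"
      using igradD(1)[OF A] igradD(1)[OF B] by measurable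
    moreover have "(if 0 < indicator {0..l} t *\<^sub>R (A t - B t) then GA t * indicator {0..l} t else GB t * indicator {0..l} t)
       = (if B t < A t then GA t else GB t) * indicator {0..l} t" for t by (auto simp: indicator_def)
    ultimately show "(\<lambda>t. (if B t < A t then GA t else GB t) * indicator {0..l} t) \<in> borel_measurable borel" by simp
  qed
qed

text \<open>By \<open>igrad_chain\<close> with both functions equal to \<open>F\<close>, every
  convex combination of two gradients with continuous weights is a gradient. The minimum is the
  combination weighted by the indicator of {G1 \<le> G2}, and this indicator is an almost everywhere
  limit of continuous functions.\<close>

lemma igrad_min_gradient:
  assumes G1: "igrad l F G1" and G2: "igrad l F G2"
  shows "igrad l F (\<lambda>t. min (G1 t) (G2 t))"
proof -
  define G1' where "G1' t = G1 t * indicator {0..l} t" for t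
  define G2' where "G2' t = G2 t * indicator {0..l} t" for t
  have m[measurable]: "G1' \<in> borel_measurable borel" "G2' \<in> borel_measurable borel"
    using igradD(1)[OF G1] igradD(1)[OF G2] by (simp_all add: G1'_def[abs_def] G2'_def[abs_def])
  define E where "E = {t. G1' t \<le> G2' t}"
  have E: "E \<in> sets borel" unfolding E_def by measurable
  have "(indicator E :: real => real) measurable_on UNIV"
    using E by (intro lebesgue_measurable_imp_measurable_on_real) (auto intro!: borel_measurable_indicator)
  then obtain N a where N: "negligible N" and ca: "\<And>n. continuous_on UNIV (a n :: real => real)"
    and la: "\<And>x. x \<notin> N ==> (\<lambda>n. a n x) \<longlonglongrightarrow> indicator E x"
    unfolding measurable_on_def by auto
  define \<alpha> where "\<alpha> n t = max 0 (min 1 (a n t))" for n t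
  have c: "continuous_on S (\<alpha> n)" for S n
    unfolding \<alpha>_def using continuous_on_subset[OF ca[of n], of S] by (auto intro!: continuous_intros)
  have \<alpha>: "0 \<le> \<alpha> n t" "\<alpha> n t \<le> 1" for n t by (auto simp: \<alpha>_def)
  have l\<alpha>: "(\<lambda>n. \<alpha> n t) \<longlonglongrightarrow> indicator E t" if "t \<notin> N" for t
  proof -
    have "(\<lambda>n. \<alpha> n t) \<longlonglongrightarrow> max 0 (min 1 (indicator E t))"
      unfolding \<alpha>_def using la[OF that] by (intro tendsto_intros)
    then show ?thesis by (auto simp: indicator_def split: if_splits)
  qed
  let ?K = "\<lambda>n t. ennreal (\<alpha> n t) * G1 t + ennreal (1 - \<alpha> n t) * G2 t"
  have Kn: "igrad l F (?K n)" for n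
  proof (rule igrad_chain[OF G1 G2])
    show "continuous_on {0..l} (\<alpha> n)" by (rule c)
    then show "continuous_on {0..l} (\<lambda>t. 1 - \<alpha> n t)" by (intro continuous_intros)
    fix \<tau> e :: real assume "0 < e"
    have "\<bar>F s - F t\<bar> \<le> (\<alpha> n \<tau> + e) * \<bar>F s - F t\<bar> + (1 - \<alpha> n \<tau> + e) * \<bar>F s - F t\<bar>" for s t
      using \<open>0 < e\<close> by (simp add: algebra_simps)
    then show "\<exists>d>0. \<forall>s t. 0 \<le> s --> s \<le> \<tau> --> \<tau> \<le> t --> t \<le> l --> t - s < d -->
      \<bar>F s - F t\<bar> \<le> (\<alpha> n \<tau> + e) * \<bar>F s - F t\<bar> + (1 - \<alpha> n \<tau> + e) * \<bar>F s - F t\<bar>"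
      by (intro exI[of _ 1]) auto
  qed (use \<alpha> in auto)
  \<comment> \<open>Supplies the integrable majorant \<open>G1 + G2\<close> for the passage to the
    limit.\<close>
  have W: "igrad l (\<lambda>t. F t + F t) (\<lambda>t. G1 t + G2 t)" by (rule igrad_add[OF G1 G2])
  show ?thesis
  proof (rule igrad_limit[OF Kn tendsto_const _ _ igradD(1)[OF W] igradD(2)[OF W]])
    show "?K n t \<le> G1 t + G2 t" for n t
    proof -
      have "ennreal (\<alpha> n t) * G1 t \<le> 1 * G1 t" "ennreal (1 - \<alpha> n t) * G2 t \<le> 1 * G2 t"
        using \<alpha> by (intro mult_right_mono; simp)+
      then show ?thesis by (simp add: add_mono)
    qed
    have "(\<lambda>t. min (G1' t) (G2' t)) \<in> borel_measurable borel" by measurable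
    moreover have "min (G1' t) (G2' t) = min (G1 t) (G2 t) * indicator {0..l} t" for t
      by (auto simp: G1'_def G2'_def indicator_def)
    ultimately show "(\<lambda>t. min (G1 t) (G2 t) * indicator {0..l} t) \<in> borel_measurable borel" by simp
    have fin: "AE t in lborel. t \<in> {0..l} --> G t \<noteq> \<infinity>" if "igrad l X G" for X G
    proof -
      have "AE t in lborel. G t * indicator {0..l} t \<noteq> \<infinity>"
        using igradD(1,2)[OF that] by (intro nn_integral_noteq_infinite) auto
      then show ?thesis by eventually_elim (auto simp: indicator_def)
    qed
    have "AE t in lborel. t \<notin> N"
    proof -
      obtain N' where "N' \<in> null_sets lborel" "N \<subseteq> N'"
        using N unfolding negligible_iff_null_sets null_sets_completion_iff2 by auto
      then show ?thesis by (intro AE_I'[of N']) auto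
    qed
    then show "AE t in lborel. t \<in> {0..l} --> (\<lambda>n. ?K n t) \<longlonglongrightarrow> min (G1 t) (G2 t)"
      using fin[OF G1] fin[OF G2]
    proof eventually_elim
      case (elim t)
      show ?case
      proof
        assume t: "t \<in> {0..l}"
        have "(\<lambda>n. ?K n t) \<longlonglongrightarrow> ennreal (indicator E t) * G1 t + ennreal (1 - indicator E t) * G2 t"
          using l\<alpha>[of t] elim t
          by (intro tendsto_add tendsto_ennreal_times tendsto_diff tendsto_const) (auto simp: less_top)
        then show "(\<lambda>n. ?K n t) \<longlonglongrightarrow> min (G1 t) (G2 t)"
          using t by (cases "t \<in> E") (auto simp: E_def G1'_def G2'_def min_def)
      qed
    qed
  qed
qed

text \<open>Subtracting from \<open>D\<close> its clipping to [-1/n, 1/n] gives functions that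
  vanish near every zero of \<open>D\<close>. At a point where \<open>D\<close> is not 0, short
  intervals lie in \<open>U\<close>. So the local inequality holds at all points for these
  functions, and they tend to \<open>D\<close>. The gradient \<open>H\<close> serves to make
  \<open>D\<close> continuous.\<close>

lemma igrad_zero_set:
  assumes D: "igrad l D H" and G: "(\<lambda>t. G t * indicator U t * indicator {0..l} t) \<in> borel_measurable borel"
    and Gf: "nnint {0..l} (\<lambda>\<tau>. G \<tau> * indicator U \<tau>) < \<infinity>"
    and zero: "\<And>t. t \<in> {0..l} ==> t \<notin> U ==> D t = 0"
    and U: "openin (top_of_set {0..l}) (U \<inter> {0..l})"
    and loc: "\<And>s t. 0 \<le> s ==> s \<le> t ==> t \<le> l ==> {s..t} \<subseteq> U ==> ennreal \<bar>D s - D t\<bar> \<le> nnint {s..t} G"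
  shows "igrad l D (\<lambda>t. G t * indicator U t)"
proof -
  define K where "K t = G t * indicator U t" for t
  define Dn where "Dn n t = D t - max (- (1 / real (Suc n))) (min (1 / real (Suc n)) (D t))" for n t
  have cD: "continuous_on {0..l} D" by (rule igrad_continuous[OF D])
  have Dn: "igrad l (Dn n) K" for n
  proof (rule igrad_local[where Q = "\<lambda>_. 0"])
    show "borel_on {0..l} K" "nnint {0..l} K < \<infinity>"
      using G Gf by (auto simp: K_def)
    fix \<tau> e :: real assume \<tau>: "0 \<le> \<tau>" "\<tau> \<le> l" and e: "0 < e"
    define \<epsilon> where "\<epsilon> = 1 / real (Suc n)"
    have \<epsilon>: "\<epsilon> > 0" by (simp add: \<epsilon>_def)
    have Dn': "Dn n t = D t - max (- \<epsilon>) (min \<epsilon> (D t))" for t by (simp add: Dn_def \<epsilon>_def)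
    show "\<exists>d>0. \<forall>s t. 0 \<le> s --> s \<le> \<tau> --> \<tau> \<le> t --> t \<le> l --> t - s < d -->
        ennreal \<bar>Dn n s - Dn n t\<bar> \<le> nnint {s..t} K + ennreal e * nnint {s..t} (\<lambda>\<tau>. 0)"
    proof (cases "D \<tau> = 0")
      case True
      obtain d where d: "d > 0" "\<And>t. t \<in> {0..l} ==> \<bar>t - \<tau>\<bar> < d ==> \<bar>D t - D \<tau>\<bar> < \<epsilon>"
        using continuous_on_interval_delta[OF cD, of \<tau> \<epsilon>] \<tau> \<epsilon> by auto
      have "Dn n t = 0" if "t \<in> {0..l}" "\<bar>t - \<tau>\<bar> < d" for t
        using d(2)[OF that] True by (auto simp: Dn' min_def max_def)
      then show ?thesis using d(1) by (intro exI[of _ d]) auto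
    next
      case False
      then have "\<tau> \<in> U \<inter> {0..l}" using zero[of \<tau>] \<tau> by auto
      then obtain d where d: "d > 0" "ball \<tau> d \<inter> {0..l} \<subseteq> U \<inter> {0..l}"
        using U unfolding openin_contains_ball by blast
      show ?thesis
      proof (intro exI[of _ d] conjI allI impI d(1))
        fix s t assume st: "0 \<le> s" "s \<le> \<tau>" "\<tau> \<le> t" "t \<le> l" "t - s < d"
        have sub: "{s..t} \<subseteq> U" using d(2) st by (auto simp: ball_def dist_real_def subset_iff)
        have "\<bar>Dn n s - Dn n t\<bar> \<le> \<bar>D s - D t\<bar>" using \<epsilon> by (auto simp: Dn' min_def max_def split: if_splits)
        then have "ennreal \<bar>Dn n s - Dn n t\<bar> \<le> ennreal \<bar>D s - D t\<bar>" by (rule ennreal_leI)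
        also have "\<dots> \<le> nnint {s..t} G" using loc[of s t] sub st by auto
        also have "\<dots> = nnint {s..t} K"
          using sub by (intro nn_integral_cong) (auto simp: K_def indicator_def)
        finally show "ennreal \<bar>Dn n s - Dn n t\<bar> \<le> nnint {s..t} K + ennreal e * nnint {s..t} (\<lambda>\<tau>. 0)"
          by simp
      qed
    qed
  qed auto
  have "igrad l D K"
  proof (rule igrad_limit[OF Dn _ _ igradD(1)[OF Dn[of 0]] igradD(1)[OF Dn[of 0]] igradD(2)[OF Dn[of 0]]])
    have \<delta>lim: "(\<lambda>n. 1 / real (Suc n)) \<longlonglongrightarrow> 0"
      using LIMSEQ_inverse_real_of_nat by (simp add: inverse_eq_divide)
    show "(\<lambda>n. Dn n t) \<longlonglongrightarrow> D t" for t
    proof -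
      have "(\<lambda>n. Dn n t) \<longlonglongrightarrow> D t - max (- 0) (min 0 (D t))"
        unfolding Dn_def by (intro tendsto_intros \<delta>lim)
      then show ?thesis by (simp add: max_def min_def split: if_splits)
    qed
  qed auto
  then show ?thesis by (simp add: K_def[abs_def])
qed

section \<open>Gradients along almost every curve\<close>

lemma epowr_0[simp]: "epowr 0 a = 0"
  by (simp add: epowr_def)

lemma epowr_top[simp]: "epowr top a = top"
  by (simp add: epowr_def)

lemma epowr_ennreal: "0 \<le> x ==> epowr (ennreal x) a = ennreal (x powr a)"
  by (simp add: epowr_def)

lemma epowr_mono:
  assumes "x \<le> y" "0 \<le> a" shows "epowr x a \<le> epowr y a"
proof (cases "y = top")
  case False
  then obtain r s where "0 \<le> r" "0 \<le> s" "x = ennreal r" "y = ennreal s"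
    using assms by (metis ennreal_cases neq_top_trans)
  then show ?thesis using assms by (auto simp: epowr_ennreal intro!: ennreal_leI powr_mono2)
qed auto

lemma epowr_inverse:
  assumes "0 < a" "0 < b" "a * b = 1" shows "epowr (epowr x a) b = x"
  by (cases x) (use assms in \<open>auto simp: epowr_ennreal powr_powr\<close>)

lemma epowr_mult:
  assumes "0 < a" shows "epowr (ennreal c * x) a = epowr (ennreal c) a * epowr x a"
proof (cases "0 < c")
  case True
  then show ?thesis
    by (cases x) (auto simp: epowr_ennreal ennreal_mult[symmetric] powr_mult ennreal_mult_top)
next
  case False
  then have "ennreal c = 0" by (simp add: ennreal_neg)
  then show ?thesis by simp
qed

lemma epowr_less_top: "epowr x a < top \<longleftrightarrow> x < top"
  by (cases x) (auto simp: epowr_ennreal)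

lemma epowr_eq_0: "epowr x a = 0 \<longleftrightarrow> x = 0"
  by (cases x) (auto simp: epowr_ennreal)

lemma epowr_measurable[measurable (raw)]:
  assumes [measurable]: "f \<in> borel_measurable M"
  shows "(\<lambda>x. epowr (f x) a) \<in> borel_measurable M"
  unfolding epowr_def by measurable

text \<open>Countably many functions are later combined by a supremum; this bound takes the place of
  Minkowski's inequality.\<close>

lemma epowr_SUP_le:
  fixes f :: "nat => ennreal"
  assumes "0 < a" shows "epowr (SUP n. f n) a \<le> (\<Sum>n. epowr (f n) a)"
proof -
  have "f n \<le> epowr (\<Sum>n. epowr (f n) a) (1 / a)" for n
  proof -
    have "f n = epowr (epowr (f n) a) (1 / a)" using assms by (simp add: epowr_inverse)
    also have "\<dots> \<le> epowr (\<Sum>n. epowr (f n) a) (1 / a)"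
      using assms sum_le_suminf[of "\<lambda>n. epowr (f n) a" "{n}"] by (intro epowr_mono) auto
    finally show ?thesis .
  qed
  then have "(SUP n. f n) \<le> epowr (\<Sum>n. epowr (f n) a) (1 / a)" by (rule SUP_least)
  then have "epowr (SUP n. f n) a \<le> epowr (epowr (\<Sum>n. epowr (f n) a) (1 / a)) a"
    using assms by (intro epowr_mono) auto
  also have "\<dots> = (\<Sum>n. epowr (f n) a)" using assms by (simp add: epowr_inverse)
  finally show ?thesis .
qed

lemma epowr_max: "0 < a ==> epowr (max x y) a = max (epowr x a) (epowr y a)"
  using epowr_mono[of x y a] epowr_mono[of y x a] by (auto simp: max_def)

section \<open>Curves parametrized by arc length and their subcurves\<close>

abbreviation curve :: "'a::metric_space set => real => (real => 'a) => bool" where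
  "curve A l \<gamma> \<equiv> (l, \<gamma>) \<in> arclength_curves A"

abbreviation grad_along :: "real => (real => 'a) => ('a => real) => ('a => ennreal) => bool" where
  "grad_along l \<gamma> u g \<equiv> igrad l (\<lambda>t. u (\<gamma> t)) (\<lambda>t. g (\<gamma> t))"

abbreviation egrad_along :: "real => (real => 'a) => ('a => ereal) => ('a => ennreal) => bool" where
  "egrad_along l \<gamma> f g \<equiv> grad_along l \<gamma> (\<lambda>x. real_of_ereal (f x)) g"

lemma arclength_curvesD:
  assumes "curve A l \<gamma>"
  shows "0 < l" "continuous_on {0..l} \<gamma>" "\<gamma> ` {0..l} \<subseteq> A" "\<And>t. t \<in> {0..l} ==> \<gamma> t \<in> A"
    "\<And>t. t \<in> {0..l} ==> curve_length \<gamma> 0 t = ennreal t"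
  using assms by (auto simp: arclength_curves_def)

lemma arclength_curves_mono: "A \<subseteq> B ==> arclength_curves A \<subseteq> arclength_curves B"
  by (auto simp: arclength_curves_def)

lemma curve_length_ge_sum:
  assumes "\<forall>i\<le>n. s i \<in> {a..b}" "\<forall>i<n. s i \<le> s (Suc i)"
  shows "(\<Sum>i<n. ennreal (dist (\<gamma> (s i)) (\<gamma> (s (Suc i))))) \<le> curve_length \<gamma> a b"
  unfolding curve_length_def using assms by (intro SUP_upper2[of "(n, s)"]) auto

text \<open>A partition of [a,b] becomes one of [a,c] by adding b and c at the end, which adds at
  least the distance between the last two points.\<close>

lemma curve_length_append:
  assumes "a \<le> b" "b \<le> c"
  shows "curve_length \<gamma> a b + ennreal (dist (\<gamma> b) (\<gamma> c)) \<le> curve_length \<gamma> a c"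
proof -
  have *: "(\<Sum>i<n. ennreal (dist (\<gamma> (s i)) (\<gamma> (s (Suc i))))) + ennreal (dist (\<gamma> b) (\<gamma> c)) \<le> curve_length \<gamma> a c"
    if s: "\<forall>i\<le>n. s i \<in> {a..b}" "\<forall>i<n. s i \<le> s (Suc i)" for n s
  proof -
    define s' where "s' i = (if i \<le> n then s i else if i = Suc n then b else c)" for i
    have A: "(\<Sum>i<Suc (Suc n). ennreal (dist (\<gamma> (s' i)) (\<gamma> (s' (Suc i))))) \<le> curve_length \<gamma> a c"
    proof (rule curve_length_ge_sum)
      show "\<forall>i\<le>Suc (Suc n). s' i \<in> {a..c}" using s(1) assms by (auto simp: s'_def intro: order_trans)
      show "\<forall>i<Suc (Suc n). s' i \<le> s' (Suc i)" using s assms by (auto simp: s'_def not_le less_Suc_eq)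
    qed
    have B: "(\<Sum>i<n. ennreal (dist (\<gamma> (s' i)) (\<gamma> (s' (Suc i))))) = (\<Sum>i<n. ennreal (dist (\<gamma> (s i)) (\<gamma> (s (Suc i)))))"
      by (intro sum.cong) (auto simp: s'_def)
    have C: "(\<Sum>i<n. ennreal (dist (\<gamma> (s' i)) (\<gamma> (s' (Suc i))))) + ennreal (dist (\<gamma> b) (\<gamma> c))
       \<le> (\<Sum>i<Suc (Suc n). ennreal (dist (\<gamma> (s' i)) (\<gamma> (s' (Suc i)))))"
      by (auto simp: s'_def intro!: add_right_mono simp: add_increasing2)
    show ?thesis using order_trans[OF C A] unfolding B .
  qed
  have "curve_length \<gamma> a b + ennreal (dist (\<gamma> b) (\<gamma> c)) =
    (SUP (n, s) \<in> {(n::nat, s). (\<forall>i\<le>n. s i \<in> {a..b}) \<and> (\<forall>i<n. s i \<le> s (Suc i))}.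
        (\<Sum>i<n. ennreal (dist (\<gamma> (s i)) (\<gamma> (s (Suc i))))) + ennreal (dist (\<gamma> b) (\<gamma> c)))"
    unfolding curve_length_def using assms(1)
    by (subst ennreal_SUP_add_left[symmetric]) (auto simp: case_prod_unfold intro!: exI[of _ "0::nat"] exI[of _ "\<lambda>_. a"])
  also have "\<dots> \<le> curve_length \<gamma> a c" by (intro SUP_least) (auto intro!: * simp del: sum_ennreal)
  finally show ?thesis .
qed

lemma arclength_dist_le:
  assumes "curve A l \<gamma>" "0 \<le> s" "s \<le> t" "t \<le> l"
  shows "dist (\<gamma> s) (\<gamma> t) \<le> t - s"
proof -
  have "ennreal s + ennreal (dist (\<gamma> s) (\<gamma> t)) \<le> ennreal t"
    using curve_length_append[of 0 s t \<gamma>] arclength_curvesD(5)[OF assms(1)] assms by simp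
  then have "ennreal (s + dist (\<gamma> s) (\<gamma> t)) \<le> ennreal t" using assms by (subst ennreal_plus) auto
  then have "s + dist (\<gamma> s) (\<gamma> t) \<le> t" using assms by (subst (asm) ennreal_le_iff) auto
  then show ?thesis by simp
qed

text \<open>Both bounds use that the curve is 1-Lipschitz. For the lower bound a partition of [0,t]
  is cut at s: the part before s contributes at most s, and the rest is a partition of
  [s,t].\<close>

lemma arclength_sub_length:
  assumes c: "curve A l \<gamma>" and st: "0 \<le> s" "s \<le> t" "t \<le> l"
  shows "curve_length \<gamma> s t = ennreal (t - s)"
proof (rule antisym)
  show "curve_length \<gamma> s t \<le> ennreal (t - s)"
    unfolding curve_length_def
  proof (intro SUP_least, clarify)
    fix n :: nat and \<sigma> :: "nat => real"
    assume \<sigma>: "\<forall>i\<le>n. \<sigma> i \<in> {s..t}" "\<forall>i<n. \<sigma> i \<le> \<sigma> (Suc i)"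
    have "(\<Sum>i<n. ennreal (dist (\<gamma> (\<sigma> i)) (\<gamma> (\<sigma> (Suc i))))) \<le> (\<Sum>i<n. ennreal (\<sigma> (Suc i) - \<sigma> i))"
    proof (intro sum_mono ennreal_leI arclength_dist_le[OF c])
      fix i assume "i \<in> {..<n}"
      then show "0 \<le> \<sigma> i" "\<sigma> i \<le> \<sigma> (Suc i)" "\<sigma> (Suc i) \<le> l"
        using \<sigma>(1)[rule_format, of i] \<sigma>(1)[rule_format, of "Suc i"] \<sigma>(2) st by auto
    qed
    also have "\<dots> = ennreal (\<Sum>i<n. \<sigma> (Suc i) - \<sigma> i)" using \<sigma>(2) by (subst sum_ennreal) auto
    also have "(\<Sum>i<n. \<sigma> (Suc i) - \<sigma> i) = \<sigma> n - \<sigma> 0" by (rule sum_lessThan_telescope)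
    also have "\<dots> \<le> t - s" using \<sigma>(1)[rule_format, of 0] \<sigma>(1)[rule_format, of n] by auto
    finally show "(\<Sum>i<n. ennreal (dist (\<gamma> (\<sigma> i)) (\<gamma> (\<sigma> (Suc i))))) \<le> ennreal (t - s)" by (simp add: ennreal_leI)
  qed
  have "ennreal t \<le> curve_length \<gamma> s t + ennreal s"
  proof -
    have "curve_length \<gamma> 0 t \<le> curve_length \<gamma> s t + ennreal s"
      unfolding curve_length_def[of \<gamma> 0 t]
    proof (intro SUP_least, clarify)
      fix n :: nat and \<sigma> :: "nat => real"
      assume \<sigma>: "\<forall>i\<le>n. \<sigma> i \<in> {0..t}" "\<forall>i<n. \<sigma> i \<le> \<sigma> (Suc i)"
      \<comment> \<open>Replacing the partition points by their maximum and minimum with s keeps the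
        index set, so the cut can be estimated term by term.\<close>
      define \<sigma>1 where "\<sigma>1 i = max s (\<sigma> i)" for i
      define \<sigma>2 where "\<sigma>2 i = min s (\<sigma> i)" for i
      have "(\<Sum>i<n. ennreal (dist (\<gamma> (\<sigma> i)) (\<gamma> (\<sigma> (Suc i))))) \<le>
          (\<Sum>i<n. ennreal (dist (\<gamma> (\<sigma>1 i)) (\<gamma> (\<sigma>1 (Suc i)))) + ennreal (\<sigma>2 (Suc i) - \<sigma>2 i))"
      proof (intro sum_mono)
        fix i assume "i \<in> {..<n}"
        then have i: "0 \<le> \<sigma> i" "\<sigma> i \<le> \<sigma> (Suc i)" "\<sigma> (Suc i) \<le> t"
          using \<sigma>(1)[rule_format, of i] \<sigma>(1)[rule_format, of "Suc i"] \<sigma>(2) by auto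
        have "dist (\<gamma> (\<sigma> i)) (\<gamma> (\<sigma> (Suc i))) \<le> dist (\<gamma> (\<sigma>1 i)) (\<gamma> (\<sigma>1 (Suc i))) + (\<sigma>2 (Suc i) - \<sigma>2 i)"
        proof -
          consider "s \<le> \<sigma> i" | "\<sigma> (Suc i) \<le> s" | "\<sigma> i \<le> s" "s \<le> \<sigma> (Suc i)" by linarith
          then show ?thesis
          proof cases
            case 1 then show ?thesis using i by (auto simp: \<sigma>1_def \<sigma>2_def max_def min_def)
          next
            case 2 then show ?thesis using i arclength_dist_le[OF c i(1,2)] st by (auto simp: \<sigma>1_def \<sigma>2_def max_def min_def)
          next
            case 3
            have "dist (\<gamma> (\<sigma> i)) (\<gamma> (\<sigma> (Suc i))) \<le> dist (\<gamma> (\<sigma> i)) (\<gamma> s) + dist (\<gamma> s) (\<gamma> (\<sigma> (Suc i)))"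
              by (rule dist_triangle)
            then show ?thesis using 3 arclength_dist_le[OF c i(1) 3(1)] st by (auto simp: \<sigma>1_def \<sigma>2_def max_def min_def)
          qed
        qed
        also have "ennreal \<dots> = ennreal (dist (\<gamma> (\<sigma>1 i)) (\<gamma> (\<sigma>1 (Suc i)))) + ennreal (\<sigma>2 (Suc i) - \<sigma>2 i)"
          using i by (intro ennreal_plus) (auto simp: \<sigma>2_def)
        finally show "ennreal (dist (\<gamma> (\<sigma> i)) (\<gamma> (\<sigma> (Suc i)))) \<le> ennreal (dist (\<gamma> (\<sigma>1 i)) (\<gamma> (\<sigma>1 (Suc i)))) + ennreal (\<sigma>2 (Suc i) - \<sigma>2 i)"
          by (simp add: ennreal_leI)
      qed
      also have "\<dots> = (\<Sum>i<n. ennreal (dist (\<gamma> (\<sigma>1 i)) (\<gamma> (\<sigma>1 (Suc i))))) + (\<Sum>i<n. ennreal (\<sigma>2 (Suc i) - \<sigma>2 i))"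
        by (rule sum.distrib)
      also have "\<dots> \<le> curve_length \<gamma> s t + ennreal s"
      proof (intro add_mono curve_length_ge_sum)
        show "\<forall>i\<le>n. \<sigma>1 i \<in> {s..t}" using \<sigma>(1) st by (auto simp: \<sigma>1_def)
        show "\<forall>i<n. \<sigma>1 i \<le> \<sigma>1 (Suc i)" using \<sigma>(2) by (auto simp: \<sigma>1_def intro: max.mono)
        have mono: "\<forall>i<n. \<sigma>2 i \<le> \<sigma>2 (Suc i)" using \<sigma>(2) by (auto simp: \<sigma>2_def intro: min.mono)
        then have "(\<Sum>i<n. ennreal (\<sigma>2 (Suc i) - \<sigma>2 i)) = ennreal (\<Sum>i<n. \<sigma>2 (Suc i) - \<sigma>2 i)"
          by (subst sum_ennreal) auto
        also have "(\<Sum>i<n. \<sigma>2 (Suc i) - \<sigma>2 i) = \<sigma>2 n - \<sigma>2 0" by (rule sum_lessThan_telescope)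
        also have "\<dots> \<le> s" using \<sigma>(1)[rule_format, of 0] st by (auto simp: \<sigma>2_def)
        finally show "(\<Sum>i<n. ennreal (\<sigma>2 (Suc i) - \<sigma>2 i)) \<le> ennreal s" by (simp add: ennreal_leI)
      qed
      finally show "(\<Sum>i<n. ennreal (dist (\<gamma> (\<sigma> i)) (\<gamma> (\<sigma> (Suc i))))) \<le> curve_length \<gamma> s t + ennreal s" .
    qed
    then show ?thesis using arclength_curvesD(5)[OF c, of t] st by simp
  qed
  then have "ennreal (t - s) + ennreal s \<le> curve_length \<gamma> s t + ennreal s"
    using st by (simp flip: ennreal_plus)
  then show "ennreal (t - s) \<le> curve_length \<gamma> s t" by (simp add: ennreal_add_left_cancel_le add.commute)
qed

lemma curve_length_shift: "curve_length (\<lambda>\<tau>. \<gamma> (s + \<tau>)) a b = curve_length \<gamma> (s + a) (s + b)"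
proof (rule antisym)
  show "curve_length (\<lambda>\<tau>. \<gamma> (s + \<tau>)) a b \<le> curve_length \<gamma> (s + a) (s + b)"
    unfolding curve_length_def[of _ a b]
  proof (intro SUP_least, clarify)
    fix n :: nat and \<sigma> assume \<sigma>: "\<forall>i\<le>n. \<sigma> i \<in> {a..b}" "\<forall>i<n. \<sigma> i \<le> \<sigma> (Suc i)"
    show "(\<Sum>i<n. ennreal (dist (\<gamma> (s + \<sigma> i)) (\<gamma> (s + \<sigma> (Suc i))))) \<le> curve_length \<gamma> (s + a) (s + b)"
      using curve_length_ge_sum[of n "\<lambda>i. s + \<sigma> i" "s + a" "s + b" \<gamma>] \<sigma> by auto
  qed
  show "curve_length \<gamma> (s + a) (s + b) \<le> curve_length (\<lambda>\<tau>. \<gamma> (s + \<tau>)) a b"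
    unfolding curve_length_def[of _ "s + a"]
  proof (intro SUP_least, clarify)
    fix n :: nat and \<sigma> assume \<sigma>: "\<forall>i\<le>n. \<sigma> i \<in> {s + a..s + b}" "\<forall>i<n. \<sigma> i \<le> \<sigma> (Suc i)"
    show "(\<Sum>i<n. ennreal (dist (\<gamma> (\<sigma> i)) (\<gamma> (\<sigma> (Suc i))))) \<le> curve_length (\<lambda>\<tau>. \<gamma> (s + \<tau>)) a b"
      using curve_length_ge_sum[of n "\<lambda>i. \<sigma> i - s" a b "\<lambda>\<tau>. \<gamma> (s + \<tau>)"] \<sigma> by (force simp: algebra_simps)
  qed
qed

lemma arclength_subcurve:
  assumes c: "curve A l \<gamma>" and st: "0 \<le> s" "s < t" "t \<le> l" and B: "\<gamma> ` {s..t} \<subseteq> B"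
  shows "(t - s, \<lambda>\<tau>. \<gamma> (s + \<tau>)) \<in> arclength_curves B"
  unfolding arclength_curves_def
proof (clarify, intro conjI ballI)
  show "0 < t - s" using st by simp
  show "continuous_on {0..t - s} (\<lambda>\<tau>. \<gamma> (s + \<tau>))"
    using st by (intro continuous_on_compose2[OF arclength_curvesD(2)[OF c]] continuous_intros) auto
  show "(\<lambda>\<tau>. \<gamma> (s + \<tau>)) ` {0..t - s} \<subseteq> B" using B by auto
  fix \<tau> assume "\<tau> \<in> {0..t - s}"
  then show "curve_length (\<lambda>\<tau>. \<gamma> (s + \<tau>)) 0 \<tau> = ennreal \<tau>"
    using arclength_sub_length[OF c, of s "s + \<tau>"] st by (auto simp: curve_length_shift)
qed

lemma curve_borel:
  fixes \<gamma> :: "real => 'a::metric_space"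
  assumes c: "curve A l \<gamma>" and g: "(g :: 'a => ennreal) \<in> borel_measurable borel"
  shows "(\<lambda>t. g (\<gamma> t) * indicator {0..l} t) \<in> borel_measurable borel"
proof -
  \<comment> \<open>Clamping the parameter to [0,l] extends the curve continuously to the whole
    line.\<close>
  have cl: "continuous_on UNIV (\<lambda>t. \<gamma> (max 0 (min l t)))"
    using arclength_curvesD(1)[OF c]
    by (intro continuous_on_compose2[OF arclength_curvesD(2)[OF c]] continuous_intros) auto
  have "(\<lambda>t. g (\<gamma> (max 0 (min l t))) * indicator {0..l} t) \<in> borel_measurable borel"
    using measurable_compose[OF borel_measurable_continuous_onI[OF cl] g] by measurable
  moreover have "g (\<gamma> (max 0 (min l t))) * indicator {0..l} t = g (\<gamma> t) * indicator {0..l} t" for t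
    by (auto simp: indicator_def)
  ultimately show ?thesis by simp
qed

lemma curve_integral_subcurve:
  fixes \<gamma> :: "real => 'a::metric_space"
  assumes c: "curve A l \<gamma>" and g: "(g :: 'a => ennreal) \<in> borel_measurable borel"
    and st: "0 \<le> s" "t \<le> l"
  shows "curve_integral (t - s) (\<lambda>\<tau>. \<gamma> (s + \<tau>)) g = nnint {s..t} (\<lambda>\<tau>. g (\<gamma> \<tau>))"
proof -
  have "(\<lambda>\<tau>. g (\<gamma> \<tau>) * indicator {s..t} \<tau>) \<in> borel_measurable borel"
    using set_borel_subinterval[OF curve_borel[OF c g]] st by auto
  from nn_integral_real_affine[OF this, of 1 s]
  show ?thesis unfolding curve_integral_def by (auto intro!: nn_integral_cong simp: indicator_def)
qed

section \<open>The completed Borel measure and exceptional families of curves\<close>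

locale borel_mm =
  fixes p :: real and \<mu> :: "'a::metric_space measure"
  assumes p1: "1 < p" and cb: "complete_borel_measure \<mu>"
begin

lemma p0: "0 < p" "0 \<le> p" using p1 by auto

lemma space_mu[simp]: "space \<mu> = UNIV"
  and borel_sets[measurable (raw)]: "A \<in> sets borel ==> A \<in> sets \<mu>"
  and mu_complete: "N \<in> null_sets \<mu> ==> M \<subseteq> N ==> M \<in> null_sets \<mu>"
proof -
  obtain \<nu> where \<nu>: "sets \<nu> = sets borel" "\<mu> = completion \<nu>" using cb unfolding complete_borel_measure_def by auto
  have "space \<nu> = UNIV" using sets_eq_imp_space_eq[OF \<nu>(1)] by simp
  then show "space \<mu> = UNIV" using \<nu> by simp
  show "A \<in> sets borel ==> A \<in> sets \<mu>" using \<nu> by (auto intro: sets_completionI_sets)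
  show "N \<in> null_sets \<mu> ==> M \<subseteq> N ==> M \<in> null_sets \<mu>"
    using \<nu>(2) by (auto intro: null_sets_completion_subset)
qed

lemma borel_mu: "f \<in> borel_measurable borel ==> f \<in> borel_measurable \<mu>"
  by (intro measurableI) (auto intro!: borel_sets intro: measurable_sets_borel)

lemma open_mu[measurable]: "open A ==> A \<in> sets \<mu>"
  by (intro borel_sets) auto

abbreviation meas :: "('a => 'b::topological_space) => bool" where "meas f \<equiv> f \<in> borel_measurable \<mu>"

text \<open>A \<open>\<mu>\<close>-measurable function composed with a curve may fail to be
  measurable, a Borel function does not. The majorant has to be larger everywhere, so that upper
  gradient inequalities and infinite curve integrals survive the replacement; on a Borel null set it
  is put equal to \<open>top\<close>.\<close>

lemma borel_majorant:
  fixes g :: "'a => ennreal"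
  assumes "meas g"
  shows "\<exists>g'. g' \<in> borel_measurable borel \<and> (\<forall>x. g x \<le> g' x) \<and> (AE x in \<mu>. g' x = g x)"
proof -
  obtain \<nu> where \<nu>: "sets \<nu> = sets borel" "\<mu> = completion \<nu>" using cb unfolding complete_borel_measure_def by auto
  obtain h where h: "h \<in> borel_measurable \<nu>" "AE x in \<nu>. g x = h x"
    using completion_ex_borel_measurable[of g \<nu>] assms unfolding \<nu>(2) by blast
  obtain N where N: "N \<in> null_sets \<nu>" "{x. g x \<noteq> h x} \<subseteq> N"
    using h(2) sets_eq_imp_space_eq[OF \<nu>(1)] by (auto elim!: AE_E simp: null_sets_def)
  have hN: "h x = g x" if "x \<notin> N" for x using N(2) that by (metis (mono_tags, lifting) mem_Collect_eq subsetD)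
  have hb: "h \<in> borel_measurable borel" using h(1) measurable_cong_sets[OF \<nu>(1) refl] by auto
  have Nb: "N \<in> sets borel" using N \<nu> by auto
  show ?thesis
  proof (intro exI[of _ "\<lambda>x. if x \<in> N then top else h x"] conjI allI)
    show "(\<lambda>x. if x \<in> N then top else h x) \<in> borel_measurable borel" using hb Nb by measurable
    show "g x \<le> (if x \<in> N then top else h x)" for x using N(2) by (auto simp: subset_iff intro: eq_refl)
    have "AE x in \<mu>. x \<notin> N" unfolding \<nu>(2) by (rule AE_completion[OF AE_not_in[OF N(1)]])
    then show "AE x in \<mu>. (if x \<in> N then top else h x) = g x"
      by eventually_elim (use hN in auto)
  qed
qed

lemma borel_minorant_set:
  assumes "S \<in> sets \<mu>"
  shows "\<exists>S'. S' \<in> sets borel \<and> S' \<subseteq> S \<and> S - S' \<in> null_sets \<mu>"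
proof -
  have im: "(indicator (- S) :: 'a => ennreal) \<in> borel_measurable \<mu>"
    using assms sets.compl_sets[OF assms] by (intro borel_measurable_indicator) (auto simp: Compl_eq_Diff_UNIV)
  obtain g' :: "'a => ennreal" where g': "g' \<in> borel_measurable borel" "\<And>x. indicator (- S) x \<le> g' x" "AE x in \<mu>. g' x = indicator (- S) x"
    using borel_majorant[OF im] by blast
  have ge: "1 \<le> g' x" if "x \<notin> S" for x using g'(2)[of x] that by auto
  show ?thesis
  proof (intro exI[of _ "{x. g' x < 1}"] conjI)
    have "{x \<in> space borel. g' x < 1} \<in> sets borel" using g'(1) by measurable
    then show b: "{x. g' x < 1} \<in> sets borel" by simp
    show "{x. g' x < 1} \<subseteq> S" using ge by (force simp: not_le[symmetric])
    have "AE x in \<mu>. x \<notin> S - {x. g' x < 1}" using g'(3) by eventually_elim auto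
    moreover have "S - {x. g' x < 1} \<in> sets \<mu>" using assms borel_sets[OF b] by auto
    ultimately show "S - {x. g' x < 1} \<in> null_sets \<mu>" by (simp add: AE_iff_null_sets)
  qed
qed

lemma AE_borel_null:
  assumes "AE x in \<mu>. P x"
  shows "\<exists>N. N \<in> sets borel \<and> N \<in> null_sets \<mu> \<and> (\<forall>x. x \<notin> N --> P x)"
proof -
  obtain M where M: "M \<in> null_sets \<mu>" "{x. \<not> P x} \<subseteq> M" using assms by (auto elim!: AE_E simp: null_sets_def)
  obtain S' where S': "S' \<in> sets borel" "S' \<subseteq> - M" "- M - S' \<in> null_sets \<mu>"
    using borel_minorant_set[of "- M"] M(1) sets.compl_sets[of M \<mu>] by (auto simp: Compl_eq_Diff_UNIV null_sets_def)
  show ?thesis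
  proof (intro exI[of _ "- S'"] conjI allI impI)
    show "- S' \<in> sets borel" using S'(1) by (simp add: Compl_eq_Diff_UNIV sets.compl_sets flip: space_borel)
    have "- S' = M \<union> (- M - S')" using S'(2) by auto
    then show "- S' \<in> null_sets \<mu>" using M(1) S'(3) by (metis null_sets.Un)
    show "P x" if "x \<notin> - S'" for x using that S'(2) M(2) by auto
  qed
qed

abbreviation energy :: "'a set => ('a => ennreal) => ennreal" where "energy A g \<equiv> \<integral>\<^sup>+x\<in>A. epowr (g x) p \<partial>\<mu>"

abbreviation ball_int :: "'a => real => ('a => real) => real" where
  "ball_int x r f \<equiv> \<integral>y. indicator (ball x r) y * f y \<partial>\<mu>"

text \<open>Borel on the whole space, so that its curve integrals have measurable integrands. Such
  functions describe exceptional families: the bad curves are those with infinite curve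
  integral.\<close>

definition bLp :: "('a => ennreal) => bool" where
  "bLp \<rho> \<longleftrightarrow> \<rho> \<in> borel_measurable borel \<and> (\<integral>\<^sup>+x. epowr (\<rho> x) p \<partial>\<mu>) < \<infinity>"

text \<open>\<open>R\<close> is at least a positive multiple of each \<open>\<rho> n\<close>, so a
  curve that is good for \<open>R\<close> is good for all of them. This merges countably many
  exceptional families.\<close>

lemma bLp_countable:
  assumes "\<And>n::nat. bLp (\<rho> n)"
  shows "\<exists>R. bLp R \<and> (\<forall>A l \<gamma> n. curve A l \<gamma> --> curve_integral l \<gamma> R < \<infinity> --> curve_integral l \<gamma> (\<rho> n) < \<infinity>)"
proof -
  define I where "I n = (\<integral>\<^sup>+x. epowr (\<rho> n x) p \<partial>\<mu>)" for n
  have I: "I n < \<infinity>" for n using assms by (auto simp: I_def bLp_def)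
  \<comment> \<open>The multiple \<open>c n\<close> has p-th power \<open>d n\<close>, chosen so
    that the n-th function contributes at most 2^-n to the integral of the p-th power of
    \<open>R\<close>; the 1 in the denominator guards against \<open>I n\<close> = 0.\<close>
  define d where "d n = (1/2)^n / (enn2real (I n) + 1)" for n
  define c where "c n = d n powr (1 / p)" for n
  have d: "d n > 0" for n by (auto simp: d_def intro!: divide_pos_pos add_nonneg_pos)
  have c: "c n > 0" for n using d[of n] by (simp add: c_def)
  have cp: "epowr (ennreal (c n)) p = ennreal (d n)" for n
    using d[of n] p0 less_imp_neq[OF d[of n], symmetric] by (simp add: epowr_ennreal c_def powr_powr)
  define R where "R x = (SUP n. ennreal (c n) * \<rho> n x)" for x
  have m: "\<rho> n \<in> borel_measurable borel" for n using assms by (auto simp: bLp_def)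
  note [measurable] = m borel_mu[OF m]
  have Rb: "R \<in> borel_measurable borel" unfolding R_def[abs_def] by measurable
  have "(\<integral>\<^sup>+x. epowr (R x) p \<partial>\<mu>) \<le> (\<integral>\<^sup>+x. (\<Sum>n. epowr (ennreal (c n) * \<rho> n x) p) \<partial>\<mu>)"
    unfolding R_def using p0 by (intro nn_integral_mono epowr_SUP_le) auto
  also have "\<dots> = (\<Sum>n. \<integral>\<^sup>+x. epowr (ennreal (c n) * \<rho> n x) p \<partial>\<mu>)"
    by (intro nn_integral_suminf) measurable
  also have "\<dots> = (\<Sum>n. ennreal (d n) * I n)"
    using p0 by (simp add: epowr_mult cp nn_integral_cmult I_def)
  also have "\<dots> \<le> (\<Sum>n. ennreal ((1/2)^n))"
  proof (intro suminf_le)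
    fix n
    obtain r where r: "0 \<le> r" "I n = ennreal r" using I[of n] by (cases "I n") auto
    have "ennreal (d n) * I n = ennreal ((1/2)^n * (r / (r + 1)))"
      using r by (simp add: d_def ennreal_mult'[symmetric])
    also have "\<dots> \<le> ennreal ((1/2)^n * 1)" using r by (intro ennreal_leI mult_left_mono) (auto simp: field_simps)
    finally show "ennreal (d n) * I n \<le> ennreal ((1/2)^n)" by simp
  qed auto
  also have "\<dots> = ennreal (\<Sum>n. (1/2)^n)" by (intro suminf_ennreal2) (auto intro: summable_geometric)
  also have "\<dots> < \<infinity>" by simp
  finally have "bLp R" using Rb by (simp add: bLp_def)
  then show ?thesis
  proof (intro exI[of _ R] conjI allI impI)
    fix A l \<gamma> n assume cu: "curve A l \<gamma>" and f: "curve_integral l \<gamma> R < \<infinity>"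
    have "ennreal (c n) * curve_integral l \<gamma> (\<rho> n) = (\<integral>\<^sup>+\<tau>. ennreal (c n) * (\<rho> n (\<gamma> \<tau>) * indicator {0..l} \<tau>) \<partial>lborel)"
      unfolding curve_integral_def using curve_borel[OF cu m[of n]] by (intro nn_integral_cmult[symmetric]) auto
    also have "\<dots> \<le> curve_integral l \<gamma> R"
      unfolding curve_integral_def R_def
      by (intro nn_integral_mono) (auto simp: indicator_def intro: SUP_upper)
    finally show "curve_integral l \<gamma> (\<rho> n) < \<infinity>"
      using f c[of n] by (auto simp: ennreal_mult_eq_top_iff top_unique less_top[symmetric] dest: neq_top_trans)
  qed
qed

lemma bLp_binary:
  assumes "bLp \<rho>1" "bLp \<rho>2"
  shows "\<exists>R. bLp R \<and> (\<forall>A l \<gamma>. curve A l \<gamma> --> curve_integral l \<gamma> R < \<infinity> -->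
     curve_integral l \<gamma> \<rho>1 < \<infinity> \<and> curve_integral l \<gamma> \<rho>2 < \<infinity>)"
proof -
  have "bLp ((\<lambda>n::nat. if n = 0 then \<rho>1 else \<rho>2) n)" for n using assms by auto
  from bLp_countable[of "\<lambda>n::nat. if n = 0 then \<rho>1 else \<rho>2", OF this] obtain R where R: "bLp R"
    "\<forall>A l \<gamma>. \<forall>n::nat. curve A l \<gamma> --> curve_integral l \<gamma> R < \<infinity> --> curve_integral l \<gamma> (if n = 0 then \<rho>1 else \<rho>2) < \<infinity>"
    by blast
  show ?thesis
  proof (intro exI[of _ R] conjI allI impI R(1))
    fix A l \<gamma> assume "curve A l \<gamma>" "curve_integral l \<gamma> R < \<infinity>"
    then show "curve_integral l \<gamma> \<rho>1 < \<infinity>" "curve_integral l \<gamma> \<rho>2 < \<infinity>"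
      using R(2)[rule_format, of l \<gamma> A 0] R(2)[rule_format, of l \<gamma> A 1] by auto
  qed
qed

text \<open>In contrast to weak upper gradients, the function is required to
  be finite along the curve and the inequality to hold on all subcurves.\<close>

definition egrad :: "'a set => ('a => ereal) => ('a => ennreal) => bool" where
  "egrad A f g \<longleftrightarrow> meas g \<and>
     (\<exists>\<rho>. bLp \<rho> \<and> (\<forall>l \<gamma>. curve A l \<gamma> --> curve_integral l \<gamma> \<rho> < \<infinity> -->
        (\<forall>t\<in>{0..l}. \<bar>f (\<gamma> t)\<bar> \<noteq> \<infinity>) \<and> egrad_along l \<gamma> f g))"

abbreviation pgrad :: "'a set => ('a => real) => ('a => ennreal) => bool" where
  "pgrad A u g \<equiv> egrad A (\<lambda>x. ereal (u x)) g"

lemma egradE: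
  assumes "egrad A f g"
  obtains \<rho> where "meas g" "bLp \<rho>"
    "\<And>l \<gamma> t. curve A l \<gamma> ==> curve_integral l \<gamma> \<rho> < \<infinity> ==> t \<in> {0..l} ==> \<bar>f (\<gamma> t)\<bar> \<noteq> \<infinity>"
    "\<And>l \<gamma>. curve A l \<gamma> ==> curve_integral l \<gamma> \<rho> < \<infinity> ==>
        egrad_along l \<gamma> f g"
proof -
  obtain \<rho> where g: "meas g" and \<rho>: "bLp \<rho>" and
    H: "\<forall>l \<gamma>. curve A l \<gamma> --> curve_integral l \<gamma> \<rho> < \<infinity> -->
        (\<forall>t\<in>{0..l}. \<bar>f (\<gamma> t)\<bar> \<noteq> \<infinity>) \<and> egrad_along l \<gamma> f g"
    using assms unfolding egrad_def by blast
  note H = H[rule_format]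
  show ?thesis
  proof (rule that[OF g \<rho>])
    fix l \<gamma> t assume a: "curve A l \<gamma>" "curve_integral l \<gamma> \<rho> < \<infinity>" and t: "t \<in> {0..l}"
    from H[OF a] have "\<forall>t\<in>{0..l}. \<bar>f (\<gamma> t)\<bar> \<noteq> \<infinity>" by (rule conjunct1)
    then show "\<bar>f (\<gamma> t)\<bar> \<noteq> \<infinity>" using t by (rule bspec)
  next
    fix l \<gamma> assume a: "curve A l \<gamma>" "curve_integral l \<gamma> \<rho> < \<infinity>"
    from H[OF a] show "egrad_along l \<gamma> f g" by (rule conjunct2)
  qed
qed

lemma pgradI:
  assumes "meas g" "bLp \<rho>"
    "\<And>l \<gamma>. curve A l \<gamma> ==> curve_integral l \<gamma> \<rho> < \<infinity> ==> grad_along l \<gamma> u g"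
  shows "pgrad A u g"
  using assms unfolding egrad_def by auto

text \<open>Carries a rule for \<open>igrad\<close> over to gradients on sets, curve by curve. The
  variants for two and for countably many functions first merge the exceptional families by
  \<open>bLp_binary\<close> and \<open>bLp_countable\<close>.\<close>

lemma egrad_lift:
  assumes f: "egrad A f g" and k: "meas k"
    and step: "\<And>l \<gamma>. curve A l \<gamma> ==> (\<forall>t\<in>{0..l}. \<bar>f (\<gamma> t)\<bar> \<noteq> \<infinity>) ==>
      egrad_along l \<gamma> f g ==>
      (\<forall>t\<in>{0..l}. \<bar>w (\<gamma> t)\<bar> \<noteq> \<infinity>) \<and> egrad_along l \<gamma> w k"
  shows "egrad A w k"
proof -
  obtain \<rho> where \<rho>: "bLp \<rho>"
    "\<And>l \<gamma> t. curve A l \<gamma> ==> curve_integral l \<gamma> \<rho> < \<infinity> ==> t \<in> {0..l} ==> \<bar>f (\<gamma> t)\<bar> \<noteq> \<infinity>"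
    "\<And>l \<gamma>. curve A l \<gamma> ==> curve_integral l \<gamma> \<rho> < \<infinity> ==>
        egrad_along l \<gamma> f g"
    using f by (rule egradE) blast
  show ?thesis unfolding egrad_def
    by (intro conjI k exI[of _ \<rho>] \<rho>(1) allI impI step) (use \<rho> in auto)
qed

lemma pgrad_lift:
  assumes f: "pgrad A u g" and k: "meas k"
    and step: "\<And>l \<gamma>. curve A l \<gamma> ==>
      grad_along l \<gamma> u g ==> grad_along l \<gamma> w k"
  shows "pgrad A w k"
  by (rule egrad_lift[OF f k]) (use step in auto)

lemma pgrad_lift2:
  assumes u: "pgrad A u g" and v: "pgrad A v h" and k: "meas k"
    and step: "\<And>l \<gamma>. curve A l \<gamma> ==>
      grad_along l \<gamma> u g ==> grad_along l \<gamma> v h ==>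
      grad_along l \<gamma> w k"
  shows "pgrad A w k"
proof -
  obtain \<rho> where \<rho>: "bLp \<rho>" "\<And>l \<gamma>. curve A l \<gamma> ==> curve_integral l \<gamma> \<rho> < \<infinity> ==>
        grad_along l \<gamma> u g"
    using u by (rule egradE) auto
  obtain \<rho>' where \<rho>': "bLp \<rho>'" "\<And>l \<gamma>. curve A l \<gamma> ==> curve_integral l \<gamma> \<rho>' < \<infinity> ==>
        grad_along l \<gamma> v h"
    using v by (rule egradE) auto
  obtain R where R: "bLp R" "\<And>A l \<gamma>. curve A l \<gamma> ==> curve_integral l \<gamma> R < \<infinity> ==>
      curve_integral l \<gamma> \<rho> < \<infinity> \<and> curve_integral l \<gamma> \<rho>' < \<infinity>"
    using bLp_binary[OF \<rho>(1) \<rho>'(1)] by blast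
  show ?thesis
    by (rule pgradI[OF k R(1)]) (use step R(2) \<rho>(2) \<rho>'(2) in blast)
qed

lemma pgrad_lift_seq:
  assumes u: "\<And>n::nat. pgrad A (u n) (g n)" and k: "meas k"
    and step: "\<And>l \<gamma>. curve A l \<gamma> ==>
      (\<And>n. igrad l (\<lambda>t. u n (\<gamma> t)) (\<lambda>t. g n (\<gamma> t))) ==> grad_along l \<gamma> w k"
  shows "pgrad A w k"
proof -
  have "\<exists>\<rho>. bLp \<rho> \<and> (\<forall>l \<gamma>. curve A l \<gamma> --> curve_integral l \<gamma> \<rho> < \<infinity> -->
        igrad l (\<lambda>t. u n (\<gamma> t)) (\<lambda>t. g n (\<gamma> t)))" for n
    using u[of n] by (rule egradE) auto
  then obtain \<rho> where \<rho>: "\<And>n. bLp (\<rho> n)" "\<And>n l \<gamma>. curve A l \<gamma> ==> curve_integral l \<gamma> (\<rho> n) < \<infinity> ==>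
        igrad l (\<lambda>t. u n (\<gamma> t)) (\<lambda>t. g n (\<gamma> t))" by metis
  obtain R where R: "bLp R" "\<And>A l \<gamma> n. curve A l \<gamma> ==> curve_integral l \<gamma> R < \<infinity> ==>
      curve_integral l \<gamma> (\<rho> n) < \<infinity>"
    using bLp_countable[of \<rho>, OF \<rho>(1)] by blast
  show ?thesis
    by (rule pgradI[OF k R(1)]) (use step R(2) \<rho>(2) in blast)
qed

section \<open>From weak upper gradients to gradients on all subcurves and back\<close>

lemma restrict_nn_integral:
  assumes "A \<in> sets borel"
  shows "(\<integral>\<^sup>+x. f x \<partial>restrict_space \<mu> A) = (\<integral>\<^sup>+x\<in>A. f x \<partial>\<mu>)"
  using assms by (intro nn_integral_restrict_space) auto

lemma restrict_measurable:
  assumes "A \<in> sets borel"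
  shows "f \<in> borel_measurable (restrict_space \<mu> A) \<longleftrightarrow> (\<lambda>x. f x * indicator A x :: ennreal) \<in> borel_measurable \<mu>"
  using assms by (intro borel_measurable_restrict_space_iff_ennreal) auto

lemma egrad_wug:
  assumes A: "A \<in> sets borel" and f: "egrad A f g"
  shows "weak_upper_gradient p \<mu> A f g"
proof -
  obtain \<rho> where \<rho>: "meas g" "bLp \<rho>"
    "\<And>l \<gamma> t. curve A l \<gamma> ==> curve_integral l \<gamma> \<rho> < \<infinity> ==> t \<in> {0..l} ==> \<bar>f (\<gamma> t)\<bar> \<noteq> \<infinity>"
    "\<And>l \<gamma>. curve A l \<gamma> ==> curve_integral l \<gamma> \<rho> < \<infinity> ==>
        egrad_along l \<gamma> f g"
    using f by (rule egradE) blast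
  show ?thesis unfolding weak_upper_gradient_def
  proof (intro conjI exI)
    show "g \<in> borel_measurable (restrict_space \<mu> A)" using \<rho>(1) by (rule measurable_restrict_space1)
    have "energy A \<rho> \<le> (\<integral>\<^sup>+x. epowr (\<rho> x) p \<partial>\<mu>)"
      by (intro nn_integral_mono) (auto simp: indicator_def)
    then have "nonneg_Lp p \<mu> A \<rho>"
      using \<rho>(2) A unfolding nonneg_Lp_def bLp_def
      by (auto simp: restrict_nn_integral intro!: measurable_restrict_space1 borel_mu)
    then show "p_exceptional p \<mu> A {(l, \<gamma>). curve_integral l \<gamma> \<rho> = \<infinity>}"
      unfolding p_exceptional_def by (intro exI[of _ \<rho>]) auto
    have "jump (f (\<gamma> 0)) (f (\<gamma> l)) \<le> curve_integral l \<gamma> g"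
      if c: "curve A l \<gamma>" and n: "curve_integral l \<gamma> \<rho> \<noteq> \<infinity>" for l \<gamma>
    proof -
      have l: "0 < l" using arclength_curvesD(1)[OF c] .
      have fin: "curve_integral l \<gamma> \<rho> < \<infinity>" using n by (simp add: less_top)
      have "\<bar>f (\<gamma> 0)\<bar> \<noteq> \<infinity>" "\<bar>f (\<gamma> l)\<bar> \<noteq> \<infinity>" using \<rho>(3)[OF c fin] l by auto
      then show "jump (f (\<gamma> 0)) (f (\<gamma> l)) \<le> curve_integral l \<gamma> g"
        using igradD(3)[OF \<rho>(4)[OF c fin], of 0 l] l by (simp add: jump_def curve_integral_def)
    qed
    then show "\<forall>(l, \<gamma>)\<in>arclength_curves A - {(l, \<gamma>). curve_integral l \<gamma> \<rho> = \<infinity>}.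
       jump (f (\<gamma> 0)) (f (\<gamma> l)) \<le> curve_integral l \<gamma> g" by blast
  qed
qed

text \<open>If a subcurve belonged to the exceptional family, the integral of \<open>\<rho>'\<close>
  along it, hence along the whole curve, would be infinite. So a curve with finite integral of
  \<open>\<rho>'\<close> satisfies the inequality on all its subcurves, and a finite integral of
  \<open>g'\<close> then excludes infinite values of \<open>f\<close> on the curve.\<close>

lemma wug_egrad:
  assumes A: "A \<in> sets borel" and g: "nonneg_Lp p \<mu> A g" and f: "weak_upper_gradient p \<mu> A f g"
  shows "\<exists>g'. bLp g' \<and> egrad A f g' \<and> (\<forall>x\<in>A. g x \<le> g' x) \<and> (AE x in \<mu>. g' x = g x * indicator A x)"
proof -
  have gm: "meas (\<lambda>x. g x * indicator A x)"
    using g A by (simp add: nonneg_Lp_def restrict_measurable)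
  obtain g' where g': "g' \<in> borel_measurable borel" "\<And>x. g x * indicator A x \<le> g' x"
      "AE x in \<mu>. g' x = g x * indicator A x"
    using borel_majorant[OF gm] by blast
  have power_ind: "epowr (h x * indicator A x) p = epowr (h x) p * indicator A x" for h x
    by (auto simp: indicator_def)
  have "(\<integral>\<^sup>+x. epowr (g' x) p \<partial>\<mu>) = energy A g"
    by (intro nn_integral_cong_AE eventually_mono[OF g'(3)]) (simp add: power_ind)
  then have g'Lp: "bLp g'" using g g'(1) A by (simp add: bLp_def nonneg_Lp_def restrict_nn_integral)
  obtain \<Gamma> where \<Gamma>: "p_exceptional p \<mu> A \<Gamma>"
    "\<And>l \<gamma>. curve A l \<gamma> ==> (l, \<gamma>) \<notin> \<Gamma> ==> jump (f (\<gamma> 0)) (f (\<gamma> l)) \<le> curve_integral l \<gamma> g"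
    using f unfolding weak_upper_gradient_def by blast
  obtain \<rho> where \<rho>: "nonneg_Lp p \<mu> A \<rho>" "\<And>l \<gamma>. (l, \<gamma>) \<in> \<Gamma> ==> curve_integral l \<gamma> \<rho> = \<infinity>"
    using \<Gamma>(1) unfolding p_exceptional_def by blast
  have \<rho>m: "meas (\<lambda>x. \<rho> x * indicator A x)"
    using \<rho> A by (simp add: nonneg_Lp_def restrict_measurable)
  obtain \<rho>' where \<rho>': "\<rho>' \<in> borel_measurable borel" "\<And>x. \<rho> x * indicator A x \<le> \<rho>' x"
      "AE x in \<mu>. \<rho>' x = \<rho> x * indicator A x"
    using borel_majorant[OF \<rho>m] by blast
  have "(\<integral>\<^sup>+x. epowr (\<rho>' x) p \<partial>\<mu>) = energy A \<rho>"
    by (intro nn_integral_cong_AE eventually_mono[OF \<rho>'(3)]) (simp add: power_ind)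
  then have \<rho>'Lp: "bLp \<rho>'" using \<rho> \<rho>'(1) A by (simp add: bLp_def nonneg_Lp_def restrict_nn_integral)
  obtain R where R: "bLp R" "\<And>A l \<gamma>. curve A l \<gamma> ==> curve_integral l \<gamma> R < \<infinity> ==>
      curve_integral l \<gamma> g' < \<infinity> \<and> curve_integral l \<gamma> \<rho>' < \<infinity>"
    using bLp_binary[OF g'Lp \<rho>'Lp] by blast
  have \<rho>le: "\<rho> x \<le> \<rho>' x" if "x \<in> A" for x using \<rho>'(2)[of x] that by simp
  have gle: "g x \<le> g' x" if "x \<in> A" for x using g'(2)[of x] that by simp
  have sub: "jump (f (\<gamma> s)) (f (\<gamma> t)) \<le> nnint {s..t} (\<lambda>\<tau>. g' (\<gamma> \<tau>))"
    if c: "curve A l \<gamma>" and fin: "curve_integral l \<gamma> \<rho>' < \<infinity>" and st: "0 \<le> s" "s < t" "t \<le> l" for l \<gamma> s t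
  proof -
    define \<kappa> where "\<kappa> = (\<lambda>\<tau>. \<gamma> (s + \<tau>))"
    have \<kappa>: "(t - s, \<kappa>) \<in> arclength_curves A"
      unfolding \<kappa>_def using st by (intro arclength_subcurve[OF c st] image_subsetI arclength_curvesD(4)[OF c]) auto
    have "curve_integral (t - s) \<kappa> \<rho> \<le> curve_integral (t - s) \<kappa> \<rho>'"
      unfolding curve_integral_def using arclength_curvesD(4)[OF \<kappa>] \<rho>le
      by (intro nn_integral_mono) (auto simp: indicator_def)
    also have "\<dots> = nnint {s..t} (\<lambda>\<tau>. \<rho>' (\<gamma> \<tau>))"
      unfolding \<kappa>_def using st by (intro curve_integral_subcurve[OF c \<rho>'(1)]) auto
    also have "\<dots> \<le> curve_integral l \<gamma> \<rho>'"
      unfolding curve_integral_def using st by (intro nn_integral_mono) (auto simp: indicator_def)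
    also have "\<dots> < \<infinity>" by (rule fin)
    finally have "(t - s, \<kappa>) \<notin> \<Gamma>" using \<rho>(2) by auto
    then have "jump (f (\<kappa> 0)) (f (\<kappa> (t - s))) \<le> curve_integral (t - s) \<kappa> g" using \<Gamma>(2) \<kappa> by auto
    also have "\<dots> \<le> curve_integral (t - s) \<kappa> g'"
      unfolding curve_integral_def using arclength_curvesD(4)[OF \<kappa>] gle
      by (intro nn_integral_mono) (auto simp: indicator_def)
    also have "\<dots> = nnint {s..t} (\<lambda>\<tau>. g' (\<gamma> \<tau>))"
      unfolding \<kappa>_def using st by (intro curve_integral_subcurve[OF c g'(1)]) auto
    finally show ?thesis by (simp add: \<kappa>_def)
  qed
  have "egrad A f g'"
    unfolding egrad_def
  proof (intro conjI borel_mu g'(1) exI[of _ R] R(1) allI impI)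
    fix l \<gamma> assume c: "curve A l \<gamma>" and fin: "curve_integral l \<gamma> R < \<infinity>"
    have fing: "curve_integral l \<gamma> g' < \<infinity>" and fin\<rho>: "curve_integral l \<gamma> \<rho>' < \<infinity>" using R(2)[OF c fin] by auto
    have l: "0 < l" by (rule arclength_curvesD(1)[OF c])
    have ifin: "nnint {s..t} (\<lambda>\<tau>. g' (\<gamma> \<tau>)) < \<infinity>" if "0 \<le> s" "t \<le> l" for s t
    proof -
      have "nnint {s..t} (\<lambda>\<tau>. g' (\<gamma> \<tau>)) \<le> curve_integral l \<gamma> g'"
        unfolding curve_integral_def using that by (intro nn_integral_mono) (auto simp: indicator_def)
      then show ?thesis using fing by (rule le_less_trans)
    qed
    show F: "\<forall>t\<in>{0..l}. \<bar>f (\<gamma> t)\<bar> \<noteq> \<infinity>"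
    proof
      fix t assume t: "t \<in> {0..l}"
      \<comment> \<open>Every parameter is an endpoint of some nondegenerate subinterval, and
        \<open>jump\<close> is infinite as soon as one endpoint value is.\<close>
      obtain s s' where s: "0 \<le> s" "s < s'" "s' \<le> l" "t = s \<or> t = s'"
        using t l by (cases "t = 0") (force intro: that[of 0 l] that[of 0 t])+
      have "jump (f (\<gamma> s)) (f (\<gamma> s')) < \<infinity>" using sub[OF c fin\<rho> s(1-3)] ifin[of s s'] s by (auto intro: le_less_trans)
      then show "\<bar>f (\<gamma> t)\<bar> \<noteq> \<infinity>" using s(4) by (auto simp: jump_def split: if_splits)
    qed
    show "igrad l (\<lambda>t. real_of_ereal (f (\<gamma> t))) (\<lambda>t. g' (\<gamma> t))"
      unfolding igrad_def
    proof (intro conjI allI impI)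
      show "(\<lambda>t. g' (\<gamma> t) * indicator {0..l} t) \<in> borel_measurable borel" by (rule curve_borel[OF c g'(1)])
      show "nnint {0..l} (\<lambda>\<tau>. g' (\<gamma> \<tau>)) < \<infinity>" using ifin[of 0 l] by auto
      fix s t assume st: "0 \<le> s" "s \<le> t" "t \<le> l"
      show "ennreal \<bar>real_of_ereal (f (\<gamma> s)) - real_of_ereal (f (\<gamma> t))\<bar> \<le> nnint {s..t} (\<lambda>\<tau>. g' (\<gamma> \<tau>))"
      proof (cases "s = t")
        case False
        then show ?thesis using sub[OF c fin\<rho>, of s t] st F by (auto simp: jump_def)
      qed simp
    qed
  qed
  moreover have "g x \<le> g' x" if "x \<in> A" for x using g'(2)[of x] that by simp
  ultimately show ?thesis using g'Lp g'(3) by blast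
qed

end

lemma igrad_mono_AE:
  assumes "igrad l F G" "AE t in lborel. t \<in> {0..l} --> G t \<le> G' t"
    "borel_on {0..l} G'" "nnint {0..l} G' < \<infinity>"
  shows "igrad l F G'"
  unfolding igrad_def
proof (intro conjI allI impI assms(3,4))
  fix s t :: real assume st: "0 \<le> s" "s \<le> t" "t \<le> l"
  have "ennreal \<bar>F s - F t\<bar> \<le> nnint {s..t} G" by (rule igradD(3)[OF assms(1) st])
  also have "\<dots> \<le> nnint {s..t} G'"
    by (rule nn_integral_mono_AE, rule eventually_mono[OF assms(2)]) (use st in \<open>auto simp: indicator_def\<close>)
  finally show "ennreal \<bar>F s - F t\<bar> \<le> nnint {s..t} G'" .
qed

lemma nn_integral_eq_imp_AE:
  fixes f g :: "'a => ennreal"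
  assumes f: "f \<in> borel_measurable M" and g: "g \<in> borel_measurable M" and le: "\<And>x. f x \<le> g x"
    and int: "(\<integral>\<^sup>+x. g x \<partial>M) \<le> (\<integral>\<^sup>+x. f x \<partial>M)" and fin: "(\<integral>\<^sup>+x. f x \<partial>M) < \<infinity>"
  shows "AE x in M. f x = g x"
proof -
  have "(\<integral>\<^sup>+x. g x - f x \<partial>M) = (\<integral>\<^sup>+x. g x \<partial>M) - (\<integral>\<^sup>+x. f x \<partial>M)"
    using fin le by (intro nn_integral_diff f g) auto
  also have "\<dots> = 0" using int le_less_trans[OF int fin] by (simp add: diff_eq_0_iff_ennreal)
  finally have "AE x in M. g x - f x = 0" using f g by (subst (asm) nn_integral_0_iff_AE) auto
  moreover have "AE x in M. f x \<noteq> \<infinity>" using f fin by (intro nn_integral_noteq_infinite) auto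
  ultimately show ?thesis
    by eventually_elim (use le in \<open>auto simp: diff_eq_0_iff_ennreal intro!: antisym\<close>)
qed

section \<open>Calculus of gradients on sets\<close>

context borel_mm
begin

lemma pgrad_measurable: "egrad A f g ==> meas g"
  by (simp add: egrad_def)

lemma pgrad_add:
  assumes "pgrad A u g" "pgrad A v h"
  shows "pgrad A (\<lambda>x. u x + v x) (\<lambda>x. g x + h x)"
proof (rule pgrad_lift2[OF assms])
  show "meas (\<lambda>x. g x + h x)"
    using pgrad_measurable[OF assms(1)] pgrad_measurable[OF assms(2)] by measurable
qed (rule igrad_add)

lemma pgrad_contraction:
  assumes "pgrad A u g" "0 \<le> c" "\<And>x y. x \<in> A ==> y \<in> A ==> \<bar>w x - w y\<bar> \<le> c * \<bar>u x - u y\<bar>"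
  shows "pgrad A w (\<lambda>x. ennreal c * g x)"
proof (rule pgrad_lift[OF assms(1)])
  show "meas (\<lambda>x. ennreal c * g x)"
    using pgrad_measurable[OF assms(1)] by measurable
  show "igrad l (\<lambda>t. w (\<gamma> t)) (\<lambda>t. ennreal c * g (\<gamma> t))"
    if "curve A l \<gamma>" "grad_along l \<gamma> u g" for l \<gamma>
    using assms(3) arclength_curvesD(4)[OF that(1)] by (intro igrad_contraction[OF that(2) assms(2)]) auto
qed

lemma pgrad_contraction1:
  assumes "pgrad A u g" "\<And>x y. x \<in> A ==> y \<in> A ==> \<bar>w x - w y\<bar> \<le> \<bar>u x - u y\<bar>"
  shows "pgrad A w g"
  using pgrad_contraction[OF assms(1), of 1 w] assms(2) by simp

lemma pgrad_uminus: "pgrad A u g ==> pgrad A (\<lambda>x. - u x) g"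
  by (erule pgrad_contraction1) auto

lemma pgrad_const: "pgrad A (\<lambda>_. c) (\<lambda>_. 0)"
  by (rule pgradI[where \<rho> = "\<lambda>_. 0"]) (auto simp: bLp_def igrad_const)

lemma pgrad_mult:
  assumes "pgrad A u g" "pgrad A v h" and [measurable]: "meas u" "meas v"
  shows "pgrad A (\<lambda>x. u x * v x) (\<lambda>x. ennreal \<bar>v x\<bar> * g x + ennreal \<bar>u x\<bar> * h x)"
proof (rule pgrad_lift2[OF assms(1,2)])
  show "meas (\<lambda>x. ennreal \<bar>v x\<bar> * g x + ennreal \<bar>u x\<bar> * h x)"
    using pgrad_measurable[OF assms(1)] pgrad_measurable[OF assms(2)] by measurable
qed (rule igrad_mult)

lemma pgrad_max:
  assumes "pgrad A u g" "pgrad A v h" and [measurable]: "meas u" "meas v"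
  shows "pgrad A (\<lambda>x. max (u x) (v x)) (\<lambda>x. if v x < u x then g x else h x)"
proof (rule pgrad_lift2[OF assms(1,2)])
  show "meas (\<lambda>x. if v x < u x then g x else h x)"
    using pgrad_measurable[OF assms(1)] pgrad_measurable[OF assms(2)] by measurable
qed (rule igrad_max)

lemma pgrad_min:
  assumes "pgrad A u g" "pgrad A v h" and "meas u" "meas v"
  shows "pgrad A (\<lambda>x. min (u x) (v x)) (\<lambda>x. if u x < v x then g x else h x)"
proof -
  have "pgrad A (\<lambda>x. - max (- u x) (- v x)) (\<lambda>x. if - v x < - u x then g x else h x)"
    using assms by (intro pgrad_uminus pgrad_max) auto
  then show ?thesis by (simp add: minus_max_eq_min)
qed

lemma pgrad_power:
  assumes "pgrad A u g" and [measurable]: "meas u"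
  shows "pgrad A (\<lambda>x. u x ^ n) (\<lambda>x. ennreal \<bar>real n * u x ^ (n - 1)\<bar> * g x)"
proof (rule pgrad_lift[OF assms(1)])
  show "meas (\<lambda>x. ennreal \<bar>real n * u x ^ (n - 1)\<bar> * g x)"
    using pgrad_measurable[OF assms(1)] by measurable
  show "igrad l (\<lambda>t. u (\<gamma> t) ^ n) (\<lambda>t. ennreal \<bar>real n * u (\<gamma> t) ^ (n - 1)\<bar> * g (\<gamma> t))"
    if "grad_along l \<gamma> u g" for l \<gamma>
    by (rule igrad_C1[OF that]) (auto intro!: derivative_eq_intros continuous_intros)
qed

lemma egrad_subset:
  assumes "egrad B f g" "A \<subseteq> B" shows "egrad A f g"
proof -
  obtain \<rho> where \<rho>: "meas g" "bLp \<rho>"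
    "\<And>l \<gamma> t. curve B l \<gamma> ==> curve_integral l \<gamma> \<rho> < \<infinity> ==> t \<in> {0..l} ==> \<bar>f (\<gamma> t)\<bar> \<noteq> \<infinity>"
    "\<And>l \<gamma>. curve B l \<gamma> ==> curve_integral l \<gamma> \<rho> < \<infinity> ==>
        egrad_along l \<gamma> f g"
    using assms(1) by (rule egradE) blast
  note sub = subsetD[OF arclength_curves_mono[OF assms(2)]]
  show ?thesis unfolding egrad_def
    by (intro conjI \<rho>(1) exI[of _ \<rho>] \<rho>(2) allI impI ballI \<rho>(3) \<rho>(4)) (use sub in auto)
qed

lemma pgrad_cong:
  assumes "pgrad A u g" "\<And>x. x \<in> A ==> w x = u x" "\<And>x. x \<in> A ==> k x = g x" "meas k"
  shows "pgrad A w k"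
proof (rule pgrad_lift[OF assms(1,4)])
  fix l \<gamma> assume c: "curve A l \<gamma>" and i: "grad_along l \<gamma> u g"
  show "grad_along l \<gamma> w k"
    using i by (rule igrad_cong[THEN iffD1, rotated 2]) (use assms arclength_curvesD(4)[OF c] in auto)
qed

text \<open>A curve along which this function has finite integral spends zero time in
  \<open>N\<close>. Added to an exceptional family, it allows inequalities valid almost everywhere
  to be used along curves.\<close>

lemma bLp_null_top:
  assumes "N \<in> sets borel" "N \<in> null_sets \<mu>"
  shows "bLp (\<lambda>x. top * indicator N x)"
proof -
  have "(\<integral>\<^sup>+x. epowr (top * indicator N x) p \<partial>\<mu>) = (\<integral>\<^sup>+x\<in>N. top \<partial>\<mu>)"
    by (intro nn_integral_cong) (auto simp: indicator_def)
  also have "\<dots> = 0" using assms(2) by (simp add: nn_integral_cmult_indicator null_setsD1 null_setsD2)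
  finally show ?thesis using assms(1) by (simp add: bLp_def)
qed

lemma curve_avoids_null:
  fixes \<gamma> :: "real => 'a"
  assumes "N \<in> sets borel" "curve A l \<gamma>" "curve_integral l \<gamma> (\<lambda>x. top * indicator N x) < \<infinity>"
  shows "AE t in lborel. t \<in> {0..l} --> \<gamma> t \<notin> N"
proof -
  have "(\<lambda>x. top * indicator N x :: ennreal) \<in> borel_measurable borel" using assms(1) by measurable
  from curve_borel[OF assms(2) this]
  have "AE t in lborel. top * indicator N (\<gamma> t) * indicator {0..l} t \<noteq> (\<infinity>::ennreal)"
    using assms(3) unfolding curve_integral_def by (intro nn_integral_noteq_infinite) auto
  then show ?thesis by eventually_elim (auto simp: indicator_def split: if_splits)
qed

text \<open>The points of \<open>A\<close> where \<open>g\<close> exceeds \<open>k\<close> lie in a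
  Borel null set, which almost every curve meets only for a null set of times. Integrability of
  \<open>k\<close> makes its curve integrals finite outside one more exceptional family.\<close>

lemma egrad_mono_AE:
  assumes f: "egrad A f g" and k: "bLp k" and le: "AE x in \<mu>. x \<in> A --> g x \<le> k x"
  shows "egrad A f k"
proof -
  obtain \<rho> where \<rho>: "meas g" "bLp \<rho>"
    "\<And>l \<gamma> t. curve A l \<gamma> ==> curve_integral l \<gamma> \<rho> < \<infinity> ==> t \<in> {0..l} ==> \<bar>f (\<gamma> t)\<bar> \<noteq> \<infinity>"
    "\<And>l \<gamma>. curve A l \<gamma> ==> curve_integral l \<gamma> \<rho> < \<infinity> ==>
        egrad_along l \<gamma> f g"
    using f by (rule egradE) blast
  obtain N where N: "N \<in> sets borel" "N \<in> null_sets \<mu>" "\<And>x. x \<notin> N ==> x \<in> A --> g x \<le> k x"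
    using AE_borel_null[OF le] by blast
  obtain R1 where R1: "bLp R1" "\<And>A l \<gamma>. curve A l \<gamma> ==> curve_integral l \<gamma> R1 < \<infinity> ==>
      curve_integral l \<gamma> \<rho> < \<infinity> \<and> curve_integral l \<gamma> k < \<infinity>"
    using bLp_binary[OF \<rho>(2) k] by blast
  obtain R where R: "bLp R" "\<And>A l \<gamma>. curve A l \<gamma> ==> curve_integral l \<gamma> R < \<infinity> ==>
      curve_integral l \<gamma> R1 < \<infinity> \<and> curve_integral l \<gamma> (\<lambda>x. top * indicator N x) < \<infinity>"
    using bLp_binary[OF R1(1) bLp_null_top[OF N(1,2)]] by blast
  have kb: "k \<in> borel_measurable borel" using k by (simp add: bLp_def)
  show ?thesis unfolding egrad_def
  proof (intro conjI exI[of _ R] allI impI borel_mu kb R(1) ballI)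
    fix l \<gamma> assume c: "curve A l \<gamma>" and fin: "curve_integral l \<gamma> R < \<infinity>"
    have f1: "curve_integral l \<gamma> \<rho> < \<infinity>" and fk: "curve_integral l \<gamma> k < \<infinity>"
      and fN: "curve_integral l \<gamma> (\<lambda>x. top * indicator N x) < \<infinity>" using R(2)[OF c fin] R1(2)[OF c] by auto
    show "\<bar>f (\<gamma> t)\<bar> \<noteq> \<infinity>" if "t \<in> {0..l}" for t by (rule \<rho>(3)[OF c f1 that])
    show "egrad_along l \<gamma> f k"
    proof (rule igrad_mono_AE[OF \<rho>(4)[OF c f1]])
      show "AE t in lborel. t \<in> {0..l} --> g (\<gamma> t) \<le> k (\<gamma> t)"
        using curve_avoids_null[OF N(1) c fN]
        by eventually_elim (use N(3) arclength_curvesD(4)[OF c] in auto)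
      show "(\<lambda>t. k (\<gamma> t) * indicator {0..l} t) \<in> borel_measurable borel" by (rule curve_borel[OF c kb])
      show "nnint {0..l} (\<lambda>\<tau>. k (\<gamma> \<tau>)) < \<infinity>" using fk by (simp add: curve_integral_def)
    qed
  qed
qed

lemma pgrad_lipschitz:
  assumes "0 \<le> L" "\<And>x y. x \<in> A ==> y \<in> A ==> \<bar>u x - u y\<bar> \<le> L * dist x y"
  shows "pgrad A u (\<lambda>_. ennreal L)"
proof (rule pgradI[where \<rho> = "\<lambda>_. 0"])
  fix l \<gamma> assume c: "curve A l \<gamma>"
  show "igrad l (\<lambda>t. u (\<gamma> t)) (\<lambda>t. ennreal L)"
    unfolding igrad_def
  proof (intro conjI allI impI)
    show "nnint {0..l} (\<lambda>\<tau>. ennreal L) < \<infinity>"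
      using arclength_curvesD(1)[OF c] by (simp add: nn_integral_cmult_indicator ennreal_mult_less_top)
    fix s t assume st: "0 \<le> s" "s \<le> t" "t \<le> l"
    have "\<bar>u (\<gamma> s) - u (\<gamma> t)\<bar> \<le> L * dist (\<gamma> s) (\<gamma> t)"
      using st by (intro assms(2) arclength_curvesD(4)[OF c]) auto
    also have "\<dots> \<le> L * (t - s)" using assms(1) arclength_dist_le[OF c st] by (rule mult_left_mono[rotated])
    finally have "ennreal \<bar>u (\<gamma> s) - u (\<gamma> t)\<bar> \<le> ennreal (L * (t - s))" by (rule ennreal_leI)
    also have "\<dots> = nnint {s..t} (\<lambda>\<tau>. ennreal L)"
      using st assms(1) by (simp add: nn_integral_cmult_indicator ennreal_mult)
    finally show "ennreal \<bar>u (\<gamma> s) - u (\<gamma> t)\<bar> \<le> nnint {s..t} (\<lambda>\<tau>. ennreal L)" .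
  qed auto
qed (auto simp: bLp_def)

text \<open>The global gradient \<open>h\<close> is used only qualitatively: it makes
  \<open>D\<close> absolutely continuous along almost every curve, also where the curve crosses the
  boundary of \<open>V\<close>. The open set of times spent in \<open>V\<close> then fits
  \<open>igrad_zero_set\<close>, and \<open>h\<close> disappears from the conclusion.\<close>

lemma pgrad_zero_extension:
  assumes V: "open V" and D: "pgrad UNIV D h" and z: "\<And>x. x \<notin> V ==> D x = 0"
    and g: "pgrad V D g" and gL: "bLp g"
  shows "pgrad UNIV D (\<lambda>x. g x * indicator V x)"
proof -
  have gb: "g \<in> borel_measurable borel" using gL by (simp add: bLp_def)
  obtain \<rho>1 where \<rho>1: "bLp \<rho>1"
    "\<And>l \<gamma>. curve UNIV l \<gamma> ==> curve_integral l \<gamma> \<rho>1 < \<infinity> ==>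
        grad_along l \<gamma> D h"
    using D by (rule egradE) auto
  obtain \<rho>2 where \<rho>2: "bLp \<rho>2"
    "\<And>l \<gamma>. curve V l \<gamma> ==> curve_integral l \<gamma> \<rho>2 < \<infinity> ==>
        grad_along l \<gamma> D g"
    using g by (rule egradE) auto
  obtain R1 where R1: "bLp R1" "\<And>A l \<gamma>. curve A l \<gamma> ==> curve_integral l \<gamma> R1 < \<infinity> ==>
      curve_integral l \<gamma> \<rho>1 < \<infinity> \<and> curve_integral l \<gamma> \<rho>2 < \<infinity>"
    using bLp_binary[OF \<rho>1(1) \<rho>2(1)] by blast
  obtain R where R: "bLp R" "\<And>A l \<gamma>. curve A l \<gamma> ==> curve_integral l \<gamma> R < \<infinity> ==>
      curve_integral l \<gamma> R1 < \<infinity> \<and> curve_integral l \<gamma> g < \<infinity>"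
    using bLp_binary[OF R1(1) gL] by blast
  have Vb: "V \<in> sets borel" using V by auto
  have gVb: "borel_on V g" using gb Vb by measurable
  show ?thesis
  proof (rule pgradI[OF borel_mu[OF gVb] R(1)])
    fix l \<gamma> assume c: "(l, \<gamma>) \<in> arclength_curves (UNIV::'a set)" and fin: "curve_integral l \<gamma> R < \<infinity>"
    have f1: "curve_integral l \<gamma> \<rho>1 < \<infinity>" and f2: "curve_integral l \<gamma> \<rho>2 < \<infinity>" and fg: "curve_integral l \<gamma> g < \<infinity>"
      using R(2)[OF c fin] R1(2)[OF c] by auto
    define U where "U = {t. \<gamma> t \<in> V}"
    have "igrad l (\<lambda>t. D (\<gamma> t)) (\<lambda>t. g (\<gamma> t) * indicator U t)"
    proof (rule igrad_zero_set[OF \<rho>1(2)[OF c f1]])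
      have e: "g (\<gamma> t) * indicator U t = g (\<gamma> t) * indicator V (\<gamma> t)" for t by (auto simp: U_def indicator_def)
      show "(\<lambda>t. g (\<gamma> t) * indicator U t * indicator {0..l} t) \<in> borel_measurable borel"
        unfolding e by (rule curve_borel[OF c gVb])
      have "nnint {0..l} (\<lambda>\<tau>. g (\<gamma> \<tau>) * indicator U \<tau>) \<le> curve_integral l \<gamma> g"
        unfolding curve_integral_def by (intro nn_integral_mono) (auto simp: indicator_def)
      then show "nnint {0..l} (\<lambda>\<tau>. g (\<gamma> \<tau>) * indicator U \<tau>) < \<infinity>" using fg by auto
      show "D (\<gamma> t) = 0" if "t \<notin> U" for t using z that by (simp add: U_def)
      have "openin (top_of_set {0..l}) ({0..l} \<inter> \<gamma> -` V)"
        using arclength_curvesD(2)[OF c] V by (intro continuous_openin_preimage_gen)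
      then show "openin (top_of_set {0..l}) (U \<inter> {0..l})"
        by (simp add: U_def vimage_def Int_commute)
      fix s t assume st: "0 \<le> s" "s \<le> t" "t \<le> l" "{s..t} \<subseteq> U"
      show "ennreal \<bar>D (\<gamma> s) - D (\<gamma> t)\<bar> \<le> nnint {s..t} (\<lambda>\<tau>. g (\<gamma> \<tau>))"
      proof (cases "s = t")
        case False
        define \<kappa> where "\<kappa> = (\<lambda>\<tau>. \<gamma> (s + \<tau>))"
        have \<kappa>: "(t - s, \<kappa>) \<in> arclength_curves V"
          unfolding \<kappa>_def using st False by (intro arclength_subcurve[OF c]) (auto simp: U_def)
        have "curve_integral (t - s) \<kappa> \<rho>2 = nnint {s..t} (\<lambda>\<tau>. \<rho>2 (\<gamma> \<tau>))"
          unfolding \<kappa>_def using st \<rho>2(1) by (intro curve_integral_subcurve[OF c]) (auto simp: bLp_def)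
        also have "\<dots> \<le> curve_integral l \<gamma> \<rho>2"
          unfolding curve_integral_def using st by (intro nn_integral_mono) (auto simp: indicator_def)
        finally have "curve_integral (t - s) \<kappa> \<rho>2 < \<infinity>" using f2 by (rule le_less_trans)
        from igradD(3)[OF \<rho>2(2)[OF \<kappa> this], of 0 "t - s"] st
        have "ennreal \<bar>D (\<gamma> s) - D (\<gamma> t)\<bar> \<le> curve_integral (t - s) \<kappa> g"
          by (simp add: curve_integral_def \<kappa>_def)
        also have "\<dots> = nnint {s..t} (\<lambda>\<tau>. g (\<gamma> \<tau>))"
          unfolding \<kappa>_def using st by (intro curve_integral_subcurve[OF c gb]) auto
        finally show ?thesis .
      qed simp
    qed
    then show "igrad l (\<lambda>t. D (\<gamma> t)) (\<lambda>t. g (\<gamma> t) * indicator V (\<gamma> t))"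
      by (simp add: U_def indicator_def)
  qed
qed

lemma egrad_min:
  assumes "egrad A f g" "egrad A f h"
  shows "egrad A f (\<lambda>x. min (g x) (h x))"
proof -
  obtain \<rho> where \<rho>: "meas g" "bLp \<rho>"
    "\<And>l \<gamma> t. curve A l \<gamma> ==> curve_integral l \<gamma> \<rho> < \<infinity> ==> t \<in> {0..l} ==> \<bar>f (\<gamma> t)\<bar> \<noteq> \<infinity>"
    "\<And>l \<gamma>. curve A l \<gamma> ==> curve_integral l \<gamma> \<rho> < \<infinity> ==>
        egrad_along l \<gamma> f g"
    using assms(1) by (rule egradE) blast
  obtain \<rho>' where \<rho>': "meas h" "bLp \<rho>'"
    "\<And>l \<gamma>. curve A l \<gamma> ==> curve_integral l \<gamma> \<rho>' < \<infinity> ==>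
        egrad_along l \<gamma> f h"
    using assms(2) by (rule egradE) blast
  obtain R where R: "bLp R" "\<And>A l \<gamma>. curve A l \<gamma> ==> curve_integral l \<gamma> R < \<infinity> ==>
      curve_integral l \<gamma> \<rho> < \<infinity> \<and> curve_integral l \<gamma> \<rho>' < \<infinity>"
    using bLp_binary[OF \<rho>(2) \<rho>'(2)] by blast
  show ?thesis unfolding egrad_def
  proof (intro conjI exI[of _ R] allI impI R(1) ballI)
    show "meas (\<lambda>x. min (g x) (h x))" using \<rho>(1) \<rho>'(1) by measurable
    fix l \<gamma> assume c: "curve A l \<gamma>" and fin: "curve_integral l \<gamma> R < \<infinity>"
    note f = R(2)[OF c fin, THEN conjunct1] R(2)[OF c fin, THEN conjunct2]
    show "\<bar>f (\<gamma> t)\<bar> \<noteq> \<infinity>" if "t \<in> {0..l}" for t by (rule \<rho>(3)[OF c f(1) that])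
    show "igrad l (\<lambda>t. real_of_ereal (f (\<gamma> t))) (\<lambda>t. min (g (\<gamma> t)) (h (\<gamma> t)))"
      by (rule igrad_min_gradient[OF \<rho>(4)[OF c f(1)] \<rho>'(3)[OF c f(2)]])
  qed
qed

lemma egrad_decreasing:
  assumes f: "\<And>n::nat. egrad A f (g n)" and dec: "\<And>n x. g (Suc n) x \<le> g n x" 
  shows "egrad A f (\<lambda>x. INF n. g n x)"
proof -
  have "\<exists>\<rho>. bLp \<rho> \<and> (\<forall>l \<gamma>. curve A l \<gamma> --> curve_integral l \<gamma> \<rho> < \<infinity> -->
        (\<forall>t\<in>{0..l}. \<bar>f (\<gamma> t)\<bar> \<noteq> \<infinity>) \<and> igrad l (\<lambda>t. real_of_ereal (f (\<gamma> t))) (\<lambda>t. g n (\<gamma> t)))" for n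
    using f[of n] unfolding egrad_def by blast
  then obtain \<rho> where \<rho>: "\<And>n. bLp (\<rho> n)"
    "\<And>n l \<gamma>. curve A l \<gamma> ==> curve_integral l \<gamma> (\<rho> n) < \<infinity> ==>
        (\<forall>t\<in>{0..l}. \<bar>f (\<gamma> t)\<bar> \<noteq> \<infinity>) \<and> igrad l (\<lambda>t. real_of_ereal (f (\<gamma> t))) (\<lambda>t. g n (\<gamma> t))" by metis
  obtain R where R: "bLp R" "\<And>A l \<gamma> n. curve A l \<gamma> ==> curve_integral l \<gamma> R < \<infinity> ==>
      curve_integral l \<gamma> (\<rho> n) < \<infinity>"
    using bLp_countable[of \<rho>, OF \<rho>(1)] by blast
  have decm: "decseq (\<lambda>n. g n x)" for x using dec by (intro decseq_SucI)
  show ?thesis unfolding egrad_def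
  proof (intro conjI exI[of _ R] allI impI R(1))
    have m: "g n \<in> borel_measurable \<mu>" for n using f[of n] by (simp add: egrad_def)
    show "meas (\<lambda>x. INF n. g n x)" by (rule borel_measurable_INF) (auto simp: m)
    fix l \<gamma> assume c: "curve A l \<gamma>" and fin: "curve_integral l \<gamma> R < \<infinity>"
    note H = \<rho>(2)[OF c R(2)[OF c fin]]
    show "\<forall>t\<in>{0..l}. \<bar>f (\<gamma> t)\<bar> \<noteq> \<infinity>" using H[of 0] by (rule conjunct1)
    have i: "igrad l (\<lambda>t. real_of_ereal (f (\<gamma> t))) (\<lambda>t. g n (\<gamma> t))" for n using H[of n] by (rule conjunct2)
    show "igrad l (\<lambda>t. real_of_ereal (f (\<gamma> t))) (\<lambda>t. INF n. g n (\<gamma> t))"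
    proof (rule igrad_limit[OF i tendsto_const _ _ igradD(1)[OF i[of 0]] igradD(2)[OF i[of 0]]])
      show "g n (\<gamma> t) \<le> g 0 (\<gamma> t)" for n t using decm[of "\<gamma> t"] by (rule decseqD) simp
      show "AE t in lborel. t \<in> {0..l} --> (\<lambda>n. g n (\<gamma> t)) \<longlonglongrightarrow> (INF n. g n (\<gamma> t))"
        by (intro AE_I2 impI LIMSEQ_INF decm)
      have "(\<lambda>t. INF n. g n (\<gamma> t) * indicator {0..l} t) \<in> borel_measurable borel"
        by (rule borel_measurable_INF) (auto intro: igradD(1)[OF i])
      moreover have "(INF n. g n (\<gamma> t) * indicator {0..l} t) = (INF n. g n (\<gamma> t)) * indicator {0..l} t" for t
        by (cases "t \<in> {0..l}") auto
      ultimately show "(\<lambda>t. (INF n. g n (\<gamma> t)) * indicator {0..l} t) \<in> borel_measurable borel" by simp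
    qed
  qed
qed

section \<open>The minimal gradient and the p-energy\<close>

lemma bLp_mono:
  assumes "bLp h" "g \<in> borel_measurable borel" "\<And>x. g x \<le> h x" shows "bLp g"
proof -
  have "(\<integral>\<^sup>+x. epowr (g x) p \<partial>\<mu>) \<le> (\<integral>\<^sup>+x. epowr (h x) p \<partial>\<mu>)"
    using assms(3) p0 by (intro nn_integral_mono epowr_mono) auto
  then show ?thesis using assms by (auto simp: bLp_def)
qed

lemma bLp_nonneg_Lp:
  assumes "A \<in> sets borel" "bLp g" shows "nonneg_Lp p \<mu> A g"
proof -
  have "energy A g \<le> (\<integral>\<^sup>+x. epowr (g x) p \<partial>\<mu>)"
    by (intro nn_integral_mono) (auto simp: indicator_def)
  then show ?thesis
    using assms unfolding nonneg_Lp_def bLp_def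
    by (auto simp: restrict_nn_integral intro!: measurable_restrict_space1 borel_mu)
qed

lemma Dp_iff:
  assumes "A \<in> sets borel"
  shows "Dp p \<mu> A f \<longleftrightarrow> f \<in> borel_measurable (restrict_space \<mu> A) \<and> (\<exists>g. bLp g \<and> egrad A f g)"
  unfolding Dp_def using wug_egrad[OF assms] egrad_wug[OF assms] bLp_nonneg_Lp[OF assms] by blast

text \<open>Take gradients whose energies approach the infimum. Their running minima
  \<open>m n\<close> are gradients that decrease to \<open>g\<close>, so \<open>g\<close> has least
  energy. For any other gradient \<open>h\<close>, min(g, h) is a gradient with energy no smaller
  than that of \<open>g\<close>, hence equals \<open>g\<close> almost everywhere.\<close>

lemma minimal_gradient_exists:
  assumes A: "A \<in> sets borel" and f: "Dp p \<mu> A f"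
  shows "\<exists>g. bLp g \<and> egrad A f g \<and> (\<forall>g'. nonneg_Lp p \<mu> A g' \<and> weak_upper_gradient p \<mu> A f g' -->
              (AE x in \<mu>. x \<in> A --> g x \<le> g' x))"
proof -
  define W where "W = {g. bLp g \<and> egrad A f g}"
  define E where "E g = energy A g" for g
  have W0: "W \<noteq> {}" using f by (auto simp: Dp_iff[OF A] W_def)
  have Efin: "E g < \<infinity>" if "g \<in> W" for g
  proof -
    have "E g \<le> (\<integral>\<^sup>+x. epowr (g x) p \<partial>\<mu>)" unfolding E_def by (intro nn_integral_mono) (auto simp: indicator_def)
    then show ?thesis using that by (auto simp: W_def bLp_def)
  qed
  have Emono: "E g \<le> E h" if "\<And>x. g x \<le> h x" for g h
    unfolding E_def using that p0 by (intro nn_integral_mono mult_right_mono epowr_mono) auto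
  have W1: "E ` W \<noteq> {}" using W0 by simp
  obtain e :: "nat => ennreal" where e: "range e \<subseteq> E ` W" "(INF g\<in>W. E g) = (INF n. e n)"
    using ennreal_Inf_countable_INF[OF W1] by blast
  have "\<forall>n. \<exists>g. g \<in> W \<and> e n = E g" using e(1) by (auto simp: image_def subset_iff)
  then obtain gs where gs: "\<And>n. gs n \<in> W" "\<And>n. e n = E (gs n)" by metis
  define m where "m = rec_nat (gs 0) (\<lambda>n h x. min (h x) (gs (Suc n) x))"
  have m0: "m 0 = gs 0" and mS: "m (Suc n) = (\<lambda>x. min (m n x) (gs (Suc n) x))" for n by (auto simp: m_def)
  have mW: "m n \<in> W" for n
  proof (induction n)
    case (Suc n)
    have b: "bLp (m n)" "bLp (gs (Suc n))" using Suc gs(1)[of "Suc n"] by (auto simp: W_def)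
    have "bLp (m (Suc n))" unfolding mS
      by (rule bLp_mono[OF b(1)]) (use b in \<open>auto simp: bLp_def\<close>)
    moreover have "egrad A f (m (Suc n))" unfolding mS
      using Suc gs(1)[of "Suc n"] by (intro egrad_min) (auto simp: W_def)
    ultimately show ?case by (simp add: W_def)
  qed (simp add: m0 gs)
  have mle: "m n x \<le> gs n x" for n x by (cases n) (auto simp: m0 mS)
  define g where "g x = (INF n. m n x)" for x
  have gle: "g x \<le> m n x" for n x unfolding g_def by (rule INF_lower) simp
  have mb: "m n \<in> borel_measurable borel" for n using mW[of n] by (auto simp: W_def bLp_def)
  have gb: "g \<in> borel_measurable borel" unfolding g_def[abs_def] by (rule borel_measurable_INF) (auto simp: mb)
  have "bLp g" using mW[of 0] gle[of _ 0] by (intro bLp_mono[OF _ gb, of "m 0"]) (auto simp: W_def)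
  moreover have "egrad A f g" unfolding g_def[abs_def]
    using mW by (intro egrad_decreasing) (auto simp: W_def mS)
  ultimately have gW: "g \<in> W" by (simp add: W_def)
  have gmin: "E g \<le> E h" if "h \<in> W" for h
  proof -
    have "E g \<le> (INF n. e n)" using gs(2) by (intro INF_greatest) (auto intro!: Emono intro: order_trans[OF gle mle])
    also have "\<dots> \<le> E h" unfolding e(2)[symmetric] using that by (rule INF_lower)
    finally show ?thesis .
  qed
  have "AE x in \<mu>. x \<in> A --> g x \<le> g' x" if g': "nonneg_Lp p \<mu> A g'" "weak_upper_gradient p \<mu> A f g'" for g'
  proof -
    obtain h where h: "bLp h" "egrad A f h" "AE x in \<mu>. h x = g' x * indicator A x"
      using wug_egrad[OF A g'] by blast
    define k where "k x = min (g x) (h x)" for x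
    have hb: "h \<in> borel_measurable borel" using h(1) by (simp add: bLp_def)
    have kb: "k \<in> borel_measurable borel" unfolding k_def[abs_def] using gb hb by measurable
    have kW: "k \<in> W"
      using gW h kb unfolding W_def k_def[abs_def]
      by (auto intro!: egrad_min bLp_mono[of g "\<lambda>x. min (g x) (h x)"])
    note [measurable] = borel_mu[OF kb] borel_mu[OF gb] A
    have "AE x in \<mu>. epowr (k x) p * indicator A x = epowr (g x) p * indicator A x"
    proof (rule nn_integral_eq_imp_AE)
      show "epowr (k x) p * indicator A x \<le> epowr (g x) p * indicator A x" for x
        using p0 by (intro mult_right_mono epowr_mono) (auto simp: k_def)
      show "energy A g \<le> energy A k" using gmin[OF kW] by (simp add: E_def)
      show "energy A k < \<infinity>" using Efin[OF kW] by (simp add: E_def)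
    qed measurable
    with h(3) show ?thesis
    proof eventually_elim
      case (elim x)
      show ?case
      proof
        assume x: "x \<in> A"
        then have "epowr (k x) p = epowr (g x) p" using elim by simp
        then have "k x = g x" using epowr_inverse[of p "1/p"] p0 by (metis divide_pos_pos less_irrefl nonzero_mult_div_cancel_left times_divide_eq_right mult.right_neutral zero_less_one)
        then show "g x \<le> g' x" using elim x by (simp add: k_def min_def split: if_splits)
      qed
    qed
  qed
  then show ?thesis using gW unfolding W_def by blast
qed

text \<open>\<open>minimal_weak_upper_gradient\<close> is a choice by \<open>SOME\<close>. Existence
  of a minimal gradient makes the choice meaningful, and any two minimal gradients agree almost
  everywhere, so the energy may be computed with the Borel one constructed above.\<close>

lemma p_energy_properties:
  assumes A: "A \<in> sets borel" and f: "Dp p \<mu> A f"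
  shows "\<exists>g. bLp g \<and> egrad A f g \<and> p_energy p \<mu> A f = energy A g"
    and "egrad A f h ==> p_energy p \<mu> A f \<le> energy A h"
proof -
  obtain g where g: "bLp g" "egrad A f g"
    "\<And>g'. nonneg_Lp p \<mu> A g' ==> weak_upper_gradient p \<mu> A f g' ==> (AE x in \<mu>. x \<in> A --> g x \<le> g' x)"
    using minimal_gradient_exists[OF assms] by blast
  define s where "s = minimal_weak_upper_gradient p \<mu> A f"
  have AEr: "(AE x in restrict_space \<mu> A. P x) \<longleftrightarrow> (AE x in \<mu>. x \<in> A --> P x)" for P
    using A by (intro AE_restrict_space_iff) auto
  have "nonneg_Lp p \<mu> A s \<and> weak_upper_gradient p \<mu> A f s \<and>
        (\<forall>g'. nonneg_Lp p \<mu> A g' \<and> weak_upper_gradient p \<mu> A f g' --> (AE x in restrict_space \<mu> A. s x \<le> g' x))"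
    unfolding s_def minimal_weak_upper_gradient_def
    by (rule someI[of _ g]) (use g bLp_nonneg_Lp[OF A] egrad_wug[OF A] AEr in auto)
  then have s: "nonneg_Lp p \<mu> A s" "weak_upper_gradient p \<mu> A f s"
    "\<And>g'. nonneg_Lp p \<mu> A g' ==> weak_upper_gradient p \<mu> A f g' ==> (AE x in \<mu>. x \<in> A --> s x \<le> g' x)"
    by (auto simp: AEr)
  have "AE x in \<mu>. x \<in> A --> s x = g x"
    using g(3)[OF s(1,2)] s(3)[OF bLp_nonneg_Lp[OF A g(1)] egrad_wug[OF A g(2)]]
    by eventually_elim auto
  then have "AE x in \<mu>. epowr (s x) p * indicator A x = epowr (g x) p * indicator A x"
    by eventually_elim (auto simp: indicator_def)
  then have e: "p_energy p \<mu> A f = energy A g"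
    unfolding p_energy_def s_def[symmetric] restrict_nn_integral[OF A] by (rule nn_integral_cong_AE)
  show "\<exists>g. bLp g \<and> egrad A f g \<and> p_energy p \<mu> A f = energy A g" using g e by blast
  assume h: "egrad A f h"
  show "p_energy p \<mu> A f \<le> energy A h"
  proof (cases "energy A h < \<infinity>")
    case True
    then have "nonneg_Lp p \<mu> A h"
      using pgrad_measurable[OF h] by (auto simp: nonneg_Lp_def restrict_nn_integral[OF A] intro!: measurable_restrict_space1)
    from g(3)[OF this egrad_wug[OF A h]]
    have "AE x in \<mu>. epowr (g x) p * indicator A x \<le> epowr (h x) p * indicator A x"
      by eventually_elim (use p0 in \<open>auto simp: indicator_def intro!: epowr_mono\<close>)
    then show ?thesis unfolding e by (rule nn_integral_mono_AE)
  qed (simp add: not_less top_unique)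
qed

end

section \<open>Minimizers of the energy\<close>

lemma continuous_on_powr_base:
  fixes p :: real
  assumes "0 < p" "continuous_on S f" "\<And>x. x \<in> S ==> 0 \<le> f x"
  shows "continuous_on S (\<lambda>x. f x powr p)"
  using assms by (intro continuous_on_powr' continuous_on_const) auto

lemma half_diff: "\<bar>x / 2 - y / 2\<bar> = \<bar>x - y\<bar> / (2::real)"
  by (simp add: diff_divide_distrib[symmetric])

text \<open>The convexity defect of the pair 1, s vanishes at s = 1 and is strictly decreasing in
  s.\<close>

lemma powr_mid_pos:
  fixes p s :: real
  assumes p: "1 < p" and s: "0 \<le> s" "s < 1"
  shows "0 < (1 + s powr p) / 2 - ((1 + s) / 2) powr p"
proof -
  define \<phi> where "\<phi> s = (1 + s powr p) / 2 - ((1 + s) / 2) powr p" for s :: real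
  have "\<phi> s > \<phi> 1"
  proof (rule DERIV_neg_imp_decreasing_open[OF s(2)])
    show "continuous_on {s..1} \<phi>" unfolding \<phi>_def using s p
      by (intro continuous_on_diff continuous_on_divide continuous_on_add continuous_on_powr_base
          continuous_on_id continuous_on_const) auto
    fix x assume x: "s < x" "x < 1"
    have "x powr (p - 1) < ((1 + x) / 2) powr (p - 1)"
      using x s p by (intro powr_less_mono2) auto
    then have neg: "p * x powr (p - 1) / 2 - p * ((1 + x) / 2) powr (p - 1) * (1/2) < 0"
      using p by (simp add: field_simps)
    have "DERIV \<phi> x :> p * x powr (p - 1) / 2 - p * ((1 + x) / 2) powr (p - 1) * (1/2)"
      unfolding \<phi>_def using x s by (auto intro!: derivative_eq_intros simp: field_simps)
    then show "\<exists>y. DERIV \<phi> x :> y \<and> y < 0" using neg by blast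
  qed
  then show ?thesis by (simp add: \<phi>_def)
qed

lemma powr_mid_scale:
  fixes a b :: real
  assumes "0 < a" "0 \<le> b"
  shows "(a powr p + b powr p) / 2 - ((a + b) / 2) powr p
       = a powr p * ((1 + (b/a) powr p) / 2 - ((1 + b/a) / 2) powr p)"
proof -
  have 1: "b powr p = a powr p * (b/a) powr p" using assms by (simp add: powr_mult[symmetric])
  have 0: "(a + b) / 2 = a * ((1 + b/a) / 2)" using assms by (simp add: field_simps)
  have 2: "((a + b) / 2) powr p = a powr p * ((1 + b/a) / 2) powr p"
    unfolding 0 by (rule powr_mult)
  show ?thesis unfolding 2 by (subst 1) (simp add: algebra_simps add_divide_distrib)
qed

lemma powr_mid_nonneg:
  fixes a b p :: real
  assumes p: "1 < p" and ab: "0 \<le> a" "0 \<le> b"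
  shows "0 \<le> (a powr p + b powr p) / 2 - ((a + b) / 2) powr p"
    and "(a powr p + b powr p) / 2 - ((a + b) / 2) powr p = 0 ==> a = b"
proof -
  have *: "0 \<le> (a powr p + b powr p) / 2 - ((a + b) / 2) powr p \<and>
    ((a powr p + b powr p) / 2 - ((a + b) / 2) powr p = 0 --> a = b)" if "0 \<le> b" "b \<le> a" for a b :: real
  proof (cases "a = b")
    case True
    then show ?thesis by simp
  next
    case False
    then have ab: "0 < a" "0 \<le> b/a" "b/a < 1" using that by (auto simp: divide_simps)
    have "0 < a powr p" using ab by simp
    with powr_mid_pos[OF p ab(2,3)] have "0 < (a powr p + b powr p) / 2 - ((a + b) / 2) powr p"
      unfolding powr_mid_scale[OF ab(1) that(1)] by (intro mult_pos_pos)
    then show ?thesis by simp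
  qed
  show "0 \<le> (a powr p + b powr p) / 2 - ((a + b) / 2) powr p"
    using *[of b a] *[of a b] ab by (cases "b \<le> a") (auto simp: add.commute)
  show "a = b" if "(a powr p + b powr p) / 2 - ((a + b) / 2) powr p = 0"
    using *[of b a] *[of a b] ab that by (cases "b \<le> a") (auto simp: add.commute)
qed

text \<open>Replaces Clarkson's inequalities and treats all exponents \<open>p > 1\<close> at once.\<close>

lemma powr_uniformly_convex:
  fixes p \<epsilon> :: real
  assumes p: "1 < p" and \<epsilon>: "0 < \<epsilon>"
  shows "\<exists>C\<ge>0. \<forall>a b. 0 \<le> a --> 0 \<le> b -->
     \<bar>a powr p - b powr p\<bar> \<le> \<epsilon> * (a powr p + b powr p) + C * ((a powr p + b powr p) / 2 - ((a + b) / 2) powr p)"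
proof -
  define \<phi> where "\<phi> s = (1 + s powr p) / 2 - ((1 + s) / 2) powr p" for s :: real
  \<comment> \<open>By homogeneity only the ratio s of the smaller to the larger number matters.
    Outside \<open>K\<close> the first term of the bound suffices; on the compact set
    \<open>K\<close> the convexity defect has a positive minimum \<delta>, and the constant is
    1/\<delta>.\<close>
  define K where "K = {s \<in> {0..1}. \<epsilon> \<le> 1 - s powr p}"
  have cont: "continuous_on {0..1} \<phi>" unfolding \<phi>_def using p
    by (intro continuous_on_diff continuous_on_divide continuous_on_add continuous_on_powr_base
          continuous_on_id continuous_on_const) auto
  have c2: "continuous_on {0..1::real} (\<lambda>s. 1 - s powr p)" using p
    by (intro continuous_on_diff continuous_on_powr_base continuous_on_id continuous_on_const) auto
  have K: "compact K"
  proof -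
    have "closed ({0..1} \<inter> (\<lambda>s. 1 - s powr p) -` {\<epsilon>..})" by (rule continuous_closed_preimage[OF c2]) auto
    moreover have "{0..1} \<inter> (\<lambda>s. 1 - s powr p) -` {\<epsilon>..} = K" by (auto simp: K_def)
    ultimately have "closed K" by simp
    moreover have "bounded K" by (rule bounded_subset[of "{0..1}"]) (auto simp: K_def)
    ultimately show ?thesis by (simp add: compact_eq_bounded_closed)
  qed
  have pos: "0 < \<phi> s" if "s \<in> K" for s
  proof -
    have "s \<noteq> 1" using that \<epsilon> by (auto simp: K_def)
    then show ?thesis unfolding \<phi>_def using that by (intro powr_mid_pos p) (auto simp: K_def)
  qed
  have "\<exists>\<delta>>0. \<forall>s\<in>K. \<delta> \<le> \<phi> s"
  proof (cases "K = {}")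
    case False
    have "continuous_on K \<phi>" using cont by (rule continuous_on_subset) (auto simp: K_def)
    then obtain s0 where "s0 \<in> K" "\<forall>s\<in>K. \<phi> s0 \<le> \<phi> s" using continuous_attains_inf[OF K False] by blast
    then show ?thesis using pos by blast
  qed (auto intro: exI[of _ 1])
  then obtain \<delta> where \<delta>: "\<delta> > 0" "\<And>s. s \<in> K ==> \<delta> \<le> \<phi> s" by blast
  have unit: "1 - s powr p \<le> \<epsilon> + (1/\<delta>) * \<phi> s" if s: "0 \<le> s" "s \<le> 1" for s
  proof (cases "s \<in> K")
    case True
    then have "1 \<le> (1/\<delta>) * \<phi> s" using \<delta> by (simp add: field_simps)
    moreover have "0 \<le> s powr p" by simp
    ultimately show ?thesis using \<epsilon> by linarith
  next
    case False
    have "0 \<le> \<phi> s" unfolding \<phi>_def using powr_mid_nonneg(1)[OF p, of 1 s] s by simp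
    then have "0 \<le> (1/\<delta>) * \<phi> s" using \<delta> by simp
    then show ?thesis using False s by (auto simp: K_def)
  qed
  have main: "\<bar>a powr p - b powr p\<bar> \<le> \<epsilon> * (a powr p + b powr p) + (1/\<delta>) * ((a powr p + b powr p) / 2 - ((a + b) / 2) powr p)"
    if ab: "0 \<le> b" "b \<le> a" for a b :: real
  proof (cases "a = 0")
    case True
    then show ?thesis using ab p by simp
  next
    case False
    then have a: "0 < a" using ab by simp
    have s: "0 \<le> b/a" "b/a \<le> 1" using a ab by auto
    have "b powr p \<le> a powr p" using ab p by (intro powr_mono2) auto
    then have "\<bar>a powr p - b powr p\<bar> = a powr p - b powr p" by simp
    also have "\<dots> = a powr p * (1 - (b/a) powr p)" using a ab by (simp add: powr_divide field_simps)
    also have "\<dots> \<le> a powr p * (\<epsilon> + (1/\<delta>) * \<phi> (b/a))" using unit[OF s] by (intro mult_left_mono) auto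
    also have "\<dots> = \<epsilon> * a powr p + (1/\<delta>) * ((a powr p + b powr p) / 2 - ((a + b) / 2) powr p)"
      unfolding powr_mid_scale[OF a ab(1)] \<phi>_def by (simp add: algebra_simps)
    also have "\<dots> \<le> \<epsilon> * (a powr p + b powr p) + (1/\<delta>) * ((a powr p + b powr p) / 2 - ((a + b) / 2) powr p)"
      using \<epsilon> by (intro add_right_mono mult_left_mono) auto
    finally show ?thesis .
  qed
  have "\<bar>a powr p - b powr p\<bar> \<le> \<epsilon> * (a powr p + b powr p) + (1/\<delta>) * ((a powr p + b powr p) / 2 - ((a + b) / 2) powr p)"
    if "0 \<le> a" "0 \<le> b" for a b :: real
    using main[of b a] main[of a b] that by (cases "b \<le> a") (auto simp: add.commute abs_minus_commute)
  then show ?thesis using \<delta>(1) by (intro exI[of _ "1/\<delta>"]) auto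
qed

section \<open>Upper limits of functions with a common gradient\<close>

lemma limsup_real_bounded:
  fixes a :: "nat => real"
  assumes "\<And>n. \<bar>a n\<bar> \<le> M"
  shows "\<bar>limsup (\<lambda>n. ereal (a n))\<bar> \<noteq> \<infinity>" "\<bar>real_of_ereal (limsup (\<lambda>n. ereal (a n)))\<bar> \<le> M"
proof -
  have a: "- M \<le> a n" "a n \<le> M" for n using assms[of n] by auto
  have "limsup (\<lambda>n. ereal (a n)) \<le> ereal M" using a(2) by (intro Limsup_bounded) auto
  moreover have "ereal (- M) \<le> limsup (\<lambda>n. ereal (a n))"
    using a(1) by (intro le_Limsup) (auto intro!: always_eventually)
  ultimately show "\<bar>limsup (\<lambda>n. ereal (a n))\<bar> \<noteq> \<infinity>" "\<bar>real_of_ereal (limsup (\<lambda>n. ereal (a n)))\<bar> \<le> M"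
    by (cases "limsup (\<lambda>n. ereal (a n))"; auto)+
qed

lemma limsup_real_diff:
  fixes a b :: "nat => real"
  assumes "\<And>n. \<bar>a n\<bar> \<le> M" "\<And>n. \<bar>b n\<bar> \<le> M" "\<And>n. \<bar>a n - b n\<bar> \<le> c"
  shows "\<bar>real_of_ereal (limsup (\<lambda>n. ereal (a n))) - real_of_ereal (limsup (\<lambda>n. ereal (b n)))\<bar> \<le> c"
proof -
  have *: "limsup (\<lambda>n. ereal (a n)) \<le> limsup (\<lambda>n. ereal (b n)) + ereal c" if "\<And>n. \<bar>a n - b n\<bar> \<le> c" for a b :: "nat => real"
  proof -
    have "a n \<le> b n + c" for n using that[of n] by linarith
    then have "limsup (\<lambda>n. ereal (a n)) \<le> limsup (\<lambda>n. ereal (b n) + ereal c)"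
      by (intro Limsup_mono always_eventually) auto
    also have "\<dots> = limsup (\<lambda>n. ereal (b n)) + ereal c" by (rule Limsup_add_ereal_right) auto
    finally show ?thesis .
  qed
  have "limsup (\<lambda>n. ereal (a n)) \<le> limsup (\<lambda>n. ereal (b n)) + ereal c" by (rule *[OF assms(3)])
  moreover have "limsup (\<lambda>n. ereal (b n)) \<le> limsup (\<lambda>n. ereal (a n)) + ereal c"
    using assms(3) by (intro *) (simp add: abs_minus_commute)
  ultimately show ?thesis
    using limsup_real_bounded(1)[of a M, OF assms(1)] limsup_real_bounded(1)[of b M, OF assms(2)]
    by (cases "limsup (\<lambda>n. ereal (a n))"; cases "limsup (\<lambda>n. ereal (b n))") auto
qed

text \<open>The bound on the increment between s and t is the same for all n, so it passes to the
  upper limit even where the sequence does not converge. Boundedness keeps the upper limit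
  finite.\<close>

lemma igrad_limsup:
  assumes i: "\<And>n. igrad l (F n) G" and b: "\<And>n t. \<bar>F n t\<bar> \<le> M"
  shows "igrad l (\<lambda>t. real_of_ereal (limsup (\<lambda>n. ereal (F n t)))) G"
  unfolding igrad_def
proof (intro conjI allI impI igradD(1,2)[OF i])
  fix s t :: real assume st: "0 \<le> s" "s \<le> t" "t \<le> l"
  define I where "I = nnint {s..t} G"
  have "I \<le> nnint {0..l} G" unfolding I_def
    using st by (intro nn_integral_mono) (auto simp: indicator_def)
  also have "\<dots> < \<infinity>" by (rule igradD(2)[OF i])
  finally obtain r where r: "0 \<le> r" "I = ennreal r" by (cases I) auto
  have "ennreal \<bar>F n s - F n t\<bar> \<le> ennreal r" for n
    using igradD(3)[OF i st, of n] unfolding I_def[symmetric] r(2) .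
  then have "\<bar>F n s - F n t\<bar> \<le> r" for n using r(1) by (simp add: ennreal_le_iff)
  then have "\<bar>real_of_ereal (limsup (\<lambda>n. ereal (F n s))) - real_of_ereal (limsup (\<lambda>n. ereal (F n t)))\<bar> \<le> r"
    by (intro limsup_real_diff[OF b b])
  then show "ennreal \<bar>real_of_ereal (limsup (\<lambda>n. ereal (F n s))) - real_of_ereal (limsup (\<lambda>n. ereal (F n t)))\<bar>
     \<le> nnint {s..t} G"
    unfolding I_def[symmetric] r(2) by (rule ennreal_leI)
qed

context borel_mm
begin

lemma pgrad_limsup:
  assumes "\<And>n::nat. pgrad A (w n) h" "\<And>n x. \<bar>w n x\<bar> \<le> M"
  shows "pgrad A (\<lambda>x. real_of_ereal (limsup (\<lambda>n. ereal (w n x)))) h"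
proof (rule pgrad_lift_seq[OF assms(1)])
  show "meas h" by (rule pgrad_measurable[OF assms(1)])
  fix l \<gamma> assume "\<And>n. igrad l (\<lambda>t. w n (\<gamma> t)) (\<lambda>t. h (\<gamma> t))"
  then show "igrad l (\<lambda>t. real_of_ereal (limsup (\<lambda>n. ereal (w n (\<gamma> t))))) (\<lambda>t. h (\<gamma> t))"
    by (rule igrad_limsup) (rule assms(2))
qed

section \<open>Energies and admissible functions\<close>

definition en :: "'a set => ('a => real) => ennreal" where
  "en V w = p_energy p \<mu> V (\<lambda>x. ereal (w x))"

text \<open>Gradients in the form to which Bochner integrals and the convexity of
  \<open>powr\<close> apply: real-valued, of finite energy, and zero off \<open>V\<close>, so that
  energies over \<open>V\<close> are integrals over the whole space.\<close>

definition rgrad :: "'a set => ('a => real) => ('a => real) => bool" where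
  "rgrad V w b \<longleftrightarrow> b \<in> borel_measurable borel \<and> (\<forall>x. 0 \<le> b x) \<and> (\<forall>x. x \<notin> V --> b x = 0) \<and>
     integrable \<mu> (\<lambda>x. b x powr p) \<and> pgrad V w (\<lambda>x. ennreal (b x))"

lemma rgradD:
  assumes "rgrad V w b"
  shows "b \<in> borel_measurable borel" "meas b" "0 \<le> b x" "x \<notin> V ==> b x = 0"
    "integrable \<mu> (\<lambda>x. b x powr p)" "pgrad V w (\<lambda>x. ennreal (b x))" "bLp (\<lambda>x. ennreal (b x))"
proof -
  show 1: "b \<in> borel_measurable borel" "0 \<le> b x" "x \<notin> V ==> b x = 0" and
    2: "integrable \<mu> (\<lambda>x. b x powr p)" "pgrad V w (\<lambda>x. ennreal (b x))" for x
    using assms by (auto simp: rgrad_def)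
  show "meas b" by (rule borel_mu[OF 1(1)])
  have "(\<integral>\<^sup>+x. epowr (ennreal (b x)) p \<partial>\<mu>) = (\<integral>\<^sup>+x. ennreal (b x powr p) \<partial>\<mu>)"
    using 1(2) by (simp add: epowr_ennreal)
  also have "\<dots> < \<infinity>" using 2(1) by (simp add: integrable_iff_bounded)
  finally show "bLp (\<lambda>x. ennreal (b x))" using 1(1) by (simp add: bLp_def)
qed

lemma Dp_pgradI:
  assumes "open V" "meas w" "pgrad V w g" "bLp g"
  shows "Dp p \<mu> V (\<lambda>x. ereal (w x))"
proof -
  have "(\<lambda>x. ereal (w x)) \<in> borel_measurable (restrict_space \<mu> V)"
    using assms(2) by (intro measurable_restrict_space1) auto
  then show ?thesis using assms by (auto simp: Dp_iff)
qed

text \<open>The minimal gradient is finite almost everywhere. Turning its infinite values into 0 by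
  \<open>enn2real\<close> and its values off \<open>V\<close> into 0 changes neither the energy nor
  the gradient property on \<open>V\<close>.\<close>

lemma energy_attained:
  assumes V: "open V" and w: "Dp p \<mu> V (\<lambda>x. ereal (w x))"
  shows "\<exists>b. rgrad V w b \<and> en V w = ennreal (\<integral>x. b x powr p \<partial>\<mu>)"
proof -
  have Vb: "V \<in> sets borel" using V by auto
  obtain g where g: "bLp g" "pgrad V w g" "p_energy p \<mu> V (\<lambda>x. ereal (w x)) = energy V g"
    using p_energy_properties(1)[OF Vb w] by blast
  have gb: "g \<in> borel_measurable borel" using g(1) by (simp add: bLp_def)
  note [measurable] = gb borel_mu[OF gb] Vb
  define b where "b x = enn2real (g x) * indicator V x" for x
  have bb: "b \<in> borel_measurable borel" unfolding b_def[abs_def] by measurable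
  have "AE x in \<mu>. epowr (g x) p \<noteq> \<infinity>" using g(1) by (intro nn_integral_noteq_infinite) (auto simp: bLp_def)
  then have AEfin: "AE x in \<mu>. g x < top"
    by eventually_elim (auto simp: less_top[symmetric])
  have kL: "bLp (\<lambda>x. ennreal (b x))"
  proof (rule bLp_mono[OF g(1)])
    show "(\<lambda>x. ennreal (b x)) \<in> borel_measurable borel" using bb by measurable
    show "ennreal (b x) \<le> g x" for x by (cases "g x") (auto simp: b_def indicator_def)
  qed
  have pg: "pgrad V w (\<lambda>x. ennreal (b x))"
    by (rule egrad_mono_AE[OF g(2) kL], rule eventually_mono[OF AEfin]) (auto simp: b_def)
  have e: "energy V g = (\<integral>\<^sup>+x. ennreal (b x powr p) \<partial>\<mu>)"
    by (rule nn_integral_cong_AE, rule eventually_mono[OF AEfin])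
       (auto simp: b_def indicator_def epowr_def less_top[symmetric])
  have "(\<integral>\<^sup>+x. ennreal (b x powr p) \<partial>\<mu>) = (\<integral>\<^sup>+x. epowr (ennreal (b x)) p \<partial>\<mu>)"
    by (simp add: epowr_ennreal b_def)
  also have "\<dots> < \<infinity>" using kL by (simp add: bLp_def)
  finally have int: "integrable \<mu> (\<lambda>x. b x powr p)"
    using borel_mu[OF bb] by (intro integrableI_nonneg) auto
  have "rgrad V w b" using bb int pg by (auto simp: rgrad_def b_def)
  moreover have "en V w = ennreal (\<integral>x. b x powr p \<partial>\<mu>)"
    unfolding en_def g(3) e using int by (intro nn_integral_eq_integral) auto
  ultimately show ?thesis by blast
qed

lemma energy_le:
  assumes V: "open V" and w: "Dp p \<mu> V (\<lambda>x. ereal (w x))" and g: "pgrad V w (\<lambda>x. ennreal (b x))"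
    and b: "\<And>x. 0 \<le> b x" "integrable \<mu> (\<lambda>x. indicator V x * b x powr p)"
  shows "en V w \<le> ennreal (\<integral>x. indicator V x * b x powr p \<partial>\<mu>)"
proof -
  have Vb: "V \<in> sets borel" using V by auto
  have "en V w \<le> (\<integral>\<^sup>+x\<in>V. epowr (ennreal (b x)) p \<partial>\<mu>)"
    unfolding en_def by (rule p_energy_properties(2)[OF Vb w g])
  also have "\<dots> = (\<integral>\<^sup>+x. ennreal (indicator V x * b x powr p) \<partial>\<mu>)"
    using b(1) by (intro nn_integral_cong) (auto simp: indicator_def epowr_ennreal)
  also have "\<dots> = ennreal (\<integral>x. indicator V x * b x powr p \<partial>\<mu>)"
    using b(2) by (intro nn_integral_eq_integral) auto
  finally show ?thesis .
qed

lemma energy_le_rgrad: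
  assumes V: "open V" and w: "Dp p \<mu> V (\<lambda>x. ereal (w x))" and b: "rgrad V w b"
  shows "en V w \<le> ennreal (\<integral>x. b x powr p \<partial>\<mu>)"
proof -
  have e: "indicator V x * b x powr p = b x powr p" for x
    using rgradD(4)[OF b, of x] by (auto simp: indicator_def)
  show ?thesis
    using energy_le[OF V w rgradD(6)[OF b] rgradD(3)[OF b]] rgradD(5)[OF b] by (simp add: e)
qed

text \<open>A real-valued rendering of w - F \<in> D^p_0(V). The gradient on the whole space carries
  no integrability; it ties \<open>w\<close> to its values off \<open>V\<close> along almost every
  curve crossing the boundary. For Lipschitz \<open>F\<close> and \<open>V\<close> of finite
  measure, \<open>pgrad_zero_extension\<close> makes an integrable gradient on \<open>V\<close> into
  a global one of w - F.\<close>

definition adm :: "('a => real) => 'a set => ('a => real) => bool" where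
  "adm F V w \<longleftrightarrow> meas w \<and> (\<forall>x. x \<notin> V --> w x = F x) \<and> (\<exists>h. pgrad UNIV w h) \<and>
     (\<exists>g. bLp g \<and> pgrad V w g)"

lemma adm_Dp: "open V ==> adm F V w ==> Dp p \<mu> V (\<lambda>x. ereal (w x))"
  by (auto simp: adm_def intro: Dp_pgradI)

lemma admI:
  assumes "meas w" "\<And>x. x \<notin> V ==> w x = F x" "pgrad UNIV w h" "pgrad V w g" "bLp g"
  shows "adm F V w"
  using assms unfolding adm_def by auto

lemma bLp_const_indicator:
  assumes "V \<in> sets borel" "emeasure \<mu> V < \<infinity>" shows "bLp (\<lambda>x. ennreal L * indicator V x)"
proof -
  have "(\<integral>\<^sup>+x. epowr (ennreal L * indicator V x) p \<partial>\<mu>) = (\<integral>\<^sup>+x. epowr (ennreal L) p * indicator V x \<partial>\<mu>)"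
    by (intro nn_integral_cong) (auto simp: indicator_def)
  also have "\<dots> = epowr (ennreal L) p * emeasure \<mu> V"
    using assms(1) by (intro nn_integral_cmult_indicator) auto
  also have "\<dots> < \<infinity>" using assms(2) by (simp add: ennreal_mult_less_top epowr_less_top)
  finally show ?thesis using assms(1) by (simp add: bLp_def)
qed

lemma lipschitz_adm:
  assumes V: "open V" "emeasure \<mu> V < \<infinity>" and F: "L-lipschitz_on UNIV (F :: 'a => real)"
  shows "adm F V F" "meas F" "pgrad UNIV F (\<lambda>_. ennreal L)"
    "pgrad V F (\<lambda>x. ennreal L * indicator V x)"
proof -
  have Vb: "V \<in> sets borel" using V by auto
  have L: "0 \<le> L" by (rule lipschitz_on_nonneg[OF F])
  show m: "meas F"
    by (intro borel_mu borel_measurable_continuous_onI lipschitz_on_continuous_on[OF F])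
  show g: "pgrad UNIV F (\<lambda>_. ennreal L)"
    using lipschitz_onD[OF F] by (intro pgrad_lipschitz L) (auto simp: dist_real_def)
  show gV: "pgrad V F (\<lambda>x. ennreal L * indicator V x)"
  proof (rule pgrad_cong[OF egrad_subset[OF g]])
    have "(\<lambda>x. ennreal L * indicator V x) \<in> borel_measurable borel" using Vb by measurable
    then show "meas (\<lambda>x. ennreal L * indicator V x)" by (rule borel_mu)
  qed auto
  show "adm F V F" by (rule admI[OF m _ g gV bLp_const_indicator[OF Vb V(2)]]) simp
qed

lemma bLp_add:
  assumes "bLp g" "bLp h" shows "bLp (\<lambda>x. g x + h x)"
proof -
  note m = assms[unfolded bLp_def, THEN conjunct1]
  note [measurable] = m borel_mu[OF m(1)] borel_mu[OF m(2)]
  have two: "epowr 2 p < top" by (simp add: epowr_less_top)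
  have "(\<integral>\<^sup>+x. epowr (g x + h x) p \<partial>\<mu>) \<le> (\<integral>\<^sup>+x. epowr 2 p * (epowr (g x) p + epowr (h x) p) \<partial>\<mu>)"
  proof (rule nn_integral_mono)
    fix x
    have "epowr (g x + h x) p \<le> epowr (ennreal 2 * max (g x) (h x)) p"
      using p0 add_mono[of "g x" "max (g x) (h x)" "h x" "max (g x) (h x)"]
      by (intro epowr_mono) (auto simp: mult_2)
    also have "\<dots> = epowr 2 p * max (epowr (g x) p) (epowr (h x) p)"
      using p0 by (simp add: epowr_mult epowr_max del: ennreal_numeral) simp
    also have "\<dots> \<le> epowr 2 p * (epowr (g x) p + epowr (h x) p)"
      by (intro mult_left_mono) (auto simp: max_def add_increasing add_increasing2)
    finally show "epowr (g x + h x) p \<le> epowr 2 p * (epowr (g x) p + epowr (h x) p)" .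
  qed
  also have "\<dots> = epowr 2 p * ((\<integral>\<^sup>+x. epowr (g x) p \<partial>\<mu>) + (\<integral>\<^sup>+x. epowr (h x) p \<partial>\<mu>))"
  proof -
    have "(\<integral>\<^sup>+x. epowr (g x) p + epowr (h x) p \<partial>\<mu>) = (\<integral>\<^sup>+x. epowr (g x) p \<partial>\<mu>) + (\<integral>\<^sup>+x. epowr (h x) p \<partial>\<mu>)"
      by (intro nn_integral_add; measurable)
    moreover have "(\<integral>\<^sup>+x. epowr 2 p * (epowr (g x) p + epowr (h x) p) \<partial>\<mu>) = epowr 2 p * (\<integral>\<^sup>+x. epowr (g x) p + epowr (h x) p \<partial>\<mu>)"
      by (intro nn_integral_cmult; measurable)
    ultimately show ?thesis by simp
  qed
  also have "\<dots> < \<infinity>" using assms two by (simp add: ennreal_mult_less_top bLp_def)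
  finally show ?thesis using m by (simp add: bLp_def)
qed

lemma adm_mid:
  assumes "adm F V w" "adm F V v" shows "adm F V (\<lambda>x. (w x + v x) / 2)"
proof -
  obtain h1 g1 h2 g2 where 1: "meas w" "\<And>x. x \<notin> V ==> w x = F x" "pgrad UNIV w h1" "pgrad V w g1" "bLp g1"
    and 2: "meas v" "\<And>x. x \<notin> V ==> v x = F x" "pgrad UNIV v h2" "pgrad V v g2" "bLp g2"
    using assms unfolding adm_def by blast
  have *: "pgrad A (\<lambda>x. (w x + v x) / 2) (\<lambda>x. g x + h x)" if "pgrad A w g" "pgrad A v h" for A g h
    using pgrad_add[OF that] by (rule pgrad_contraction1) (simp only: half_diff, simp)
  show ?thesis
    by (rule admI[OF _ _ *[OF 1(3) 2(3)] *[OF 1(4) 2(4)] bLp_add[OF 1(5) 2(5)]]) (use 1 2 in auto)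
qed

lemma rgrad_mid:
  assumes "rgrad V w b" "rgrad V v c"
  shows "rgrad V (\<lambda>x. (w x + v x) / 2) (\<lambda>x. (b x + c x) / 2)"
  unfolding rgrad_def
proof (intro conjI allI impI)
  note b = rgradD[OF assms(1)] and c = rgradD[OF assms(2)]
  note [measurable] = b(1,2) c(1,2)
  show "(\<lambda>x. (b x + c x) / 2) \<in> borel_measurable borel" by measurable
  show "0 \<le> (b x + c x) / 2" for x using b(3)[of x] c(3)[of x] by simp
  show "(b x + c x) / 2 = 0" if "x \<notin> V" for x using b(4) c(4) that by simp
  show "integrable \<mu> (\<lambda>x. ((b x + c x) / 2) powr p)"
  proof (rule Bochner_Integration.integrable_bound)
    show "integrable \<mu> (\<lambda>x. (b x powr p + c x powr p) / 2)" using b(5) c(5) by auto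
    show "meas (\<lambda>x. ((b x + c x) / 2) powr p)" by measurable
    show "AE x in \<mu>. norm (((b x + c x) / 2) powr p) \<le> norm ((b x powr p + c x powr p) / 2)"
      using powr_mid_nonneg(1)[OF p1 b(3) c(3)] by (intro AE_I2) auto
  qed
  have "pgrad V (\<lambda>x. (w x + v x) / 2) (\<lambda>x. ennreal (1/2) * (ennreal (b x) + ennreal (c x)))"
    by (rule pgrad_contraction[OF pgrad_add[OF b(6) c(6)]]) (simp, unfold half_diff, simp)
  moreover have "ennreal (1/2) * (ennreal (b x) + ennreal (c x)) = ennreal ((b x + c x) / 2)" for x
  proof -
    have "ennreal (1/2) * (ennreal (b x) + ennreal (c x)) = ennreal (1/2) * ennreal (b x + c x)"
      using b(3)[of x] c(3)[of x] by (simp only: ennreal_plus)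
    also have "\<dots> = ennreal (1/2 * (b x + c x))"
      using b(3)[of x] c(3)[of x] by (intro ennreal_mult[symmetric]) auto
    finally show ?thesis by simp
  qed
  ultimately show "pgrad V (\<lambda>x. (w x + v x) / 2) (\<lambda>x. ennreal ((b x + c x) / 2))" by simp
qed

end

section \<open>Existence of minimizers and the gradient of their difference\<close>

context borel_mm
begin

lemma pgrad_clip:
  assumes "pgrad A w g" shows "pgrad A (\<lambda>x. max (- M) (min M (w x))) g"
  using assms by (rule pgrad_contraction1) auto

lemma adm_clip:
  assumes w: "adm F V w" and F: "\<And>x. \<bar>F x\<bar> \<le> M"
  shows "adm F V (\<lambda>x. max (- M) (min M (w x)))"
proof -
  obtain h1 g1 where 1: "meas w" "\<And>x. x \<notin> V ==> w x = F x" "pgrad UNIV w h1" "pgrad V w g1" "bLp g1"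
    using w unfolding adm_def by blast
  show ?thesis
  proof (rule admI[OF _ _ pgrad_clip[OF 1(3)] pgrad_clip[OF 1(4)] 1(5)])
    show "meas (\<lambda>x. max (- M) (min M (w x)))" using 1(1) by measurable
    show "max (- M) (min M (w x)) = F x" if "x \<notin> V" for x
      using 1(2)[OF that] F[of x] by (auto simp: max_def min_def abs_le_iff)
  qed
qed

lemma en_clip:
  assumes V: "open V" and w: "Dp p \<mu> V (\<lambda>x. ereal (w x))" and m: "meas w"
  shows "en V (\<lambda>x. max (- M) (min M (w x))) \<le> en V w"
proof -
  obtain b where b: "rgrad V w b" "en V w = ennreal (\<integral>x. b x powr p \<partial>\<mu>)"
    using energy_attained[OF V w] by blast
  have g: "pgrad V (\<lambda>x. max (- M) (min M (w x))) (\<lambda>x. ennreal (b x))"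
    by (rule pgrad_clip[OF rgradD(6)[OF b(1)]])
  have "rgrad V (\<lambda>x. max (- M) (min M (w x))) b" using g b(1) by (auto simp: rgrad_def)
  moreover have "Dp p \<mu> V (\<lambda>x. ereal (max (- M) (min M (w x))))"
    using Dp_pgradI[OF V _ g rgradD(7)[OF b(1)]] m by simp
  ultimately show ?thesis unfolding b(2) by (intro energy_le_rgrad[OF V])
qed

text \<open>The powers \<open>g^p\<close> of the gradients of a minimizing sequence are Cauchy in \<open>L^1\<close>, so the tails of a subsequence
  have a common majorant of nearly minimal energy.  It is a gradient of the upper limit of the functions, whose
  convergence is not needed.\<close>

lemma minimizer_exists_bounded:
  assumes V: "open V" "emeasure \<mu> V < \<infinity>" and F: "L-lipschitz_on UNIV F" and FM: "\<And>x. \<bar>F x\<bar> \<le> M"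
  shows "\<exists>w. adm F V w \<and> (\<forall>x. \<bar>w x\<bar> \<le> M) \<and> (\<forall>v. adm F V v --> (\<forall>x. \<bar>v x\<bar> \<le> M) --> en V w \<le> en V v)"
proof -
  have Vb: "V \<in> sets borel" using V by auto
  note [measurable] = Vb
  note Fadm = lipschitz_adm[OF V F]
  define \<A> where "\<A> = {w. adm F V w \<and> (\<forall>x. \<bar>w x\<bar> \<le> M)}"
  have \<A>0: "\<A> \<noteq> {}" using Fadm(1) FM by (auto simp: \<A>_def)
  have Dp\<A>: "Dp p \<mu> V (\<lambda>x. ereal (w x))" if "w \<in> \<A>" for w
    using adm_Dp[OF V(1)] that by (auto simp: \<A>_def)
  have m\<A>: "meas w" if "w \<in> \<A>" for w using that by (auto simp: \<A>_def adm_def)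
  have "en V ` \<A> \<noteq> {}" using \<A>0 by simp
  from ennreal_Inf_countable_INF[OF this]
  obtain e :: "nat => ennreal" where e: "decseq e" "range e \<subseteq> en V ` \<A>" "(INF w\<in>\<A>. en V w) = (INF n. e n)"
    by blast
  have "\<forall>n. \<exists>w. w \<in> \<A> \<and> e n = en V w" using e(2) by (auto simp: image_def subset_iff)
  then obtain w where w: "\<And>n. w n \<in> \<A>" "\<And>n. e n = en V (w n)" by metis
  have "\<forall>n. \<exists>b. rgrad V (w n) b \<and> en V (w n) = ennreal (\<integral>x. b x powr p \<partial>\<mu>)"
    using energy_attained[OF V(1) Dp\<A>[OF w(1)]] by blast
  then obtain b where b: "\<And>n. rgrad V (w n) (b n)" "\<And>n. en V (w n) = ennreal (\<integral>x. b n x powr p \<partial>\<mu>)" by metis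
  define G where "G n x = b n x powr p" for n x
  define a where "a n = (\<integral>x. G n x \<partial>\<mu>)" for n
  have G0: "0 \<le> G n x" for n x by (simp add: G_def)
  have Gi: "integrable \<mu> (G n)" for n unfolding G_def[abs_def] by (rule rgradD(5)[OF b(1)])
  have a0: "0 \<le> a n" for n unfolding a_def by (intro integral_nonneg_AE) (auto simp: G0)
  have ea: "e n = ennreal (a n)" for n unfolding w(2) b(2) a_def G_def ..
  define I where "I = (INF n. e n)"
  have elim: "e \<longlonglongrightarrow> I" unfolding I_def by (rule LIMSEQ_INF[OF e(1)])
  obtain i where i: "0 \<le> i" "I = ennreal i"
  proof -
    have "I \<le> e 0" unfolding I_def by (rule INF_lower) simp
    then show ?thesis using that ea[of 0] by (cases I) (auto simp: top_unique)
  qed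
  have alim: "a \<longlonglongrightarrow> i" using elim unfolding ea[abs_def] i(2) using a0 i(1) by (subst (asm) tendsto_ennreal_iff) auto
  have Ile: "I \<le> en V v" if "v \<in> \<A>" for v unfolding I_def e(3)[symmetric] using that by (rule INF_lower)
  \<comment> \<open>Midpoints of the minimizing sequence are again competitors, so their energy is
    at least the infimum. This bounds the integrated convexity defect of \<open>b n\<close> and
    \<open>b m\<close> from above.\<close>
  have mid: "i \<le> (\<integral>x. ((b n x + b m x) / 2) powr p \<partial>\<mu>)" for n m
  proof -
    have v: "(\<lambda>x. (w n x + w m x) / 2) \<in> \<A>"
    proof -
      have 1: "adm F V (w n)" "adm F V (w m)" "\<And>x. \<bar>w n x\<bar> \<le> M" "\<And>x. \<bar>w m x\<bar> \<le> M" using w(1) by (auto simp: \<A>_def)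
      have "\<bar>(w n x + w m x) / 2\<bar> \<le> M" for x using 1(3,4)[of x] by (auto simp: abs_le_iff)
      then show ?thesis using adm_mid[OF 1(1,2)] by (simp add: \<A>_def)
    qed
    have "I \<le> ennreal (\<integral>x. ((b n x + b m x) / 2) powr p \<partial>\<mu>)"
      by (rule order_trans[OF Ile[OF v] energy_le_rgrad[OF V(1) Dp\<A>[OF v] rgrad_mid[OF b(1) b(1)]]])
    then show ?thesis unfolding i(2) by (subst (asm) ennreal_le_iff) (auto intro!: integral_nonneg_AE)
  qed
  have diff: "\<exists>N. \<forall>m\<ge>N. \<forall>n\<ge>N. (\<integral>x. \<bar>G n x - G m x\<bar> \<partial>\<mu>) \<le> \<eta>" if \<eta>: "0 < \<eta>" for \<eta> :: real
  proof -
    \<comment> \<open>As \<open>a n\<close> is eventually at most i + 1, the \<epsilon>-term of the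
      uniform convexity bound is at most \<eta>/2; \<open>\<theta>\<close> below does the same for
      the defect term.\<close>
    define \<epsilon> where "\<epsilon> = \<eta> / (4 * (i + 1))"
    have \<epsilon>: "0 < \<epsilon>" using \<eta> i(1) by (simp add: \<epsilon>_def)
    obtain C where C: "0 \<le> C" "\<And>s t. 0 \<le> s ==> 0 \<le> t ==>
     \<bar>s powr p - t powr p\<bar> \<le> \<epsilon> * (s powr p + t powr p) + C * ((s powr p + t powr p) / 2 - ((s + t) / 2) powr p)"
      using powr_uniformly_convex[OF p1 \<epsilon>] by blast
    define \<theta> where "\<theta> = min 1 (\<eta> / (2 * (C + 1)))"
    have \<theta>: "0 < \<theta>" "\<theta> \<le> 1" using \<eta> C(1) by (auto simp: \<theta>_def)
    have "eventually (\<lambda>n. a n < i + \<theta>) sequentially" using order_tendstoD(2)[OF alim, of "i + \<theta>"] \<theta>(1) by simp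
    then obtain N where N: "\<And>n. n \<ge> N ==> a n \<le> i + \<theta>"
      unfolding eventually_sequentially by (blast intro: less_imp_le)
    have "(\<integral>x. \<bar>G n x - G m x\<bar> \<partial>\<mu>) \<le> \<eta>" if nm: "n \<ge> N" "m \<ge> N" for n m
    proof -
      have mi: "integrable \<mu> (\<lambda>x. ((b n x + b m x) / 2) powr p)" by (rule rgradD(5)[OF rgrad_mid[OF b(1) b(1)]])
      have "(\<integral>x. \<bar>G n x - G m x\<bar> \<partial>\<mu>) \<le>
         (\<integral>x. \<epsilon> * (G n x + G m x) + C * ((G n x + G m x) / 2 - ((b n x + b m x) / 2) powr p) \<partial>\<mu>)"
      proof (rule integral_mono)
        show "integrable \<mu> (\<lambda>x. \<bar>G n x - G m x\<bar>)" using Gi by auto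
        show "integrable \<mu> (\<lambda>x. \<epsilon> * (G n x + G m x) + C * ((G n x + G m x) / 2 - ((b n x + b m x) / 2) powr p))"
          using Gi mi by auto
        show "\<bar>G n x - G m x\<bar> \<le> \<epsilon> * (G n x + G m x) + C * ((G n x + G m x) / 2 - ((b n x + b m x) / 2) powr p)" for x
          unfolding G_def by (rule C(2)[OF rgradD(3)[OF b(1)] rgradD(3)[OF b(1)]])
      qed
      also have "\<dots> = \<epsilon> * (a n + a m) + C * ((a n + a m) / 2 - (\<integral>x. ((b n x + b m x) / 2) powr p \<partial>\<mu>))"
        using Gi mi by (simp add: a_def)
      also have "\<dots> \<le> \<epsilon> * (2 * (i + 1)) + C * \<theta>"
      proof (intro add_mono mult_left_mono)
        show "a n + a m \<le> 2 * (i + 1)" using N[OF nm(1)] N[OF nm(2)] \<theta>(2) by simp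
        show "(a n + a m) / 2 - (\<integral>x. ((b n x + b m x) / 2) powr p \<partial>\<mu>) \<le> \<theta>"
        proof -
          have "(a n + a m) / 2 \<le> i + \<theta>" using N[OF nm(1)] N[OF nm(2)] by argo
          then show ?thesis using mid[of n m] by argo
        qed
      qed (use \<epsilon> C in auto)
      also have "\<epsilon> * (2 * (i + 1)) = \<eta> / 2" using i(1) by (simp add: \<epsilon>_def field_simps)
      also have "C * \<theta> \<le> (C + 1) * (\<eta> / (2 * (C + 1)))"
        using C(1) \<theta> \<eta> by (intro mult_mono) (auto simp: \<theta>_def)
      also have "\<dots> = \<eta> / 2" using C(1) by (simp add: field_simps)
      finally show ?thesis by simp
    qed
    then show ?thesis by blast
  qed
  have "\<exists>N. \<forall>j::nat. \<forall>m\<ge>N j. \<forall>n\<ge>N j. (\<integral>x. \<bar>G n x - G m x\<bar> \<partial>\<mu>) \<le> (1/2)^j"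
    using diff[of "(1/2)^j" for j] by (intro choice) auto
  then obtain N where N: "\<And>j m n. m \<ge> N j ==> n \<ge> N j ==> (\<integral>x. \<bar>G n x - G m x\<bar> \<partial>\<mu>) \<le> (1/2)^j" by blast
  \<comment> \<open>The sum over all earlier \<open>N i\<close> makes \<open>k\<close> increasing
    and keeps it above \<open>N j\<close>; the summand j makes it unbounded.\<close>
  define k where "k j = j + (\<Sum>i\<le>j. N i)" for j
  have kN: "N j \<le> k j" for j
  proof -
    have "N j \<le> (\<Sum>i\<le>j. N i)" by (rule member_le_sum) auto
    then show ?thesis by (simp add: k_def)
  qed
  have kS: "k j \<le> k (Suc j)" and kj: "j \<le> k j" for j by (simp_all add: k_def)
  have step: "(\<integral>x. \<bar>G (k (Suc j)) x - G (k j) x\<bar> \<partial>\<mu>) \<le> (1/2)^j" for j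
    using kN[of j] kS[of j] by (intro N) auto
  \<comment> \<open>By telescoping, \<open>H m\<close> dominates the p-th powers of all gradients of
    the subsequence from index m on, while its integral exceeds \<open>a (k m)\<close> by at most 2
    * 2^-m.\<close>
  define H where "H m x = ennreal (G (k m) x) + (\<Sum>j. ennreal \<bar>G (k (Suc (j + m))) x - G (k (j + m)) x\<bar>)" for m x
  have Gb[measurable]: "G n \<in> borel_measurable borel" for n
    unfolding G_def[abs_def] using rgradD(1)[OF b(1)] by measurable
  have Gm[measurable]: "G n \<in> borel_measurable \<mu>" for n by (rule borel_mu[OF Gb])
  have Hb: "H m \<in> borel_measurable borel" for m unfolding H_def[abs_def] by measurable
  have geo: "(\<Sum>j. ennreal ((1/2)^(j + m))) = ennreal (2 * (1/2)^m)" for m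
  proof -
    have "(\<lambda>j. (1/2)^(j + m) :: real) sums (2 * (1/2)^m)"
      using sums_mult[OF geometric_sums[of "1/2::real"], of "(1/2)^m"] by (simp add: power_add mult.commute)
    then show ?thesis by (intro suminf_ennreal_eq) auto
  qed
  have Hint: "(\<integral>\<^sup>+x. H m x \<partial>\<mu>) \<le> ennreal (a (k m) + 2 * (1/2)^m)" for m
  proof -
    have "(\<integral>\<^sup>+x. H m x \<partial>\<mu>) = (\<integral>\<^sup>+x. ennreal (G (k m) x) \<partial>\<mu>) +
        (\<Sum>j. \<integral>\<^sup>+x. ennreal \<bar>G (k (Suc (j + m))) x - G (k (j + m)) x\<bar> \<partial>\<mu>)"
      unfolding H_def by (subst nn_integral_add, measurable, subst nn_integral_suminf, measurable)
    also have "(\<integral>\<^sup>+x. ennreal (G (k m) x) \<partial>\<mu>) = ennreal (a (k m))"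
      unfolding a_def by (intro nn_integral_eq_integral Gi) (simp add: G0)
    also have "(\<Sum>j. \<integral>\<^sup>+x. ennreal \<bar>G (k (Suc (j + m))) x - G (k (j + m)) x\<bar> \<partial>\<mu>) \<le> (\<Sum>j. ennreal ((1/2)^(j + m)))"
    proof (intro suminf_le)
      fix j
      have "(\<integral>\<^sup>+x. ennreal \<bar>G (k (Suc (j + m))) x - G (k (j + m)) x\<bar> \<partial>\<mu>)
         = ennreal (\<integral>x. \<bar>G (k (Suc (j + m))) x - G (k (j + m)) x\<bar> \<partial>\<mu>)"
        using Gi by (intro nn_integral_eq_integral) auto
      also have "\<dots> \<le> ennreal ((1/2)^(j + m))" by (intro ennreal_leI step)
      finally show "(\<integral>\<^sup>+x. ennreal \<bar>G (k (Suc (j + m))) x - G (k (j + m)) x\<bar> \<partial>\<mu>) \<le> ennreal ((1/2)^(j + m))" .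
    qed auto
    also have "ennreal (a (k m)) + (\<Sum>j. ennreal ((1/2)^(j + m))) = ennreal (a (k m) + 2 * (1/2)^m)"
      unfolding geo using a0 by (subst ennreal_plus) auto
    finally show ?thesis by (simp add: add_left_mono)
  qed
  have GH: "ennreal (G (k (m + n)) x) \<le> H m x" for m n x
  proof -
    have "ennreal (G (k (m + n)) x) \<le> ennreal (G (k m) x) + (\<Sum>j<n. ennreal \<bar>G (k (Suc (j + m))) x - G (k (j + m)) x\<bar>)"
    proof (induction n)
      case (Suc n)
      have "G (k (m + Suc n)) x \<le> G (k (m + n)) x + \<bar>G (k (Suc (n + m))) x - G (k (n + m)) x\<bar>"
        by (simp add: add.commute)
      then have "ennreal (G (k (m + Suc n)) x) \<le> ennreal (G (k (m + n)) x + \<bar>G (k (Suc (n + m))) x - G (k (n + m)) x\<bar>)"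
        by (rule ennreal_leI)
      also have "\<dots> = ennreal (G (k (m + n)) x) + ennreal \<bar>G (k (Suc (n + m))) x - G (k (n + m)) x\<bar>"
        using G0 by simp
      also have "\<dots> \<le> ennreal (G (k m) x) + (\<Sum>j<n. ennreal \<bar>G (k (Suc (j + m))) x - G (k (j + m)) x\<bar>)
         + ennreal \<bar>G (k (Suc (n + m))) x - G (k (n + m)) x\<bar>"
        by (rule add_right_mono[OF Suc])
      finally show ?case by (simp only: sum.lessThan_Suc add.assoc)
    qed (simp del: sum_ennreal)
    also have "\<dots> \<le> H m x" unfolding H_def by (intro add_left_mono sum_le_suminf) auto
    finally show ?thesis .
  qed
  define h where "h m x = epowr (H m x) (1/p)" for m x
  have hb: "h m \<in> borel_measurable borel" for m unfolding h_def[abs_def] using Hb by measurable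
  have hp: "epowr (h m x) p = H m x" for m x unfolding h_def using p0 by (simp add: epowr_inverse)
  have hL: "bLp (h m)" for m
    using hb Hint[of m] by (auto simp: bLp_def hp intro: le_less_trans)
  have bh: "ennreal (b (k (m + n)) x) \<le> h m x" for m n x
  proof -
    have "ennreal (b (k (m + n)) x) = epowr (ennreal (G (k (m + n)) x)) (1/p)"
      unfolding G_def using p0 rgradD(3)[OF b(1)] by (simp add: epowr_ennreal powr_powr)
    also have "\<dots> \<le> h m x" unfolding h_def using p0 by (intro epowr_mono GH) auto
    finally show ?thesis .
  qed
  define v where "v x = real_of_ereal (limsup (\<lambda>n. ereal (w (k n) x)))" for x
  have wM: "\<bar>w n x\<bar> \<le> M" for n x using w(1)[of n] by (auto simp: \<A>_def)
  have vM: "\<bar>v x\<bar> \<le> M" for x unfolding v_def by (rule limsup_real_bounded(2)) (rule wM)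
  have wm: "w n \<in> borel_measurable \<mu>" for n by (rule m\<A>[OF w(1)])
  have vm: "meas v" unfolding v_def[abs_def] using wm by measurable
  have gV: "pgrad V (w (k (m + n))) (h m)" for m n
    using bh[of m n] by (intro egrad_mono_AE[OF rgradD(6)[OF b(1)] hL]) auto
  have vV: "pgrad V v (h m)" for m
  proof -
    have "pgrad V (\<lambda>x. real_of_ereal (limsup (\<lambda>n. ereal (w (k (m + n)) x)))) (h m)"
      by (rule pgrad_limsup[OF gV wM])
    moreover have "limsup (\<lambda>n. ereal (w (k (m + n)) x)) = limsup (\<lambda>n. ereal (w (k n) x))" for x
      using limsup_shift_k[of "\<lambda>n. ereal (w (k n) x)" m] by (simp add: add.commute)
    ultimately show ?thesis by (simp add: v_def[abs_def])
  qed
  define h' where "h' x = h 0 x + ennreal L * indicator V x" for x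
  have h'L: "bLp h'" unfolding h'_def[abs_def] by (rule bLp_add[OF hL bLp_const_indicator[OF Vb V(2)]])
  have mF: "pgrad A (\<lambda>x. - F x) g" if "pgrad A F g" for A g by (rule pgrad_uminus[OF that])
  \<comment> \<open>The differences w - F vanish off \<open>V\<close> and have the common gradient
    \<open>h'\<close> on \<open>V\<close>. Zero extension gives all members of the sequence one
    common gradient on the whole space, which their upper limit inherits.\<close>
  have wU: "pgrad UNIV (w (k n)) (\<lambda>x. h' x * indicator V x + ennreal L)" for n
  proof -
    have ad: "adm F V (w (k n))" using w(1) by (auto simp: \<A>_def)
    obtain g where g: "pgrad UNIV (w (k n)) g" using ad by (auto simp: adm_def)
    have off: "w (k n) x = F x" if "x \<notin> V" for x using ad that by (auto simp: adm_def)
    have D: "pgrad UNIV (\<lambda>x. w (k n) x + - F x) (\<lambda>x. h' x * indicator V x)"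
    proof (rule pgrad_zero_extension[OF V(1) pgrad_add[OF g mF[OF Fadm(3)]] _ _ h'L])
      show "w (k n) x + - F x = 0" if "x \<notin> V" for x using off[OF that] by simp
      show "pgrad V (\<lambda>x. w (k n) x + - F x) h'"
        unfolding h'_def[abs_def] using gV[of 0 n] by (intro pgrad_add mF Fadm(4)) simp
    qed
    show ?thesis using pgrad_add[OF D Fadm(3)] by simp
  qed
  have vU: "pgrad UNIV v (\<lambda>x. h' x * indicator V x + ennreal L)"
    unfolding v_def[abs_def] by (rule pgrad_limsup[OF wU wM])
  have vF: "v x = F x" if "x \<notin> V" for x
  proof -
    have "w (k n) x = F x" for n using w(1)[of "k n"] that by (auto simp: \<A>_def adm_def)
    then show ?thesis by (simp add: v_def Limsup_const)
  qed
  have vadm: "adm F V v" by (rule admI[OF vm vF vU vV hL])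
  have vI: "en V v \<le> I"
  proof -
    have le: "en V v \<le> ennreal (a (k m) + 2 * (1/2)^m)" for m
    proof -
      have "en V v \<le> (\<integral>\<^sup>+x\<in>V. epowr (h m x) p \<partial>\<mu>)"
        unfolding en_def by (rule p_energy_properties(2)[OF Vb adm_Dp[OF V(1) vadm] vV])
      also have "\<dots> \<le> (\<integral>\<^sup>+x. H m x \<partial>\<mu>)" unfolding hp by (intro nn_integral_mono) (auto simp: indicator_def)
      finally show ?thesis using Hint[of m] by (rule order_trans)
    qed
    have "(\<lambda>m. a (k m) + 2 * (1/2)^m) \<longlonglongrightarrow> i + 2 * 0"
    proof (intro tendsto_add tendsto_mult tendsto_const)
      have "filterlim k at_top sequentially" by (rule filterlim_at_top_mono[OF filterlim_ident]) (auto intro: always_eventually kj)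
      then show "(\<lambda>m. a (k m)) \<longlonglongrightarrow> i" by (rule filterlim_compose[OF alim])
      show "(\<lambda>m. (1/2)^m :: real) \<longlonglongrightarrow> 0" by (rule LIMSEQ_power_zero) simp
    qed
    then have "(\<lambda>m. ennreal (a (k m) + 2 * (1/2)^m)) \<longlonglongrightarrow> ennreal i" by (intro tendsto_ennrealI) simp
    then show ?thesis unfolding i(2) by (rule LIMSEQ_le_const) (use le in auto)
  qed
  have "en V v \<le> en V u" if "adm F V u" "\<forall>x. \<bar>u x\<bar> \<le> M" for u
    using vI Ile[of u] that by (auto simp: \<A>_def)
  then show ?thesis using vadm vM by blast
qed

definition minimizer :: "('a => real) => 'a set => ('a => real) => bool" where
  "minimizer F V w \<longleftrightarrow> adm F V w \<and> (\<forall>v. adm F V v --> en V w \<le> en V v)"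

text \<open>Clipping a competitor to [-M, M] keeps its boundary data and does not raise its energy,
  so minimality among bounded competitors is minimality among all.\<close>

lemma minimizer_exists:
  assumes V: "open V" "emeasure \<mu> V < \<infinity>" and F: "L-lipschitz_on UNIV F" and FM: "\<And>x. \<bar>F x\<bar> \<le> M"
  shows "\<exists>w. minimizer F V w \<and> (\<forall>x. \<bar>w x\<bar> \<le> M)"
proof -
  obtain w where w: "adm F V w" "\<And>x. \<bar>w x\<bar> \<le> M" "\<And>v. adm F V v ==> (\<forall>x. \<bar>v x\<bar> \<le> M) ==> en V w \<le> en V v"
    using minimizer_exists_bounded[OF assms] by blast
  have M: "0 \<le> M" using w(2)[of undefined] by linarith
  have "en V w \<le> en V v" if v: "adm F V v" for v
  proof -
    have "en V w \<le> en V (\<lambda>x. max (- M) (min M (v x)))"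
      by (rule w(3)[OF adm_clip[OF v FM]]) (use M in auto)
    also have "\<dots> \<le> en V v" using v by (intro en_clip V adm_Dp[OF V(1) v]) (auto simp: adm_def)
    finally show ?thesis .
  qed
  then show ?thesis using w(1,2) unfolding minimizer_def by blast
qed

text \<open>Minimizers of the same data have a.e. the same gradient, by strict convexity.  Comparison with
  \<open>max w1 (min w2 c)\<close>, whose gradient vanishes where \<open>w1 \<le> c \<le> w2\<close>, then shows that this gradient vanishes
  where the minimizers differ.\<close>

lemma minimizers_zero_gradient:
  assumes V: "open V" and w1: "minimizer F V w1" and w2: "minimizer F V w2"
  shows "pgrad UNIV (\<lambda>x. max (w2 x - w1 x) 0) (\<lambda>_. 0)"
proof -
  have Vb: "V \<in> sets borel" using V by auto
  have ad: "adm F V w1" "adm F V w2" using w1 w2 by (auto simp: minimizer_def)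
  have e: "en V w1 = en V w2" using w1 w2 by (intro antisym) (auto simp: minimizer_def)
  obtain b1 where b1: "rgrad V w1 b1" "en V w1 = ennreal (\<integral>x. b1 x powr p \<partial>\<mu>)"
    using energy_attained[OF V adm_Dp[OF V ad(1)]] by blast
  obtain b2 where b2: "rgrad V w2 b2" "en V w2 = ennreal (\<integral>x. b2 x powr p \<partial>\<mu>)"
    using energy_attained[OF V adm_Dp[OF V ad(2)]] by blast
  have nn: "0 \<le> (\<integral>x. f x powr p \<partial>\<mu>)" for f by (intro integral_nonneg_AE) auto
  note D1 = rgradD[OF b1(1)] and D2 = rgradD[OF b2(1)]
  have wm: "meas w1" "meas w2" using ad by (auto simp: adm_def)
  note [measurable] = D1(1,2) D2(1,2) Vb wm
  have eq: "(\<integral>x. b1 x powr p \<partial>\<mu>) = (\<integral>x. b2 x powr p \<partial>\<mu>)"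
    using e unfolding b1(2) b2(2) by (simp add: nn)
  have mi: "integrable \<mu> (\<lambda>x. ((b1 x + b2 x) / 2) powr p)" by (rule rgradD(5)[OF rgrad_mid[OF b1(1) b2(1)]])
  have "en V w1 \<le> ennreal (\<integral>x. ((b1 x + b2 x) / 2) powr p \<partial>\<mu>)"
    using w1 adm_mid[OF ad] energy_le_rgrad[OF V adm_Dp[OF V adm_mid[OF ad]] rgrad_mid[OF b1(1) b2(1)]]
    unfolding minimizer_def by (meson order_trans)
  then have le: "(\<integral>x. b1 x powr p \<partial>\<mu>) \<le> (\<integral>x. ((b1 x + b2 x) / 2) powr p \<partial>\<mu>)"
    unfolding b1(2) by (subst (asm) ennreal_le_iff) (auto simp: nn)
  define \<phi> where "\<phi> x = (b1 x powr p + b2 x powr p) / 2 - ((b1 x + b2 x) / 2) powr p" for x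
  have \<phi>i: "integrable \<mu> \<phi>" unfolding \<phi>_def[abs_def] using D1(5) D2(5) mi by auto
  have \<phi>0: "0 \<le> \<phi> x" for x unfolding \<phi>_def by (rule powr_mid_nonneg(1)[OF p1 D1(3) D2(3)])
  have "(\<integral>x. \<phi> x \<partial>\<mu>) = ((\<integral>x. b1 x powr p \<partial>\<mu>) + (\<integral>x. b2 x powr p \<partial>\<mu>)) / 2 - (\<integral>x. ((b1 x + b2 x) / 2) powr p \<partial>\<mu>)"
    unfolding \<phi>_def using D1(5) D2(5) mi by simp
  then have "(\<integral>x. \<phi> x \<partial>\<mu>) \<le> 0" using le eq by simp
  moreover have "0 \<le> (\<integral>x. \<phi> x \<partial>\<mu>)" by (intro integral_nonneg_AE) (auto simp: \<phi>0)
  ultimately have "(\<integral>x. \<phi> x \<partial>\<mu>) = 0" by simp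
  then have "AE x in \<mu>. \<phi> x = 0" using \<phi>i \<phi>0 by (subst (asm) integral_nonneg_eq_0_iff_AE) auto
  then have bb: "AE x in \<mu>. b1 x = b2 x"
    by eventually_elim (use powr_mid_nonneg(2)[OF p1 D1(3) D2(3)] in \<open>auto simp: \<phi>_def\<close>)
  have zero: "AE x in \<mu>. x \<in> V \<and> w1 x \<le> c \<and> c \<le> w2 x --> b1 x = 0" for c
  proof -
    define v where "v x = max (w1 x) (min (w2 x) c)" for x
    define d where "d x = (if min (w2 x) c < w1 x then b1 x else if w2 x < c then b2 x else 0)" for x
    have pg: "pgrad V v (\<lambda>x. ennreal (d x))"
    proof -
      have "pgrad V v (\<lambda>x. if min (w2 x) c < w1 x then ennreal (b1 x) else if w2 x < c then ennreal (b2 x) else 0)"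
        unfolding v_def[abs_def] by (intro pgrad_max pgrad_min pgrad_const D1(6) D2(6)) measurable
      moreover have "(\<lambda>x. ennreal (d x)) = (\<lambda>x. if min (w2 x) c < w1 x then ennreal (b1 x) else if w2 x < c then ennreal (b2 x) else 0)"
        by (auto simp: d_def fun_eq_iff)
      ultimately show ?thesis by simp
    qed
    have vadm: "adm F V v"
    proof -
      obtain h1 h2 where h: "pgrad UNIV w1 h1" "pgrad UNIV w2 h2" using ad by (auto simp: adm_def)
      have "pgrad V v (\<lambda>x. ennreal (b1 x) + ennreal (b2 x))"
        by (rule egrad_mono_AE[OF pg bLp_add[OF D1(7) D2(7)]]) (auto simp: d_def add_increasing add_increasing2)
      moreover have "pgrad UNIV v (\<lambda>x. if min (w2 x) c < w1 x then h1 x else if w2 x < c then h2 x else 0)"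
        unfolding v_def[abs_def] by (intro pgrad_max pgrad_min pgrad_const h) measurable
      moreover have "meas v" unfolding v_def[abs_def] by measurable
      moreover have "v x = F x" if "x \<notin> V" for x using ad that by (auto simp: v_def adm_def)
      ultimately show ?thesis
        using bLp_add[OF D1(7) D2(7)] by (intro admI)
    qed
    define Z where "Z = {x. x \<in> V \<and> w1 x \<le> c \<and> c \<le> w2 x}"
    have "Z = {x \<in> space \<mu>. x \<in> V \<and> w1 x \<le> c \<and> c \<le> w2 x}" by (simp add: Z_def)
    then have Zm[measurable]: "Z \<in> sets \<mu>" by simp
    have dm[measurable]: "meas d" unfolding d_def[abs_def] by measurable
    \<comment> \<open>On \<open>Z\<close> both conditions in the definition of \<open>d\<close>
      fail, so \<open>d\<close> is 0 there. Elsewhere its values are among 0, \<open>b1\<close> and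
      \<open>b2\<close>, and the last two agree almost everywhere.\<close>
    have dle: "AE x in \<mu>. indicator V x * d x powr p \<le> indicator (- Z) x * b1 x powr p"
      using bb
    proof eventually_elim
      case (elim x)
      show ?case using elim D1(3)[of x] by (auto simp: d_def Z_def indicator_def)
    qed
    have Zi: "integrable \<mu> (\<lambda>x. indicator (- Z) x * b1 x powr p)"
      by (rule Bochner_Integration.integrable_bound[OF D1(5)]) (auto simp: indicator_def)
    have di: "integrable \<mu> (\<lambda>x. indicator V x * d x powr p)"
      by (rule Bochner_Integration.integrable_bound[OF Zi], measurable, rule eventually_mono[OF dle]) auto
    have "en V w1 \<le> en V v" using w1 vadm by (simp add: minimizer_def)
    also have "\<dots> \<le> ennreal (\<integral>x. indicator V x * d x powr p \<partial>\<mu>)"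
      by (rule energy_le[OF V adm_Dp[OF V vadm] pg _ di]) (use D1(3) D2(3) in \<open>auto simp: d_def\<close>)
    also have "\<dots> \<le> ennreal (\<integral>x. indicator (- Z) x * b1 x powr p \<partial>\<mu>)"
      by (intro ennreal_leI integral_mono_AE di Zi dle)
    finally have "(\<integral>x. b1 x powr p \<partial>\<mu>) \<le> (\<integral>x. indicator (- Z) x * b1 x powr p \<partial>\<mu>)"
      unfolding b1(2) by (subst (asm) ennreal_le_iff) (auto intro!: integral_nonneg_AE)
    then have "(\<integral>x. b1 x powr p - indicator (- Z) x * b1 x powr p \<partial>\<mu>) \<le> 0" using D1(5) Zi by simp
    moreover have "b1 x powr p - indicator (- Z) x * b1 x powr p = indicator Z x * b1 x powr p" for x
      by (auto simp: indicator_def)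
    ultimately have le0: "(\<integral>x. indicator Z x * b1 x powr p \<partial>\<mu>) \<le> 0" by simp
    have Zi': "integrable \<mu> (\<lambda>x. indicator Z x * b1 x powr p)"
      by (rule Bochner_Integration.integrable_bound[OF D1(5)]) (auto simp: indicator_def)
    have "0 \<le> (\<integral>x. indicator Z x * b1 x powr p \<partial>\<mu>)" by (intro integral_nonneg_AE) auto
    then have "(\<integral>x. indicator Z x * b1 x powr p \<partial>\<mu>) = 0" by (rule antisym[OF le0])
    then have "AE x in \<mu>. indicator Z x * b1 x powr p = 0"
      using Zi' by (subst (asm) integral_nonneg_eq_0_iff_AE) auto
    then show ?thesis by eventually_elim (auto simp: Z_def indicator_def)
  qed
  \<comment> \<open>Where w1 < w2 there is a rational level in between, so the null sets of
    countably many levels suffice.\<close>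
  have "AE x in \<mu>. \<forall>q::rat. x \<in> V \<and> w1 x \<le> of_rat q \<and> of_rat q \<le> w2 x --> b1 x = 0"
    by (subst AE_all_countable) (auto intro: zero)
  then have ae1: "AE x in \<mu>. x \<in> V \<and> w1 x < w2 x --> b1 x = 0"
    by eventually_elim (metis less_imp_le of_rat_dense)
  obtain h1 h2 where h: "pgrad UNIV w1 h1" "pgrad UNIV w2 h2" using ad by (auto simp: adm_def)
  have g: "pgrad V (\<lambda>x. max (w2 x + - w1 x) 0) (\<lambda>x. if 0 < w2 x + - w1 x then ennreal (b2 x) + ennreal (b1 x) else 0)"
    by (intro pgrad_max pgrad_add pgrad_uminus pgrad_const D1(6) D2(6)) measurable
  have "pgrad V (\<lambda>x. max (w2 x + - w1 x) 0) (\<lambda>_. 0)"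
  proof (rule egrad_mono_AE[OF g])
    show "bLp (\<lambda>_. 0)" by (simp add: bLp_def)
    show "AE x in \<mu>. x \<in> V --> (if 0 < w2 x + - w1 x then ennreal (b2 x) + ennreal (b1 x) else 0) \<le> 0"
      using ae1 bb by eventually_elim auto
  qed
  from pgrad_zero_extension[OF V pgrad_max[OF pgrad_add[OF h(2) pgrad_uminus[OF h(1)]] pgrad_const] _ this]
  have "pgrad UNIV (\<lambda>x. max (w2 x + - w1 x) 0) (\<lambda>x. 0 * indicator V x)"
    using ad by (auto simp: adm_def bLp_def)
  then show ?thesis by simp
qed

end

section \<open>Doubling spaces\<close>

text \<open>Greedy choice: take a ball of largest radius, discard all balls that meet it, and
  continue with the rest. A discarded ball has no larger radius and so lies in the triple of the
  chosen one.\<close>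

lemma finite_Vitali_balls:
  fixes c :: "'i => 'a::metric_space"
  assumes "finite I" "\<And>i. i \<in> I ==> 0 < r i"
  shows "\<exists>J\<subseteq>I. (\<forall>i\<in>J. \<forall>j\<in>J. i \<noteq> j --> ball (c i) (r i) \<inter> ball (c j) (r j) = {}) \<and>
     (\<Union>i\<in>I. ball (c i) (r i)) \<subseteq> (\<Union>i\<in>J. ball (c i) (3 * r i))"
  using assms
proof (induction "card I" arbitrary: I rule: less_induct)
  case less
  show ?case
  proof (cases "I = {}")
    case False
    have "Max (r ` I) \<in> r ` I" using less.prems(1) False by (intro Max_in) auto
    then obtain i where "i \<in> I" "r i = Max (r ` I)" by auto
    moreover have "r j \<le> Max (r ` I)" if "j \<in> I" for j using that less.prems(1) by (intro Max_ge) auto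
    ultimately have i: "i \<in> I" "\<And>j. j \<in> I ==> r j \<le> r i" by simp_all
    define I' where "I' = {j \<in> I. ball (c i) (r i) \<inter> ball (c j) (r j) = {}}"
    have "0 < r i" using less.prems(2) i(1) by auto
    then have "i \<notin> I'" by (auto simp: I'_def)
    then have "I' \<subset> I" using i(1) unfolding I'_def by blast
    then have lt: "card I' < card I" by (rule psubset_card_mono[OF less.prems(1)])
    have fin: "finite I'" and pos: "\<And>j. j \<in> I' ==> 0 < r j" using less.prems by (auto simp: I'_def)
    have "\<exists>J\<subseteq>I'. (\<forall>i\<in>J. \<forall>j\<in>J. i \<noteq> j --> ball (c i) (r i) \<inter> ball (c j) (r j) = {}) \<and>
       (\<Union>i\<in>I'. ball (c i) (r i)) \<subseteq> (\<Union>i\<in>J. ball (c i) (3 * r i))"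
      by (rule less.hyps[OF lt fin]) (rule pos)
    then obtain J where J: "J \<subseteq> I'" "\<forall>i\<in>J. \<forall>j\<in>J. i \<noteq> j --> ball (c i) (r i) \<inter> ball (c j) (r j) = {}"
      "(\<Union>i\<in>I'. ball (c i) (r i)) \<subseteq> (\<Union>i\<in>J. ball (c i) (3 * r i))"
      by (elim exE conjE) (rule that; assumption)
    have "ball (c j) (r j) \<subseteq> ball (c i) (3 * r i)" if j: "j \<in> I" "j \<notin> I'" for j
    proof
      fix y assume y: "y \<in> ball (c j) (r j)"
      obtain z where z: "z \<in> ball (c i) (r i)" "z \<in> ball (c j) (r j)" using j by (auto simp: I'_def)
      have "dist (c i) y \<le> dist (c i) z + dist z (c j) + dist (c j) y"
        by (meson dist_triangle dist_triangle_le order_trans add_mono order_refl)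
      also have "\<dots> < r i + r j + r j" using y z by (auto simp: dist_commute)
      also have "\<dots> \<le> 3 * r i" using i(2)[OF j(1)] by simp
      finally show "y \<in> ball (c i) (3 * r i)" by simp
    qed
    then have "(\<Union>i\<in>I. ball (c i) (r i)) \<subseteq> (\<Union>i\<in>insert i J. ball (c i) (3 * r i))"
      using J(3) by blast
    moreover have "\<forall>k\<in>insert i J. \<forall>j\<in>insert i J. k \<noteq> j --> ball (c k) (r k) \<inter> ball (c j) (r j) = {}"
      using J(1,2) by (auto simp: I'_def)
    ultimately show ?thesis using J(1) i(1) by (intro exI[of _ "insert i J"]) (auto simp: I'_def)
  qed auto
qed

text \<open>Fixes the constants of the doubling and Poincare hypotheses. A doubling constant can
  always be enlarged; \<open>Cd\<close> \<ge> 2 makes 1 / Cd^2 a ratio of geometric decay in De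
  Giorgi's iteration.\<close>

locale pi_space = borel_mm p \<mu> for p and \<mu> :: "'a::complete_space measure" +
  fixes Cd CP \<tau> :: real
  assumes bpos: "0 < r ==> 0 < emeasure \<mu> (ball x r) \<and> emeasure \<mu> (ball x r) < \<infinity>"
    and Cd: "2 \<le> Cd"
    and dbl: "0 < r ==> emeasure \<mu> (ball x (2 * r)) \<le> ennreal Cd * emeasure \<mu> (ball x r)"
    and CP: "0 < CP" and \<tau>1: "1 \<le> \<tau>"
    and poinc: "0 < r ==> f \<in> borel_measurable \<mu> ==> (\<integral>\<^sup>+y. e2ennreal \<bar>f y\<bar> \<partial>\<mu>) < \<infinity> ==>
           weak_upper_gradient p \<mu> UNIV f g ==>
           (\<integral>\<^sup>+y\<in>ball x r. e2ennreal \<bar>f y - ereal (mean_value \<mu> (ball x r) f)\<bar> \<partial>\<mu>)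
               / emeasure \<mu> (ball x r)
           \<le> ennreal (CP * diameter (ball x r)) *
              epowr ((\<integral>\<^sup>+y\<in>ball x (\<tau> * r). epowr (g y) p \<partial>\<mu>) / emeasure \<mu> (ball x (\<tau> * r)))
                    (1 / p)"
begin

abbreviation bm :: "'a => real => real" where "bm x r \<equiv> measure \<mu> (ball x r)"

lemma ball_finite: "emeasure \<mu> (ball x r) < \<infinity>"
proof (cases "0 < r")
  case False
  then have e: "ball x r = {}" by (simp add: ball_empty)
  show ?thesis unfolding e by simp
qed (use bpos in auto)

lemma ball_mu[simp, measurable]: "ball x r \<in> sets \<mu>" "cball x r \<in> sets \<mu>"
  by (auto intro: borel_sets)

lemma subset_ball_finite: "A \<subseteq> ball x r ==> emeasure \<mu> A < \<infinity>"
  by (rule le_less_trans[OF emeasure_mono ball_finite]) auto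

lemma emeasure_bm: "emeasure \<mu> (ball x r) = ennreal (bm x r)"
  using ball_finite[of x r] by (intro emeasure_eq_ennreal_measure) auto

lemma bm_pos: "0 < r ==> 0 < bm x r"
  using bpos[of r x] by (simp add: emeasure_bm)

lemma bounded_measure_mono:
  assumes "A \<subseteq> B" "A \<in> sets \<mu>" "B \<in> sets \<mu>" "B \<subseteq> ball x r"
  shows "measure \<mu> A \<le> measure \<mu> B"
  using subset_ball_finite[OF assms(4)] assms by (intro measure_mono_fmeasurable) (auto simp: fmeasurable_def)

lemma bm_mono: "ball x r \<subseteq> ball y s ==> bm x r \<le> bm y s"
  by (rule bounded_measure_mono[of _ _ y s]) auto

lemma bm_double: "0 < r ==> bm x (2 * r) \<le> Cd * bm x r"
  using dbl[of r x] Cd by (simp add: emeasure_bm ennreal_mult[symmetric] ennreal_le_iff)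

lemma bm_double_pow: "0 < r ==> bm x (2 ^ n * r) \<le> Cd ^ n * bm x r"
proof (induction n)
  case (Suc n)
  have "bm x (2 ^ Suc n * r) \<le> Cd * bm x (2 ^ n * r)" using bm_double[of "2^n * r" x] Suc(2) by (simp add: mult.assoc)
  also have "\<dots> \<le> Cd * (Cd ^ n * bm x r)" using Suc Cd by (intro mult_left_mono) auto
  finally show ?case by simp
qed simp

text \<open>The balls of radius e/2 about the points of \<open>S\<close> are disjoint and lie in a
  ball whose measure is at most Cd^n times that of each of them.\<close>

lemma separated_card_le:
  fixes x :: 'a
  assumes e: "0 < e" and n: "2 * (R + e) \<le> 2 ^ n * (e / 2)" and R: "0 \<le> R"
    and S: "finite S" "S \<subseteq> cball x R" "\<And>s t. s \<in> S ==> t \<in> S ==> s \<noteq> t ==> e \<le> dist s t"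
  shows "real (card S) \<le> Cd ^ n"
proof -
  define B where "B = bm x (R + e)"
  have B: "0 < B" unfolding B_def using e R by (intro bm_pos) auto
  have each: "B \<le> Cd ^ n * bm s (e / 2)" if "s \<in> S" for s
  proof -
    have "ball x (R + e) \<subseteq> ball s (2 ^ n * (e / 2))"
    proof
      fix y assume y: "y \<in> ball x (R + e)"
      have "dist s y \<le> dist s x + dist x y" by (rule dist_triangle)
      also have "\<dots> < R + (R + e)" using y S(2) that by (intro add_le_less_mono) (auto simp: dist_commute)
      finally show "y \<in> ball s (2 ^ n * (e / 2))" using n e by simp
    qed
    then have "B \<le> bm s (2 ^ n * (e / 2))" unfolding B_def by (rule bm_mono)
    also have "\<dots> \<le> Cd ^ n * bm s (e / 2)" using e by (intro bm_double_pow) auto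
    finally show ?thesis .
  qed
  have dis: "disjoint_family_on (\<lambda>s. ball s (e/2)) S"
    unfolding disjoint_family_on_def
  proof (intro ballI impI)
    fix s t assume st: "s \<in> S" "t \<in> S" "s \<noteq> t"
    show "ball s (e/2) \<inter> ball t (e/2) = {}"
    proof (rule ccontr)
      assume "ball s (e/2) \<inter> ball t (e/2) \<noteq> {}"
      then obtain y where y: "dist s y < e/2" "dist t y < e/2" by auto
      have "dist s t \<le> dist s y + dist t y" by (rule dist_triangle2)
      also have "\<dots> < e" using y by simp
      finally show False using S(3)[OF st] by simp
    qed
  qed
  have "real (card S) * B = (\<Sum>s\<in>S. B)" by simp
  also have "\<dots> \<le> (\<Sum>s\<in>S. Cd ^ n * bm s (e/2))" by (intro sum_mono each)
  also have "\<dots> = Cd ^ n * (\<Sum>s\<in>S. bm s (e/2))" by (rule sum_distrib_left[symmetric])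
  also have "(\<Sum>s\<in>S. bm s (e/2)) = measure \<mu> (\<Union>s\<in>S. ball s (e/2))"
    using dis S(1) ball_finite by (intro measure_finite_Union[symmetric]) (auto simp: less_top)
  also have "\<dots> \<le> B" unfolding B_def
  proof (rule bounded_measure_mono[of _ _ x "R + e"])
    show "(\<Union>s\<in>S. ball s (e/2)) \<subseteq> ball x (R + e)"
    proof clarify
      fix s y assume "s \<in> S" "y \<in> ball s (e/2)"
      then show "y \<in> ball x (R + e)" using S(2) dist_triangle[of x y s] e by (auto simp: subset_iff)
    qed
    show "(\<Union>s\<in>S. ball s (e/2)) \<in> sets \<mu>" using S(1) by auto
  qed auto
  finally have "real (card S) * B \<le> Cd ^ n * B" using Cd by (simp add: mult_left_mono)
  then show ?thesis using B by simp
qed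

text \<open>Separated sets have bounded cardinality, and one of largest cardinality is a finite
  e-net. So a closed ball is totally bounded, and it is complete.\<close>

lemma compact_cball_mm: "compact (cball (x::'a) R)"
proof (cases "0 \<le> R")
  case R: True
  have "\<exists>k. finite k \<and> cball x R \<subseteq> (\<Union>y\<in>k. ball y e)" if e: "0 < e" for e
  proof -
    obtain n where n: "2 * (R + e) / (e / 2) < 2 ^ n" using real_arch_pow[of 2] by auto
    then have n: "2 * (R + e) \<le> 2 ^ n * (e / 2)" using e by (simp add: field_simps)
    define P where "P S \<longleftrightarrow> finite S \<and> S \<subseteq> cball x R \<and> (\<forall>s\<in>S. \<forall>t\<in>S. s \<noteq> t --> e \<le> dist s t)" for S
    have bd: "card S \<le> nat \<lceil>Cd ^ n\<rceil>" if "P S" for S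
      using separated_card_le[OF e n R, of S x] that by (auto simp: P_def) linarith
    have "P {}" by (simp add: P_def)
    then obtain S where S: "P S" "\<And>T. P T ==> card T \<le> card S"
      using ex_has_greatest_nat[of P "{}" card "Suc (nat \<lceil>Cd ^ n\<rceil>)"] bd by (auto simp: less_Suc_eq_le)
    have "cball x R \<subseteq> (\<Union>y\<in>S. ball y e)"
    proof
      fix z assume z: "z \<in> cball x R"
      show "z \<in> (\<Union>y\<in>S. ball y e)"
      proof (rule ccontr)
        assume no: "z \<notin> (\<Union>y\<in>S. ball y e)"
        then have "e \<le> dist s z" if "s \<in> S" for s using that by force
        then have "P (insert z S)" using S(1) z by (auto simp: P_def dist_commute)
        then have "card (insert z S) \<le> card S" by (rule S(2))
        moreover have "z \<notin> S" using no e by auto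
        ultimately show False using S(1) by (simp add: P_def)
      qed
    qed
    then show ?thesis using S(1) by (auto simp: P_def)
  qed
  then show ?thesis unfolding compact_eq_totally_bounded by (auto simp: complete_eq_closed)
qed simp

lemma closed_bounded_compact: "closed K ==> bounded K ==> compact (K::'a set)"
proof -
  assume K: "closed K" "bounded K"
  obtain x R where "K \<subseteq> cball x R" using K(2) unfolding bounded_def by (auto simp: subset_iff)
  then have "K = cball x R \<inter> K" by auto
  then show ?thesis using compact_Int_closed[OF compact_cball_mm K(1), of x R] by simp
qed

text \<open>Induction over the \<sigma>-algebra generated by the open sets. The error is measured
  inside one ball, where the measure is finite; for a countable union this lets finitely many of the
  closed sets approximate all of them.\<close>

lemma Borel_regular:
  assumes "E \<in> sets borel" "0 < e"
  shows "\<exists>C U. closed C \<and> open U \<and> C \<subseteq> E \<and> E \<subseteq> U \<and> measure \<mu> ((U - C) \<inter> ball z R) < e"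
proof -
  have "E \<in> sigma_sets UNIV {S. open S}" using assms(1) by (simp add: sets_borel)
  then show ?thesis using assms(2)
  proof (induction arbitrary: e)
    case (Basic E)
    then have E: "open E" by simp
    define C where "C n = {y. infdist y (- E) \<ge> 1 / real (Suc n)}" for n
    have Cc: "closed (C n)" for n
      unfolding C_def by (intro closed_Collect_le continuous_on_const continuous_on_infdist continuous_on_id)
    show ?case
    \<comment> \<open>\<open>infdist\<close> to the empty set is 0 by convention, so every
      \<open>C n\<close> would be empty in the first case.\<close>
    proof (cases "- E = {}")
      case True
      then have "E = UNIV" by auto
      then show ?thesis using Basic(2) by (intro exI[of _ UNIV]) auto
    next
      case False
      have CE: "C n \<subseteq> E" for n
      proof
        fix y assume y: "y \<in> C n"
        have "infdist y (- E) > 0" using y unfolding C_def by (auto intro: less_le_trans[rotated])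
        then show "y \<in> E" by (metis ComplI infdist_zero less_irrefl)
      qed
      have inc: "C m \<subseteq> C n" if "m \<le> n" for m n
        unfolding C_def using that by (auto intro: order_trans[rotated] simp: frac_le)
      have un: "(\<Inter>n. (E - C n)) = {}"
      proof (rule ccontr)
        assume "(\<Inter>n. (E - C n)) \<noteq> {}"
        then obtain y where y: "y \<in> E" "\<And>n. y \<notin> C n" by auto
        have "y \<notin> closure (- E)" using y(1) E by (simp add: closure_complement interior_open)
        then have "0 < infdist y (- E)" using False by (metis in_closure_iff_infdist_zero infdist_nonneg less_eq_real_def)
        then obtain n where "1 / real (Suc n) < infdist y (- E)" by (metis nat_approx_posE)
        then show False using y(2)[of n] by (simp add: C_def)
      qed
      have "(\<lambda>n. measure \<mu> ((E - C n) \<inter> ball z R)) \<longlonglongrightarrow> measure \<mu> (\<Inter>n. (E - C n) \<inter> ball z R)"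
      proof (rule Lim_measure_decseq)
        show "range (\<lambda>n. (E - C n) \<inter> ball z R) \<subseteq> sets \<mu>" using E Cc by (auto intro!: borel_sets)
        show "decseq (\<lambda>n. (E - C n) \<inter> ball z R)" using inc by (fastforce simp: decseq_def)
        show "emeasure \<mu> ((E - C n) \<inter> ball z R) \<noteq> \<infinity>" for n
          using subset_ball_finite[of "(E - C n) \<inter> ball z R" z R] by auto
      qed
      moreover have "(\<Inter>n. (E - C n) \<inter> ball z R) = {}" using un by blast
      ultimately have "(\<lambda>n. measure \<mu> ((E - C n) \<inter> ball z R)) \<longlonglongrightarrow> 0" by simp
      then have "eventually (\<lambda>n. measure \<mu> ((E - C n) \<inter> ball z R) < e) sequentially"
        using Basic(2) by (rule order_tendstoD)
      then obtain n where "measure \<mu> ((E - C n) \<inter> ball z R) < e" by (auto simp: eventually_sequentially)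
      then show ?thesis using E Cc CE by blast
    qed
  next
    case Empty
    then show ?case by (intro exI[of _ "{}"]) auto
  next
    case (Compl E)
    obtain C U where CU: "closed C" "open U" "C \<subseteq> E" "E \<subseteq> U" "measure \<mu> ((U - C) \<inter> ball z R) < e"
      using Compl.IH[OF Compl.prems] by blast
    have "- C - - U = U - C" by auto
    then show ?case using CU by (intro exI[of _ "- U"] exI[of _ "- C"]) auto
  next
    case (Union E)
    have "\<exists>C U. closed C \<and> open U \<and> C \<subseteq> E n \<and> E n \<subseteq> U \<and> measure \<mu> ((U - C) \<inter> ball z R) < e / 4 * (1/2)^n" for n
      using Union.prems by (intro Union.IH) auto
    then obtain C U where CU: "\<And>n. closed (C n)" "\<And>n. open (U n)" "\<And>n. C n \<subseteq> E n" "\<And>n. E n \<subseteq> U n"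
      "\<And>n. measure \<mu> ((U n - C n) \<inter> ball z R) < e / 4 * (1/2)^n" by metis
    define W where "W = (\<Union>n. U n)"
    define D where "D n = (\<Union>i\<le>n. C i)" for n
    have W: "open W" unfolding W_def using CU(2) by auto
    have D: "closed (D n)" for n unfolding D_def using CU(1) by auto
    have Cm: "C n \<in> sets \<mu>" for n using CU(1) by (auto intro: borel_sets)
    have Um: "U n \<in> sets \<mu>" for n using CU(2) by (auto intro: borel_sets)
    have Wm: "W \<in> sets \<mu>" using W by (auto intro: borel_sets)
    have Dm: "D n \<in> sets \<mu>" for n using D by (auto intro: borel_sets)
    have lim: "(\<lambda>n. measure \<mu> ((W - D n) \<inter> ball z R)) \<longlonglongrightarrow> measure \<mu> (\<Inter>n. (W - D n) \<inter> ball z R)"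
    proof (rule Lim_measure_decseq)
      show "range (\<lambda>n. (W - D n) \<inter> ball z R) \<subseteq> sets \<mu>" using Wm Dm by auto
      show "decseq (\<lambda>n. (W - D n) \<inter> ball z R)"
        unfolding decseq_def D_def by (auto intro: order_trans)
      show "emeasure \<mu> ((W - D n) \<inter> ball z R) \<noteq> \<infinity>" for n
        using subset_ball_finite[of "(W - D n) \<inter> ball z R" z R] by auto
    qed
    have "measure \<mu> (\<Inter>n. (W - D n) \<inter> ball z R) \<le> e / 2"
    proof -
      have "emeasure \<mu> (\<Inter>n. (W - D n) \<inter> ball z R) \<le> emeasure \<mu> (\<Union>n. (U n - C n) \<inter> ball z R)"
      proof (intro emeasure_mono subsetI)
        fix y assume y: "y \<in> (\<Inter>n. (W - D n) \<inter> ball z R)"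
        then obtain n where "y \<in> U n" by (auto simp: W_def)
        moreover have "y \<notin> C n" using y by (auto simp: D_def)
        ultimately show "y \<in> (\<Union>n. (U n - C n) \<inter> ball z R)" using y by auto
      qed (use Um Cm in auto)
      also have "\<dots> \<le> (\<Sum>n. emeasure \<mu> ((U n - C n) \<inter> ball z R))"
        using Um Cm by (intro emeasure_subadditive_countably) auto
      also have "\<dots> \<le> (\<Sum>n. ennreal (e / 4 * (1/2)^n))"
      proof (intro suminf_le)
        fix n
        have "emeasure \<mu> ((U n - C n) \<inter> ball z R) = ennreal (measure \<mu> ((U n - C n) \<inter> ball z R))"
          using subset_ball_finite[of "(U n - C n) \<inter> ball z R" z R] by (intro emeasure_eq_ennreal_measure) auto
        then show "emeasure \<mu> ((U n - C n) \<inter> ball z R) \<le> ennreal (e / 4 * (1/2)^n)"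
          using CU(5)[of n] by (simp add: ennreal_leI less_imp_le)
      qed auto
      also have "\<dots> = ennreal (e / 2)"
      proof -
        have "(\<lambda>n. e / 4 * (1/2)^n) sums (e / 4 * 2)" using sums_mult[OF geometric_sums[of "1/2::real"], of "e/4"] by simp
        then show ?thesis using Union.prems by (intro suminf_ennreal_eq) auto
      qed
      finally have "enn2real (emeasure \<mu> (\<Inter>n. (W - D n) \<inter> ball z R)) \<le> enn2real (ennreal (e / 2))"
        by (intro enn2real_mono) auto
      then show ?thesis using Union.prems by (simp add: measure_def)
    qed
    then have "measure \<mu> (\<Inter>n. (W - D n) \<inter> ball z R) < e" using Union.prems by linarith
    from order_tendstoD(2)[OF lim this]
    have "eventually (\<lambda>n. measure \<mu> ((W - D n) \<inter> ball z R) < e) sequentially" .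
    then obtain n where "measure \<mu> ((W - D n) \<inter> ball z R) < e" by (auto simp: eventually_sequentially)
    moreover have "D n \<subseteq> (\<Union>i. E i)" using CU(3) by (auto simp: D_def)
    moreover have "(\<Union>i. E i) \<subseteq> W" using CU(4) unfolding W_def by blast
    ultimately show ?case using W D[of n] by (intro exI[of _ "D n"] exI[of _ W] conjI) simp_all
  qed
qed

text \<open>A set of the completed \<sigma>-algebra lies between the Borel sets \<open>S1\<close>
  and \<open>- S2\<close>, from which it differs by null sets; these are approximated from inside
  and outside. Closed bounded sets are compact here, which gives the compact
  \<open>K\<close>.\<close>

lemma measurable_regular:
  assumes S: "S \<in> sets \<mu>" "S \<subseteq> ball z R" and e: "0 < e"
  shows "\<exists>K U. compact K \<and> open U \<and> K \<subseteq> S \<and> S \<subseteq> U \<and> U \<subseteq> ball z R \<and>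
     measure \<mu> S - e \<le> measure \<mu> K \<and> measure \<mu> U \<le> measure \<mu> S + e"
proof -
  obtain S1 where S1: "S1 \<in> sets borel" "S1 \<subseteq> S" "S - S1 \<in> null_sets \<mu>" using borel_minorant_set[OF S(1)] by blast
  have "- S \<in> sets \<mu>" using sets.compl_sets[OF S(1)] by (simp add: Compl_eq_Diff_UNIV)
  then obtain S2 where S2: "S2 \<in> sets borel" "S2 \<subseteq> - S" "- S - S2 \<in> null_sets \<mu>" using borel_minorant_set by blast
  have S2c: "- S2 \<in> sets borel" using S2(1) by auto
  obtain C1 U1 where 1: "closed C1" "C1 \<subseteq> S1" "S1 \<subseteq> U1" "open U1" "measure \<mu> ((U1 - C1) \<inter> ball z R) < e"
    using Borel_regular[OF S1(1) e, of z R] by blast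
  obtain C2 U2 where 2: "closed C2" "C2 \<subseteq> - S2" "- S2 \<subseteq> U2" "open U2" "measure \<mu> ((U2 - C2) \<inter> ball z R) < e"
    using Borel_regular[OF S2c e, of z R] by blast
  have m[measurable]: "S1 \<in> sets \<mu>" "S2 \<in> sets \<mu>" "C1 \<in> sets \<mu>" "C2 \<in> sets \<mu>" "U1 \<in> sets \<mu>" "U2 \<in> sets \<mu>"
    using S1 S2 1 2 by (auto intro: borel_sets)
  have C1S: "C1 \<subseteq> ball z R" using 1 S1 S by auto
  have "compact C1"
    using 1(1) bounded_subset[OF bounded_ball C1S] by (rule closed_bounded_compact)
  moreover have "measure \<mu> S - e \<le> measure \<mu> C1"
  proof -
    have "measure \<mu> S = measure \<mu> (S1 \<union> (S - S1))" using S1(2) by (simp add: Un_absorb1)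
    also have "\<dots> \<le> measure \<mu> S1 + measure \<mu> (S - S1)"
      using S S1 by (intro measure_Un_le) auto
    also have "measure \<mu> (S - S1) = 0" using S1(3) by (simp add: measure_eq_0_null_sets)
    also have "measure \<mu> S1 = measure \<mu> (C1 \<union> (S1 - C1))" using 1(2) by (simp add: Un_absorb1)
    also have "\<dots> \<le> measure \<mu> C1 + measure \<mu> (S1 - C1)" by (intro measure_Un_le) auto
    also have "measure \<mu> (S1 - C1) \<le> measure \<mu> ((U1 - C1) \<inter> ball z R)"
      using 1 S1 S by (intro bounded_measure_mono[of _ _ z R]) auto
    finally show ?thesis using 1(5) by simp
  qed
  moreover have "measure \<mu> (U2 \<inter> ball z R) \<le> measure \<mu> S + e"
  proof -
    have "measure \<mu> (U2 \<inter> ball z R) \<le> measure \<mu> ((S \<union> (- S - S2)) \<union> ((U2 - C2) \<inter> ball z R)) "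
    proof (rule measure_mono_fmeasurable)
      show "U2 \<inter> ball z R \<subseteq> S \<union> (- S - S2) \<union> (U2 - C2) \<inter> ball z R" using 2 by auto
      have "emeasure \<mu> (S \<union> (- S - S2) \<union> (U2 - C2) \<inter> ball z R) \<le> emeasure \<mu> (ball z R \<union> (- S - S2))"
        using S S2 by (intro emeasure_mono) auto
      also have "\<dots> \<le> emeasure \<mu> (ball z R) + emeasure \<mu> (- S - S2)" using S2 by (intro emeasure_subadditive) auto
      also have "\<dots> < \<infinity>" using S2(3) ball_finite by (simp add: null_setsD1)
      finally show "S \<union> (- S - S2) \<union> (U2 - C2) \<inter> ball z R \<in> fmeasurable \<mu>"
        using S S2 by (intro fmeasurableI) auto
    qed auto
    also have "\<dots> \<le> measure \<mu> (S \<union> (- S - S2)) + measure \<mu> ((U2 - C2) \<inter> ball z R)"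
      using S S2 by (intro measure_Un_le) auto
    also have "measure \<mu> (S \<union> (- S - S2)) \<le> measure \<mu> S + measure \<mu> (- S - S2)"
      using S S2 by (intro measure_Un_le) auto
    also have "measure \<mu> (- S - S2) = 0" using S2(3) by (simp add: measure_eq_0_null_sets)
    finally show ?thesis using 2(5) by simp
  qed
  moreover have "S \<subseteq> U2 \<inter> ball z R" using S2 2 S by auto
  ultimately show ?thesis
    using 1 2 S1 by (intro exI[of _ C1] exI[of _ "U2 \<inter> ball z R"]) auto
qed

end

section \<open>Mean values and a weak Sobolev inequality\<close>

lemma diameter_ball_le:
  fixes x :: "'a::metric_space"
  assumes "0 < r" shows "diameter (ball x r) \<le> 2 * r"
proof -
  have "dist y z \<le> 2 * r" if "y \<in> ball x r" "z \<in> ball x r" for y z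
    using dist_triangle3[of y z x] that by auto
  moreover have "x \<in> ball x r" using assms by simp
  then have "ball x r \<times> ball x r \<noteq> {}" by blast
  ultimately show ?thesis unfolding diameter_def by (auto intro!: cSUP_least)
qed

context pi_space
begin

lemma integrable_bounded_on:
  fixes f :: "'a => real"
  assumes "meas f" "\<And>y. y \<in> A ==> \<bar>f y\<bar> \<le> M" "A \<in> sets \<mu>" "A \<subseteq> ball z R"
  shows "integrable \<mu> (\<lambda>y. indicator A y * f y)"
proof (rule Bochner_Integration.integrable_bound)
  show "integrable \<mu> (\<lambda>y. M * indicator A y)"
    using assms(3) subset_ball_finite[OF assms(4)] by (intro integrable_mult_right integrable_real_indicator) auto
  show "meas (\<lambda>y. indicator A y * f y)" using assms by measurable
  show "AE y in \<mu>. norm (indicator A y * f y) \<le> norm (M * indicator A y)"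
    using assms(2) by (intro AE_I2) (auto simp: indicator_def intro: order_trans[OF _ abs_ge_self])
qed

lemma integrable_ball:
  fixes f :: "'a => real"
  assumes "meas f" "\<And>y. \<bar>f y\<bar> \<le> M"
  shows "integrable \<mu> (\<lambda>y. indicator (ball x r) y * f y)"
  by (rule integrable_bounded_on[where M = M and z = x and R = r]) (use assms in auto)

text \<open>The gradient need only be controlled on the larger ball: replaced by \<open>\<infinity>\<close> outside of it, it becomes a weak upper
  gradient on the whole space, because a curve leaving \<open>V\<close> spends a positive amount of time outside
  that ball.\<close>

lemma local_weak_upper_gradient:
  fixes f :: "'a => real"
  assumes g: "pgrad V f g" and sub: "cball x R \<subseteq> V"
  shows "weak_upper_gradient p \<mu> UNIV (\<lambda>y. ereal (f y)) (\<lambda>y. if y \<in> ball x R then g y else \<infinity>)"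
    (is "weak_upper_gradient p \<mu> UNIV _ ?G")
proof -
  obtain \<rho> where \<rho>: "meas g" "bLp \<rho>"
    "\<And>l \<gamma>. curve V l \<gamma> ==> curve_integral l \<gamma> \<rho> < \<infinity> ==>
        grad_along l \<gamma> f g"
    using g by (rule egradE) auto
  have Gm: "?G \<in> borel_measurable \<mu>" using \<rho>(1) by measurable
  define \<Gamma> where "\<Gamma> = {(l, \<gamma>). curve V l \<gamma> \<and> curve_integral l \<gamma> \<rho> = \<infinity>}"
  show ?thesis unfolding weak_upper_gradient_def
  proof (intro conjI exI[of _ \<Gamma>])
    show "?G \<in> borel_measurable (restrict_space \<mu> UNIV)" using Gm by (rule measurable_restrict_space1)
    show "p_exceptional p \<mu> UNIV \<Gamma>"
      unfolding p_exceptional_def using bLp_nonneg_Lp[OF _ \<rho>(2), of UNIV]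
      by (intro exI[of _ \<rho>]) (auto simp: \<Gamma>_def)
    have "jump (ereal (f (\<gamma> 0))) (ereal (f (\<gamma> l))) \<le> curve_integral l \<gamma> ?G"
      if c: "curve UNIV l \<gamma>" and n: "(l, \<gamma>) \<notin> \<Gamma>" for l \<gamma>
    proof (cases "\<gamma> ` {0..l} \<subseteq> V")
      case True
      have l: "0 < l" by (rule arclength_curvesD(1)[OF c])
      have cV: "curve V l \<gamma>" using c True by (auto simp: arclength_curves_def)
      have "curve_integral l \<gamma> \<rho> < \<infinity>" using n cV by (auto simp: \<Gamma>_def less_top)
      from igradD(3)[OF \<rho>(3)[OF cV this], of 0 l] l
      have "jump (ereal (f (\<gamma> 0))) (ereal (f (\<gamma> l))) \<le> nnint {0..l} (\<lambda>\<tau>. g (\<gamma> \<tau>))"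
        by (simp add: jump_def)
      also have "\<dots> \<le> curve_integral l \<gamma> ?G" unfolding curve_integral_def
        by (intro nn_integral_mono mult_right_mono) auto
      finally show ?thesis .
    next
      case False
      then obtain t0 where t0: "t0 \<in> {0..l}" "\<gamma> t0 \<notin> V" by (metis image_subsetI)
      have l: "0 < l" by (rule arclength_curvesD(1)[OF c])
      have d0: "R < dist x (\<gamma> t0)" using t0 sub by (auto simp: subset_iff not_le[symmetric])
      have "continuous_on {0..l} (\<lambda>t. dist x (\<gamma> t))"
        by (intro continuous_on_dist continuous_on_const arclength_curvesD(2)[OF c])
      then obtain d where d: "d > 0" "\<And>t. t \<in> {0..l} ==> \<bar>t - t0\<bar> < d ==> \<bar>dist x (\<gamma> t) - dist x (\<gamma> t0)\<bar> < dist x (\<gamma> t0) - R"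
        using continuous_on_interval_delta[of l "\<lambda>t. dist x (\<gamma> t)" t0 "dist x (\<gamma> t0) - R"] t0(1) d0 by auto
      define a where "a = max 0 (t0 - d/2)"
      define b where "b = min l (t0 + d/2)"
      have ab: "a < b" "0 \<le> a" "b \<le> l" using d(1) t0(1) l by (auto simp: a_def b_def)
      have out: "\<gamma> t \<notin> ball x R" if "t \<in> {a..b}" for t
        using d(2)[of t] that d(1) t0(1) by (auto simp: a_def b_def abs_le_iff abs_less_iff)
      have "\<infinity> = (\<infinity>::ennreal) * ennreal (b - a)" using ab by (simp add: ennreal_mult_eq_top_iff ennreal_top_mult)
      also have "\<dots> = (\<integral>\<^sup>+t. \<infinity> * indicator {a..b} t \<partial>lborel)" using ab by (simp add: nn_integral_cmult_indicator)
      also have "\<dots> \<le> curve_integral l \<gamma> ?G"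
        unfolding curve_integral_def using out ab by (intro nn_integral_mono) (auto simp: indicator_def)
      finally show ?thesis by (simp add: top_unique)
    qed
    then show "\<forall>(l, \<gamma>)\<in>arclength_curves UNIV - \<Gamma>.
       jump (ereal (f (\<gamma> 0))) (ereal (f (\<gamma> l))) \<le> curve_integral l \<gamma> ?G" by blast
  qed
qed

definition avg :: "('a => real) => 'a => real => real" where
  "avg f x r = ball_int x r f / bm x r"

definition osc :: "('a => real) => 'a => real => real" where
  "osc f x r = ball_int x r (\<lambda>y. \<bar>f y - avg f x r\<bar>) / bm x r"

text \<open>The Poincare inequality speaks of integrable functions on the whole space, whence the
  bound and the vanishing of \<open>f\<close> off some ball; the local gradient is made global by
  \<open>local_weak_upper_gradient\<close>. The factor 2 r bounds the diameter of the ball.\<close>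

lemma poincare_local:
  fixes f :: "'a => real"
  assumes fm: "meas f" and fb: "\<And>y. \<bar>f y\<bar> \<le> M" and f0: "\<And>y. y \<notin> ball z R ==> f y = 0"
    and g: "pgrad V f (\<lambda>y. ennreal (b y))" and b0: "\<And>y. 0 \<le> b y"
    and bi: "integrable \<mu> (\<lambda>y. indicator (ball x (\<tau> * r)) y * b y powr p)"
    and r: "0 < r" and sub: "cball x (\<tau> * r) \<subseteq> V"
  shows "osc f x r \<le> 2 * CP * r *
     (ball_int x (\<tau> * r) (\<lambda>y. b y powr p) / bm x (\<tau> * r)) powr (1 / p)"
proof -
  define G where "G = (\<lambda>y. if y \<in> ball x (\<tau> * r) then ennreal (b y) else \<infinity>)"
  have wug: "weak_upper_gradient p \<mu> UNIV (\<lambda>y. ereal (f y)) G"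
    unfolding G_def by (rule local_weak_upper_gradient[OF g sub])
  have \<tau>r: "0 < \<tau> * r" using \<tau>1 r by simp
  have finf: "(\<integral>\<^sup>+y. e2ennreal \<bar>ereal (f y)\<bar> \<partial>\<mu>) < \<infinity>"
  proof -
    have "(\<integral>\<^sup>+y. e2ennreal \<bar>ereal (f y)\<bar> \<partial>\<mu>) \<le> (\<integral>\<^sup>+y. ennreal M * indicator (ball z R) y \<partial>\<mu>)"
      using fb f0 by (intro nn_integral_mono) (auto simp: indicator_def e2ennreal_ereal intro!: ennreal_leI)
    also have "\<dots> = ennreal M * emeasure \<mu> (ball z R)" by (intro nn_integral_cmult_indicator) auto
    also have "\<dots> < \<infinity>" using ball_finite[of z R] by (simp add: ennreal_mult_less_top)
    finally show ?thesis .
  qed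
  have mv: "mean_value \<mu> (ball x r) (\<lambda>y. ereal (f y)) = avg f x r"
    by (simp add: mean_value_def avg_def set_lebesgue_integral_def)
  define A where "A = avg f x r"
  have fA: "meas (\<lambda>y. \<bar>f y - A\<bar>)" using fm by measurable
  have "\<And>y. \<bar>\<bar>f y - A\<bar>\<bar> \<le> M + \<bar>A\<bar>" using fb by (smt (verit))
  from integrable_ball[OF fA this]
  have oi: "integrable \<mu> (\<lambda>y. indicator (ball x r) y * \<bar>f y - A\<bar>)" by simp
  have "(\<integral>\<^sup>+y\<in>ball x r. e2ennreal \<bar>ereal (f y) - ereal A\<bar> \<partial>\<mu>) = (\<integral>\<^sup>+y. ennreal (indicator (ball x r) y * \<bar>f y - A\<bar>) \<partial>\<mu>)"
    by (intro nn_integral_cong) (auto simp: indicator_def e2ennreal_ereal)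
  also have "\<dots> = ennreal (ball_int x r (\<lambda>y. \<bar>f y - A\<bar>))"
    using oi by (intro nn_integral_eq_integral) auto
  finally have L: "(\<integral>\<^sup>+y\<in>ball x r. e2ennreal \<bar>ereal (f y) - ereal A\<bar> \<partial>\<mu>) / emeasure \<mu> (ball x r) = ennreal (osc f x r)"
    unfolding emeasure_bm osc_def A_def[symmetric] using bm_pos[OF r, of x]
    by (simp add: divide_ennreal integral_nonneg_AE)
  define I where "I = ball_int x (\<tau> * r) (\<lambda>y. b y powr p)"
  have I0: "0 \<le> I" unfolding I_def by (intro integral_nonneg_AE) auto
  have "(\<integral>\<^sup>+y\<in>ball x (\<tau> * r). epowr (G y) p \<partial>\<mu>) = (\<integral>\<^sup>+y. ennreal (indicator (ball x (\<tau> * r)) y * b y powr p) \<partial>\<mu>)"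
    using b0 by (intro nn_integral_cong) (auto simp: indicator_def epowr_ennreal G_def)
  also have "\<dots> = ennreal I" unfolding I_def using bi by (intro nn_integral_eq_integral) auto
  finally have Rr: "epowr ((\<integral>\<^sup>+y\<in>ball x (\<tau> * r). epowr (G y) p \<partial>\<mu>) / emeasure \<mu> (ball x (\<tau> * r))) (1 / p)
     = ennreal ((I / bm x (\<tau> * r)) powr (1 / p))"
    unfolding emeasure_bm using bm_pos[OF \<tau>r, of x] I0 by (simp add: divide_ennreal epowr_ennreal)
  have "ennreal (osc f x r) \<le> ennreal (CP * diameter (ball x r)) * ennreal ((I / bm x (\<tau> * r)) powr (1 / p))"
    using poinc[OF r _ finf wug, of x] fm unfolding mv A_def[symmetric] L Rr by simp
  also have "\<dots> \<le> ennreal (CP * (2 * r)) * ennreal ((I / bm x (\<tau> * r)) powr (1 / p))"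
    using CP diameter_ball_le[OF r, of x] by (intro mult_right_mono ennreal_leI mult_left_mono) auto
  also have "\<dots> = ennreal (2 * CP * r * (I / bm x (\<tau> * r)) powr (1 / p))"
    using CP r by (subst ennreal_mult[symmetric]) (auto simp: mult_ac)
  finally show ?thesis
    unfolding I_def using CP r by (subst (asm) ennreal_le_iff) auto
qed

lemma avg_nonneg:
  assumes "\<And>y. 0 \<le> f y" shows "0 \<le> avg f x r"
  unfolding avg_def using assms by (intro divide_nonneg_nonneg integral_nonneg_AE) auto

lemma osc_nonneg: "0 \<le> osc f x r"
  unfolding osc_def by (intro divide_nonneg_nonneg integral_nonneg_AE) auto

lemma avg_mult: "0 < r ==> avg f x r * bm x r = ball_int x r f"
  using bm_pos[of r x] by (simp add: avg_def)

lemma osc_mult: "0 < r ==> osc f x r * bm x r = ball_int x r (\<lambda>y. \<bar>f y - avg f x r\<bar>)"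
  using bm_pos[of r x] by (simp add: osc_def)

lemma osc_integrable:
  fixes f :: "'a => real"
  assumes "meas f" "\<And>y. \<bar>f y\<bar> \<le> M"
  shows "integrable \<mu> (\<lambda>y. indicator (ball x r) y * \<bar>f y - c\<bar>)"
proof (rule integrable_ball)
  show "meas (\<lambda>y. \<bar>f y - c\<bar>)" using assms(1) by measurable
  show "\<bar>\<bar>f y - c\<bar>\<bar> \<le> M + \<bar>c\<bar>" for y using assms(2)[of y] by simp
qed

text \<open>On the zero set of \<open>f\<close> the deviation from the mean value is the mean value
  itself, and this set fills at least half of the ball.\<close>

lemma avg_le_osc:
  fixes f :: "'a => real"
  assumes fm: "meas f" and fb: "\<And>y. \<bar>f y\<bar> \<le> M" and f0: "\<And>y. 0 \<le> f y" and r: "0 < r"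
    and half: "measure \<mu> ({y. 0 < f y} \<inter> ball x r) \<le> bm x r / 2"
  shows "avg f x r \<le> 2 * osc f x r"
proof -
  define A where "A = avg f x r"
  have A: "0 \<le> A" unfolding A_def by (rule avg_nonneg[OF f0])
  define P where "P = {y \<in> space \<mu>. 0 < f y} \<inter> ball x r"
  define Z where "Z = ball x r - P"
  have Pm: "P \<in> sets \<mu>" unfolding P_def using fm by measurable
  have Zm: "Z \<in> sets \<mu>" unfolding Z_def using Pm by auto
  have "measure \<mu> Z = bm x r - measure \<mu> P"
    unfolding Z_def using Pm subset_ball_finite[of P x r] ball_finite[of x r]
    by (intro measure_Diff) (auto simp: P_def)
  then have Z: "bm x r / 2 \<le> measure \<mu> Z" using half by (simp add: P_def)
  have "A * (bm x r / 2) \<le> A * measure \<mu> Z" by (intro mult_left_mono A Z)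
  also have "\<dots> = (\<integral>y. A * indicator Z y \<partial>\<mu>)" using Zm by simp
  also have "\<dots> \<le> ball_int x r (\<lambda>y. \<bar>f y - A\<bar>)"
  proof (rule integral_mono)
    show "integrable \<mu> (\<lambda>y. A * indicator Z y)"
      using Zm subset_ball_finite[of Z x r] by (intro integrable_mult_right integrable_real_indicator) (auto simp: Z_def)
    show "integrable \<mu> (\<lambda>y. indicator (ball x r) y * \<bar>f y - A\<bar>)" by (rule osc_integrable[OF fm fb])
    show "A * indicator Z y \<le> indicator (ball x r) y * \<bar>f y - A\<bar>" for y
      using f0[of y] A by (auto simp: Z_def P_def indicator_def not_less)
  qed
  also have "\<dots> = osc f x r * bm x r" unfolding A_def by (rule osc_mult[OF r, symmetric])
  finally have "A * bm x r \<le> (2 * osc f x r) * bm x r" by simp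
  then show ?thesis using bm_pos[OF r, of x] by (simp add: A_def)
qed

text \<open>The deviation integrated over the half ball is at most that over the whole ball, and
  doubling compares the two measures.\<close>

lemma avg_half_le:
  fixes f :: "'a => real"
  assumes fm: "meas f" and fb: "\<And>y. \<bar>f y\<bar> \<le> M" and r: "0 < r"
  shows "avg f x (r / 2) \<le> avg f x r + Cd * osc f x r"
proof -
  define A where "A = avg f x r"
  have r2: "0 < r / 2" using r by simp
  have "(avg f x (r/2) - A) * bm x (r/2) = ball_int x (r/2) f - (\<integral>y. A * indicator (ball x (r/2)) y \<partial>\<mu>)"
    using avg_mult[OF r2, of f x] by (simp add: algebra_simps)
  also have "\<dots> = (\<integral>y. indicator (ball x (r/2)) y * f y - A * indicator (ball x (r/2)) y \<partial>\<mu>)"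
    using ball_finite[of x "r/2"] by (intro Bochner_Integration.integral_diff[symmetric] integrable_ball[OF fm fb] integrable_mult_right integrable_real_indicator) auto
  also have "\<dots> \<le> ball_int x r (\<lambda>y. \<bar>f y - A\<bar>)"
  proof (rule integral_mono)
    show "integrable \<mu> (\<lambda>y. indicator (ball x (r/2)) y * f y - A * indicator (ball x (r/2)) y)"
      using ball_finite[of x "r/2"] by (intro Bochner_Integration.integrable_diff integrable_ball[OF fm fb] integrable_mult_right integrable_real_indicator) auto
    show "integrable \<mu> (\<lambda>y. indicator (ball x r) y * \<bar>f y - A\<bar>)" by (rule osc_integrable[OF fm fb])
    show "indicator (ball x (r/2)) y * f y - A * indicator (ball x (r/2)) y \<le> indicator (ball x r) y * \<bar>f y - A\<bar>" for y
      using r by (auto simp: indicator_def)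
  qed
  also have "\<dots> = osc f x r * bm x r" unfolding A_def by (rule osc_mult[OF r, symmetric])
  also have "\<dots> \<le> osc f x r * (Cd * bm x (r/2))"
    using bm_double[OF r2, of x] by (intro mult_left_mono osc_nonneg) simp
  finally have "(avg f x (r/2) - A) * bm x (r/2) \<le> (Cd * osc f x r) * bm x (r/2)" by (simp add: mult_ac)
  then have "avg f x (r/2) - A \<le> Cd * osc f x r" using bm_pos[OF r2, of x] by simp
  then show ?thesis by (simp add: A_def)
qed

text \<open>In \<open>weak_sobolev\<close> the factor 4 Cd^2 is left after absorption, and 16 Cd^2
  (2 + Cd) is 1/\<theta> for the oscillation threshold \<theta> chosen there.\<close>

definition KS :: real where
  "KS = 4 * Cd^2 * (2 * CP * (16 * Cd^2 * (2 + Cd))) powr p"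

lemma KS_pos: "0 < KS"
  unfolding KS_def using Cd CP by (intro mult_pos_pos) auto

text \<open>Every point of \<open>S\<close> is the centre of a ball at which either the oscillation is large
  compared with its radius, so that the Poincare inequality bounds its measure by the energy in it, or,
  by telescoping the mean values, \<open>S\<close> has small density.  A Vitali covering by such balls is summed.\<close>

lemma weak_sobolev:
  fixes f b :: "'a => real"
  assumes fm: "meas f" and fb: "\<And>y. \<bar>f y\<bar> \<le> M" and f0: "\<And>y. y \<notin> ball z R ==> f y = 0"
    and fpos: "\<And>y. 0 \<le> f y"
    and g: "pgrad V f (\<lambda>y. ennreal (b y))" and b0: "\<And>y. 0 \<le> b y"
    and U: "U \<subseteq> V" "U \<in> sets \<mu>" and bi: "integrable \<mu> (\<lambda>y. indicator U y * b y powr p)"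
    and S: "S \<in> sets \<mu>" "S \<subseteq> ball z R" and t: "0 < t" "\<And>x. x \<in> S ==> t \<le> f x"
    and \<rho>: "0 < \<rho>" "\<And>x. x \<in> S ==> cball x (\<tau> * \<rho>) \<subseteq> U"
    and half: "\<And>x. x \<in> S ==> measure \<mu> ({y. 0 < f y} \<inter> ball x \<rho>) \<le> bm x \<rho> / 2"
  shows "t powr p * measure \<mu> S \<le> KS * \<rho> powr p * (\<integral>y. indicator U y * b y powr p \<partial>\<mu>)"
proof (cases "measure \<mu> S = 0")
  case True
  have "0 \<le> (\<integral>y. indicator U y * b y powr p \<partial>\<mu>)" by (intro integral_nonneg_AE) auto
  then show ?thesis using True KS_pos by simp
next
  case False
  define s where "s = measure \<mu> S"
  have s: "0 < s" using False by (simp add: s_def zero_less_measure_iff)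
  \<comment> \<open>The compact \<open>K\<close> has at least half the measure of \<open>S\<close>
    and admits finite covers. The open \<open>W\<close> has at most twice the measure of
    \<open>S\<close> and contains small balls about each point of \<open>S\<close>.\<close>
  obtain K W where KW: "compact K" "open W" "K \<subseteq> S" "S \<subseteq> W" "W \<subseteq> ball z R" "s - s/2 \<le> measure \<mu> K" "measure \<mu> W \<le> s + s"
    using measurable_regular[OF S, of "s/2"] s unfolding s_def[symmetric]
    by (smt (verit, ccfv_SIG) field_sum_of_halves half_gt_zero_iff)
  \<comment> \<open>With this value c0 Cd^2 * 2 s is s/4, which is absorbed at the end; \<theta> is
    chosen so that the telescoped mean values stay below c0 t.\<close>
  define c0 where "c0 = 1 / (8 * Cd^2)"
  define \<theta> where "\<theta> = c0 / (2 * (2 + Cd))"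
  have c0: "0 < c0" and \<theta>: "0 < \<theta>" using Cd by (auto simp: c0_def \<theta>_def intro!: divide_pos_pos)
  define D where "D = (2 * CP * \<rho> / (\<theta> * t)) powr p"
  have D0: "0 \<le> D" by (simp add: D_def)
  define J where "J A = (\<integral>y. indicator (A \<inter> U) y * b y powr p \<partial>\<mu>)" for A
  have biA: "integrable \<mu> (\<lambda>y. indicator (A \<inter> U) y * b y powr p)" if "A \<in> sets \<mu>" for A
  proof -
    have "integrable \<mu> (\<lambda>y. indicator A y *\<^sub>R (indicator U y * b y powr p))"
      using bi that by (intro integrable_mult_indicator) auto
    moreover have "(\<lambda>y. indicator A y *\<^sub>R (indicator U y * b y powr p)) = (\<lambda>y. indicator (A \<inter> U) y * b y powr p)"
      by (auto simp: indicator_def fun_eq_iff)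
    ultimately show ?thesis by (simp only:)
  qed
  have J0: "0 \<le> J A" for A unfolding J_def by (intro integral_nonneg_AE) auto
  have Wm: "W \<in> sets \<mu>" using KW(2) by auto
  have Km: "K \<in> sets \<mu>" using KW(1) by (intro borel_sets borel_compact)
  \<comment> \<open>The left side has the triple ball of the Vitali covering, while the right side
    involves only the ball itself, so that disjoint balls can be summed.\<close>
  define good where "good x q \<longleftrightarrow> 0 < q \<and>
     measure \<mu> (S \<inter> ball x (3 * q)) \<le> Cd^2 * D * J (ball x q) + c0 * Cd^2 * measure \<mu> (ball x q \<inter> W)" for x q
  have ex: "\<exists>q. good x q" if x: "x \<in> K" for x
  proof -
    have xS: "x \<in> S" using x KW by auto
    define \<rho>i where "\<rho>i i = \<rho> / 2^i" for i :: nat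
    have \<rho>i: "0 < \<rho>i i" "\<rho>i i \<le> \<rho>" for i using \<rho>(1) by (auto simp: \<rho>i_def field_simps)
    have \<rho>S: "\<rho>i (Suc i) = \<rho>i i / 2" for i by (simp add: \<rho>i_def)
    have tsub: "ball x (\<tau> * \<rho>i i) \<subseteq> U" "cball x (\<tau> * \<rho>i i) \<subseteq> V" for i
    proof -
      have "\<tau> * \<rho>i i \<le> \<tau> * \<rho>" using \<rho>i(2)[of i] \<tau>1 by simp
      then have "cball x (\<tau> * \<rho>i i) \<subseteq> cball x (\<tau> * \<rho>)" by (rule subset_cball)
      then show "ball x (\<tau> * \<rho>i i) \<subseteq> U" "cball x (\<tau> * \<rho>i i) \<subseteq> V" using \<rho>(2)[OF xS] U(1) ball_subset_cball[of x "\<tau> * \<rho>i i"] by blast+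
    qed
    define \<beta> where "\<beta> i = J (ball x (\<tau> * \<rho>i i)) / bm x (\<tau> * \<rho>i i)" for i
    have bm\<tau>: "0 < bm x (\<tau> * \<rho>i i)" for i using \<rho>i(1)[of i] \<tau>1 by (intro bm_pos mult_pos_pos) auto
    have \<beta>0: "0 \<le> \<beta> i" for i unfolding \<beta>_def using J0 bm\<tau>[of i] by (intro divide_nonneg_pos)
    have po: "osc f x (\<rho>i i) \<le> 2 * CP * \<rho>i i * \<beta> i powr (1/p)" for i
    proof -
      have e: "indicator (ball x (\<tau> * \<rho>i i) \<inter> U) y * b y powr p = indicator (ball x (\<tau> * \<rho>i i)) y * b y powr p" for y
        using tsub(1)[of i] by (auto simp: indicator_def)
      have "integrable \<mu> (\<lambda>y. indicator (ball x (\<tau> * \<rho>i i)) y * b y powr p)"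
        using biA[of "ball x (\<tau> * \<rho>i i)"] by (simp add: e)
      from poincare_local[OF fm fb f0 g b0 this \<rho>i(1) tsub(2)]
      show ?thesis by (simp add: \<beta>_def J_def e)
    qed
    show ?thesis
    \<comment> \<open>The threshold decreases like the radius \<rho>/2^m. So the powers of 2 cancel
      in the Poincare inequality if it is exceeded for some m, and it is summable over m if it is
      never exceeded.\<close>
    proof (cases "\<exists>m. \<theta> * t / 2^m < osc f x (\<rho>i m)")
      case True
      then obtain m where m: "\<theta> * t / 2^m < osc f x (\<rho>i m)" by blast
      define q where "q = \<tau> * \<rho>i m"
      have q: "0 < q" using \<rho>i(1)[of m] \<tau>1 by (simp add: q_def)
      have "\<theta> * t / 2^m < 2 * CP * \<rho>i m * \<beta> m powr (1/p)" using m po[of m] by linarith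
      then have "\<theta> * t < 2 * CP * \<rho> * \<beta> m powr (1/p)" by (simp add: \<rho>i_def field_simps)
      then have "1 < (2 * CP * \<rho> / (\<theta> * t)) * \<beta> m powr (1/p)" using \<theta> t(1) by (simp add: field_simps)
      then have "1 powr p \<le> ((2 * CP * \<rho> / (\<theta> * t)) * \<beta> m powr (1/p)) powr p"
        using p0 by (intro powr_mono2) auto
      also have "\<dots> = D * (\<beta> m powr (1/p)) powr p"
        unfolding D_def by (rule powr_mult)
      also have "(\<beta> m powr (1/p)) powr p = \<beta> m" using p0 \<beta>0[of m] by (simp add: powr_powr)
      finally have "1 \<le> D * \<beta> m" by simp
      then have key: "bm x q \<le> D * J (ball x q)"
        using bm\<tau>[of m] by (simp add: \<beta>_def q_def field_simps)
      have "measure \<mu> (S \<inter> ball x (3 * q)) \<le> bm x (2^2 * q)"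
        using S(1) q by (intro bounded_measure_mono[of _ _ x "2^2 * q"]) auto
      also have "\<dots> \<le> Cd^2 * bm x q" by (rule bm_double_pow[OF q])
      also have "\<dots> \<le> Cd^2 * (D * J (ball x q))" by (intro mult_left_mono key) auto
      also have "\<dots> \<le> Cd^2 * D * J (ball x q) + c0 * Cd^2 * measure \<mu> (ball x q \<inter> W)"
        using c0 by (simp add: mult.assoc)
      finally show ?thesis using q unfolding good_def by blast
    next
      case False
      then have os: "osc f x (\<rho>i m) \<le> \<theta> * t / 2^m" for m by (simp add: not_less)
      have av: "avg f x (\<rho>i i) \<le> 2 * (\<theta> * t) + Cd * (2 * (\<theta> * t) * (1 - 1 / 2^i))" for i
      proof (induction i)
        case 0
        have "avg f x (\<rho>i 0) \<le> 2 * osc f x (\<rho>i 0)"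
          using half[OF xS] by (intro avg_le_osc[OF fm fb fpos \<rho>i(1)]) (simp add: \<rho>i_def)
        also have "\<dots> \<le> 2 * (\<theta> * t)" using os[of 0] by simp
        finally show ?case by simp
      next
        case (Suc i)
        have "avg f x (\<rho>i (Suc i)) \<le> avg f x (\<rho>i i) + Cd * osc f x (\<rho>i i)"
          unfolding \<rho>S by (rule avg_half_le[OF fm fb \<rho>i(1)])
        also have "\<dots> \<le> (2 * (\<theta> * t) + Cd * (2 * (\<theta> * t) * (1 - 1 / 2^i))) + Cd * (\<theta> * t / 2^i)"
          using Suc os[of i] Cd by (intro add_mono mult_left_mono) auto
        also have "\<dots> = 2 * (\<theta> * t) + Cd * (2 * (\<theta> * t) * (1 - 1 / 2^Suc i))" by (simp add: field_simps)
        finally show ?case .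
      qed
      obtain e where e: "0 < e" "ball x e \<subseteq> W" using KW(2) xS KW(4) by (meson openE subsetD)
      obtain i where i: "(1/2)^i < e / \<rho>" using real_arch_pow_inv[of "e/\<rho>" "1/2"] e(1) \<rho>(1) by auto
      have "\<rho>i i < e" using i \<rho>(1) by (simp add: \<rho>i_def field_simps)
      \<comment> \<open>With a quarter of the radius the triple ball stays inside the ball of radius
        \<open>\<rho>i i\<close>, and two doublings lead back from q to \<open>\<rho>i i\<close>.
        The index i is large enough for the ball to lie in \<open>W\<close>.\<close>
      define q where "q = \<rho>i i / 4"
      have q: "0 < q" "2^2 * q = \<rho>i i" using \<rho>i(1)[of i] by (auto simp: q_def)
      have qW: "ball x q \<subseteq> W" using e(2) \<open>\<rho>i i < e\<close> \<rho>i(1)[of i] by (auto simp: q_def)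
      define B where "B = ball x (\<rho>i i)"
      have "0 \<le> \<theta> * t" using \<theta> t(1) by simp
      then have "Cd * (2 * (\<theta> * t) * (1 - 1 / 2^i)) \<le> Cd * (2 * (\<theta> * t) * 1)"
        using Cd by (intro mult_left_mono) auto
      then have "avg f x (\<rho>i i) \<le> 2 * (2 + Cd) * (\<theta> * t)" using av[of i] \<open>0 \<le> \<theta> * t\<close> by (simp add: algebra_simps)
      also have "\<dots> = c0 * t" using Cd by (simp add: \<theta>_def)
      finally have avc: "avg f x (\<rho>i i) \<le> c0 * t" .
      have "t * measure \<mu> (S \<inter> B) = (\<integral>y. t * indicator (S \<inter> B) y \<partial>\<mu>)" using S(1) by (simp add: B_def)
      also have "\<dots> \<le> ball_int x (\<rho>i i) f"
      proof (rule integral_mono)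
        show "integrable \<mu> (\<lambda>y. t * indicator (S \<inter> B) y)"
          using S(1) subset_ball_finite[of "S \<inter> B" x "\<rho>i i"] by (intro integrable_mult_right integrable_real_indicator) (auto simp: B_def)
        show "integrable \<mu> (\<lambda>y. indicator (ball x (\<rho>i i)) y * f y)" by (rule integrable_ball[OF fm fb])
        show "t * indicator (S \<inter> B) y \<le> indicator (ball x (\<rho>i i)) y * f y" for y
          using t(2)[of y] fpos[of y] by (auto simp: indicator_def B_def)
      qed
      also have "\<dots> = avg f x (\<rho>i i) * bm x (\<rho>i i)" by (rule avg_mult[OF \<rho>i(1), symmetric])
      also have "\<dots> \<le> c0 * t * bm x (\<rho>i i)" by (intro mult_right_mono avc) auto
      finally have "measure \<mu> (S \<inter> B) \<le> c0 * bm x (\<rho>i i)" using t(1) by (simp add: mult_ac)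
      also have "\<dots> \<le> c0 * (Cd^2 * bm x q)" using bm_double_pow[OF q(1), of x 2] c0 unfolding q(2) by (intro mult_left_mono) auto
      also have "bm x q = measure \<mu> (ball x q \<inter> W)" using qW by (simp add: Int_absorb2)
      finally have 1: "measure \<mu> (S \<inter> B) \<le> c0 * Cd^2 * measure \<mu> (ball x q \<inter> W)" by (simp add: mult.assoc)
      have "measure \<mu> (S \<inter> ball x (3 * q)) \<le> measure \<mu> (S \<inter> B)"
        using S(1) q by (intro bounded_measure_mono[of _ _ x "\<rho>i i"]) (auto simp: B_def)
      also have "\<dots> \<le> Cd^2 * D * J (ball x q) + c0 * Cd^2 * measure \<mu> (ball x q \<inter> W)"
        using 1 D0 J0[of "ball x q"] by (simp add: add_increasing)
      finally show ?thesis using q(1) unfolding good_def by blast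
    qed
  qed
  then obtain q where q: "\<And>x. x \<in> K ==> good x (q x)" by metis
  have qpos: "0 < q x" if "x \<in> K" for x using q[OF that] by (simp add: good_def)
  obtain I where I: "I \<subseteq> K" "finite I" "K \<subseteq> (\<Union>x\<in>I. ball x (q x))"
  proof (rule compactE_image[OF KW(1), of K "\<lambda>x. ball x (q x)"])
    show "K \<subseteq> (\<Union>x\<in>K. ball x (q x))" using qpos by force
  qed (auto intro: that)
  have "\<exists>F\<subseteq>I. (\<forall>i\<in>F. \<forall>j\<in>F. i \<noteq> j --> ball i (q i) \<inter> ball j (q j) = {}) \<and>
     (\<Union>i\<in>I. ball i (q i)) \<subseteq> (\<Union>i\<in>F. ball i (3 * q i))"
    using finite_Vitali_balls[of I q "\<lambda>x. x"] I qpos by blast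
  then obtain F where F: "F \<subseteq> I" "\<forall>i\<in>F. \<forall>j\<in>F. i \<noteq> j --> ball i (q i) \<inter> ball j (q j) = {}"
     "(\<Union>i\<in>I. ball i (q i)) \<subseteq> (\<Union>i\<in>F. ball i (3 * q i))" by (elim exE conjE) (rule that; assumption)
  have Ff: "finite F" using F(1) I(2) by (rule finite_subset)
  have dis: "disjoint_family_on (\<lambda>x. ball x (q x)) F" using F(2) by (auto simp: disjoint_family_on_def)
  have "measure \<mu> K \<le> measure \<mu> (\<Union>x\<in>F. S \<inter> ball x (3 * q x))"
  proof (rule bounded_measure_mono[of _ _ z R])
    show "K \<subseteq> (\<Union>x\<in>F. S \<inter> ball x (3 * q x))" using KW(3) I(3) F(3) by blast
    show "(\<Union>x\<in>F. S \<inter> ball x (3 * q x)) \<subseteq> ball z R" using S(2) by auto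
  qed (use Km Ff S(1) in auto)
  also have "\<dots> \<le> (\<Sum>x\<in>F. measure \<mu> (S \<inter> ball x (3 * q x)))"
    using S(1) Ff subset_ball_finite by (intro measure_UNION_le) auto
  also have "\<dots> \<le> (\<Sum>x\<in>F. Cd^2 * D * J (ball x (q x)) + c0 * Cd^2 * measure \<mu> (ball x (q x) \<inter> W))"
    using q F(1) I(1) by (intro sum_mono) (auto simp: good_def)
  also have "\<dots> = Cd^2 * D * (\<Sum>x\<in>F. J (ball x (q x))) + c0 * Cd^2 * (\<Sum>x\<in>F. measure \<mu> (ball x (q x) \<inter> W))"
    by (simp add: sum.distrib sum_distrib_left)
  also have "\<dots> \<le> Cd^2 * D * J UNIV + c0 * Cd^2 * (s + s)"
  proof (intro add_mono mult_left_mono)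
    have "(\<Sum>x\<in>F. J (ball x (q x))) = (\<integral>y. (\<Sum>x\<in>F. indicator (ball x (q x) \<inter> U) y * b y powr p) \<partial>\<mu>)"
      unfolding J_def by (intro Bochner_Integration.integral_sum[symmetric] biA) auto
    also have "\<dots> \<le> J UNIV" unfolding J_def
    proof (rule integral_mono)
      show "integrable \<mu> (\<lambda>y. \<Sum>x\<in>F. indicator (ball x (q x) \<inter> U) y * b y powr p)"
        by (intro Bochner_Integration.integrable_sum biA) auto
      show "integrable \<mu> (\<lambda>y. indicator (UNIV \<inter> U) y * b y powr p)" by (rule biA) (metis sets.top space_mu)
      fix y
      have "(\<Sum>x\<in>F. indicator (ball x (q x) \<inter> U) y * b y powr p)
          = (\<Sum>x\<in>F. indicator (ball x (q x)) y) * (indicator U y * b y powr p)"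
        by (simp add: sum_distrib_right indicator_inter_arith mult.assoc)
      also have "(\<Sum>x\<in>F. indicator (ball x (q x)) y) = (indicator (\<Union>x\<in>F. ball x (q x)) y :: real)"
        by (rule indicator_UN_disjoint[OF Ff dis, symmetric])
      also have "\<dots> * (indicator U y * b y powr p) \<le> 1 * (indicator U y * b y powr p)"
        by (intro mult_right_mono) (auto simp: indicator_def)
      finally show "(\<Sum>x\<in>F. indicator (ball x (q x) \<inter> U) y * b y powr p) \<le> indicator (UNIV \<inter> U) y * b y powr p"
        by simp
    qed
    finally show "(\<Sum>x\<in>F. J (ball x (q x))) \<le> J UNIV" .
    have "(\<Sum>x\<in>F. measure \<mu> (ball x (q x) \<inter> W)) = measure \<mu> (\<Union>x\<in>F. ball x (q x) \<inter> W)"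
    proof (rule measure_finite_Union[symmetric])
      show "disjoint_family_on (\<lambda>x. ball x (q x) \<inter> W) F" using dis by (auto simp: disjoint_family_on_def)
      show "emeasure \<mu> (ball x (q x) \<inter> W) \<noteq> \<infinity>" for x
        using subset_ball_finite[of "ball x (q x) \<inter> W" x "q x"] by auto
    qed (use Ff Wm in auto)
    also have "\<dots> \<le> measure \<mu> W"
      using Ff Wm KW(5) by (intro bounded_measure_mono[of _ _ z R]) auto
    finally show "(\<Sum>x\<in>F. measure \<mu> (ball x (q x) \<inter> W)) \<le> s + s" using KW(7) by simp
  qed (use D0 c0 in auto)
  also have "c0 * Cd^2 * (s + s) = s / 4" using Cd by (simp add: c0_def)
  \<comment> \<open>The s/4 on the right is absorbed by the s/2 on the left.\<close>
  finally have "s - s/2 \<le> Cd^2 * D * J UNIV + s / 4" using KW(6) by simp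
  then have "s \<le> 4 * (Cd^2 * D * J UNIV)" by simp
  then have "t powr p * s \<le> t powr p * (4 * (Cd^2 * D * J UNIV))" by (intro mult_left_mono) auto
  also have "\<dots> = (4 * Cd^2 * (t powr p * D)) * J UNIV" by simp
  also have "t powr p * D = (2 * CP * (16 * Cd^2 * (2 + Cd))) powr p * \<rho> powr p"
  proof -
    have "t powr p * D = (t * (2 * CP * \<rho> / (\<theta> * t))) powr p" unfolding D_def by (rule powr_mult[symmetric])
    also have "t * (2 * CP * \<rho> / (\<theta> * t)) = (2 * CP * (16 * Cd^2 * (2 + Cd))) * \<rho>"
      using t(1) Cd by (simp add: \<theta>_def c0_def field_simps)
    also have "\<dots> powr p = (2 * CP * (16 * Cd^2 * (2 + Cd))) powr p * \<rho> powr p" by (rule powr_mult)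
    finally show ?thesis .
  qed
  also have "4 * Cd^2 * ((2 * CP * (16 * Cd^2 * (2 + Cd))) powr p * \<rho> powr p) = KS * \<rho> powr p"
    by (simp add: KS_def)
  finally show ?thesis unfolding s_def J_def by simp
qed

end

section \<open>De Giorgi's method\<close>

text \<open>\<open>powr_convex\<close> speaks of positive numbers; if one of them is 0, the claim
  reduces to u^p \<le> u for u in [0,1].\<close>

lemma powr_convex_combination:
  fixes a b s p :: real
  assumes p: "1 \<le> p" and ab: "0 \<le> a" "0 \<le> b" and s: "0 \<le> s" "s \<le> 1"
  shows "((1 - s) * a + s * b) powr p \<le> (1 - s) * a powr p + s * b powr p"
proof -
  have zero: "(u * c) powr p \<le> u * c powr p" if "0 \<le> u" "u \<le> 1" "0 \<le> c" for u c :: real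
  proof (cases "u = 0")
    case False
    have "u powr p \<le> u powr 1" using that False p by (intro powr_mono') auto
    then have "u powr p * c powr p \<le> u * c powr p" using that False by (intro mult_right_mono) auto
    then show ?thesis by (simp add: powr_mult)
  qed simp
  show ?thesis
  proof (cases "a = 0 \<or> b = 0")
    case True
    then show ?thesis using zero[of "1 - s" a] zero[of s b] s ab p by auto
  next
    case False
    then have "a \<in> {0<..}" "b \<in> {0<..}" using ab by auto
    from convex_onD[OF powr_convex[OF p] s this] show ?thesis by simp
  qed
qed

context borel_mm
begin

lemma rgrad_affine:
  assumes "rgrad V w b"
  shows "rgrad V (\<lambda>x. a * w x + c) (\<lambda>x. \<bar>a\<bar> * b x)"
  unfolding rgrad_def
proof (intro conjI allI impI)
  note b = rgradD[OF assms]
  show "(\<lambda>x. \<bar>a\<bar> * b x) \<in> borel_measurable borel" using b(1) by measurable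
  show "0 \<le> \<bar>a\<bar> * b x" for x using b(3) by simp
  show "\<bar>a\<bar> * b x = 0" if "x \<notin> V" for x using b(4) that by simp
  have "integrable \<mu> (\<lambda>x. \<bar>a\<bar> powr p * b x powr p)" using b(5) by (rule integrable_mult_right)
  then show "integrable \<mu> (\<lambda>x. (\<bar>a\<bar> * b x) powr p)" by (simp add: powr_mult)
  have "pgrad V (\<lambda>x. a * w x + c) (\<lambda>x. ennreal \<bar>a\<bar> * ennreal (b x))"
    by (rule pgrad_contraction[OF b(6)]) (auto simp: abs_mult[symmetric] algebra_simps)
  then show "pgrad V (\<lambda>x. a * w x + c) (\<lambda>x. ennreal (\<bar>a\<bar> * b x))"
    using b(3) by (simp add: ennreal_mult)
qed

lemma en_affine:
  assumes V: "open V" and w: "Dp p \<mu> V (\<lambda>x. ereal (w x))" and m: "meas w"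
  shows "en V (\<lambda>x. a * w x + c) \<le> ennreal (\<bar>a\<bar> powr p) * en V w"
proof -
  obtain b where b: "rgrad V w b" "en V w = ennreal (\<integral>x. b x powr p \<partial>\<mu>)"
    using energy_attained[OF V w] by blast
  note r = rgrad_affine[OF b(1), of a c]
  have "Dp p \<mu> V (\<lambda>x. ereal (a * w x + c))"
    by (rule Dp_pgradI[OF V _ rgradD(6,7)[OF r]]) (use m in measurable)
  from energy_le_rgrad[OF V this r]
  have "en V (\<lambda>x. a * w x + c) \<le> ennreal (\<integral>x. (\<bar>a\<bar> * b x) powr p \<partial>\<mu>)" .
  also have "\<dots> = ennreal (\<bar>a\<bar> powr p * (\<integral>x. b x powr p \<partial>\<mu>))" by (simp add: powr_mult)
  also have "\<dots> = ennreal (\<bar>a\<bar> powr p) * en V w"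
    unfolding b(2) by (intro ennreal_mult integral_nonneg_AE) auto
  finally show ?thesis .
qed

lemma adm_affine:
  assumes "adm F V w" shows "adm (\<lambda>x. a * F x + c) V (\<lambda>x. a * w x + c)"
proof -
  obtain h g where 1: "meas w" "\<And>x. x \<notin> V ==> w x = F x" "pgrad UNIV w h" "pgrad V w g" "bLp g"
    using assms unfolding adm_def by blast
  have *: "pgrad A (\<lambda>x. a * w x + c) (\<lambda>x. ennreal \<bar>a\<bar> * g x)" if "pgrad A w g" for A g
    by (rule pgrad_contraction[OF that]) (auto simp: abs_mult[symmetric] algebra_simps)
  have "bLp (\<lambda>x. ennreal \<bar>a\<bar> * g x)"
  proof -
    have m[measurable]: "g \<in> borel_measurable borel" using 1(5) by (simp add: bLp_def)
    have [measurable]: "meas g" by (rule borel_mu[OF m])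
    have "(\<integral>\<^sup>+x. epowr (ennreal \<bar>a\<bar> * g x) p \<partial>\<mu>) = epowr (ennreal \<bar>a\<bar>) p * (\<integral>\<^sup>+x. epowr (g x) p \<partial>\<mu>)"
      unfolding epowr_mult[OF p0(1)] by (rule nn_integral_cmult) measurable
    also have "\<dots> < \<infinity>" using 1(5) by (simp add: bLp_def ennreal_mult_less_top epowr_less_top)
    finally show ?thesis using m by (simp add: bLp_def)
  qed
  then show ?thesis
    by (intro admI[OF _ _ *[OF 1(3)] *[OF 1(4)]]) (use 1 in auto)
qed

text \<open>The inverse affine map takes competitors back to competitors, and the factors |a|^p and
  |1/a|^p of the two energy estimates cancel.\<close>

lemma minimizer_affine:
  assumes V: "open V" and w: "minimizer F V w" and a: "a \<noteq> 0"
  shows "minimizer (\<lambda>x. a * F x + c) V (\<lambda>x. a * w x + c)"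
  unfolding minimizer_def
proof (intro conjI allI impI)
  have wa: "adm F V w" using w by (simp add: minimizer_def)
  show "adm (\<lambda>x. a * F x + c) V (\<lambda>x. a * w x + c)" by (rule adm_affine[OF wa])
  fix v assume v: "adm (\<lambda>x. a * F x + c) V v"
  define v' where "v' x = (1/a) * v x + (- c / a)" for x
  have e: "(\<lambda>x. (1/a) * (a * F x + c) + (- c / a)) = F" using a by (auto simp: field_simps)
  have v': "adm F V v'" using adm_affine[OF v, of "1/a" "- c / a"] unfolding e v'_def[abs_def] .
  have m: "meas w" "meas v" using wa v by (auto simp: adm_def)
  have "en V (\<lambda>x. a * w x + c) \<le> ennreal (\<bar>a\<bar> powr p) * en V w" by (rule en_affine[OF V adm_Dp[OF V wa] m(1)])
  also have "\<dots> \<le> ennreal (\<bar>a\<bar> powr p) * en V v'" using w v' by (intro mult_left_mono) (auto simp: minimizer_def)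
  also have "\<dots> \<le> ennreal (\<bar>a\<bar> powr p) * (ennreal (\<bar>1/a\<bar> powr p) * en V v)"
    unfolding v'_def by (intro mult_left_mono en_affine[OF V adm_Dp[OF V v] m(2)]) auto
  also have "\<dots> = ennreal (\<bar>a\<bar> powr p * \<bar>1/a\<bar> powr p) * en V v" by (simp add: ennreal_mult mult.assoc)
  also have "\<bar>a\<bar> powr p * \<bar>1/a\<bar> powr p = (\<bar>a\<bar> * \<bar>1/a\<bar>) powr p" by (rule powr_mult[symmetric])
  also have "\<bar>a\<bar> * \<bar>1/a\<bar> = 1" using a by (simp add: abs_mult[symmetric])
  finally show "en V (\<lambda>x. a * w x + c) \<le> en V v" by simp
qed

section \<open>The Caccioppoli inequality\<close>

definition PC :: real where "PC = real (nat \<lceil>p\<rceil>)"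

lemma PC: "p \<le> real (nat \<lceil>p\<rceil>)" "2 \<le> nat \<lceil>p\<rceil>" "0 < PC"
proof -
  show 1: "p \<le> real (nat \<lceil>p\<rceil>)" using p0 by (metis le_of_int_ceiling of_nat_nat zero_le_ceiling less_imp_le less_trans zero_less_one neg_less_0_iff_less of_int_of_nat_eq order_less_le_trans)
  then have "1 < real (nat \<lceil>p\<rceil>)" using p1 by linarith
  then show "2 \<le> nat \<lceil>p\<rceil>" "0 < PC" unfolding PC_def by linarith+
qed

text \<open>The Caccioppoli inequality on superlevel sets, for all levels and all pairs of
  concentric balls inside \<open>V\<close>. Required of both \<open>u\<close> and
  \<open>- u\<close>, it is the condition that defines De Giorgi's class.\<close>

definition cacc :: "'a set => ('a => real) => ('a => real) => bool" where
  "cacc V u b \<longleftrightarrow> (\<forall>k x r R. 0 < r --> r < R --> cball x R \<subseteq> V -->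
     (\<integral>y. indicator {y \<in> ball x r. k < u y} y * b y powr p \<partial>\<mu>)
       \<le> (PC / (R - r)) powr p * ball_int x R (\<lambda>y. max (u y - k) 0 powr p))"

text \<open>Write \<zeta>^(n-1) d as \<zeta>^n (d/\<zeta>) and use convexity with weight \<zeta>^n:
  the second term becomes \<zeta>^(n-p) d^p, which is at most d^p because n \<ge> p. This is why the
  cutoff is raised to the power \<lceil>p\<rceil>.\<close>

lemma cutoff_pointwise:
  fixes a d \<zeta> :: real
  assumes "0 \<le> a" "0 \<le> d" "0 \<le> \<zeta>" "\<zeta> \<le> 1" and n: "n = nat \<lceil>p\<rceil>"
  shows "((1 - \<zeta> ^ n) * a + \<zeta> ^ (n - 1) * d) powr p \<le> (1 - \<zeta> ^ n) * a powr p + d powr p"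
proof (cases "\<zeta> = 0")
  case True
  then show ?thesis using PC n p1 by (simp add: power_0_left)
next
  case False
  then have \<zeta>: "0 < \<zeta>" using assms by simp
  have n1: "\<zeta> ^ (n - 1) * d = \<zeta> ^ n * (d / \<zeta>)"
    using \<zeta> PC(2) n p0 by (simp add: power_eq_if)
  have "((1 - \<zeta> ^ n) * a + \<zeta> ^ (n - 1) * d) powr p \<le> (1 - \<zeta> ^ n) * a powr p + \<zeta> ^ n * (d / \<zeta>) powr p"
    unfolding n1 using assms \<zeta> p1 by (intro powr_convex_combination) (auto intro: power_le_one)
  also have "\<zeta> ^ n * (d / \<zeta>) powr p = \<zeta> powr (real n - p) * d powr p"
    using \<zeta> assms by (simp add: powr_divide powr_diff powr_realpow)
  also have "\<dots> \<le> 1 * d powr p"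
    using \<zeta> assms PC(1) by (intro mult_right_mono powr_le1) auto
  finally show ?thesis by simp
qed

text \<open>The competitor is \<open>w - \<eta> (w - k)_+\<close> with \<open>\<eta> = \<zeta>^n\<close>; the factor \<open>\<eta>\<close> gained by convexity of the
  \<open>p\<close>-th power makes the energy on \<open>{w > k}\<close> absorb itself.\<close>

lemma minimizer_cacc:
  assumes V: "open V" "emeasure \<mu> V < \<infinity>" and w: "minimizer F V w" and wM: "\<And>x. \<bar>w x\<bar> \<le> M"
    and b: "rgrad V w b" "en V w = ennreal (\<integral>x. b x powr p \<partial>\<mu>)"
  shows "cacc V w b"
  unfolding cacc_def
proof (intro allI impI)
  fix k x r R assume rR: "0 < r" "r < R" "cball x R \<subseteq> V"
  define n where "n = nat \<lceil>p\<rceil>"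
  define L where "L = 1 / (R - r)"
  have L: "0 < L" using rR by (simp add: L_def)
  \<comment> \<open>The cutoff arises from \<open>\<zeta>0\<close> by a maximum with 0, because
    \<open>pgrad_max\<close> then confines its gradient to {\<zeta>0 > 0}, the ball of radius
    R.\<close>
  define \<zeta>0 where "\<zeta>0 y = min 1 (L * (R - dist x y))" for y
  define \<zeta> where "\<zeta> y = max (\<zeta>0 y) 0" for y
  have wa: "adm F V w" using w by (simp add: minimizer_def)
  obtain h where h: "pgrad UNIV w h" and wm[measurable]: "meas w" and wF: "\<And>x. x \<notin> V ==> w x = F x"
    using wa by (auto simp: adm_def)
  note B = rgradD[OF b(1)]
  note [measurable] = B(2)
  have "continuous_on UNIV \<zeta>0" unfolding \<zeta>0_def by (intro continuous_intros)
  then have \<zeta>0m[measurable]: "meas \<zeta>0" by (intro borel_mu borel_measurable_continuous_onI)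
  have \<zeta>m[measurable]: "meas \<zeta>" unfolding \<zeta>_def[abs_def] by measurable
  have \<zeta>01: "0 \<le> \<zeta> y" "\<zeta> y \<le> 1" for y by (auto simp: \<zeta>_def \<zeta>0_def)
  have \<zeta>pos: "0 < \<zeta>0 y \<longleftrightarrow> y \<in> ball x R" for y using L by (auto simp: \<zeta>0_def zero_less_mult_iff)
  have \<zeta>out: "\<zeta> y = 0" if "y \<notin> ball x R" for y using \<zeta>pos[of y] that by (auto simp: \<zeta>_def)
  have \<zeta>in: "\<zeta> y = 1" if "y \<in> ball x r" for y
  proof -
    have "1 \<le> L * (R - dist x y)" using that rR by (simp add: L_def field_simps)
    then show ?thesis by (simp add: \<zeta>_def \<zeta>0_def)
  qed
  have g\<zeta>0: "pgrad UNIV \<zeta>0 (\<lambda>_. ennreal L)"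
  proof (rule pgrad_lipschitz)
    fix y z
    have "\<bar>L * (R - dist x y) - L * (R - dist x z)\<bar> = L * \<bar>dist x z - dist x y\<bar>"
      using L by (simp add: abs_mult right_diff_distrib[symmetric])
    also have "\<dots> \<le> L * dist y z" using L abs_dist_diff_le[of y x z] by (intro mult_left_mono) (auto simp: dist_commute abs_minus_commute)
    finally show "\<bar>\<zeta>0 y - \<zeta>0 z\<bar> \<le> L * dist y z" unfolding \<zeta>0_def by linarith
  qed (use L in simp)
  define g\<zeta> where "g\<zeta> y = ennreal (L * indicator (ball x R) y)" for y
  have g\<zeta>: "pgrad UNIV \<zeta> g\<zeta>"
  proof -
    have "pgrad UNIV \<zeta> (\<lambda>y. if 0 < \<zeta>0 y then ennreal L else 0)"
      unfolding \<zeta>_def[abs_def] by (intro pgrad_max g\<zeta>0 pgrad_const) measurable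
    moreover have "(\<lambda>y. if 0 < \<zeta>0 y then ennreal L else 0) = g\<zeta>" by (auto simp: g\<zeta>_def \<zeta>pos fun_eq_iff indicator_def)
    ultimately show ?thesis by simp
  qed
  \<comment> \<open>In the code \<open>\<eta>\<close> denotes 1 - \<zeta>^n, the complement of the
    factor subtracted from w. The competitor min(w, k) + \<eta> (w - k)_+ equals w - \<zeta>^n (w -
    k)_+.\<close>
  define \<eta> where "\<eta> y = 1 - \<zeta> y ^ n" for y
  define g\<eta> where "g\<eta> y = ennreal \<bar>real n * \<zeta> y ^ (n - 1)\<bar> * g\<zeta> y" for y
  have g\<eta>: "pgrad UNIV \<eta> g\<eta>"
    unfolding \<eta>_def[abs_def] g\<eta>_def[abs_def]
    by (rule pgrad_contraction1[OF pgrad_power[OF g\<zeta> \<zeta>m]]) auto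
  have \<eta>m[measurable]: "meas \<eta>" unfolding \<eta>_def[abs_def] by measurable
  have \<eta>01: "0 \<le> \<eta> y" "\<eta> y \<le> 1" for y using \<zeta>01[of y] by (auto simp: \<eta>_def power_le_one)
  define f where "f y = max (w y - k) 0" for y
  have fm[measurable]: "meas f" unfolding f_def[abs_def] by measurable
  have gf: "pgrad A f (\<lambda>y. if k < w y then g y else 0)" if "pgrad A w g" for A g
  proof -
    have "pgrad A (\<lambda>y. w y - k) g" by (rule pgrad_contraction1[OF that]) auto
    from pgrad_max[OF this pgrad_const[of A 0]]
    have "pgrad A f (\<lambda>y. if 0 < w y - k then g y else 0)" unfolding f_def[abs_def] by simp
    moreover have "(\<lambda>y. if 0 < w y - k then g y else 0) = (\<lambda>y. if k < w y then g y else 0)" by (auto simp: fun_eq_iff)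
    ultimately show ?thesis by simp
  qed
  have gmin: "pgrad A (\<lambda>y. min (w y) k) (\<lambda>y. if w y < k then g y else 0)" if "pgrad A w g" for A g
    by (intro pgrad_min that pgrad_const) measurable
  define v where "v y = min (w y) k + \<eta> y * f y" for y
  define Gv where "Gv g y = (if w y < k then g y else 0) +
    (ennreal \<bar>f y\<bar> * g\<eta> y + ennreal \<bar>\<eta> y\<bar> * (if k < w y then g y else 0))" for g :: "'a => ennreal" and y
  have gv: "pgrad A v (Gv g)" if "pgrad A w g" for A g
    unfolding v_def[abs_def] Gv_def[abs_def]
    by (intro pgrad_add gmin that pgrad_mult gf egrad_subset[OF g\<eta>]) auto
  define d where "d y = (if w y < k then b y else 0) +
     (f y * (real n * \<zeta> y ^ (n - 1) * L * indicator (ball x R) y) + \<eta> y * (if k < w y then b y else 0))" for y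
  have f0: "0 \<le> f y" for y by (simp add: f_def)
  have d0: "0 \<le> d y" for y
    unfolding d_def using B(3)[of y] f0[of y] \<zeta>01[of y] \<eta>01[of y] L by (intro add_nonneg_nonneg mult_nonneg_nonneg) auto
  have Gd: "Gv (\<lambda>y. ennreal (b y)) y = ennreal (d y)" for y
  proof -
    have 1: "ennreal \<bar>f y\<bar> * g\<eta> y = ennreal (f y * (real n * \<zeta> y ^ (n - 1) * L * indicator (ball x R) y))"
      unfolding g\<eta>_def g\<zeta>_def using f0[of y] \<zeta>01[of y] L by (simp add: ennreal_mult[symmetric] mult.assoc)
    have 2: "ennreal \<bar>\<eta> y\<bar> * (if k < w y then ennreal (b y) else 0) = ennreal (\<eta> y * (if k < w y then b y else 0))"
      using \<eta>01[of y] B(3)[of y] by (simp add: ennreal_mult)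
    show ?thesis unfolding Gv_def 1 2 d_def
      using B(3)[of y] f0[of y] \<zeta>01[of y] \<eta>01[of y] L by (auto simp: ennreal_plus)
  qed
  have gvV: "pgrad V v (\<lambda>y. ennreal (d y))" 
  proof -
    have "Gv (\<lambda>x. ennreal (b x)) = (\<lambda>y. ennreal (d y))" by (rule ext) (rule Gd)
    then show ?thesis using gv[OF B(6)] by simp
  qed
  have vm: "meas v" unfolding v_def[abs_def] by measurable
  have vF: "v y = F y" if "y \<notin> V" for y
  proof -
    have "\<zeta> y = 0" using that rR(3) ball_subset_cball[of x R] by (intro \<zeta>out) blast
    then have "\<eta> y = 1" using PC(2) p0 by (simp add: \<eta>_def n_def power_0_left)
    then show ?thesis using wF[OF that] by (simp add: v_def f_def min_def max_def)
  qed
  have Vb: "V \<in> sets borel" using V by auto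
  define C where "C = (M + \<bar>k\<bar>) * (real n * L)"
  have fM: "f y \<le> M + \<bar>k\<bar>" for y using wM[of y] by (auto simp: f_def)
  have bL: "bLp (\<lambda>y. ennreal (b y) + (ennreal C * indicator V y + ennreal (b y)))"
    by (intro bLp_add B(7) bLp_const_indicator Vb V)
  have vadm: "adm F V v"
  proof (rule admI[OF vm vF gv[OF h] _ bL])
    show "pgrad V v (\<lambda>y. ennreal (b y) + (ennreal C * indicator V y + ennreal (b y)))"
    proof (rule egrad_mono_AE[OF gv[OF B(6)] bL], intro AE_I2 impI)
      fix y assume y: "y \<in> V"
      have "f y * (real n * \<zeta> y ^ (n - 1) * L * indicator (ball x R) y) \<le> (M + \<bar>k\<bar>) * (real n * 1 * L * 1)"
        using \<zeta>01[of y] L f0[of y] order_trans[OF f0[of y] fM[of y]]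
        by (intro mult_mono fM) (auto simp: power_le_one indicator_def)
      then have 1: "ennreal \<bar>f y\<bar> * g\<eta> y \<le> ennreal C"
        unfolding g\<eta>_def g\<zeta>_def using f0[of y] \<zeta>01[of y] L
        by (simp add: ennreal_mult[symmetric] mult.assoc C_def ennreal_leI)
      have 2: "ennreal \<bar>\<eta> y\<bar> * (if k < w y then ennreal (b y) else 0) \<le> 1 * ennreal (b y)"
        using \<eta>01[of y] by (intro mult_mono) auto
      show "Gv (\<lambda>y. ennreal (b y)) y \<le> ennreal (b y) + (ennreal C * indicator V y + ennreal (b y))"
        unfolding Gv_def using 1 2 y by (intro add_mono) auto
    qed
  qed
  define Q where "Q y = indicator (ball x R) y * (real n * L * f y) powr p" for y
  define E where "E y = \<zeta> y ^ n * (if k < w y then b y powr p else 0)" for y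
  \<comment> \<open>Above level k this is \<open>cutoff_pointwise\<close>, with the term from the
    gradient of the cutoff in the role of its d; at or below k the competitor agrees with w.\<close>
  have dle: "d y powr p \<le> b y powr p - E y + Q y" for y
  proof (cases "k < w y")
    case True
    have "d y = (1 - \<zeta> y ^ n) * b y + \<zeta> y ^ (n - 1) * (real n * L * f y * indicator (ball x R) y)"
      using True by (simp add: d_def \<eta>_def mult_ac)
    then have "d y powr p \<le> (1 - \<zeta> y ^ n) * b y powr p + (real n * L * f y * indicator (ball x R) y) powr p"
      using L f0[of y] by (simp only:) (intro cutoff_pointwise B(3) \<zeta>01 n_def mult_nonneg_nonneg; simp)
    also have "\<dots> = b y powr p - E y + Q y" using True p0 by (simp add: E_def Q_def algebra_simps indicator_def)
    finally show ?thesis .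
  next
    case False
    have "d y \<le> b y" using False B(3)[of y] by (auto simp: d_def f_def)
    then have "d y powr p \<le> b y powr p" using d0 p0 by (intro powr_mono2) auto
    moreover have "E y = 0" "0 \<le> Q y" using False by (auto simp: E_def Q_def)
    ultimately show ?thesis by simp
  qed
  have Ei: "integrable \<mu> E"
  proof (rule Bochner_Integration.integrable_bound[OF B(5)])
    show "meas E" unfolding E_def[abs_def] by measurable
    show "AE y in \<mu>. norm (E y) \<le> norm (b y powr p)"
      using \<zeta>01 by (intro AE_I2) (auto simp: E_def abs_mult power_le_one mult_left_le_one_le)
  qed
  have Bm: "ball x R \<in> sets \<mu>" by auto
  have Qi: "integrable \<mu> Q"
  proof (rule Bochner_Integration.integrable_bound)
    have "emeasure \<mu> (ball x R) \<le> emeasure \<mu> V"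
      using rR(3) ball_subset_cball[of x R] V(1) by (intro emeasure_mono) auto
    then show "integrable \<mu> (\<lambda>y. (real n * L * (M + \<bar>k\<bar>)) powr p * indicator (ball x R) y)"
      using V(2) Bm by (intro integrable_mult_right integrable_real_indicator) auto
    show "meas Q" unfolding Q_def[abs_def] using Bm by measurable
    show "AE y in \<mu>. norm (Q y) \<le> norm ((real n * L * (M + \<bar>k\<bar>)) powr p * indicator (ball x R) y)"
      using L f0 fM p0 by (intro AE_I2) (auto simp: Q_def indicator_def intro!: powr_mono2 mult_left_mono)
  qed
  have rhs: "integrable \<mu> (\<lambda>y. b y powr p - E y + Q y)" using B(5) Ei Qi by auto
  have di: "integrable \<mu> (\<lambda>y. indicator V y * d y powr p)"
  proof (rule Bochner_Integration.integrable_bound[OF rhs])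
    have "meas d" unfolding d_def[abs_def] using Bm by measurable
    then show "meas (\<lambda>y. indicator V y * d y powr p)" using V(1) by measurable
    show "AE y in \<mu>. norm (indicator V y * d y powr p) \<le> norm (b y powr p - E y + Q y)"
      using dle by (intro AE_I2) (auto simp: indicator_def intro: order_trans[OF _ abs_ge_self])
  qed
  have "en V w \<le> en V v" using w vadm by (simp add: minimizer_def)
  also have "\<dots> \<le> ennreal (\<integral>y. indicator V y * d y powr p \<partial>\<mu>)"
    by (rule energy_le[OF V(1) adm_Dp[OF V(1) vadm] gvV d0 di])
  also have "(\<integral>y. indicator V y * d y powr p \<partial>\<mu>) \<le> (\<integral>y. b y powr p - E y + Q y \<partial>\<mu>)"
  proof (rule integral_mono[OF di rhs])
    show "indicator V y * d y powr p \<le> b y powr p - E y + Q y" for y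
      using dle[of y] powr_ge_zero[of "d y" p] by (auto simp: indicator_def simp del: powr_ge_zero)
  qed
  also have "(\<integral>y. b y powr p - E y + Q y \<partial>\<mu>) = (\<integral>y. b y powr p \<partial>\<mu>) - (\<integral>y. E y \<partial>\<mu>) + (\<integral>y. Q y \<partial>\<mu>)"
    using B(5) Ei Qi by simp
  finally have fin: "ennreal (\<integral>y. b y powr p \<partial>\<mu>) \<le> ennreal ((\<integral>y. b y powr p \<partial>\<mu>) - (\<integral>y. E y \<partial>\<mu>) + (\<integral>y. Q y \<partial>\<mu>))"
    unfolding b(2) by (simp add: ennreal_leI)
  have E0: "0 \<le> (\<integral>y. E y \<partial>\<mu>)" and Q0: "0 \<le> (\<integral>y. Q y \<partial>\<mu>)" and b0: "0 \<le> (\<integral>y. b y powr p \<partial>\<mu>)"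
    using \<zeta>01 by (auto intro!: integral_nonneg_AE simp: E_def Q_def)
  have EQ: "(\<integral>y. E y \<partial>\<mu>) \<le> (\<integral>y. Q y \<partial>\<mu>)"
  proof (rule ccontr)
    assume "\<not> ?thesis"
    then have lt: "(\<integral>y. b y powr p \<partial>\<mu>) - (\<integral>y. E y \<partial>\<mu>) + (\<integral>y. Q y \<partial>\<mu>) < (\<integral>y. b y powr p \<partial>\<mu>)" by simp
    \<comment> \<open>\<open>ennreal\<close> sends negative numbers to 0, so \<open>fin\<close>
      contradicts \<open>lt\<close> directly only if the energy of \<open>w\<close> is
      positive.\<close>
    show False
    proof (cases "0 < (\<integral>y. b y powr p \<partial>\<mu>)")
      case True
      then show False using fin lt by (metis ennreal_less_iff linorder_not_le ennreal_lessI)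
    next
      case False
      have "(\<integral>y. E y \<partial>\<mu>) \<le> (\<integral>y. b y powr p \<partial>\<mu>)"
        using \<zeta>01 by (intro integral_mono Ei B(5)) (auto simp: E_def power_le_one mult_left_le_one_le)
      then show False using False lt Q0 E0 by linarith
    qed
  qed
  have Em: "{y \<in> ball x r. k < w y} \<in> sets \<mu>"
  proof -
    have "{y \<in> ball x r. k < w y} = {y \<in> space \<mu>. k < w y} \<inter> ball x r" by auto
    then show ?thesis by (simp add: sets.Int)
  qed
  have "(\<integral>y. indicator {y \<in> ball x r. k < w y} y * b y powr p \<partial>\<mu>) \<le> (\<integral>y. E y \<partial>\<mu>)"
  proof (rule integral_mono[OF _ Ei])
    show "integrable \<mu> (\<lambda>y. indicator {y \<in> ball x r. k < w y} y * b y powr p)"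
    proof (rule Bochner_Integration.integrable_bound[OF B(5)])
      show "(\<lambda>y. indicator {y \<in> ball x r. k < w y} y * b y powr p) \<in> borel_measurable \<mu>"
        using Em B(2) by (intro borel_measurable_times borel_measurable_indicator) measurable
    qed (auto simp: indicator_def)
    show "indicator {y \<in> ball x r. k < w y} y * b y powr p \<le> E y" for y
      using \<zeta>in[of y] \<zeta>01[of y] by (auto simp: E_def indicator_def)
  qed
  also note EQ
  also have "(\<integral>y. Q y \<partial>\<mu>) = (PC / (R - r)) powr p * ball_int x R (\<lambda>y. max (w y - k) 0 powr p)"
  proof -
    have "Q y = (PC / (R - r)) powr p * (indicator (ball x R) y * max (w y - k) 0 powr p)" for y
      unfolding Q_def f_def PC_def n_def L_def by (simp add: powr_mult powr_divide)
    then show ?thesis by simp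
  qed
  finally show "(\<integral>y. indicator {y \<in> ball x r. k < w y} y * b y powr p \<partial>\<mu>)
     \<le> (PC / (R - r)) powr p * ball_int x R (\<lambda>y. max (w y - k) 0 powr p)" .
qed

end

section \<open>De Giorgi's class: from small density to a pointwise bound\<close>

context pi_space
begin

text \<open>Collects all that the proof of continuity uses of a minimizer. The class is symmetric
  under u \<mapsto> - u, which the oscillation estimate exploits.\<close>

definition dg :: "'a set => ('a => real) => ('a => real) => bool" where
  "dg V u b \<longleftrightarrow> (\<exists>z R. V \<subseteq> ball z R) \<and> meas u \<and> (\<exists>M. \<forall>y. \<bar>u y\<bar> \<le> M) \<and>
     rgrad V u b \<and> cacc V u b \<and> cacc V (\<lambda>y. - u y) b"

lemma dg_uminus: "dg V u b ==> dg V (\<lambda>y. - u y) b"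
  unfolding dg_def rgrad_def by (auto intro: pgrad_uminus[of V u, simplified])

text \<open>Truncations are extended by zero, which the local Poincare inequality permits.\<close>

lemma dg_truncation:
  assumes V: "open V" and d: "dg V u b"
  shows "(\<lambda>y. if y \<in> V then max (u y - k) 0 else 0) \<in> borel_measurable \<mu>"
    and "\<exists>M. \<forall>y. \<bar>if y \<in> V then max (u y - k) 0 else 0\<bar> \<le> M"
    and "pgrad V (\<lambda>y. if y \<in> V then max (u y - k) 0 else 0) (\<lambda>y. ennreal (if k < u y then b y else 0))"
proof -
  have um[measurable]: "meas u" and [measurable]: "V \<in> sets \<mu>" using d V by (auto simp: dg_def)
  note B = rgradD[of V u b]
  have r: "rgrad V u b" using d by (simp add: dg_def)
  note [measurable] = B(2)[OF r]
  show "(\<lambda>y. if y \<in> V then max (u y - k) 0 else 0) \<in> borel_measurable \<mu>" by measurable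
  obtain M where "\<And>y. \<bar>u y\<bar> \<le> M" using d by (auto simp: dg_def)
  then have "\<bar>if y \<in> V then max (u y - k) 0 else 0\<bar> \<le> M + \<bar>k\<bar>" for y by (smt (verit))
  then show "\<exists>M. \<forall>y. \<bar>if y \<in> V then max (u y - k) 0 else 0\<bar> \<le> M" by blast
  have g: "pgrad V (\<lambda>y. u y - k) (\<lambda>y. ennreal (b y))"
    by (rule pgrad_contraction1[OF B(6)[OF r]]) auto
  show "pgrad V (\<lambda>y. if y \<in> V then max (u y - k) 0 else 0) (\<lambda>y. ennreal (if k < u y then b y else 0))"
    by (rule pgrad_cong[OF pgrad_max[OF g pgrad_const[of V 0]]]) auto
qed

lemma AE_from_measure_zero:
  assumes "A \<in> sets \<mu>" "A \<subseteq> ball z R" "measure \<mu> A = 0" shows "AE y in \<mu>. y \<notin> A"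
proof -
  have "emeasure \<mu> A \<noteq> top" using subset_ball_finite[OF assms(2)] by (simp add: less_top)
  then have "emeasure \<mu> A = 0"
    using assms(3) by (simp add: measure_def enn2real_eq_0_iff)
  then show ?thesis using assms(1) by (intro AE_not_in) (simp add: null_setsI)
qed

lemma superlevel_mu[measurable]:
  assumes "(u :: 'a => real) \<in> borel_measurable \<mu>"
  shows "{y. k < u y} \<inter> ball x R \<in> sets \<mu>" "{y \<in> ball x R. k < u y} \<in> sets \<mu>"
    "{y. u y \<le> k} \<inter> ball x R \<in> sets \<mu>"
proof -
  have "{y \<in> space \<mu>. k < u y} \<in> sets \<mu>" "{y \<in> space \<mu>. u y \<le> k} \<in> sets \<mu>" using assms by measurable
  then have 1: "{y. k < u y} \<in> sets \<mu>" "{y. u y \<le> k} \<in> sets \<mu>" by simp_all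
  then show "{y. k < u y} \<inter> ball x R \<in> sets \<mu>" "{y. u y \<le> k} \<inter> ball x R \<in> sets \<mu>" by auto
  moreover have "{y \<in> ball x R. k < u y} = {y. k < u y} \<inter> ball x R" by auto
  ultimately show "{y \<in> ball x R. k < u y} \<in> sets \<mu>" by simp
qed

text \<open>Iteration over radii decreasing from R to R/2 and levels increasing from k to k + T/2,
  both with gaps of order 2^-j. The truncations are estimated by \<open>weak_sobolev\<close> at
  radii of order 4^-j and their energies by the Caccioppoli inequality; the superlevel sets
  \<open>A j\<close> shrink in measure by 1 / Cd^2 per step.\<close>

lemma de_giorgi:
  "\<exists>\<epsilon>>0. \<forall>V u b k T x R. open V --> dg V u b --> 0 < R --> 0 < T --> cball x R \<subseteq> V -->
     (AE y in \<mu>. y \<in> ball x R --> u y \<le> k + T) --> measure \<mu> ({y. k < u y} \<inter> ball x R) \<le> \<epsilon> * bm x R -->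
     (AE y in \<mu>. y \<in> ball x (R/2) --> u y \<le> k + T/2)"
proof -
  define c where "c = (1 / (KS * Cd^2)) powr (1/p)"
  have c: "0 < c" using KS_pos Cd by (simp add: c_def)
  \<comment> \<open>The first bound fits balls of radius \<tau> \<rho> into the gap between
    successive balls, the second makes each step of the iteration a contraction by 1 / Cd^2.\<close>
  obtain n0 where n0: "(1/2)^n0 < min (1 / (8 * \<tau>)) (c / (32 * PC))"
    using real_arch_pow_inv[of "min (1 / (8 * \<tau>)) (c / (32 * PC))" "1/2"] \<tau>1 c PC(3) by auto
  have n0a: "\<tau> * (1/2)^n0 \<le> 1/8"
  proof -
    have "(1/2)^n0 \<le> 1 / (8 * \<tau>)" using n0 by simp
    then have "\<tau> * (1/2)^n0 \<le> \<tau> * (1 / (8 * \<tau>))" using \<tau>1 by (intro mult_left_mono) auto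
    then show ?thesis using \<tau>1 by simp
  qed
  have n0b: "KS * (32 * PC * (1/2)^n0) powr p \<le> 1 / Cd^2"
  proof -
    have "32 * PC * (1/2)^n0 \<le> 32 * PC * (c / (32 * PC))" using n0 PC(3) by (intro mult_left_mono) auto
    also have "\<dots> = c" using PC(3) by simp
    finally have "(32 * PC * (1/2)^n0) powr p \<le> c powr p" using p0 PC(3) by (intro powr_mono2) auto
    also have "\<dots> = 1 / (KS * Cd^2)" unfolding c_def using p0 KS_pos Cd by (simp add: powr_powr)
    finally have "KS * (32 * PC * (1/2)^n0) powr p \<le> KS * (1 / (KS * Cd^2))" using KS_pos by (intro mult_left_mono) auto
    then show ?thesis using KS_pos by simp
  qed
  \<comment> \<open>n0 + 2j + 1 doublings lead from the radius \<open>\<rho>\<close> of step j to 2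
    R, and Cd^(2j) of the resulting factor is offset by the decay already proved. What is left,
    \<epsilon> Cd^(n0+1), has to be the 1/2 required by \<open>weak_sobolev\<close>.\<close>
  define \<epsilon> where "\<epsilon> = 1 / (2 * Cd^(n0+1))"
  have \<epsilon>: "0 < \<epsilon>" using Cd by (simp add: \<epsilon>_def)
  have "AE y in \<mu>. y \<in> ball x (R/2) --> u y \<le> k + T/2"
    if V: "open V" and d: "dg V u b" and R: "0 < R" and T: "0 < T" and sub: "cball x R \<subseteq> V"
      and up: "AE y in \<mu>. y \<in> ball x R --> u y \<le> k + T" and small: "measure \<mu> ({y. k < u y} \<inter> ball x R) \<le> \<epsilon> * bm x R"
    for V u b k T x R
  proof -
    define h where "h j = (1/2::real)^j" for j :: nat
    have h: "0 < h j" "h j \<le> 1" "h (Suc j) = h j / 2" for j by (auto simp: h_def power_le_one)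
    define r where "r j = R/2 * (1 + h j)" for j
    define \<kappa> where "\<kappa> j = k + T/2 * (1 - h j)" for j
    define A where "A j = {y. \<kappa> j < u y} \<inter> ball x (r j)" for j
    define a where "a j = measure \<mu> (A j)" for j
    obtain z R0 where VR: "V \<subseteq> ball z R0" using d by (auto simp: dg_def)
    have um[measurable]: "meas u" using d by (simp add: dg_def)
    have rg: "rgrad V u b" using d by (simp add: dg_def)
    note B = rgradD[OF rg]
    note [measurable] = B(2)
    have ca: "cacc V u b" using d by (simp add: dg_def)
    have rj: "0 < r j" "r j \<le> R" "r (Suc j) = r j - R * h j / 4" for j
    proof -
      show "0 < r j" unfolding r_def using R h(1)[of j] by (intro mult_pos_pos add_pos_pos) auto
      have "R * h j \<le> R * 1" using R h(2)[of j] by (intro mult_left_mono) auto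
      then show "r j \<le> R" by (simp add: r_def algebra_simps)
      show "r (Suc j) = r j - R * h j / 4" by (simp add: r_def h(3) algebra_simps)
    qed
    have Am: "A j \<in> sets \<mu>" for j unfolding A_def by measurable
    have bs: "cball x s \<subseteq> V" if "s \<le> R" for s using sub subset_cball[OF that, of x] by blast
    have step: "a (Suc j) \<le> \<epsilon> * (1 / Cd^2)^(Suc j) * bm x R" if aj: "a j \<le> \<epsilon> * (1 / Cd^2)^j * bm x R" for j
    proof -
      define \<rho> where "\<rho> = R * (1/2)^(n0 + 2*j)"
      have \<rho>: "0 < \<rho>" using R by (simp add: \<rho>_def)
      \<comment> \<open>An intermediate radius: \<open>weak_sobolev\<close> uses the gap between r
        (Suc j) and \<open>r'\<close>, the Caccioppoli inequality the gap between \<open>r'\<close>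
        and r j.\<close>
      define r' where "r' = r (Suc j) + R * h j / 8"
      have r': "r' = r j - R * h j / 8" "0 < r'" "r' < r j" unfolding r'_def using rj[of j] rj(1)[of "Suc j"] R h(1)[of j]
        by (auto intro!: add_pos_pos mult_pos_pos divide_pos_pos)
      have \<tau>\<rho>: "\<tau> * \<rho> \<le> R * h j / 8"
      proof -
        have "(1/2::real)^(n0 + 2*j) = (1/2)^n0 * (h j * h j)" by (simp add: h_def power_add mult_2)
        then have "\<tau> * \<rho> = (\<tau> * (1/2)^n0) * (R * (h j * h j))" by (simp add: \<rho>_def)
        also have "\<dots> \<le> 1/8 * (R * (h j * 1))" using n0a R h[of j] \<tau>1 by (intro mult_mono) auto
        finally show ?thesis by simp
      qed
      have \<rho>le: "\<rho> \<le> \<tau> * \<rho>" using \<tau>1 \<rho> by simp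
      define t where "t = T/4 * h j"
      have t: "0 < t" using T h(1) by (simp add: t_def)
      define f where "f = (\<lambda>y. if y \<in> V then max (u y - \<kappa> j) 0 else 0)"
      define bj where "bj = (\<lambda>y. if \<kappa> j < u y then b y else 0)"
      have tr1: "meas f" unfolding f_def by (rule dg_truncation(1)[OF V d])
      have tr3: "pgrad V f (\<lambda>y. ennreal (bj y))" unfolding f_def bj_def by (rule dg_truncation(3)[OF V d])
      obtain M where M: "\<And>y. \<bar>f y\<bar> \<le> M" using dg_truncation(2)[OF V d, of "\<kappa> j"] unfolding f_def by blast
      have bj0: "0 \<le> bj y" for y using B(3) by (simp add: bj_def)
      have sball: "cball y (\<tau> * \<rho>) \<subseteq> ball x r'" if "y \<in> ball x (r (Suc j))" for y
      proof
        fix w assume "w \<in> cball y (\<tau> * \<rho>)"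
        then have "dist x w < r (Suc j) + R * h j / 8" using that \<tau>\<rho> dist_triangle[of x w y] by auto
        then show "w \<in> ball x r'" by (simp add: r'_def)
      qed
      have main: "t powr p * measure \<mu> (A (Suc j)) \<le> KS * \<rho> powr p * (\<integral>y. indicator (ball x r') y * bj y powr p \<partial>\<mu>)"
      proof (rule weak_sobolev[OF tr1 M _ _ tr3 bj0])
        show "f y = 0" if "y \<notin> ball z R0" for y using that VR by (auto simp: f_def)
        show "0 \<le> f y" for y by (simp add: f_def)
        show "ball x r' \<subseteq> V" using bs[of r'] r' rj(2)[of j] ball_subset_cball[of x r'] by fastforce
        show "ball x r' \<in> sets \<mu>" by simp
        show "integrable \<mu> (\<lambda>y. indicator (ball x r') y * bj y powr p)"
        proof (rule Bochner_Integration.integrable_bound[OF B(5)])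
          show "meas (\<lambda>y. indicator (ball x r') y * bj y powr p)" unfolding bj_def by measurable
        qed (auto simp: bj_def indicator_def)
        show "A (Suc j) \<in> sets \<mu>" by (rule Am)
        show "A (Suc j) \<subseteq> ball z R0"
          using VR bs[OF rj(2)[of "Suc j"]] ball_subset_cball[of x "r (Suc j)"] unfolding A_def by blast
        show "0 < t" by (rule t)
        show "0 < \<rho>" by (rule \<rho>)
        fix y assume y: "y \<in> A (Suc j)"
        then have yb: "y \<in> ball x (r (Suc j))" by (simp add: A_def)
        have "y \<in> V" using yb bs[OF rj(2)[of "Suc j"]] by auto
        moreover have "\<kappa> (Suc j) = \<kappa> j + t" unfolding \<kappa>_def t_def h(3) by (simp add: field_simps)
        ultimately show "t \<le> f y" using y by (auto simp: A_def f_def le_max_iff_disj)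
        show "cball y (\<tau> * \<rho>) \<subseteq> ball x r'" by (rule sball[OF yb])
        have byr: "ball y \<rho> \<subseteq> ball x (r j)"
          using sball[OF yb] ball_subset_cball[of y \<rho>] subset_cball[OF \<rho>le, of y] subset_ball[of r' "r j" x] r'(3) by force
        have "measure \<mu> ({y. 0 < f y} \<inter> ball y \<rho>) \<le> a j" unfolding a_def
        proof (rule bounded_measure_mono[of _ _ x "r j"])
          show "{y. 0 < f y} \<inter> ball y \<rho> \<subseteq> A j" using byr by (auto simp: f_def A_def split: if_splits)
          have "{y \<in> space \<mu>. 0 < f y} \<in> sets \<mu>" using tr1 by measurable
          then show "{y. 0 < f y} \<inter> ball y \<rho> \<in> sets \<mu>" by auto
        qed (use Am in \<open>auto simp: A_def\<close>)
        also have "\<dots> \<le> \<epsilon> * (1 / Cd^2)^j * bm x R" by (rule aj)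
        also have "bm x R \<le> bm y (2^(n0 + 2*j + 1) * \<rho>)"
        proof (rule bm_mono)
          have e: "2^(n0 + 2*j + 1) * \<rho> = 2 * R" by (simp add: \<rho>_def power_divide)
          have yR: "dist y x < R" using yb rj(2)[of "Suc j"] by (simp add: dist_commute)
          have "dist y w < 2 * R" if "dist x w < R" for w
            using dist_triangle[of y w x] that yR by linarith
          then show "ball x R \<subseteq> ball y (2^(n0 + 2*j + 1) * \<rho>)" unfolding e by auto
        qed
        also have "\<dots> \<le> Cd^(n0 + 2*j + 1) * bm y \<rho>" by (rule bm_double_pow[OF \<rho>])
        finally have "measure \<mu> ({y. 0 < f y} \<inter> ball y \<rho>) \<le> \<epsilon> * (1 / Cd^2)^j * (Cd^(n0 + 2*j + 1) * bm y \<rho>)"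
          using \<epsilon> Cd by (simp add: mult_left_mono)
        also have "\<dots> = bm y \<rho> / 2"
        proof -
          have "(1 / Cd^2)^j * Cd^(n0 + 2*j + 1) = Cd^(n0 + 1)"
            using Cd by (simp add: power_divide power_mult power_add)
          then show ?thesis using Cd by (simp add: \<epsilon>_def mult.assoc[symmetric])
        qed
        finally show "measure \<mu> ({y. 0 < f y} \<inter> ball y \<rho>) \<le> bm y \<rho> / 2" .
      qed
      have "(\<integral>y. indicator (ball x r') y * bj y powr p \<partial>\<mu>) = (\<integral>y. indicator {y \<in> ball x r'. \<kappa> j < u y} y * b y powr p \<partial>\<mu>)"
        using p0 by (intro Bochner_Integration.integral_cong) (auto simp: bj_def indicator_def)
      also have "\<dots> \<le> (PC / (r j - r')) powr p * ball_int x (r j) (\<lambda>y. max (u y - \<kappa> j) 0 powr p)"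
        by (rule ca[unfolded cacc_def, rule_format, OF r'(2,3) bs[OF rj(2)]])
      also have "ball_int x (r j) (\<lambda>y. max (u y - \<kappa> j) 0 powr p) \<le> (\<integral>y. T powr p * indicator (A j) y \<partial>\<mu>)"
      proof (rule integral_mono_AE)
        show "integrable \<mu> (\<lambda>y. T powr p * indicator (A j) y)"
          using Am[of j] subset_ball_finite[of "A j" x "r j"]
          by (intro integrable_mult_right integrable_real_indicator) (auto simp: A_def)
        have ae: "AE y in \<mu>. indicator (ball x (r j)) y * max (u y - \<kappa> j) 0 powr p \<le> T powr p * indicator (A j) y"
          using up
        proof eventually_elim
          case (elim y)
          show ?case
          proof (cases "y \<in> A j")
            case True
            then have "y \<in> ball x R" using rj(2)[of j] by (auto simp: A_def)
            then have "u y \<le> k + T" using elim by simp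
            moreover have "k \<le> \<kappa> j" using T h[of j] by (simp add: \<kappa>_def)
            ultimately show ?thesis using True p0 T by (auto simp: A_def indicator_def intro!: powr_mono2)
          next
            case False
            then show ?thesis using p0 by (auto simp: A_def indicator_def max_def)
          qed
        qed
        then show "AE y in \<mu>. indicator (ball x (r j)) y * max (u y - \<kappa> j) 0 powr p \<le> T powr p * indicator (A j) y" .
        show "integrable \<mu> (\<lambda>y. indicator (ball x (r j)) y * max (u y - \<kappa> j) 0 powr p)"
          by (rule Bochner_Integration.integrable_bound[OF \<open>integrable \<mu> (\<lambda>y. T powr p * indicator (A j) y)\<close>], measurable, rule eventually_mono[OF ae]) auto
      qed
      also have "(\<integral>y. T powr p * indicator (A j) y \<partial>\<mu>) = T powr p * a j" using Am[of j] by (simp add: a_def)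
      finally have "(\<integral>y. indicator (ball x r') y * bj y powr p \<partial>\<mu>) \<le> (PC / (r j - r')) powr p * (T powr p * a j)"
        by (simp add: mult_left_mono)
      also have "r j - r' = R * h j / 8" by (simp add: r'(1))
      finally have "KS * \<rho> powr p * (\<integral>y. indicator (ball x r') y * bj y powr p \<partial>\<mu>)
         \<le> KS * \<rho> powr p * ((PC / (R * h j / 8)) powr p * (T powr p * a j))"
        using KS_pos by (intro mult_left_mono) auto
      with main have "t powr p * a (Suc j) \<le> KS * \<rho> powr p * ((PC / (R * h j / 8)) powr p * (T powr p * a j))"
        unfolding a_def by linarith
      also have "\<dots> = t powr p * (KS * (32 * PC * (1/2)^n0) powr p * a j)"
      proof -
        have "\<rho> powr p * ((PC / (R * h j / 8)) powr p * T powr p) = (\<rho> * ((PC / (R * h j / 8)) * T)) powr p"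
          by (simp only: powr_mult)
        \<comment> \<open>\<open>\<rho>\<close> carries h j twice: one factor compensates the
          Caccioppoli constant, the other the level gap \<open>t\<close>. So the contraction factor
          is the same in all steps.\<close>
        also have "\<rho> * ((PC / (R * h j / 8)) * T) = t * (32 * PC * (1/2)^n0)"
        proof -
          have "\<rho> = R * ((1/2)^n0 * (h j * h j))" by (simp add: \<rho>_def h_def power_add mult_2)
          then show ?thesis using R h(1)[of j] by (simp add: t_def field_simps)
        qed
        also have "\<dots> powr p = t powr p * (32 * PC * (1/2)^n0) powr p" by (rule powr_mult)
        finally show ?thesis by (simp add: mult_ac)
      qed
      finally have "a (Suc j) \<le> KS * (32 * PC * (1/2)^n0) powr p * a j" using t by simp
      also have "\<dots> \<le> 1 / Cd^2 * a j" by (intro mult_right_mono n0b) (simp add: a_def)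
      also have "\<dots> \<le> 1 / Cd^2 * (\<epsilon> * (1 / Cd^2)^j * bm x R)" by (intro mult_left_mono aj) auto
      finally show ?thesis by (simp add: mult_ac)
    qed
    have aj: "a j \<le> \<epsilon> * (1 / Cd^2)^j * bm x R" for j
    proof (induction j)
      case 0
      have "\<kappa> 0 = k" "r 0 = R" by (auto simp: \<kappa>_def r_def h_def)
      then show ?case using small by (simp add: a_def A_def)
    qed (rule step)
    define Z where "Z = {y. k + T/2 < u y} \<inter> ball x (R/2)"
    have Zm: "Z \<in> sets \<mu>" unfolding Z_def by measurable
    have "measure \<mu> Z \<le> \<epsilon> * (1 / Cd^2)^j * bm x R" for j
    proof -
      have "Z \<subseteq> A j"
      proof
        fix y assume y: "y \<in> Z"
        have "\<kappa> j \<le> k + T/2" using T h(1)[of j] by (simp add: \<kappa>_def field_simps)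
        moreover have "R/2 \<le> r j" using R h(1)[of j] by (simp add: r_def)
        ultimately show "y \<in> A j" using y by (auto simp: Z_def A_def)
      qed
      then have "measure \<mu> Z \<le> a j" unfolding a_def
        using Zm Am[of j] by (intro bounded_measure_mono[of _ _ x "r j"]) (auto simp: A_def)
      then show ?thesis using aj[of j] by simp
    qed
    moreover have "(\<lambda>j. \<epsilon> * (1 / Cd^2)^j * bm x R) \<longlonglongrightarrow> \<epsilon> * 0 * bm x R"
    proof (intro tendsto_mult tendsto_const LIMSEQ_power_zero)
      have "2^2 \<le> Cd^2" using Cd by (intro power_mono) auto
      then have "1 < Cd^2" by simp
      then show "norm (1 / Cd^2) < 1" by (simp add: divide_less_eq)
    qed
    ultimately have "measure \<mu> Z \<le> 0" by (intro LIMSEQ_le_const[of _ "\<epsilon> * 0 * bm x R", simplified]) auto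
    then have "measure \<mu> Z = 0" by (simp add: antisym)
    then have "AE y in \<mu>. y \<notin> Z" using Zm by (intro AE_from_measure_zero[of Z x "R/2"]) (auto simp: Z_def)
    then show ?thesis by eventually_elim (auto simp: Z_def not_less)
  qed
  then show ?thesis using \<epsilon> by blast
qed

end

lemma powr_sum_single:
  fixes x :: "'i => real"
  assumes "finite I" "\<And>i j. i \<in> I ==> j \<in> I ==> i \<noteq> j ==> x i = 0 \<or> x j = 0"
  shows "(\<Sum>i\<in>I. x i) powr p = (\<Sum>i\<in>I. x i powr p)"
proof (cases "\<exists>i\<in>I. x i \<noteq> 0")
  case True
  then obtain i where i: "i \<in> I" "x i \<noteq> 0" by blast
  then have z: "x j = 0" if "j \<in> I - {i}" for j using assms(2)[of i j] that by auto
  have "(\<Sum>j\<in>I - {i}. x j) = 0" "(\<Sum>j\<in>I - {i}. x j powr p) = 0" using z by (auto intro!: sum.neutral)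
  then show ?thesis using sum.remove[OF assms(1) i(1), of x] sum.remove[OF assms(1) i(1), of "\<lambda>j. x j powr p"] by simp
qed auto

context borel_mm
begin

lemma pgrad_sum:
  assumes "\<And>j. j < (N::nat) ==> pgrad A (w j) (g j)"
  shows "pgrad A (\<lambda>y. \<Sum>j<N. w j y) (\<lambda>y. \<Sum>j<N. g j y)"
  using assms
proof (induction N)
  case 0
  then show ?case using pgrad_const[of A 0] by simp
next
  case (Suc N)
  have "pgrad A (\<lambda>y. (\<Sum>j<N. w j y) + w N y) (\<lambda>y. (\<Sum>j<N. g j y) + g N y)"
    using Suc by (intro pgrad_add) auto
  then show ?case by simp
qed

text \<open>Along a good curve \<open>w\<close> is continuous because it has a gradient, and
  \<open>w'\<close> is continuous inside \<open>V\<close>. If they differed at one time, they would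
  differ during an interval of times, and the curve would spend positive time in a null set.\<close>

lemma pgrad_continuous_representative:
  assumes g: "pgrad A w g" and V: "open V" and c: "continuous_on V w'"
    and ae: "AE y in \<mu>. y \<in> V --> w' y = w y" and off: "\<And>y. y \<in> A ==> y \<notin> V ==> w' y = w y"
  shows "pgrad A w' g"
proof -
  obtain \<rho> where \<rho>: "bLp \<rho>"
    "\<And>l \<gamma>. curve A l \<gamma> ==> curve_integral l \<gamma> \<rho> < \<infinity> ==>
        grad_along l \<gamma> w g"
    using g by (rule egradE) auto
  obtain N where N: "N \<in> sets borel" "N \<in> null_sets \<mu>" "\<And>y. y \<notin> N ==> y \<in> V --> w' y = w y"
    using AE_borel_null[OF ae] by blast
  obtain R where R: "bLp R" "\<And>A l \<gamma>. curve A l \<gamma> ==> curve_integral l \<gamma> R < \<infinity> ==>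
      curve_integral l \<gamma> \<rho> < \<infinity> \<and> curve_integral l \<gamma> (\<lambda>x. top * indicator N x) < \<infinity>"
    using bLp_binary[OF \<rho>(1) bLp_null_top[OF N(1,2)]] by blast
  show ?thesis
  proof (rule pgradI[OF pgrad_measurable[OF g] R(1)])
    fix l \<gamma> assume cu: "curve A l \<gamma>" and fin: "curve_integral l \<gamma> R < \<infinity>"
    have i: "grad_along l \<gamma> w g" using \<rho>(2)[OF cu] R(2)[OF cu fin] by blast
    have av: "AE t in lborel. t \<in> {0..l} --> \<gamma> t \<notin> N"
      by (rule curve_avoids_null[OF N(1) cu]) (use R(2)[OF cu fin] in blast)
    have l: "0 < l" by (rule arclength_curvesD(1)[OF cu])
    have eq: "w' (\<gamma> t) = w (\<gamma> t)" if t: "t \<in> {0..l}" for t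
    proof (rule ccontr)
      assume ne: "w' (\<gamma> t) \<noteq> w (\<gamma> t)"
      then have tV: "\<gamma> t \<in> V" using off arclength_curvesD(4)[OF cu t] by blast
      define D where "D s = w' (\<gamma> s) - w (\<gamma> s)" for s
      have c\<gamma>: "continuous (at t within {0..l}) \<gamma>"
        using arclength_curvesD(2)[OF cu] t by (simp add: continuous_on_eq_continuous_within)
      have "continuous (at (\<gamma> t)) w'" using c V tV by (simp add: continuous_on_eq_continuous_at)
      then have "continuous (at (\<gamma> t) within \<gamma> ` {0..l}) w'" by (rule continuous_at_imp_continuous_at_within)
      from continuous_within_compose[OF c\<gamma> this]
      have c1: "continuous (at t within {0..l}) (\<lambda>s. w' (\<gamma> s))" by (simp add: o_def)
      have c2: "continuous (at t within {0..l}) (\<lambda>s. w (\<gamma> s))"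
        using igrad_continuous[OF i] t by (simp add: continuous_on_eq_continuous_within)
      have cD: "continuous (at t within {0..l}) D" unfolding D_def by (intro continuous_diff c1 c2)
      have "D t \<noteq> 0" using ne by (simp add: D_def)
      then obtain d where d: "d > 0" "\<And>s. s \<in> {0..l} ==> dist s t < d ==> D s \<noteq> 0"
        using cD unfolding continuous_within_eps_delta
        by (metis dist_real_def abs_minus_commute diff_zero less_irrefl zero_less_abs_iff)
      obtain e where e: "e > 0" "\<And>s. s \<in> {0..l} ==> dist s t < e ==> \<gamma> s \<in> V"
      proof -
        have "\<exists>e>0. ball (\<gamma> t) e \<subseteq> V" using V tV by (auto simp: open_contains_ball)
        then obtain r where r: "r > 0" "ball (\<gamma> t) r \<subseteq> V" by blast
        then show ?thesis using c\<gamma> that unfolding continuous_within_eps_delta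
          by (metis mem_ball dist_commute subsetD)
      qed
      define \<delta> where "\<delta> = min d e"
      define p1 where "p1 = max 0 (t - \<delta>/2)"
      define p2 where "p2 = min l (t + \<delta>/2)"
      have p12: "p1 < p2" "0 \<le> p1" "p2 \<le> l" using d(1) e(1) t l by (auto simp: p1_def p2_def \<delta>_def)
      have bad: "\<gamma> s \<in> N" if "s \<in> {p1..p2}" for s
      proof -
        have s: "s \<in> {0..l}" "dist s t < d" "dist s t < e"
          using that d(1) e(1) t by (auto simp: p1_def p2_def \<delta>_def dist_real_def abs_less_iff)
        show ?thesis using d(2)[OF s(1,2)] e(2)[OF s(1,3)] N(3)[of "\<gamma> s"] by (auto simp: D_def)
      qed
      have "AE s in lborel. s \<notin> {p1..p2}" using av by eventually_elim (use bad p12 in auto)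
      then have "emeasure lborel {p1..p2} = 0" using AE_iff_null_sets[of "{p1..p2}" lborel] by auto
      then show False using p12 by simp
    qed
    show "igrad l (\<lambda>t. w' (\<gamma> t)) (\<lambda>t. g (\<gamma> t))"
      using i by (rule igrad_cong[THEN iffD1, rotated 2]) (use eq in auto)
  qed
qed

end

section \<open>From half density to small density\<close>

context pi_space
begin

text \<open>The sum of \<open>N\<close> normalized truncations between successive levels equals \<open>N\<close> above the last level, while its
  energy is only of order \<open>N\<close>, because the gradients of the truncations live on disjoint sets.\<close>

lemma growth:
  "\<exists>C>0. \<forall>V u b k T x R N. open V --> dg V u b --> 0 < R --> 0 < T --> cball x (2 * \<tau> * R) \<subseteq> V -->
     (AE y in \<mu>. y \<in> ball x (2 * \<tau> * R) --> u y \<le> k + T) -->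
     bm x R / 2 \<le> measure \<mu> ({y. u y \<le> k} \<inter> ball x R) --> 0 < (N::nat) -->
     measure \<mu> ({y. k + T * (1 - (1/2)^N) < u y} \<inter> ball x R) \<le> C * real N powr (1/p - 1) * bm x R"
proof -
  define C where "C = 8 * CP * PC / \<tau> * Cd powr (1/p)"
  have C: "0 < C" using CP PC(3) \<tau>1 Cd by (simp add: C_def)
  have "measure \<mu> ({y. k + T * (1 - (1/2)^N) < u y} \<inter> ball x R) \<le> C * real N powr (1/p - 1) * bm x R"
    if V: "open V" and d: "dg V u b" and R: "0 < R" and T: "0 < T" and sub: "cball x (2 * \<tau> * R) \<subseteq> V"
      and up: "AE y in \<mu>. y \<in> ball x (2 * \<tau> * R) --> u y \<le> k + T"
      and half: "bm x R / 2 \<le> measure \<mu> ({y. u y \<le> k} \<inter> ball x R)" and N: "0 < N"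
    for V u b k T x R and N :: nat
  proof -
    obtain z R0 where VR: "V \<subseteq> ball z R0" using d by (auto simp: dg_def)
    have um[measurable]: "meas u" and [measurable]: "V \<in> sets \<mu>" using d V by (auto simp: dg_def)
    have rg: "rgrad V u b" using d by (simp add: dg_def)
    note B = rgradD[OF rg]
    note [measurable] = B(2)
    have ca: "cacc V u b" using d by (simp add: dg_def)
    define h where "h j = (1/2::real)^j" for j :: nat
    have h: "0 < h j" "h j \<le> 1" "h (Suc j) = h j / 2" for j by (auto simp: h_def power_le_one)
    define \<kappa> where "\<kappa> j = k + T * (1 - h j)" for j
    have \<kappa>S: "\<kappa> (Suc j) - \<kappa> j = T * h j / 2" for j by (simp add: \<kappa>_def h(3) algebra_simps)
    have \<kappa>mono: "\<kappa> i \<le> \<kappa> j" if "i \<le> j" for i j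
    proof -
      have "h j \<le> h i" unfolding h_def using that by (intro power_decreasing) auto
      then show ?thesis using T by (simp add: \<kappa>_def mult_left_mono)
    qed
    have \<kappa>0: "k \<le> \<kappa> j" for j using T h(2)[of j] by (simp add: \<kappa>_def)
    \<comment> \<open>The reciprocal of the gap between the levels j and j + 1, so that each
      normalized truncation has values in [0,1].\<close>
    define c where "c j = 2 / (T * h j)" for j
    have c: "0 < c j" "c j * (T * h j / 2) = 1" "c j * (T * h j) = 2" for j
    proof -
      have "T * h j > 0" using T h(1)[of j] by simp
      then show "0 < c j" "c j * (T * h j / 2) = 1" "c j * (T * h j) = 2" by (auto simp: c_def)
    qed
    define wj where "wj j y = (if y \<in> V then c j * max (min (u y) (\<kappa> (Suc j)) - \<kappa> j) 0 else 0)" for j y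
    define \<beta>j where "\<beta>j j y = (if \<kappa> j < u y \<and> u y < \<kappa> (Suc j) then c j * b y else 0)" for j y
    have \<beta>j0: "0 \<le> \<beta>j j y" for j y using c(1)[of j] B(3)[of y] by (simp add: \<beta>j_def)
    have gj: "pgrad V (wj j) (\<lambda>y. ennreal (\<beta>j j y))" for j
    proof -
      have lt: "\<kappa> j < \<kappa> (Suc j)" using \<kappa>S[of j] T h(1)[of j] by (smt (verit) divide_pos_pos mult_pos_pos)
      have "pgrad V (\<lambda>y. min (u y) (\<kappa> (Suc j)) - \<kappa> j) (\<lambda>y. if u y < \<kappa> (Suc j) then ennreal (b y) else 0)"
        by (rule pgrad_contraction1[OF pgrad_min[OF B(6) pgrad_const]]) auto
      from pgrad_max[OF this pgrad_const[of V 0]]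
      have "pgrad V (\<lambda>y. max (min (u y) (\<kappa> (Suc j)) - \<kappa> j) 0)
        (\<lambda>y. if 0 < min (u y) (\<kappa> (Suc j)) - \<kappa> j then if u y < \<kappa> (Suc j) then ennreal (b y) else 0 else 0)" by simp
      from pgrad_contraction[OF this, of "c j" "\<lambda>y. c j * max (min (u y) (\<kappa> (Suc j)) - \<kappa> j) 0"]
      have "pgrad V (\<lambda>y. c j * max (min (u y) (\<kappa> (Suc j)) - \<kappa> j) 0)
        (\<lambda>y. ennreal (c j) * (if 0 < min (u y) (\<kappa> (Suc j)) - \<kappa> j then if u y < \<kappa> (Suc j) then ennreal (b y) else 0 else 0))"
        using c(1)[of j] by (simp add: abs_mult right_diff_distrib[symmetric])
      then show ?thesis
      proof (rule pgrad_cong)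
        show "meas (\<lambda>y. ennreal (\<beta>j j y))" unfolding \<beta>j_def by measurable
        show "wj j y = c j * max (min (u y) (\<kappa> (Suc j)) - \<kappa> j) 0" if "y \<in> V" for y using that by (simp add: wj_def)
        show "ennreal (\<beta>j j y) = ennreal (c j) * (if 0 < min (u y) (\<kappa> (Suc j)) - \<kappa> j then if u y < \<kappa> (Suc j) then ennreal (b y) else 0 else 0)" for y
          using c(1)[of j] B(3)[of y] lt by (auto simp: \<beta>j_def ennreal_mult)
      qed
    qed
    have wj01: "0 \<le> wj j y" "wj j y \<le> 1" for j y
    proof -
      show "0 \<le> wj j y" using c(1)[of j] by (simp add: wj_def)
      have "T * h j / 2 \<ge> 0" using T h(1)[of j] by simp
      moreover have "min (u y) (\<kappa> (Suc j)) - \<kappa> j \<le> T * h j / 2"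
        using \<kappa>S[of j] min.cobounded2[of "u y" "\<kappa> (Suc j)"] by linarith
      ultimately have "max (min (u y) (\<kappa> (Suc j)) - \<kappa> j) 0 \<le> T * h j / 2" by (rule max.boundedI[rotated])
      then have "c j * max (min (u y) (\<kappa> (Suc j)) - \<kappa> j) 0 \<le> c j * (T * h j / 2)" using c(1)[of j] by (intro mult_left_mono) auto
      then show "wj j y \<le> 1" unfolding c(2) by (simp add: wj_def)
    qed
    define w where "w y = (\<Sum>j<N. wj j y)" for y
    define \<beta> where "\<beta> y = (\<Sum>j<N. \<beta>j j y)" for y
    have wm: "meas w" unfolding w_def[abs_def] wj_def by measurable
    have w0: "0 \<le> w y" for y unfolding w_def by (intro sum_nonneg wj01)
    have wN: "\<bar>w y\<bar> \<le> real N" for y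
    proof -
      have "w y \<le> (\<Sum>j<N. 1)" unfolding w_def by (intro sum_mono wj01)
      then show ?thesis using w0[of y] by simp
    qed
    have gw: "pgrad V w (\<lambda>y. ennreal (\<beta> y))"
    proof -
      have "pgrad V w (\<lambda>y. \<Sum>j<N. ennreal (\<beta>j j y))" unfolding w_def[abs_def] by (rule pgrad_sum[OF gj])
      then show ?thesis by (simp add: \<beta>_def \<beta>j0)
    qed
    have \<beta>0: "0 \<le> \<beta> y" for y unfolding \<beta>_def by (intro sum_nonneg \<beta>j0)
    \<comment> \<open>The sets {\<kappa> j < u < \<kappa> (Suc j)} are disjoint, so the p-th power
      of the sum is the sum of the p-th powers. This gives an energy of order N instead of
      N^p.\<close>
    have \<beta>p: "\<beta> y powr p = (\<Sum>j<N. \<beta>j j y powr p)" for y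
      unfolding \<beta>_def
    proof (rule powr_sum_single)
      fix i j :: nat assume "i \<noteq> j"
      then show "\<beta>j i y = 0 \<or> \<beta>j j y = 0"
        using \<kappa>mono[of "Suc i" j] \<kappa>mono[of "Suc j" i] by (cases "i < j") (auto simp: \<beta>j_def)
    qed simp
    have \<tau>R: "0 < \<tau> * R" using \<tau>1 R by simp
    have s1: "cball x (\<tau> * R) \<subseteq> V" using sub subset_cball[of "\<tau> * R" "2 * \<tau> * R" x] \<tau>R by (auto simp: mult.assoc)
    have \<beta>ji: "integrable \<mu> (\<lambda>y. indicator (ball x (\<tau> * R)) y * \<beta>j j y powr p)" for j
    proof (rule Bochner_Integration.integrable_bound)
      show "integrable \<mu> (\<lambda>y. c j powr p * b y powr p)" using B(5) by auto
      show "meas (\<lambda>y. indicator (ball x (\<tau> * R)) y * \<beta>j j y powr p)" unfolding \<beta>j_def by measurable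
      show "AE y in \<mu>. norm (indicator (ball x (\<tau> * R)) y * \<beta>j j y powr p) \<le> norm (c j powr p * b y powr p)"
        using p0 by (intro AE_I2) (auto simp: indicator_def \<beta>j_def powr_mult)
    qed
    \<comment> \<open>Almost everywhere u - \<kappa> j is at most T h j, and c j T h j = 2, so the
      Caccioppoli bound is the same for all truncations.\<close>
    have Ij: "ball_int x (\<tau> * R) (\<lambda>y. \<beta>j j y powr p) \<le> (2 * PC / (\<tau> * R)) powr p * (Cd * bm x (\<tau> * R))" for j
    proof -
      have Em: "{y \<in> ball x (\<tau> * R). \<kappa> j < u y} \<in> sets \<mu>" by measurable
      have "ball_int x (\<tau> * R) (\<lambda>y. \<beta>j j y powr p)
          \<le> (\<integral>y. c j powr p * (indicator {y \<in> ball x (\<tau> * R). \<kappa> j < u y} y * b y powr p) \<partial>\<mu>)"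
      proof (rule integral_mono[OF \<beta>ji])
        have "integrable \<mu> (\<lambda>y. indicator {y \<in> ball x (\<tau> * R). \<kappa> j < u y} y * b y powr p)"
        proof (rule Bochner_Integration.integrable_bound[OF B(5)])
          show "(\<lambda>y. indicator {y \<in> ball x (\<tau> * R). \<kappa> j < u y} y * b y powr p) \<in> borel_measurable \<mu>"
            using Em B(2) by (intro borel_measurable_times borel_measurable_indicator) measurable
        qed (auto simp: indicator_def)
        then show "integrable \<mu> (\<lambda>y. c j powr p * (indicator {y \<in> ball x (\<tau> * R). \<kappa> j < u y} y * b y powr p))"
          by (rule integrable_mult_right)
        show "indicator (ball x (\<tau> * R)) y * \<beta>j j y powr p \<le> c j powr p * (indicator {y \<in> ball x (\<tau> * R). \<kappa> j < u y} y * b y powr p)" for y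
          using p0 by (auto simp: indicator_def \<beta>j_def powr_mult)
      qed
      also have "\<dots> = c j powr p * (\<integral>y. indicator {y \<in> ball x (\<tau> * R). \<kappa> j < u y} y * b y powr p \<partial>\<mu>)" by simp
      also have "\<dots> \<le> c j powr p * ((PC / (2 * \<tau> * R - \<tau> * R)) powr p * ball_int x (2 * \<tau> * R) (\<lambda>y. max (u y - \<kappa> j) 0 powr p))"
        by (intro mult_left_mono ca[unfolded cacc_def, rule_format, OF \<tau>R _ sub]) (use \<tau>R in \<open>auto simp: mult.commute\<close>)
      also have "2 * \<tau> * R - \<tau> * R = \<tau> * R" by simp
      also have "ball_int x (2 * \<tau> * R) (\<lambda>y. max (u y - \<kappa> j) 0 powr p) \<le> (\<integral>y. (T * h j) powr p * indicator (ball x (2 * \<tau> * R)) y \<partial>\<mu>)"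
      proof (rule integral_mono_AE)
        show 1: "integrable \<mu> (\<lambda>y. (T * h j) powr p * indicator (ball x (2 * \<tau> * R)) y)"
          using ball_finite by (intro integrable_mult_right integrable_real_indicator) auto
        show ae: "AE y in \<mu>. indicator (ball x (2 * \<tau> * R)) y * max (u y - \<kappa> j) 0 powr p \<le> (T * h j) powr p * indicator (ball x (2 * \<tau> * R)) y"
          using up
        proof eventually_elim
          case (elim y)
          have Th: "0 \<le> T * h j" using T h(1)[of j] by simp
          show ?case
          proof (cases "y \<in> ball x (2 * \<tau> * R)")
            case True
            then have "max (u y - \<kappa> j) 0 \<le> T * h j" using elim Th by (simp add: \<kappa>_def algebra_simps)
            then show ?thesis using True p0 by (auto intro!: powr_mono2)
          qed auto
        qed
        show "integrable \<mu> (\<lambda>y. indicator (ball x (2 * \<tau> * R)) y * max (u y - \<kappa> j) 0 powr p)"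
          by (rule Bochner_Integration.integrable_bound[OF 1], measurable, rule eventually_mono[OF ae]) auto
      qed
      also have "(\<integral>y. (T * h j) powr p * indicator (ball x (2 * \<tau> * R)) y \<partial>\<mu>) = (T * h j) powr p * bm x (2 * (\<tau> * R))"
        by (simp add: mult.assoc)
      also have "\<dots> \<le> (T * h j) powr p * (Cd * bm x (\<tau> * R))" by (intro mult_left_mono bm_double \<tau>R) auto
      finally have "ball_int x (\<tau> * R) (\<lambda>y. \<beta>j j y powr p)
         \<le> c j powr p * ((PC / (\<tau> * R)) powr p * ((T * h j) powr p * (Cd * bm x (\<tau> * R))))"
        by (simp add: mult_left_mono)
      also have "\<dots> = (c j powr p * ((PC / (\<tau> * R)) powr p * (T * h j) powr p)) * (Cd * bm x (\<tau> * R))" by simp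
      also have "c j powr p * ((PC / (\<tau> * R)) powr p * (T * h j) powr p) = (c j * ((PC / (\<tau> * R)) * (T * h j))) powr p"
        by (simp only: powr_mult)
      also have "c j * ((PC / (\<tau> * R)) * (T * h j)) = 2 * PC / (\<tau> * R)"
        using c(3)[of j] by (simp add: field_simps)
      finally show ?thesis .
    qed
    have \<beta>i: "integrable \<mu> (\<lambda>y. indicator (ball x (\<tau> * R)) y * \<beta> y powr p)"
      unfolding \<beta>p sum_distrib_left by (intro Bochner_Integration.integrable_sum \<beta>ji)
    have bm\<tau>: "0 < bm x (\<tau> * R)" by (rule bm_pos[OF \<tau>R])
    define I where "I = ball_int x (\<tau> * R) (\<lambda>y. \<beta> y powr p)"
    have I0: "0 \<le> I" unfolding I_def by (intro integral_nonneg_AE) auto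
    have "I = (\<Sum>j<N. \<integral>y. indicator (ball x (\<tau> * R)) y * \<beta>j j y powr p \<partial>\<mu>)"
      unfolding I_def \<beta>p sum_distrib_left by (intro Bochner_Integration.integral_sum \<beta>ji)
    also have "\<dots> \<le> (\<Sum>j<N. (2 * PC / (\<tau> * R)) powr p * (Cd * bm x (\<tau> * R)))" by (intro sum_mono Ij)
    finally have "I \<le> (real N * Cd * (2 * PC / (\<tau> * R)) powr p) * bm x (\<tau> * R)" by (simp add: mult_ac)
    then have "I / bm x (\<tau> * R) \<le> real N * Cd * (2 * PC / (\<tau> * R)) powr p" using bm\<tau> by (simp add: divide_le_eq)
    then have "(I / bm x (\<tau> * R)) powr (1/p) \<le> (real N * Cd * (2 * PC / (\<tau> * R)) powr p) powr (1/p)"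
      using p0 I0 bm\<tau> by (intro powr_mono2) auto
    also have "\<dots> = real N powr (1/p) * Cd powr (1/p) * (2 * PC / (\<tau> * R))"
      using p0 PC(3) \<tau>R by (simp add: powr_mult powr_powr)
    finally have Ib: "(I / bm x (\<tau> * R)) powr (1/p) \<le> real N powr (1/p) * Cd powr (1/p) * (2 * PC / (\<tau> * R))" .
    have wout: "w y = 0" if "y \<notin> ball z R0" for y
      unfolding w_def using that VR by (intro sum.neutral) (auto simp: wj_def)
    have "osc w x R \<le> 2 * CP * R * (I / bm x (\<tau> * R)) powr (1/p)"
      unfolding I_def by (rule poincare_local[OF wm wN wout gw \<beta>0 \<beta>i R s1])
    also have "\<dots> \<le> 2 * CP * R * (real N powr (1/p) * Cd powr (1/p) * (2 * PC / (\<tau> * R)))"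
      using CP R by (intro mult_left_mono Ib) auto
    also have "\<dots> = C / 2 * real N powr (1/p)" using R \<tau>1 by (simp add: C_def)
    finally have os: "osc w x R \<le> C / 2 * real N powr (1/p)" .
    have av: "avg w x R \<le> 2 * osc w x R"
    proof (rule avg_le_osc[OF wm wN w0 R])
      have L: "{y. u y \<le> k} \<inter> ball x R \<in> sets \<mu>" by measurable
      have "{y \<in> space \<mu>. 0 < w y} \<in> sets \<mu>" using wm by measurable
      then have P: "{y. 0 < w y} \<inter> ball x R \<in> sets \<mu>" by auto
      have "measure \<mu> ({y. 0 < w y} \<inter> ball x R) \<le> measure \<mu> (ball x R - ({y. u y \<le> k} \<inter> ball x R))"
      proof (rule bounded_measure_mono[of _ _ x R])
        have "w y = 0" if "u y \<le> k" for y
          unfolding w_def using that \<kappa>0 by (intro sum.neutral) (auto simp: wj_def min_def max_def dest: order_trans)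
        then show "{y. 0 < w y} \<inter> ball x R \<subseteq> ball x R - ({y. u y \<le> k} \<inter> ball x R)" by force
      qed (use P L in auto)
      also have "\<dots> = bm x R - measure \<mu> ({y. u y \<le> k} \<inter> ball x R)"
        using L ball_finite[of x R] by (intro measure_Diff) auto
      finally show "measure \<mu> ({y. 0 < w y} \<inter> ball x R) \<le> bm x R / 2" using half by simp
    qed
    define A where "A = {y. k + T * (1 - (1/2)^N) < u y} \<inter> ball x R"
    have Am: "A \<in> sets \<mu>" unfolding A_def by measurable
    have "real N * measure \<mu> A = (\<integral>y. real N * indicator A y \<partial>\<mu>)" using Am by simp
    also have "\<dots> \<le> ball_int x R w"
    proof (rule integral_mono)
      show "integrable \<mu> (\<lambda>y. real N * indicator A y)"
        using Am subset_ball_finite[of A x R] by (intro integrable_mult_right integrable_real_indicator) (auto simp: A_def)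
      show "integrable \<mu> (\<lambda>y. indicator (ball x R) y * w y)" by (rule integrable_ball[OF wm wN])
      show "real N * indicator A y \<le> indicator (ball x R) y * w y" for y
      proof (cases "y \<in> A")
        case True
        then have yR: "y \<in> ball x R" and uy: "\<kappa> N < u y" by (auto simp: A_def \<kappa>_def h_def)
        have "R \<le> 2 * \<tau> * R" using \<tau>1 R by simp
        then have yV: "y \<in> V" using yR sub by (auto simp: subset_iff)
        have "wj j y = 1" if "j < N" for j
        proof -
          have "\<kappa> (Suc j) \<le> u y" using \<kappa>mono[of "Suc j" N] that uy by auto
          then have "wj j y = c j * max (T * h j / 2) 0" unfolding \<kappa>S[symmetric] using yV by (simp add: wj_def min_absorb2)
          also have "max (T * h j / 2) 0 = T * h j / 2" using T h(1)[of j] by simp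
          finally show ?thesis using c(2)[of j] by simp
        qed
        then have "w y = real N" by (simp add: w_def)
        then show ?thesis using yR by (simp add: indicator_def)
      next
        case False
        then show ?thesis using w0[of y] by (simp add: indicator_def)
      qed
    qed
    also have "\<dots> = avg w x R * bm x R" by (rule avg_mult[OF R, symmetric])
    also have "\<dots> \<le> (2 * (C / 2 * real N powr (1/p))) * bm x R" using av os by (intro mult_right_mono) auto
    finally have "real N * measure \<mu> A \<le> C * real N powr (1/p) * bm x R" by simp
    then have "measure \<mu> A \<le> C * (real N powr (1/p) / real N) * bm x R" using N by (simp add: field_simps)
    also have "real N powr (1/p) / real N = real N powr (1/p - 1)" using N by (simp add: powr_diff)
    finally show ?thesis unfolding A_def .
  qed
  then show ?thesis using C by blast
qed

end

section \<open>Oscillation decay and continuity\<close>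

context pi_space
begin

text \<open>If u \<le> m + T/2 on half of the ball, \<open>growth\<close> with a suitable N makes
  the density of {u > m + T - T h/2}, h = 2^-N, at most the \<epsilon> of \<open>de_giorgi\<close>,
  which then lowers the upper bound to m + T - T h/4 on the half ball. Hence \<sigma> = 1 -
  h/4.\<close>

lemma oscillation_decay:
  "\<exists>\<sigma>. 0 < \<sigma> \<and> \<sigma> < 1 \<and> (\<forall>V u b m T x R. open V --> dg V u b --> 0 < R --> 0 < T --> cball x (2 * \<tau> * R) \<subseteq> V -->
     (AE y in \<mu>. y \<in> ball x (2 * \<tau> * R) --> m \<le> u y \<and> u y \<le> m + T) -->
     (\<exists>m'. AE y in \<mu>. y \<in> ball x (R/2) --> m' \<le> u y \<and> u y \<le> m' + \<sigma> * T))"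
proof -
  obtain \<epsilon> where \<epsilon>: "0 < \<epsilon>" and DG: "\<And>V u b k T x R. open V ==> dg V u b ==> 0 < R ==> 0 < T ==> cball x R \<subseteq> V ==>
     (AE y in \<mu>. y \<in> ball x R --> u y \<le> k + T) ==> measure \<mu> ({y. k < u y} \<inter> ball x R) \<le> \<epsilon> * bm x R ==>
     (AE y in \<mu>. y \<in> ball x (R/2) --> u y \<le> k + T/2)"
    using de_giorgi by blast
  obtain C where C: "0 < C" and GR: "\<And>V u b k T x R N. open V ==> dg V u b ==> 0 < R ==> 0 < T ==> cball x (2 * \<tau> * R) \<subseteq> V ==>
     (AE y in \<mu>. y \<in> ball x (2 * \<tau> * R) --> u y \<le> k + T) ==>
     bm x R / 2 \<le> measure \<mu> ({y. u y \<le> k} \<inter> ball x R) ==> 0 < (N::nat) ==>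
     measure \<mu> ({y. k + T * (1 - (1/2)^N) < u y} \<inter> ball x R) \<le> C * real N powr (1/p - 1) * bm x R"
    using growth by blast
  have "(\<lambda>N. C * real N powr (1/p - 1)) \<longlonglongrightarrow> C * 0"
    using p1 by (intro tendsto_mult tendsto_const tendsto_neg_powr filterlim_real_sequentially) (simp add: divide_less_eq)
  then have "eventually (\<lambda>N. C * real N powr (1/p - 1) < \<epsilon>) sequentially"
    using \<epsilon> by (intro order_tendstoD(2)) auto
  then have "eventually (\<lambda>N. C * real N powr (1/p - 1) < \<epsilon> \<and> 0 < N) sequentially"
    using eventually_gt_at_top[of 0] by eventually_elim simp
  then obtain N where N: "C * real N powr (1/p - 1) < \<epsilon>" "0 < N" by (auto simp: eventually_sequentially)
  define h where "h = (1/2::real)^N"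
  have h: "0 < h" "h \<le> 1" by (auto simp: h_def power_le_one)
  define \<sigma> where "\<sigma> = 1 - h / 4"
  have \<sigma>: "0 < \<sigma>" "\<sigma> < 1" using h by (auto simp: \<sigma>_def)
  have one: "AE y in \<mu>. y \<in> ball x (R/2) --> u y \<le> m + \<sigma> * T"
    if V: "open V" and d: "dg V u b" and R: "0 < R" and T: "0 < T" and sub: "cball x (2 * \<tau> * R) \<subseteq> V"
      and up: "AE y in \<mu>. y \<in> ball x (2 * \<tau> * R) --> u y \<le> m + T"
      and half: "bm x R / 2 \<le> measure \<mu> ({y. u y \<le> m + T/2} \<inter> ball x R)" for V u b m T x R
  proof -
    have R\<tau>: "R \<le> 2 * \<tau> * R" using \<tau>1 R by simp
    have up': "AE y in \<mu>. y \<in> ball x (2 * \<tau> * R) --> u y \<le> (m + T/2) + T/2" using up by eventually_elim auto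
    have T2: "0 < T/2" using T by simp
    have "measure \<mu> ({y. (m + T/2) + T/2 * (1 - h) < u y} \<inter> ball x R) \<le> C * real N powr (1/p - 1) * bm x R"
      unfolding h_def by (rule GR[OF V d R T2 sub up' half N(2)])
    also have "\<dots> \<le> \<epsilon> * bm x R" using N(1) by (intro mult_right_mono) auto
    finally have m1: "measure \<mu> ({y. (m + T/2) + T/2 * (1 - h) < u y} \<inter> ball x R) \<le> \<epsilon> * bm x R" .
    have Th: "0 < T/2 * h" using T h by simp
    have subR: "cball x R \<subseteq> V" using sub subset_cball[OF R\<tau>, of x] by blast
    have e: "(m + T/2) + T/2 * (1 - h) + T/2 * h = m + T" by (simp add: field_simps)
    have up2: "AE y in \<mu>. y \<in> ball x R --> u y \<le> (m + T/2) + T/2 * (1 - h) + T/2 * h"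
      unfolding e using up by eventually_elim (use R\<tau> in auto)
    have "AE y in \<mu>. y \<in> ball x (R/2) --> u y \<le> (m + T/2) + T/2 * (1 - h) + T/2 * h / 2"
      by (rule DG[OF V d R Th subR up2 m1])
    moreover have e2: "(m + T/2) + T/2 * (1 - h) + T/2 * h / 2 = m + \<sigma> * T" by (simp add: \<sigma>_def field_simps)
    ultimately show ?thesis unfolding e2 by blast
  qed
  have "\<exists>m'. AE y in \<mu>. y \<in> ball x (R/2) --> m' \<le> u y \<and> u y \<le> m' + \<sigma> * T"
    if V: "open V" and d: "dg V u b" and R: "0 < R" and T: "0 < T" and sub: "cball x (2 * \<tau> * R) \<subseteq> V"
      and up: "AE y in \<mu>. y \<in> ball x (2 * \<tau> * R) --> m \<le> u y \<and> u y \<le> m + T" for V u b m T x R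
  proof -
    have um[measurable]: "meas u" using d by (simp add: dg_def)
    have R2: "R/2 \<le> 2 * \<tau> * R" using \<tau>1 R by (simp add: mult.assoc)
    have R\<tau>: "R \<le> 2 * \<tau> * R" using \<tau>1 R by simp
    show ?thesis
    \<comment> \<open>One of u \<le> m + T/2 and u \<ge> m + T/2 holds on at least half of the ball;
      the second alternative is the first one for \<open>- u\<close>, and there the lower bound is
      raised.\<close>
    proof (cases "bm x R / 2 \<le> measure \<mu> ({y. u y \<le> m + T/2} \<inter> ball x R)")
      case True
      have "AE y in \<mu>. y \<in> ball x (2 * \<tau> * R) --> u y \<le> m + T" using up by eventually_elim auto
      from one[OF V d R T sub this True] up
      have "AE y in \<mu>. y \<in> ball x (R/2) --> m \<le> u y \<and> u y \<le> m + \<sigma> * T"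
        by eventually_elim (use R2 in auto)
      then show ?thesis by blast
    next
      case False
      have up': "AE y in \<mu>. y \<in> ball x (2 * \<tau> * R) --> - u y \<le> (- m - T) + T" using up by eventually_elim auto
      have L: "{y. u y \<le> m + T/2} \<inter> ball x R \<in> sets \<mu>" by measurable
      have "bm x R - measure \<mu> ({y. u y \<le> m + T/2} \<inter> ball x R) = measure \<mu> (ball x R - {y. u y \<le> m + T/2} \<inter> ball x R)"
        using L ball_finite[of x R] by (intro measure_Diff[symmetric]) auto
      also have "\<dots> \<le> measure \<mu> ({y. - u y \<le> (- m - T) + T/2} \<inter> ball x R)"
        using L superlevel_mu(3)[of "\<lambda>y. - u y"] by (intro bounded_measure_mono[of _ _ x R]) auto
      finally have "bm x R / 2 \<le> measure \<mu> ({y. - u y \<le> (- m - T) + T/2} \<inter> ball x R)" using False by simp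
      from one[OF V dg_uminus[OF d] R T sub up' this] up
      have "AE y in \<mu>. y \<in> ball x (R/2) --> (m + T - \<sigma> * T) \<le> u y \<and> u y \<le> (m + T - \<sigma> * T) + \<sigma> * T"
        by eventually_elim (use R2 in auto)
      then show ?thesis by blast
    qed
  qed
  then show ?thesis using \<sigma> by blast
qed

text \<open>Each application of the oscillation decay replaces a radius r by r / (4 \<tau>) and
  multiplies the bound on the oscillation by \<sigma>.\<close>

lemma dg_almost_constant:
  assumes V: "open V" and d: "dg V u b" and x: "x \<in> V" and e: "0 < e"
  shows "\<exists>r>0. \<exists>c. AE y in \<mu>. y \<in> ball x r --> \<bar>u y - c\<bar> \<le> e"
proof -
  obtain \<sigma> where \<sigma>: "0 < \<sigma>" "\<sigma> < 1" and OD: "\<And>V u b m T x R. open V ==> dg V u b ==> 0 < R ==> 0 < T ==> cball x (2 * \<tau> * R) \<subseteq> V ==>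
     (AE y in \<mu>. y \<in> ball x (2 * \<tau> * R) --> m \<le> u y \<and> u y \<le> m + T) ==>
     (\<exists>m'. AE y in \<mu>. y \<in> ball x (R/2) --> m' \<le> u y \<and> u y \<le> m' + \<sigma> * T)"
    using oscillation_decay by blast
  obtain M where M: "\<And>y. \<bar>u y\<bar> \<le> M" using d by (auto simp: dg_def)
  define T where "T = 2 * \<bar>M\<bar> + 1"
  have T: "0 < T" by (simp add: T_def)
  have "\<exists>r>0. \<exists>m. cball x r \<subseteq> V \<and> (AE y in \<mu>. y \<in> ball x r --> m \<le> u y \<and> u y \<le> m + \<sigma>^n * T)" for n
  proof (induction n)
    case 0
    obtain r where r: "r > 0" "cball x r \<subseteq> V" using V x open_contains_cball by blast
    have "- \<bar>M\<bar> \<le> u y \<and> u y \<le> - \<bar>M\<bar> + \<sigma>^0 * T" for y using M[of y] by (auto simp: T_def)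
    then have "AE y in \<mu>. y \<in> ball x r --> - \<bar>M\<bar> \<le> u y \<and> u y \<le> - \<bar>M\<bar> + \<sigma>^0 * T" by (intro AE_I2) blast
    then show ?case using r by blast
  next
    case (Suc n)
    then obtain r m where r: "r > 0" "cball x r \<subseteq> V" "AE y in \<mu>. y \<in> ball x r --> m \<le> u y \<and> u y \<le> m + \<sigma>^n * T" by blast
    define R where "R = r / (2 * \<tau>)"
    have R: "0 < R" "2 * \<tau> * R = r" using r(1) \<tau>1 by (auto simp: R_def)
    have "R / 2 \<le> r" using R \<tau>1 by (simp add: R_def field_simps)
    then have sub: "cball x (R/2) \<subseteq> V" using r(2) subset_cball by blast
    have "\<exists>m'. AE y in \<mu>. y \<in> ball x (R/2) --> m' \<le> u y \<and> u y \<le> m' + \<sigma> * (\<sigma>^n * T)"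
      by (rule OD[OF V d R(1)]) (use r R \<sigma> T in auto)
    then show ?case using sub R(1) by (intro exI[of _ "R/2"]) (auto simp: mult.assoc)
  qed
  moreover obtain n where "\<sigma>^n < e / T" using real_arch_pow_inv[of "e/T" \<sigma>] \<sigma> e T by auto
  ultimately obtain r m where r: "r > 0" "AE y in \<mu>. y \<in> ball x r --> m \<le> u y \<and> u y \<le> m + \<sigma>^n * T" by blast
  have "\<sigma>^n * T \<le> e" using \<open>\<sigma>^n < e / T\<close> T by (simp add: field_simps)
  then have "AE y in \<mu>. y \<in> ball x r --> \<bar>u y - m\<bar> \<le> e"
    using r(2) by (auto elim!: eventually_mono)
  then show ?thesis using r(1) by blast
qed

lemma half_sum: "\<bar>a - c\<bar> \<le> e / 2 ==> \<bar>b - c\<bar> \<le> e / 2 ==> \<bar>b - a\<bar> \<le> (e::real)"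
  by linarith

lemma AE_ball_exists:
  assumes "AE y in \<mu>. P y" "0 < r" shows "\<exists>y\<in>ball x r. P y"
proof (rule ccontr)
  assume "\<not> ?thesis"
  then have "AE y in \<mu>. y \<notin> ball x r" using assms(1) by (auto elim!: eventually_mono)
  then have "ball x r \<in> null_sets \<mu>" by (subst AE_iff_null_sets) auto
  then show False using bpos[OF assms(2), of x] by (simp add: null_setsD1)
qed

text \<open>\<open>V\<close> is the union of the compact sets \<open>K n\<close> of its points at
  distance at least 1/(n+1) from the complement, and each of them is covered by finitely many of the
  given balls.\<close>

lemma AE_open_cover:
  assumes V: "open V" "V \<subseteq> ball z R"
    and loc: "\<And>x. x \<in> V ==> \<exists>r>0. AE y in \<mu>. y \<in> ball x r --> P y"
  shows "AE y in \<mu>. y \<in> V --> P y"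
proof -
  define K where "K n = cball z R \<inter> - (\<Union>w\<in>- V. ball w (1 / real (Suc n)))" for n
  have KV: "K n \<subseteq> V" for n
  proof
    fix y assume y: "y \<in> K n"
    show "y \<in> V"
    proof (rule ccontr)
      assume "y \<notin> V"
      then have "y \<in> (\<Union>w\<in>- V. ball w (1 / real (Suc n)))" by (intro UN_I[of y]) auto
      then show False using y by (simp add: K_def)
    qed
  qed
  have Kc: "compact (K n)" for n
    unfolding K_def by (intro compact_Int_closed compact_cball_mm closed_Compl open_UN) auto
  have VK: "\<exists>n. y \<in> K n" if y: "y \<in> V" for y
  proof -
    obtain e where e: "e > 0" "ball y e \<subseteq> V" using V(1) y by (meson openE)
    obtain n where n: "1 / real (Suc n) < e" using nat_approx_posE[OF e(1)] by blast
    have "y \<notin> ball w (1 / real (Suc n))" if "w \<in> - V" for w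
    proof
      assume "y \<in> ball w (1 / real (Suc n))"
      then have "w \<in> ball y e" using n by (simp add: dist_commute)
      then show False using e(2) that by auto
    qed
    then show ?thesis using y V(2) by (intro exI[of _ n]) (auto simp: K_def)
  qed
  have "AE y in \<mu>. y \<in> K n --> P y" for n
  proof -
    have "\<forall>x\<in>V. \<exists>r. r > 0 \<and> (AE y in \<mu>. y \<in> ball x r --> P y)" using loc by blast
    then obtain r where r: "\<And>x. x \<in> V ==> r x > 0" "\<And>x. x \<in> V ==> AE y in \<mu>. y \<in> ball x (r x) --> P y" by metis
    obtain I where I: "I \<subseteq> K n" "finite I" "K n \<subseteq> (\<Union>x\<in>I. ball x (r x))"
    proof (rule compactE_image[OF Kc, of "K n" "\<lambda>x. ball x (r x)"])
      show "K n \<subseteq> (\<Union>x\<in>K n. ball x (r x))" using r(1) KV by force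
    qed (auto intro: that)
    have "AE y in \<mu>. \<forall>x\<in>I. y \<in> ball x (r x) --> P y"
      using I(1) KV r(2) by (intro AE_finite_allI I(2)) auto
    then show ?thesis by eventually_elim (use I(3) in blast)
  qed
  then have "AE y in \<mu>. \<forall>n. y \<in> K n --> P y" by (subst AE_all_countable) auto
  then show ?thesis by eventually_elim (use VK in blast)
qed

text \<open>\<open>v x\<close> is the limit of the essential suprema of \<open>u\<close> over small
  balls about x. It is defined at every point, and it is within e of c wherever \<open>u\<close> is
  within e of c almost everywhere nearby.\<close>

lemma continuous_representative_exists:
  assumes V: "open V" "V \<subseteq> ball z R" and uM: "\<And>y. \<bar>u y\<bar> \<le> M"
    and loc: "\<And>x e. x \<in> V ==> 0 < e ==> \<exists>r>0. \<exists>c. AE y in \<mu>. y \<in> ball x r --> \<bar>u y - c\<bar> \<le> e"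
  shows "\<exists>v::'a => real. continuous_on V v \<and> (AE y in \<mu>. y \<in> V --> v y = u y)"
proof -
  define Q where "Q x = {c. \<exists>r>0. AE y in \<mu>. y \<in> ball x r --> u y \<le> c}" for x
  define v where "v x = Inf (Q x)" for x
  \<comment> \<open>c + e is an essential upper bound near x. Every other one is at least c - e,
    because balls have positive measure and so contain points where both almost everywhere
    statements hold.\<close>
  have near: "\<bar>v x - c\<bar> \<le> e" if ae: "AE y in \<mu>. y \<in> ball x0 r --> \<bar>u y - c\<bar> \<le> e" and x: "x \<in> ball x0 r" for x x0 c e r
  proof -
    define s where "s = r - dist x0 x"
    have s: "0 < s" "ball x s \<subseteq> ball x0 r"
    proof -
      show "0 < s" using x by (simp add: s_def)
      show "ball x s \<subseteq> ball x0 r"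
      proof
        fix y assume "y \<in> ball x s"
        then show "y \<in> ball x0 r" using dist_triangle[of x0 y x] by (simp add: s_def)
      qed
    qed
    have "AE y in \<mu>. y \<in> ball x s --> u y \<le> c + e" using ae by eventually_elim (use s(2) in auto)
    then have up: "c + e \<in> Q x" using s(1) by (auto simp: Q_def)
    have lo: "c - e \<le> q" if q: "q \<in> Q x" for q
    proof -
      obtain t where t: "t > 0" "AE y in \<mu>. y \<in> ball x t --> u y \<le> q" using q by (auto simp: Q_def)
      have "AE y in \<mu>. (y \<in> ball x t --> u y \<le> q) \<and> (y \<in> ball x0 r --> \<bar>u y - c\<bar> \<le> e)"
        using t(2) ae by eventually_elim simp
      then obtain y where y: "y \<in> ball x (min s t)" "y \<in> ball x t --> u y \<le> q" "y \<in> ball x0 r --> \<bar>u y - c\<bar> \<le> e"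
        using AE_ball_exists[of _ "min s t" x] s(1) t(1) by (metis (mono_tags, lifting) min_less_iff_conj)
      have "y \<in> ball x t" "y \<in> ball x0 r" using y(1) s(2) by auto
      then show ?thesis using y(2,3) by auto
    qed
    have "v x \<le> c + e" unfolding v_def by (rule cInf_lower[OF up]) (rule bdd_belowI[OF lo])
    moreover have "c - e \<le> v x" unfolding v_def using up lo by (intro cInf_greatest) auto
    ultimately show ?thesis by auto
  qed
  have "continuous_on V v"
    unfolding continuous_on_iff
  proof (intro ballI allI impI)
    fix x and e :: real assume x: "x \<in> V" and e: "0 < e"
    obtain r c where r: "r > 0" "AE y in \<mu>. y \<in> ball x r --> \<bar>u y - c\<bar> \<le> e/3" using loc[OF x, of "e/3"] e by auto
    have "dist (v y) (v x) < e" if "dist y x < r" for y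
    proof -
      have "\<bar>v y - c\<bar> \<le> e/3" "\<bar>v x - c\<bar> \<le> e/3" using near[OF r(2), of y] near[OF r(2), of x] that r(1) by (auto simp: dist_commute)
      then show ?thesis using e unfolding dist_real_def by argo
    qed
    then show "\<exists>d>0. \<forall>y\<in>V. dist y x < d --> dist (v y) (v x) < e" using r(1) by blast
  qed
  moreover have "AE y in \<mu>. y \<in> V --> v y = u y"
  proof -
    have "AE y in \<mu>. y \<in> V --> \<bar>v y - u y\<bar> \<le> 1 / real (Suc n)" for n
    proof (rule AE_open_cover[OF V])
      fix x assume x: "x \<in> V"
      obtain r c where r: "r > 0" "AE y in \<mu>. y \<in> ball x r --> \<bar>u y - c\<bar> \<le> 1 / real (Suc n) / 2"
        using loc[OF x, of "1 / real (Suc n) / 2"] by auto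
      have "AE y in \<mu>. y \<in> ball x r --> \<bar>v y - u y\<bar> \<le> 1 / real (Suc n)"
        using r(2)
      proof eventually_elim
        case (elim y)
        show ?case
        proof
          assume y: "y \<in> ball x r"
          then have "\<bar>u y - c\<bar> \<le> 1 / real (Suc n) / 2" using elim by blast
          then show "\<bar>v y - u y\<bar> \<le> 1 / real (Suc n)" using near[OF r(2) y] half_sum[of "u y" c "1 / real (Suc n)" "v y"] by blast
        qed
      qed
      then show "\<exists>r>0. AE y in \<mu>. y \<in> ball x r --> \<bar>v y - u y\<bar> \<le> 1 / real (Suc n)" using r(1) by blast
    qed
    then have "AE y in \<mu>. \<forall>n. y \<in> V --> \<bar>v y - u y\<bar> \<le> 1 / real (Suc n)" by (subst AE_all_countable) auto
    then show ?thesis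
    proof eventually_elim
      case (elim y)
      show ?case
      proof
        assume y: "y \<in> V"
        show "v y = u y"
        proof (rule ccontr)
          assume "v y \<noteq> u y"
          then have "0 < \<bar>v y - u y\<bar>" by simp
          then obtain n where "1 / real (Suc n) < \<bar>v y - u y\<bar>" by (rule nat_approx_posE)
          then show False using elim y by (meson not_le)
        qed
      qed
    qed
  qed
  ultimately show ?thesis by blast
qed

text \<open>The continuous representative inherits the gradients of the minimizer by
  \<open>pgrad_continuous_representative\<close>, also across the boundary of \<open>V\<close>. So
  it is still admissible and has no larger energy.\<close>

theorem continuous_minimizer_exists:
  assumes V: "open V" "V \<subseteq> ball z R0" and F: "L-lipschitz_on UNIV F" and FM: "\<And>x. \<bar>F x\<bar> \<le> M"
  shows "\<exists>w. minimizer F V w \<and> continuous_on V w"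
proof -
  have fin: "emeasure \<mu> V < \<infinity>" by (rule subset_ball_finite[OF V(2)])
  obtain w where w: "minimizer F V w" "\<And>x. \<bar>w x\<bar> \<le> M" using minimizer_exists[OF V(1) fin F FM] by blast
  have wa: "adm F V w" using w(1) by (simp add: minimizer_def)
  obtain b where b: "rgrad V w b" "en V w = ennreal (\<integral>x. b x powr p \<partial>\<mu>)"
    using energy_attained[OF V(1) adm_Dp[OF V(1) wa]] by blast
  have wm[measurable]: "meas w" using wa by (simp add: adm_def)
  have [measurable]: "V \<in> sets \<mu>" using V by auto
  have c1: "cacc V w b" by (rule minimizer_cacc[OF V(1) fin w b])
  \<comment> \<open>\<open>- w\<close> minimizes the energy for the data \<open>- F\<close> with the
    same gradient \<open>b\<close>, so the Caccioppoli inequality holds for it as well.\<close>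
  have c2: "cacc V (\<lambda>y. - w y) b"
  proof -
    have m: "minimizer (\<lambda>x. - F x) V (\<lambda>x. - w x)"
      using minimizer_affine[OF V(1) w(1), of "-1" 0] by simp
    have r: "rgrad V (\<lambda>x. - w x) b" using rgrad_affine[OF b(1), of "-1" 0] by simp
    have "en V (\<lambda>x. - w x) = en V w"
    proof (rule antisym)
      have p1: "\<bar>-1::real\<bar> powr p = 1" by simp
      show "en V (\<lambda>x. - w x) \<le> en V w"
        using en_affine[OF V(1) adm_Dp[OF V(1) wa] wm, of "-1" 0] by simp
      have "adm (\<lambda>x. - F x) V (\<lambda>x. - w x)" using m by (simp add: minimizer_def)
      from en_affine[OF V(1) adm_Dp[OF V(1) this], of "-1" 0] wm
      show "en V w \<le> en V (\<lambda>x. - w x)" by simp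
    qed
    then show ?thesis using b(2) w(2) by (intro minimizer_cacc[OF V(1) fin m _ r, of M]) auto
  qed
  define u where "u y = (if y \<in> V then w y else 0)" for y
  have um: "meas u" unfolding u_def[abs_def] by measurable
  have uM: "\<bar>u y\<bar> \<le> \<bar>M\<bar>" for y using w(2)[of y] by (auto simp: u_def)
  have ru: "rgrad V u b"
    unfolding rgrad_def
  proof (intro conjI allI impI)
    show "pgrad V u (\<lambda>x. ennreal (b x))"
      by (rule pgrad_cong[OF rgradD(6)[OF b(1)]]) (use rgradD(2)[OF b(1)] in \<open>auto simp: u_def\<close>)
  qed (use rgradD[OF b(1)] in auto)
  have cu: "cacc V u' b" if c: "cacc V w' b" and e: "\<And>y. y \<in> V ==> u' y = w' y" for u' w'
    unfolding cacc_def
  proof (intro allI impI)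
    fix k x r R assume rR: "0 < r" "r < R" "cball x R \<subseteq> V"
    have inV: "y \<in> V" if "dist x y < R" for y using that rR(3) by auto
    have "(\<integral>y. indicator {y \<in> ball x r. k < u' y} y * b y powr p \<partial>\<mu>) = (\<integral>y. indicator {y \<in> ball x r. k < w' y} y * b y powr p \<partial>\<mu>)"
      using e inV rR by (intro Bochner_Integration.integral_cong) (auto simp: indicator_def)
    also have "\<dots> \<le> (PC / (R - r)) powr p * ball_int x R (\<lambda>y. max (w' y - k) 0 powr p)"
      by (rule c[unfolded cacc_def, rule_format, OF rR])
    also have "ball_int x R (\<lambda>y. max (w' y - k) 0 powr p) = ball_int x R (\<lambda>y. max (u' y - k) 0 powr p)"
      using e inV by (intro Bochner_Integration.integral_cong) (auto simp: indicator_def)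
    finally show "(\<integral>y. indicator {y \<in> ball x r. k < u' y} y * b y powr p \<partial>\<mu>) \<le> (PC / (R - r)) powr p * ball_int x R (\<lambda>y. max (u' y - k) 0 powr p)" .
  qed
  have "cacc V u b" by (rule cu[OF c1]) (simp add: u_def)
  moreover have "cacc V (\<lambda>y. - u y) b" by (rule cu[OF c2]) (simp add: u_def)
  ultimately have d: "dg V u b"
    unfolding dg_def using V(2) um uM ru by blast
  obtain v where v: "continuous_on V v" "AE y in \<mu>. y \<in> V --> v y = u y"
    using continuous_representative_exists[OF V uM dg_almost_constant[OF V(1) d]] by blast
  define w' where "w' y = (if y \<in> V then v y else F y)" for y
  have cw': "continuous_on V w'" using v(1) by (rule continuous_on_eq) (simp add: w'_def)
  have ae: "AE y in \<mu>. y \<in> V --> w' y = w y" using v(2) by eventually_elim (auto simp: w'_def u_def)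
  have off: "w' y = w y" if "y \<notin> V" for y using wa that by (simp add: w'_def adm_def)
  have w'm: "meas w'" unfolding w'_def[abs_def]
    using V(1) v(1) lipschitz_on_continuous_on[OF F]
    by (intro borel_mu borel_measurable_continuous_on_if) (auto intro: continuous_on_subset)
  note rep = pgrad_continuous_representative[OF _ V(1) cw' ae]
  obtain h where h: "pgrad UNIV w h" using wa by (auto simp: adm_def)
  have gU: "pgrad UNIV w' h" by (rule rep[OF h]) (use off in auto)
  have gV: "pgrad V w' (\<lambda>x. ennreal (b x))" by (rule rep[OF rgradD(6)[OF b(1)]]) auto
  have w'a: "adm F V w'" by (rule admI[OF w'm _ gU gV rgradD(7)[OF b(1)]]) (simp add: w'_def)
  have "rgrad V w' b" using b(1) gV by (auto simp: rgrad_def)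
  then have "en V w' \<le> en V w" unfolding b(2) by (rule energy_le_rgrad[OF V(1) adm_Dp[OF V(1) w'a]])
  then have "minimizer F V w'" using w(1) w'a unfolding minimizer_def by (meson order_trans)
  then show ?thesis using cw' by blast
qed

end

section \<open>Harmonic extensions\<close>

text \<open>McShane's formula, an infimum of cones with slope \<open>L\<close>, followed by clipping
  to [-M, M].\<close>

lemma lipschitz_extension_bounded:
  fixes v :: "'a::metric_space => real"
  assumes v: "L-lipschitz_on S v" and M: "\<And>y. y \<in> S ==> \<bar>v y\<bar> \<le> M" "0 \<le> M"
  shows "\<exists>F. L-lipschitz_on UNIV F \<and> (\<forall>y\<in>S. F y = v y) \<and> (\<forall>y. \<bar>F y\<bar> \<le> M)"
proof (cases "S = {}")
  case True
  have "L-lipschitz_on UNIV (\<lambda>_::'a. 0::real)"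
    using lipschitz_on_nonneg[OF v] by (intro lipschitz_onI) auto
  then show ?thesis using True M by (intro exI[of _ "\<lambda>_. 0"]) auto
next
  case False
  have L: "0 \<le> L" by (rule lipschitz_on_nonneg[OF v])
  have v': "v y \<le> v z + L * dist y z" if "y \<in> S" "z \<in> S" for y z
    using lipschitz_onD[OF v that] by (simp add: dist_real_def)
  define G where "G x = (INF y\<in>S. v y + L * dist x y)" for x
  have bd: "bdd_below ((\<lambda>y. v y + L * dist x y) ` S)" for x
  proof (rule bdd_belowI2)
    show "- M \<le> v y + L * dist x y" if "y \<in> S" for y
      using M(1)[OF that] L zero_le_dist[of x y] mult_nonneg_nonneg[of L "dist x y"] by linarith
  qed
  have GS: "G x = v x" if x: "x \<in> S" for x
  proof (rule antisym)
    show "G x \<le> v x" unfolding G_def using cINF_lower[OF bd x, of x] by simp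
    show "v x \<le> G x" unfolding G_def using False v'[OF x] by (intro cINF_greatest) auto
  qed
  have GL: "G x \<le> G x' + L * dist x x'" for x x'
  proof -
    have "G x - L * dist x x' \<le> v y + L * dist x' y" if y: "y \<in> S" for y
    proof -
      have "G x \<le> v y + L * dist x y" unfolding G_def by (rule cINF_lower[OF bd y])
      also have "\<dots> \<le> v y + L * (dist x x' + dist x' y)" using L by (intro add_left_mono mult_left_mono dist_triangle)
      finally show ?thesis by (simp add: algebra_simps)
    qed
    then have "G x - L * dist x x' \<le> G x'" unfolding G_def[of x'] using False by (intro cINF_greatest)
    then show ?thesis by simp
  qed
  define F where "F x = max (- M) (min M (G x))" for x
  have "L-lipschitz_on UNIV F"
  proof (rule lipschitz_onI[OF _ L])
    fix x y
    have "\<bar>G x - G y\<bar> \<le> L * dist x y" using GL[of x y] GL[of y x] by (simp add: dist_commute abs_le_iff)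
    moreover have "\<bar>F x - F y\<bar> \<le> \<bar>G x - G y\<bar>" unfolding F_def by linarith
    ultimately show "dist (F x) (F y) \<le> L * dist x y" by (simp add: dist_real_def)
  qed
  moreover have "F y = v y" if "y \<in> S" for y using GS[OF that] M(1)[OF that] by (auto simp: F_def abs_le_iff)
  moreover have "\<bar>F y\<bar> \<le> M" for y using M(2) by (auto simp: F_def abs_le_iff)
  ultimately show ?thesis by blast
qed

section \<open>Harmonic extensions as minimizers\<close>

lemma weak_upper_gradient_cong:
  assumes "\<And>x. x \<in> V ==> f x = f' x"
  shows "weak_upper_gradient p \<mu> V f g = weak_upper_gradient p \<mu> V f' g"
proof -
  have "jump (f (\<gamma> 0)) (f (\<gamma> l)) = jump (f' (\<gamma> 0)) (f' (\<gamma> l))" if "curve V l \<gamma>" for l \<gamma>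
    using assms arclength_curvesD(1)[OF that] arclength_curvesD(4)[OF that, of 0] arclength_curvesD(4)[OF that, of l] by simp
  then have "(\<forall>(l, \<gamma>)\<in>arclength_curves V - \<Gamma>. jump (f (\<gamma> 0)) (f (\<gamma> l)) \<le> curve_integral l \<gamma> g)
     = (\<forall>(l, \<gamma>)\<in>arclength_curves V - \<Gamma>. jump (f' (\<gamma> 0)) (f' (\<gamma> l)) \<le> curve_integral l \<gamma> g)" for \<Gamma>
    by (intro ball_cong) auto
  then show ?thesis unfolding weak_upper_gradient_def by simp
qed

lemma p_energy_cong:
  assumes "\<And>x. x \<in> V ==> f x = f' x" shows "p_energy p \<mu> V f = p_energy p \<mu> V f'"
proof -
  have e: "weak_upper_gradient p \<mu> V f = weak_upper_gradient p \<mu> V f'"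
    by (rule ext) (rule weak_upper_gradient_cong[OF assms])
  show ?thesis unfolding p_energy_def minimal_weak_upper_gradient_def e ..
qed

lemma capacity_antimono: "A \<subseteq> B ==> capacity p \<mu> A \<le> capacity p \<mu> B"
  unfolding capacity_def by (intro INF_superset_mono) auto

context borel_mm
begin

abbreviation is_Hext :: "'a set => ('a => real) => ('a => real) => bool" where
  "is_Hext V v \<equiv> is_p_harmonic_extension p \<mu> V (\<lambda>y. ereal (v y))"

abbreviation Hext :: "'a set => ('a => real) => 'a => real" where
  "Hext V v \<equiv> p_harmonic_extension p \<mu> V (\<lambda>y. ereal (v y))"

lemma measurable_restrict_cong:
  fixes f f' :: "'a => ereal"
  assumes "\<And>x. x \<in> V ==> f x = f' x"
  shows "f \<in> borel_measurable (restrict_space \<mu> V) \<longleftrightarrow> f' \<in> borel_measurable (restrict_space \<mu> V)"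
  using assms by (intro measurable_cong) (auto simp: space_restrict_space)

lemma Dp_cong: "(\<And>x. x \<in> V ==> f x = f' x) ==> Dp p \<mu> V f = Dp p \<mu> V f'"
  unfolding Dp_def using weak_upper_gradient_cong[of V f f' p \<mu>] measurable_restrict_cong[of V f f'] by simp

lemma egrad_real: "egrad A f g ==> pgrad A (\<lambda>x. real_of_ereal (f x)) g"
  by (rule egrad_lift) (auto simp: pgrad_measurable)

text \<open>The definition compares extended real functions on \<open>V\<close> through D^p_0(V);
  the minimizers above are real functions on the whole space that equal \<open>F\<close> off
  \<open>V\<close>. Zero extension of the difference leads from the second setting to the first, and
  gluing with \<open>F\<close> leads back.\<close>

lemma is_extension_iff:
  assumes V: "open V" "emeasure \<mu> V < \<infinity>" and F: "L-lipschitz_on UNIV F" and FM: "\<And>x. \<bar>F x\<bar> \<le> M"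
    and v: "\<And>x. x \<in> V ==> v x = F x"
  shows "is_Hext V v u \<longleftrightarrow>
    continuous_on V u \<and> minimizer F V (\<lambda>x. if x \<in> V then u x else F x)"
proof -
  have Vb: "V \<in> sets borel" and Ub: "(UNIV :: 'a set) \<in> sets borel" using V by auto
  have UNIVm: "f \<in> borel_measurable (restrict_space \<mu> UNIV) \<longleftrightarrow> meas f" for f :: "'a => ereal"
    by (simp cong: measurable_cong_sets)
  note Fa = lipschitz_adm[OF V F]
  note [measurable] = Fa(2) Vb
  have Dp0I: "Dp0 p \<mu> V (\<lambda>x. ereal (u x) - ereal (v x))"
    if t: "adm F V t" and ut: "\<And>x. x \<in> V ==> u x = t x" for t u
  proof -
    obtain h g where 1: "meas t" "\<And>x. x \<notin> V ==> t x = F x" "pgrad UNIV t h" "pgrad V t g" "bLp g"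
      using t unfolding adm_def by blast
    define D where "D x = t x + - F x" for x
    define k where "k x = g x + ennreal L * indicator V x" for x
    have kL: "bLp k" unfolding k_def[abs_def] by (intro bLp_add 1 bLp_const_indicator Vb V)
    have kb: "k \<in> borel_measurable borel" using kL by (simp add: bLp_def)
    have gU: "pgrad UNIV D (\<lambda>x. k x * indicator V x)"
    proof (rule pgrad_zero_extension[OF V(1) _ _ _ kL])
      show "pgrad UNIV D (\<lambda>x. h x + ennreal L)"
        unfolding D_def[abs_def] by (intro pgrad_add pgrad_uminus 1 Fa)
      show "pgrad V D k" unfolding D_def[abs_def] k_def[abs_def] by (intro pgrad_add pgrad_uminus 1 Fa)
      show "D x = 0" if "x \<notin> V" for x using 1(2)[OF that] by (simp add: D_def)
    qed
    have "bLp (\<lambda>x. k x * indicator V x)"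
      by (rule bLp_mono[OF kL]) (use kb in \<open>measurable, auto simp: indicator_def\<close>)
    moreover have "meas (\<lambda>x. ereal (D x))" using 1(1) unfolding D_def by measurable
    ultimately have "Dp p \<mu> UNIV (\<lambda>x. ereal (D x))" unfolding Dp_iff[OF Ub] UNIVm using gU by blast
    then show ?thesis unfolding Dp0_def
      using 1(2) v ut by (intro exI[of _ "\<lambda>x. ereal (D x)"]) (auto simp: D_def)
  qed
  have Dp0D: "\<exists>h k. h \<in> borel_measurable \<mu> \<and> egrad UNIV h k \<and> (\<forall>x. x \<notin> V --> h x = 0) \<and> (\<forall>x\<in>V. h x = w x - ereal (v x))"
    if "Dp0 p \<mu> V (\<lambda>x. w x - ereal (v x))" for w
    using that unfolding Dp0_def Dp_iff[OF Ub] UNIVm by auto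
  define E where "E u x = (if x \<in> V then u x else F x)" for u :: "'a => real" and x
  have EV: "E u x = u x" if "x \<in> V" for u x using that by (simp add: E_def)
  have en_E: "en V (E u) = p_energy p \<mu> V (\<lambda>x. ereal (u x))" for u
    unfolding en_def by (rule p_energy_cong) (simp add: EV)
  have toadm: "adm F V (E u)" if Du: "Dp p \<mu> V (\<lambda>x. ereal (u x))" and D0: "Dp0 p \<mu> V (\<lambda>x. ereal (u x) - ereal (v x))" for u
  proof -
    obtain h k where h: "meas h" "egrad UNIV h k" "\<And>x. x \<notin> V ==> h x = 0" "\<And>x. x \<in> V ==> h x = ereal (u x) - ereal (v x)"
      using Dp0D[OF D0] by blast
    have e: "E u = (\<lambda>x. F x + real_of_ereal (h x))" using h(3,4) v by (auto simp: E_def fun_eq_iff)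
    obtain g where g: "bLp g" "pgrad V u g" using Du unfolding Dp_iff[OF Vb] by blast
    show ?thesis
    proof (rule admI)
      show "E u \<in> borel_measurable \<mu>" unfolding e using h(1) by measurable
      show "pgrad UNIV (E u) (\<lambda>x. ennreal L + k x)" unfolding e by (rule pgrad_add[OF Fa(3) egrad_real[OF h(2)]])
      show "pgrad V (E u) g" using g by (intro pgrad_cong[OF g(2)]) (auto simp: EV pgrad_measurable)
      show "bLp g" by (rule g)
    qed (simp add: E_def)
  qed
  have key: "is_Hext V v u \<longleftrightarrow> continuous_on V u \<and> minimizer F V (E u)"
  proof
    assume H: "is_Hext V v u"
    then have c: "continuous_on V u" and Du: "Dp p \<mu> V (\<lambda>x. ereal (u x))"
      and D0: "Dp0 p \<mu> V (\<lambda>x. ereal (u x) - ereal (v x))"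
      and min: "\<And>w. Dp p \<mu> V w ==> Dp0 p \<mu> V (\<lambda>x. w x - ereal (v x)) ==> p_energy p \<mu> V (\<lambda>x. ereal (u x)) \<le> p_energy p \<mu> V w"
      unfolding is_p_harmonic_extension_def by auto
    have "en V (E u) \<le> en V t" if t: "adm F V t" for t
      unfolding en_E unfolding en_def by (intro min adm_Dp[OF V(1) t] Dp0I[OF t refl])
    then show "continuous_on V u \<and> minimizer F V (E u)" using c toadm[OF Du D0] by (auto simp: minimizer_def)
  next
    assume H: "continuous_on V u \<and> minimizer F V (E u)"
    then have ad: "adm F V (E u)" by (simp add: minimizer_def)
    have Du: "Dp p \<mu> V (\<lambda>x. ereal (u x))"
      using adm_Dp[OF V(1) ad] by (subst Dp_cong[of V _ "\<lambda>x. ereal (E u x)"]) (auto simp: EV)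
    have D0: "Dp0 p \<mu> V (\<lambda>x. ereal (u x) - ereal (v x))" by (rule Dp0I[OF ad]) (simp add: EV)
    have "p_energy p \<mu> V (\<lambda>x. ereal (u x)) \<le> p_energy p \<mu> V w"
      if w: "Dp p \<mu> V w" and w0: "Dp0 p \<mu> V (\<lambda>x. w x - ereal (v x))" for w
    proof -
      obtain h k where h: "meas h" "egrad UNIV h k" "\<And>x. x \<notin> V ==> h x = 0" "\<And>x. x \<in> V ==> h x = w x - ereal (v x)"
        using Dp0D[OF w0] by blast
      obtain g where g: "bLp g" "egrad V w g" "p_energy p \<mu> V w = energy V g"
        using p_energy_properties(1)[OF Vb w] by blast
      \<comment> \<open>A competitor \<open>w\<close> may take infinite values, where
        \<open>real_of_ereal\<close> gives the default 0. Almost no curve in \<open>V\<close> meets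
        such points, so the clipped real function has the gradient \<open>g\<close> of
        \<open>w\<close>.\<close>
      define t where "t x = max (- M) (min M (F x + real_of_ereal (h x)))" for x
      have tm: "meas t" unfolding t_def[abs_def] using h(1) by measurable
      have gt: "pgrad V t g"
      proof (rule egrad_lift[OF g(2) pgrad_measurable[OF g(2)]])
        fix l \<gamma> assume cu: "curve V l \<gamma>" and fin: "\<forall>s\<in>{0..l}. \<bar>w (\<gamma> s)\<bar> \<noteq> \<infinity>"
          and i: "egrad_along l \<gamma> w g"
        have e: "F (\<gamma> s) + real_of_ereal (h (\<gamma> s)) = real_of_ereal (w (\<gamma> s))" if s: "s \<in> {0..l}" for s
        proof -
          have "\<bar>w (\<gamma> s)\<bar> \<noteq> \<infinity>" using fin s by (rule bspec)
          then obtain r where r: "w (\<gamma> s) = ereal r" by (cases "w (\<gamma> s)") auto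
          show ?thesis using h(4)[OF arclength_curvesD(4)[OF cu s]] v[OF arclength_curvesD(4)[OF cu s]] r by simp
        qed
        have "igrad l (\<lambda>s. t (\<gamma> s)) (\<lambda>s. ennreal 1 * g (\<gamma> s))"
          by (rule igrad_contraction[OF i]) (auto simp: t_def e)
        then show "(\<forall>s\<in>{0..l}. \<bar>ereal (t (\<gamma> s))\<bar> \<noteq> \<infinity>) \<and> igrad l (\<lambda>s. real_of_ereal (ereal (t (\<gamma> s)))) (\<lambda>s. g (\<gamma> s))" by simp
      qed
      have "adm F V t"
      proof (rule admI[OF tm _ _ gt g(1)])
        show "t x = F x" if "x \<notin> V" for x using h(3)[OF that] FM[of x] by (auto simp: t_def abs_le_iff)
        show "pgrad UNIV t (\<lambda>x. ennreal L + k x)"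
          unfolding t_def[abs_def] by (rule pgrad_clip[OF pgrad_add[OF Fa(3) egrad_real[OF h(2)]]])
      qed
      then have "en V (E u) \<le> en V t" using H by (simp add: minimizer_def)
      also have "\<dots> \<le> energy V g"
        unfolding en_def by (rule p_energy_properties(2)[OF Vb adm_Dp[OF V(1) \<open>adm F V t\<close>] gt])
      finally show ?thesis unfolding en_E g(3) .
    qed
    then show "is_Hext V v u"
      unfolding is_p_harmonic_extension_def using H Du D0 by blast
  qed
  show ?thesis using key unfolding E_def[abs_def] .
qed

end

section \<open>Uniqueness and affine invariance of harmonic extensions\<close>

context pi_space
begin

text \<open>By the Poincare inequality \<open>D\<close> has no oscillation on any ball about z, and
  the constants on these balls agree on the unit ball.\<close>

lemma zero_gradient_constant:
  assumes Dm: "meas D" and D1: "\<And>y. \<bar>D y\<bar> \<le> M" and D0: "\<And>y. y \<notin> ball z R ==> D y = 0"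
    and g: "pgrad UNIV D (\<lambda>_. 0)"
  shows "\<exists>c. AE y in \<mu>. D y = c"
proof -
  have g': "pgrad UNIV D (\<lambda>y. ennreal ((\<lambda>_. 0::real) y))" using g by simp
  have ball: "AE y in \<mu>. y \<in> ball z r --> D y = avg D z r" if r: "0 < r" for r
  proof -
    have "osc D z r \<le> 0"
      using poincare_local[OF Dm D1 D0 g' _ _ r, of z] by simp
    then have "osc D z r * bm z r \<le> 0" using osc_nonneg[of D z r] bm_pos[OF r, of z] by (simp add: mult_nonpos_nonneg)
    then have le: "ball_int z r (\<lambda>y. \<bar>D y - avg D z r\<bar>) \<le> 0" unfolding osc_mult[OF r] .
    have i: "integrable \<mu> (\<lambda>y. indicator (ball z r) y * \<bar>D y - avg D z r\<bar>)" by (rule osc_integrable[OF Dm D1])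
    have "0 \<le> ball_int z r (\<lambda>y. \<bar>D y - avg D z r\<bar>)" by (intro integral_nonneg_AE) auto
    then have "ball_int z r (\<lambda>y. \<bar>D y - avg D z r\<bar>) = 0" by (rule antisym[OF le])
    then have "AE y in \<mu>. indicator (ball z r) y * \<bar>D y - avg D z r\<bar> = 0"
      using i by (subst (asm) integral_nonneg_eq_0_iff_AE) auto
    then show ?thesis by eventually_elim (auto simp: indicator_def)
  qed
  have "AE y in \<mu>. y \<in> ball z (real (Suc n)) --> D y = avg D z 1" for n
  proof -
    have "AE y in \<mu>. (y \<in> ball z (real (Suc n)) --> D y = avg D z (real (Suc n))) \<and> (y \<in> ball z 1 --> D y = avg D z 1)"
      using ball[of "real (Suc n)"] ball[of 1] by auto
    then obtain y where y: "y \<in> ball z 1" "y \<in> ball z (real (Suc n)) --> D y = avg D z (real (Suc n))" "y \<in> ball z 1 --> D y = avg D z 1"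
      using AE_ball_exists[of _ 1 z] by (metis (mono_tags, lifting) zero_less_one)
    have "y \<in> ball z (real (Suc n))" using y(1) by auto
    then have "avg D z (real (Suc n)) = avg D z 1" using y by auto
    then show ?thesis using ball[of "real (Suc n)"] by simp
  qed
  then have "AE y in \<mu>. \<forall>n. y \<in> ball z (real (Suc n)) --> D y = avg D z 1" by (subst AE_all_countable) auto
  then have "AE y in \<mu>. D y = avg D z 1"
  proof eventually_elim
    case (elim y)
    obtain n where "dist z y < real n" using reals_Archimedean2 by blast
    then have "y \<in> ball z (real (Suc n))" by simp
    then show ?case using elim by blast
  qed
  then show ?thesis by blast
qed

text \<open>The truncated difference \<open>D\<close> has gradient 0, so it is a constant c0 almost
  everywhere. If c0 were not 0, then 1 - D/c0 would be 1 off \<open>V\<close>, 0 almost everywhere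
  and of zero gradient, and the capacity of the complement would vanish. So \<open>D\<close> is 0
  almost everywhere, and continuity gives the inequality at every point of \<open>V\<close>.\<close>

lemma continuous_minimizers_le:
  assumes V: "open V" "V \<subseteq> ball z R" and cap: "0 < capacity p \<mu> (- V)"
    and w: "minimizer F V w1" "minimizer F V w2" and c: "continuous_on V w1" "continuous_on V w2"
    and x: "x \<in> V"
  shows "w2 x \<le> w1 x"
proof -
  have wm[measurable]: "meas w1" "meas w2" using w by (auto simp: minimizer_def adm_def)
  have off: "w1 y = w2 y" if "y \<notin> V" for y using w that by (auto simp: minimizer_def adm_def)
  define D where "D y = min 1 (max (w2 y - w1 y) 0)" for y
  have Dm[measurable]: "meas D" unfolding D_def[abs_def] by measurable
  have D01: "0 \<le> D y" "D y \<le> 1" for y by (auto simp: D_def)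
  have D0: "D y = 0" if "y \<notin> V" for y using off[OF that] by (simp add: D_def)
  have g: "pgrad UNIV D (\<lambda>_. 0)"
  proof (rule pgrad_contraction1[OF minimizers_zero_gradient[OF V(1) w]])
    have "\<bar>min 1 a - min 1 b\<bar> \<le> \<bar>a - b\<bar>" for a b :: real by linarith
    then show "\<bar>D x - D y\<bar> \<le> \<bar>max (w2 x - w1 x) 0 - max (w2 y - w1 y) 0\<bar>" for x y unfolding D_def .
  qed
  obtain c0 where c0: "AE y in \<mu>. D y = c0"
  proof -
    have a: "\<bar>D y\<bar> \<le> 1" for y using D01[of y] by simp
    have b: "D y = 0" if "y \<notin> ball z R" for y using D0[of y] V(2) that by blast
    from zero_gradient_constant[OF Dm a b g] show ?thesis using that by blast
  qed
  have "c0 = 0"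
  proof (rule ccontr)
    assume n0: "c0 \<noteq> 0"
    define f where "f y = 1 - D y / c0" for y
    have fm: "meas (\<lambda>y. ereal (f y))" unfolding f_def by measurable
    have "pgrad UNIV f (\<lambda>y. ennreal \<bar>1 / c0\<bar> * 0)"
      by (rule pgrad_contraction[OF g]) (auto simp: f_def diff_divide_distrib[symmetric] abs_minus_commute)
    then have gf: "weak_upper_gradient p \<mu> UNIV (\<lambda>y. ereal (f y)) (\<lambda>_. 0)" by (intro egrad_wug) auto
    have "AE y in \<mu>. f y = 0" using c0 by eventually_elim (use n0 in \<open>simp add: f_def\<close>)
    then have i0: "(\<integral>\<^sup>+y. epowr (e2ennreal \<bar>ereal (f y)\<bar>) p \<partial>\<mu>) = 0"
      by (subst nn_integral_cong_AE[of _ "\<lambda>_. 0"]) (auto elim!: eventually_mono simp: e2ennreal_ereal)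
    have "(INF g\<in>{g. weak_upper_gradient p \<mu> UNIV (\<lambda>y. ereal (f y)) g}. \<integral>\<^sup>+x. epowr (g x) p \<partial>\<mu>) \<le> (\<integral>\<^sup>+x. epowr 0 p \<partial>\<mu>)"
      using gf by (intro INF_lower2[of "\<lambda>_. 0"]) auto
    then have n: "N1p_norm p \<mu> (\<lambda>y. ereal (f y)) = 0"
      unfolding N1p_norm_def i0 by (simp add: epowr_eq_0)
    have "capacity p \<mu> (- V) \<le> epowr (N1p_norm p \<mu> (\<lambda>y. ereal (f y))) p"
      unfolding capacity_def
    proof (rule INF_lower)
      have "1 \<le> f y" if "y \<notin> V" for y using D0[OF that] by (simp add: f_def)
      then show "(\<lambda>y. ereal (f y)) \<in> {f. N1p p \<mu> f \<and> (\<forall>x\<in>- V. 1 \<le> f x)}"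
        using fm n by (auto simp: N1p_def one_ereal_def)
    qed
    then show False using cap unfolding n by simp
  qed
  show ?thesis
  proof (rule ccontr)
    assume "\<not> ?thesis"
    then have lt: "0 < w2 x - w1 x" by simp
    have "continuous_on V (\<lambda>y. w2 y - w1 y)" by (intro continuous_on_diff c)
    then have "isCont (\<lambda>y. w2 y - w1 y) x" using V(1) x by (simp add: continuous_on_eq_continuous_at)
    then have "((\<lambda>y. w2 y - w1 y) \<longlongrightarrow> w2 x - w1 x) (at x)" by (simp add: isCont_def)
    then have "eventually (\<lambda>y. 0 < w2 y - w1 y) (at x)" using lt by (rule order_tendstoD)
    then obtain d where d: "d > 0" "\<And>y. y \<noteq> x ==> dist y x < d ==> 0 < w2 y - w1 y"
      unfolding eventually_at by auto
    obtain y where "y \<in> ball x d" "D y = c0" using AE_ball_exists[OF c0 d(1)] by blast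
    then have "0 < w2 y - w1 y" "D y = 0" using d(2)[of y] lt \<open>c0 = 0\<close> by (cases "y = x", auto simp: dist_commute)
    then show False by (auto simp: D_def min_def max_def split: if_splits)
  qed
qed

definition Hdom :: "'a set => ('a => real) => bool" where
  "Hdom V v \<longleftrightarrow> open V \<and> compact (closure V) \<and> 0 < capacity p \<mu> (- V) \<and> (\<exists>L. L-lipschitz_on (closure V) v)"

lemma Hdom_extension:
  assumes "Hdom V v"
  shows "\<exists>F L M z R. open V \<and> V \<subseteq> ball z R \<and> emeasure \<mu> V < \<infinity> \<and> L-lipschitz_on UNIV F \<and> (\<forall>x. \<bar>F x\<bar> \<le> M) \<and> (\<forall>x\<in>V. v x = F x)"
proof -
  obtain L where V: "open V" "compact (closure V)" and L: "L-lipschitz_on (closure V) v"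
    using assms by (auto simp: Hdom_def)
  have "bounded V" using bounded_subset[OF compact_imp_bounded[OF V(2)] closure_subset] .
  then obtain z e where ze: "V \<subseteq> cball z e" unfolding bounded_def by (auto simp: subset_iff)
  have sub: "V \<subseteq> ball z (e + 1)"
  proof
    fix y assume "y \<in> V"
    then have "dist z y \<le> e" using ze by auto
    then show "y \<in> ball z (e + 1)" by simp
  qed
  have "bounded (v ` closure V)"
    by (rule compact_imp_bounded[OF compact_continuous_image[OF lipschitz_on_continuous_on[OF L] V(2)]])
  then obtain M where "\<forall>y\<in>closure V. \<bar>v y\<bar> \<le> M" unfolding bounded_iff by auto
  then have "\<And>y. y \<in> closure V ==> \<bar>v y\<bar> \<le> \<bar>M\<bar>" by (meson abs_ge_self order_trans)
  from lipschitz_extension_bounded[OF L this]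
  obtain F where F: "L-lipschitz_on UNIV F" "\<forall>y\<in>closure V. F y = v y" "\<forall>y. \<bar>F y\<bar> \<le> \<bar>M\<bar>" by auto
  have "\<forall>x\<in>V. v x = F x" using F(2) closure_subset[of V] by force
  then show ?thesis using V(1) sub subset_ball_finite[OF sub] F(1,3) by blast
qed

lemma harmonic_extension_unique:
  assumes H: "Hdom V v" and u: "is_Hext V v u"
    and u': "is_Hext V v u'" and x: "x \<in> V"
  shows "u x = u' x"
proof -
  obtain F L M z R where V: "open V" "V \<subseteq> ball z R" "emeasure \<mu> V < \<infinity>" and F: "L-lipschitz_on UNIV F" "\<And>x. \<bar>F x\<bar> \<le> M" "\<And>x. x \<in> V ==> v x = F x"
    using Hdom_extension[OF H] by blast
  have cap: "0 < capacity p \<mu> (- V)" using H by (simp add: Hdom_def)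
  have iff: "is_Hext V v u \<longleftrightarrow>
    continuous_on V u \<and> minimizer F V (\<lambda>x. if x \<in> V then u x else F x)" for u
    by (rule is_extension_iff[OF V(1,3) F(1,2)]) (rule F(3))
  have 1: "continuous_on V u" "minimizer F V (\<lambda>x. if x \<in> V then u x else F x)"
    using u unfolding iff by auto
  have 2: "continuous_on V u'" "minimizer F V (\<lambda>x. if x \<in> V then u' x else F x)"
    using u' unfolding iff by auto
  have c1: "continuous_on V (\<lambda>x. if x \<in> V then u x else F x)" using 1(1) by (rule continuous_on_eq) simp
  have c2: "continuous_on V (\<lambda>x. if x \<in> V then u' x else F x)" using 2(1) by (rule continuous_on_eq) simp
  show ?thesis
    using continuous_minimizers_le[OF V(1,2) cap 1(2) 2(2) c1 c2 x] continuous_minimizers_le[OF V(1,2) cap 2(2) 1(2) c2 c1 x] x by simp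
qed

text \<open>The normalization to 0 off \<open>V\<close> turns uniqueness on \<open>V\<close> into
  uniqueness as a function on the type, so the definite description denotes.\<close>

lemma harmonic_extension_is:
  assumes H: "Hdom V v"
  shows "is_Hext V v (Hext V v)"
proof -
  obtain F L M z R where V: "open V" "V \<subseteq> ball z R" "emeasure \<mu> V < \<infinity>" and F: "L-lipschitz_on UNIV F" "\<And>x. \<bar>F x\<bar> \<le> M" "\<And>x. x \<in> V ==> v x = F x"
    using Hdom_extension[OF H] by blast
  have iff: "is_Hext V v u \<longleftrightarrow>
    continuous_on V u \<and> minimizer F V (\<lambda>x. if x \<in> V then u x else F x)" for u
    by (rule is_extension_iff[OF V(1,3) F(1,2)]) (rule F(3))
  obtain w where w: "minimizer F V w" "continuous_on V w"
    using continuous_minimizer_exists[OF V(1,2) F(1,2)] by blast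
  define u where "u x = (if x \<in> V then w x else 0)" for x
  have cu: "continuous_on V u" using w(2) by (rule continuous_on_eq) (simp add: u_def)
  have "(\<lambda>x. if x \<in> V then u x else F x) = w" using w(1) by (auto simp: u_def minimizer_def adm_def)
  then have u: "is_Hext V v u" unfolding iff using cu w(1) by simp
  have "\<exists>!u. is_Hext V v u \<and> (\<forall>x\<in>- V. u x = 0)"
  proof (rule ex1I[of _ u])
    show "is_Hext V v u \<and> (\<forall>x\<in>- V. u x = 0)" using u by (simp add: u_def)
    fix u' assume u': "is_Hext V v u' \<and> (\<forall>x\<in>- V. u' x = 0)"
    show "u' = u"
    proof
      fix x show "u' x = u x"
        using harmonic_extension_unique[OF H _ u, of u' x] u' by (cases "x \<in> V") (auto simp: u_def)
    qed
  qed
  from theI'[OF this] show ?thesis unfolding p_harmonic_extension_def by blast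
qed

text \<open>Positive \<open>a\<close> serves the affine images of superharmonic functions;
  \<open>a\<close> = -1 serves the comparison of two of them, where \<phi> and - \<phi> - \<epsilon>
  are extended on the same set.\<close>

lemma harmonic_extension_affine:
  assumes H: "Hdom V v" and a: "a \<noteq> 0" and x: "x \<in> V"
  shows "Hext V (\<lambda>y. a * v y + c) x
       = a * Hext V v x + c"
proof -
  obtain F L M z R where V: "open V" "V \<subseteq> ball z R" "emeasure \<mu> V < \<infinity>" and F: "L-lipschitz_on UNIV F" "\<And>x. \<bar>F x\<bar> \<le> M" "\<And>x. x \<in> V ==> v x = F x"
    using Hdom_extension[OF H] by blast
  define h where "h = Hext V v"
  have h: "continuous_on V h" "minimizer F V (\<lambda>x. if x \<in> V then h x else F x)"
  proof -
    have iff: "is_Hext V v h \<longleftrightarrow>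
      continuous_on V h \<and> minimizer F V (\<lambda>x. if x \<in> V then h x else F x)"
      by (rule is_extension_iff[OF V(1,3) F(1,2)]) (rule F(3))
    show "continuous_on V h" "minimizer F V (\<lambda>x. if x \<in> V then h x else F x)"
      using harmonic_extension_is[OF H, folded h_def] unfolding iff by auto
  qed
  have lip: "(\<bar>a\<bar> * K)-lipschitz_on S (\<lambda>y. a * f y + c)" if "K-lipschitz_on S f" for K S and f :: "'a => real"
  proof (rule lipschitz_onI)
    fix y z assume "y \<in> S" "z \<in> S"
    then have "\<bar>a\<bar> * dist (f y) (f z) \<le> \<bar>a\<bar> * (K * dist y z)" using lipschitz_onD[OF that] by (intro mult_left_mono) auto
    moreover have "dist (a * f y + c) (a * f z + c) = \<bar>a\<bar> * dist (f y) (f z)"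
      by (simp add: dist_real_def abs_mult[symmetric] right_diff_distrib)
    ultimately show "dist (a * f y + c) (a * f z + c) \<le> \<bar>a\<bar> * K * dist y z" by (simp add: mult.assoc)
  qed (use lipschitz_on_nonneg[OF that] in simp)
  have H': "Hdom V (\<lambda>y. a * v y + c)" using H lip unfolding Hdom_def by blast
  have F': "(\<bar>a\<bar> * L)-lipschitz_on UNIV (\<lambda>y. a * F y + c)" by (rule lip[OF F(1)])
  have FM': "\<bar>a * F y + c\<bar> \<le> \<bar>a\<bar> * M + \<bar>c\<bar>" for y
  proof -
    have "\<bar>a * F y\<bar> \<le> \<bar>a\<bar> * M" unfolding abs_mult using F(2) by (intro mult_left_mono) auto
    then show ?thesis by linarith
  qed
  have m: "minimizer (\<lambda>x. a * F x + c) V (\<lambda>x. a * (if x \<in> V then h x else F x) + c)"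
    by (rule minimizer_affine[OF V(1) h(2) a])
  have "(\<lambda>x. a * (if x \<in> V then h x else F x) + c) = (\<lambda>x. if x \<in> V then a * h x + c else a * F x + c)" by auto
  then have "is_Hext V (\<lambda>y. a * v y + c) (\<lambda>x. a * h x + c)"
    using m h(1) F(3)
    by (subst is_extension_iff[OF V(1,3) F' FM']) (auto intro!: continuous_intros)
  from harmonic_extension_unique[OF H' harmonic_extension_is[OF H'] this x]
  show ?thesis by (simp add: h_def)
qed

end

section \<open>Perron solutions and boundary regularity\<close>

lemma eventually_approach:
  "eventually P (approach \<Omega> x0) \<longleftrightarrow>
    (\<exists>T. openin Xstar T \<and> x0 \<in> T \<and> (\<forall>y\<in>\<Omega>. Some y \<in> T --> Some y \<noteq> x0 --> P y))"
proof
  assume "eventually P (approach \<Omega> x0)"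
  then obtain Q where Q: "eventually Q (atin_within Xstar x0 (Some ` \<Omega>))" "\<And>x. Q (Some x) ==> P x"
    unfolding approach_def eventually_filtercomap by blast
  have "x0 \<in> topspace Xstar" by (cases x0) auto
  then obtain T where "openin Xstar T" "x0 \<in> T" "\<And>z. z \<in> T ==> z \<in> Some ` \<Omega> ==> z \<noteq> x0 ==> Q z"
    using Q(1) unfolding eventually_atin_within by blast
  then show "\<exists>T. openin Xstar T \<and> x0 \<in> T \<and> (\<forall>y\<in>\<Omega>. Some y \<in> T --> Some y \<noteq> x0 --> P y)"
    using Q(2) by blast
next
  assume "\<exists>T. openin Xstar T \<and> x0 \<in> T \<and> (\<forall>y\<in>\<Omega>. Some y \<in> T --> Some y \<noteq> x0 --> P y)"
  then obtain T where T: "openin Xstar T" "x0 \<in> T" "\<And>y. y \<in> \<Omega> ==> Some y \<in> T ==> Some y \<noteq> x0 ==> P y" by blast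
  have "eventually (\<lambda>z. \<forall>y. z = Some y --> P y) (atin_within Xstar x0 (Some ` \<Omega>))"
    unfolding eventually_atin_within using T by (intro disjI2 exI[of _ T]) auto
  then show "eventually P (approach \<Omega> x0)" unfolding approach_def eventually_filtercomap by blast
qed

lemma openin_Xstar_Some:
  assumes "openin Xstar T" shows "open (Some -` T)"
proof -
  from assms consider U where "open U" "T = Some ` U" | C where "compact C" "closed C" "T = insert None (Some ` (- C))"
    unfolding openin_Alexandroff_compactification by (auto simp: Compl_eq_Diff_UNIV)
  then show ?thesis
  proof cases
    case 1
    then have "Some -` T = U" by auto
    then show ?thesis using 1 by simp
  next
    case 2
    then have "Some -` T = - C" by auto
    then show ?thesis using 2 by auto
  qed
qed

lemma openin_Xstar_None:
  assumes "openin Xstar T" "None \<in> T" shows "\<exists>C. compact C \<and> T = insert None (Some ` (- C))"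
  using assms unfolding openin_Alexandroff_compactification by (auto simp: Compl_eq_Diff_UNIV)

lemma Liminf_affine_le:
  fixes u :: "'b => ereal"
  assumes a: "0 < a" and l: "l \<le> Liminf F u"
  shows "ereal a * l + ereal c \<le> Liminf F (\<lambda>x. ereal a * u x + ereal c)"
proof (cases "F = bot")
  case True
  then have "Liminf F (\<lambda>x. ereal a * u x + ereal c) = top" by (intro top.extremum_uniqueI Liminf_bounded) simp
  then show ?thesis by simp
next
  case False
  have "ereal a * l + ereal c \<le> ereal a * Liminf F u + ereal c"
    using a l by (intro add_right_mono ereal_mult_left_mono) auto
  also have "\<dots> = Liminf F (\<lambda>x. ereal a * u x + ereal c)"
    using False a by (simp add: Liminf_add_ereal_right Liminf_ereal_mult_left)
  finally show ?thesis .
qed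

lemma ereal_affine_le_iff:
  fixes a c v :: real assumes a: "0 < a"
  shows "ereal v \<le> ereal a * u + ereal c \<longleftrightarrow> ereal ((1 / a) * v + (- c / a)) \<le> u"
  using a by (cases u) (auto simp: field_simps)

lemma lipschitz_max:
  assumes "L-lipschitz_on S f" "L'-lipschitz_on S (g :: 'a::metric_space => real)"
  shows "(max L L')-lipschitz_on S (\<lambda>x. max (f x) (g x))"
proof (rule lipschitz_onI)
  fix x y assume xy: "x \<in> S" "y \<in> S"
  have "\<bar>f x - f y\<bar> \<le> max L L' * dist x y" "\<bar>g x - g y\<bar> \<le> max L L' * dist x y"
    using lipschitz_onD[OF lipschitz_on_le[OF assms(1), of "max L L'"] xy]
      lipschitz_onD[OF lipschitz_on_le[OF assms(2), of "max L L'"] xy] by (auto simp: dist_real_def)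
  then show "dist (max (f x) (g x)) (max (f y) (g y)) \<le> max L L' * dist x y"
    unfolding dist_real_def by linarith
qed (use lipschitz_on_nonneg[OF assms(1)] in auto)

lemma ereal_add_gt_split:
  fixes a b :: ereal assumes "ereal c < a + b" "a \<noteq> - \<infinity>" "b \<noteq> - \<infinity>"
  shows "\<exists>r s. r + s \<ge> c \<and> ereal r < a \<and> ereal s < b"
proof (cases a)
  case (real x)
  show ?thesis
  proof (cases b)
    case (real y)
    then show ?thesis using assms \<open>a = ereal x\<close>
      by (intro exI[of _ "x - (x + y - c) / 2"] exI[of _ "y - (x + y - c) / 2"]) (auto simp: field_simps)
  next
    case PInf
    then show ?thesis using \<open>a = ereal x\<close> by (intro exI[of _ "x - 1"] exI[of _ "c - x + 1"]) auto
  qed (use assms in auto)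
next
  case PInf
  show ?thesis
  proof (cases b)
    case (real y)
    then show ?thesis using PInf by (intro exI[of _ "c - y + 1"] exI[of _ "y - 1"]) auto
  next
    case PInf
    then show ?thesis using \<open>a = \<infinity>\<close> by (intro exI[of _ c] exI[of _ 0]) auto
  qed (use assms in auto)
qed (use assms in auto)

text \<open>The lower limit is taken along a punctured filter, so the point x itself is added by
  hand.\<close>

lemma lsc_nhd:
  fixes u :: "'a::metric_space => ereal"
  assumes "open \<Omega>" "x \<in> \<Omega>" "u x \<le> Liminf (at x within \<Omega>) u" "ereal c < u x"
  shows "\<exists>d>0. ball x d \<subseteq> \<Omega> \<and> (\<forall>y\<in>ball x d. ereal c < u y)"
proof -
  have "eventually (\<lambda>y. ereal c < u y) (at x within \<Omega>)"
    using assms(3,4) by (intro less_LiminfD) (rule less_le_trans)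
  then obtain d where d: "d > 0" "\<And>y. y \<in> \<Omega> ==> y \<noteq> x ==> dist y x < d ==> ereal c < u y"
    unfolding eventually_at by auto
  obtain e where e: "e > 0" "ball x e \<subseteq> \<Omega>" using assms(1,2) by (meson openE)
  have "ereal c < u y" if y: "y \<in> ball x (min d e)" for y
  proof (cases "y = x")
    case False
    have "y \<in> ball x e" using y by simp
    then show ?thesis using d(2)[of y] False y e(2) by (auto simp: dist_commute)
  qed (use assms in simp)
  moreover have "ball x (min d e) \<subseteq> \<Omega>" using e(2) by auto
  ultimately show ?thesis using d(1) e(1) by (intro exI[of _ "min d e"]) auto
qed

text \<open>The function is a maximum of finitely many cones.\<close>

lemma lipschitz_between:
  fixes u w :: "'a::metric_space => ereal"
  assumes S: "compact S" and m: "\<And>y. y \<in> S ==> ereal m \<le> u y"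
    and loc: "\<And>x. x \<in> S ==> \<exists>c d. 0 < d \<and> (\<forall>y\<in>S \<inter> ball x d. ereal c < u y \<and> ereal (- c - \<epsilon>) < w y)"
  shows "\<exists>L \<phi>. L-lipschitz_on UNIV \<phi> \<and> (\<forall>y\<in>S. ereal (\<phi> y) \<le> u y \<and> ereal (- \<phi> y - \<epsilon>) \<le> w y)"
proof -
  obtain c d where cd: "\<And>x. x \<in> S ==> 0 < d x" 
    "\<And>x y. x \<in> S ==> y \<in> S ==> dist x y < d x ==> ereal (c x) < u y \<and> ereal (- c x - \<epsilon>) < w y"
    using loc by (metis Int_iff mem_ball)
  have cover: "S \<subseteq> (\<Union>x\<in>S. ball x (d x / 2))" using cd(1) by force
  obtain I where I: "I \<subseteq> S" "finite I" "S \<subseteq> (\<Union>x\<in>I. ball x (d x / 2))"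
    by (rule compactE_image[OF S _ cover]) auto
  have "\<exists>L \<phi>. L-lipschitz_on UNIV \<phi> \<and> (\<forall>y\<in>S. ereal (\<phi> y) \<le> u y) \<and> (\<forall>i\<in>J. \<forall>y\<in>ball i (d i / 2). c i \<le> \<phi> y)"
    if "finite J" "J \<subseteq> S" for J using that
  proof (induction J rule: finite_induct)
    case empty
    have "0-lipschitz_on UNIV (\<lambda>_::'a. m)" by (intro lipschitz_onI) auto
    then show ?case using m by blast
  next
    case (insert i J)
    then obtain L \<phi> where \<phi>: "L-lipschitz_on UNIV \<phi>" "\<And>y. y \<in> S ==> ereal (\<phi> y) \<le> u y" "\<forall>i\<in>J. \<forall>y\<in>ball i (d i / 2). c i \<le> \<phi> y"
      by blast
    have i: "i \<in> S" "0 < d i" using insert cd(1) by auto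
    \<comment> \<open>The slope at which the cone falls from \<open>c i\<close> to at most the lower
      bound \<open>m\<close> of \<open>u\<close> between the radii d i / 2 and d i, so that it stays
      below \<open>u\<close> outside the ball as well.\<close>
    define N where "N = \<bar>c i - m\<bar> / (d i / 2)"
    have N: "0 \<le> N" "N * (d i / 2) = \<bar>c i - m\<bar>" using i(2) by (auto simp: N_def)
    define \<psi> where "\<psi> y = c i - N * max 0 (dist y i - d i / 2)" for y
    have "N-lipschitz_on UNIV \<psi>"
    proof (rule lipschitz_onI[OF _ N(1)])
      fix x y :: 'a
      have "\<bar>max 0 (dist x i - d i / 2) - max 0 (dist y i - d i / 2)\<bar> \<le> dist x y"
        using dist_triangle[of x i y] dist_triangle[of y i x] dist_commute[of x y] by linarith
      then have "N * \<bar>max 0 (dist x i - d i / 2) - max 0 (dist y i - d i / 2)\<bar> \<le> N * dist x y" using N(1) by (rule mult_left_mono)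
      moreover have "dist (\<psi> x) (\<psi> y) = N * \<bar>max 0 (dist x i - d i / 2) - max 0 (dist y i - d i / 2)\<bar>"
      proof -
        have "\<bar>(c i - N * a) - (c i - N * b)\<bar> = N * \<bar>a - b\<bar>" for a b
        proof -
          have "(c i - N * a) - (c i - N * b) = N * (b - a)" by (simp add: algebra_simps)
          then show ?thesis using N(1) by (simp add: abs_mult abs_minus_commute)
        qed
        then show ?thesis by (simp add: \<psi>_def dist_real_def)
      qed
      ultimately show "dist (\<psi> x) (\<psi> y) \<le> N * dist x y" by simp
    qed
    moreover have "ereal (\<psi> y) \<le> u y" if y: "y \<in> S" for y
    proof (cases "dist i y < d i")
      case True
      have "\<psi> y \<le> c i" using N(1) by (simp add: \<psi>_def)
      then show ?thesis using cd(2)[OF i(1) y True] by (meson ereal_less_eq(3) less_imp_le order_trans)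
    next
      case False
      then have "N * (d i / 2) \<le> N * max 0 (dist y i - d i / 2)"
        using N(1) dist_commute[of i y] by (intro mult_left_mono) (linarith, simp)
      then have "\<psi> y \<le> m" using N(2) by (simp add: \<psi>_def)
      then show ?thesis using m[OF y] by (meson ereal_less_eq(3) order_trans)
    qed
    moreover have "\<psi> y = c i" if "y \<in> ball i (d i / 2)" for y using that by (simp add: \<psi>_def dist_commute)
    ultimately have 1: "ereal (max (\<phi> y) (\<psi> y)) \<le> u y" if "y \<in> S" for y using \<phi>(2) that by (simp add: max_def)
    have "c j \<le> max (\<phi> y) (\<psi> y)" if "j \<in> insert i J" "y \<in> ball j (d j / 2)" for j y
    proof (cases "j = i")
      case True
      then show ?thesis using \<open>\<And>y. y \<in> ball i (d i / 2) ==> \<psi> y = c i\<close> that(2) by simp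
    next
      case False
      then have "c j \<le> \<phi> y" using \<phi>(3) that by blast
      then show ?thesis by simp
    qed
    then show ?case using lipschitz_max[OF \<phi>(1) \<open>N-lipschitz_on UNIV \<psi>\<close>] 1 by blast
  qed
  from this[OF I(2,1)] obtain L \<phi> where \<phi>: "L-lipschitz_on UNIV \<phi>" "\<And>y. y \<in> S ==> ereal (\<phi> y) \<le> u y"
    "\<And>i y. i \<in> I ==> y \<in> ball i (d i / 2) ==> c i \<le> \<phi> y" by blast
  have "ereal (- \<phi> y - \<epsilon>) \<le> w y" if y: "y \<in> S" for y
  proof -
    obtain i where i: "i \<in> I" "y \<in> ball i (d i / 2)" using I(3) y by blast
    have iS: "i \<in> S" using i I by auto
    have "dist i y < d i" using i(2) cd(1)[OF iS] by simp
    then have "ereal (- c i - \<epsilon>) < w y" using cd(2)[OF iS y] by simp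
    then show ?thesis using \<phi>(3)[OF i] by (meson diff_right_mono ereal_less_eq(3) le_imp_neg_le less_imp_le order_trans)
  qed
  then show ?thesis using \<phi>(1,2) by blast
qed

section \<open>Superharmonic functions and upper Perron solutions\<close>

context pi_space
begin

lemma superharmonicD:
  assumes "superharmonic p \<mu> \<Omega> u"
  shows "\<And>x. x \<in> \<Omega> ==> u x \<noteq> -\<infinity>" and "\<And>x. x \<in> \<Omega> ==> u x \<le> Liminf (at x within \<Omega>) u"
    and "\<And>W. W \<in> components \<Omega> ==> \<exists>x\<in>W. u x \<noteq> \<infinity>"
    and "\<And>V v L x. open V ==> V \<noteq> {} ==> compact (closure V) ==> closure V \<subseteq> \<Omega> ==> L-lipschitz_on (closure V) v ==>
       (\<forall>x\<in>frontier V. ereal (v x) \<le> u x) ==> x \<in> V ==> ereal (Hext V v x) \<le> u x"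
proof -
  note * = assms[unfolded superharmonic_def]
  show "\<And>x. x \<in> \<Omega> ==> u x \<noteq> -\<infinity>" "\<And>x. x \<in> \<Omega> ==> u x \<le> Liminf (at x within \<Omega>) u" "\<And>W. W \<in> components \<Omega> ==> \<exists>x\<in>W. u x \<noteq> \<infinity>"
    using * by blast+
  show "ereal (Hext V v x) \<le> u x"
    if "open V" "V \<noteq> {}" "compact (closure V)" "closure V \<subseteq> \<Omega>" "L-lipschitz_on (closure V) v"
      "\<forall>x\<in>frontier V. ereal (v x) \<le> u x" "x \<in> V" for V v L x
  proof -
    from * have "\<forall>V v L. open V \<and> V \<noteq> {} \<and> compact (closure V) \<and> closure V \<subseteq> \<Omega> \<and> L-lipschitz_on (closure V) v \<and>
        (\<forall>x\<in>frontier V. ereal (v x) \<le> u x) --> (\<forall>x\<in>V. ereal (Hext V v x) \<le> u x)" by (elim conjE)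
    from this[rule_format, of V L v x] that show ?thesis by blast
  qed
qed

lemma Hdom_inside:
  assumes "0 < capacity p \<mu> (- \<Omega>)" "open V" "compact (closure V)" "closure V \<subseteq> \<Omega>" "L-lipschitz_on (closure V) v"
  shows "Hdom V v"
proof -
  have "- \<Omega> \<subseteq> - V" using assms(4) closure_subset[of V] by blast
  then have "0 < capacity p \<mu> (- V)" using assms(1) capacity_antimono less_le_trans by blast
  then show ?thesis using assms by (auto simp: Hdom_def)
qed

text \<open>A Lipschitz test function for a u + c is pulled back by the inverse affine map to one
  for \<open>u\<close>, and the harmonic extension commutes with that map.\<close>

lemma superharmonic_affine:
  assumes cap: "0 < capacity p \<mu> (- \<Omega>)" and u: "superharmonic p \<mu> \<Omega> u" and a: "0 < a"
  shows "superharmonic p \<mu> \<Omega> (\<lambda>x. ereal a * u x + ereal c)"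
proof -
  note u1 = superharmonicD(1)[OF u] and u2 = superharmonicD(2)[OF u] and u3 = superharmonicD(3)[OF u]
    and u4 = superharmonicD(4)[OF u]
  have fin: "ereal a * t + ereal c = \<infinity> \<longleftrightarrow> t = \<infinity>" "ereal a * t + ereal c = -\<infinity> \<longleftrightarrow> t = -\<infinity>" for t
    using a by (cases t, auto)+
  have "ereal (Hext V v x) \<le> ereal a * u x + ereal c"
    if V: "open V" "V \<noteq> {}" "compact (closure V)" "closure V \<subseteq> \<Omega>" and v: "L-lipschitz_on (closure V) v"
      and fr: "\<forall>x\<in>frontier V. ereal (v x) \<le> ereal a * u x + ereal c" and x: "x \<in> V" for V v L x
  proof -
    have H: "Hdom V v" by (rule Hdom_inside[OF cap V(1,3,4) v])
    have "((1 / a) * L)-lipschitz_on (closure V) (\<lambda>y. (1 / a) * v y + (- c / a))"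
    proof (rule lipschitz_onI)
      fix y z assume "y \<in> closure V" "z \<in> closure V"
      then have "\<bar>v y - v z\<bar> \<le> L * dist y z" using lipschitz_onD[OF v] by (auto simp: dist_real_def)
      moreover have "\<bar>((1 / a) * v y + (- c / a)) - ((1 / a) * v z + (- c / a))\<bar> = (1 / a) * \<bar>v y - v z\<bar>"
        using a by (simp add: diff_divide_distrib[symmetric])
      ultimately show "dist ((1 / a) * v y + (- c / a)) ((1 / a) * v z + (- c / a)) \<le> (1 / a) * L * dist y z"
        using a by (simp add: dist_real_def divide_right_mono)
    qed (use a lipschitz_on_nonneg[OF v] in simp)
    moreover have "\<forall>x\<in>frontier V. ereal ((1 / a) * v x + (- c / a)) \<le> u x"
      using fr ereal_affine_le_iff[OF a] by blast
    ultimately have "ereal (Hext V (\<lambda>y. (1 / a) * v y + (- c / a)) x) \<le> u x"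
      by (intro u4[OF V]) (use x in blast)+
    moreover have "Hext V (\<lambda>y. (1 / a) * v y + (- c / a)) x
        = (1 / a) * Hext V v x + (- c / a)"
      by (rule harmonic_extension_affine[OF H _ x]) (use a in simp)
    ultimately show ?thesis unfolding ereal_affine_le_iff[OF a] by simp
  qed
  moreover have "ereal a * u x + ereal c \<le> Liminf (at x within \<Omega>) (\<lambda>x. ereal a * u x + ereal c)" if "x \<in> \<Omega>" for x
    by (rule Liminf_affine_le[OF a u2[OF that]])
  moreover have "\<forall>x\<in>\<Omega>. ereal a * u x + ereal c \<noteq> -\<infinity>" "\<forall>W\<in>components \<Omega>. \<exists>x\<in>W. ereal a * u x + ereal c \<noteq> \<infinity>"
    unfolding fin using u1 u3 by blast+
  ultimately show ?thesis unfolding superharmonic_def by blast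
qed

text \<open>The boundary hypotheses and semicontinuity force the set where u + w \<le> - \<epsilon>
  to be compact in \<open>\<Omega>\<close>, so it can be enclosed in a relatively compact open set.
  On the frontier of that set the sum exceeds - \<epsilon>, which leaves room for \<phi>; the
  extensions of \<phi> and - \<phi> - \<epsilon> add up to - \<epsilon>.\<close>

lemma superharmonic_comparison:
  assumes \<Omega>: "open \<Omega>" and cap: "0 < capacity p \<mu> (- \<Omega>)"
    and u: "superharmonic p \<mu> \<Omega> u" and w: "superharmonic p \<mu> \<Omega> w" and m: "\<And>y. y \<in> \<Omega> ==> ereal m \<le> u y"
    and f: "\<And>z. z \<in> boundary \<Omega> ==> ereal (f z) \<le> Liminf (approach \<Omega> z) u"
      "\<And>z. z \<in> boundary \<Omega> ==> ereal (- f z) \<le> Liminf (approach \<Omega> z) w"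
    and x: "x \<in> \<Omega>"
  shows "0 \<le> u x + w x"
proof -
  note fin = superharmonicD(1)[OF u] superharmonicD(1)[OF w]
    and lsc = superharmonicD(2)[OF u] superharmonicD(2)[OF w]
  have loc: "\<exists>c d. 0 < d \<and> ball y d \<subseteq> \<Omega> \<and> (\<forall>z\<in>ball y d. ereal c < u z \<and> ereal (- c - \<epsilon>) < w z)"
    if y: "y \<in> \<Omega>" "ereal (- \<epsilon>) < u y + w y" for y \<epsilon>
  proof -
    obtain r s where rs: "- \<epsilon> \<le> r + s" "ereal r < u y" "ereal s < w y"
      using ereal_add_gt_split[OF y(2) fin(1)[OF y(1)] fin(2)[OF y(1)]] by blast
    obtain d where d: "d > 0" "ball y d \<subseteq> \<Omega>" "\<forall>z\<in>ball y d. ereal r < u z"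
      using lsc_nhd[OF \<Omega> y(1) lsc(1)[OF y(1)] rs(2)] by blast
    obtain d' where d': "d' > 0" "\<forall>z\<in>ball y d'. ereal s < w z"
      using lsc_nhd[OF \<Omega> y(1) lsc(2)[OF y(1)] rs(3)] by blast
    have "ereal (- r - \<epsilon>) < w z" if "z \<in> ball y (min d d')" for z
    proof -
      have "ereal s < w z" using that d'(2) by simp
      moreover have "ereal (- r - \<epsilon>) \<le> ereal s" using rs(1) by simp
      ultimately show ?thesis by (rule order.strict_trans1[rotated])
    qed
    moreover have "ball y (min d d') \<subseteq> \<Omega>" using d(2) by auto
    ultimately show ?thesis using d d' by (intro exI[of _ r] exI[of _ "min d d'"]) auto
  qed
  have "ereal (- \<epsilon>) \<le> u x + w x" if \<epsilon>: "0 < \<epsilon>" for \<epsilon>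
  proof (rule ccontr)
    assume neg: "\<not> ?thesis"
    define K where "K = {y \<in> \<Omega>. u y + w y \<le> ereal (- \<epsilon>)}"
    have xK: "x \<in> K" using neg x by (auto simp: K_def)
    \<comment> \<open>Near each boundary point, the point at infinity included, the two lower limits
      add up to at least 0, so u + w > - \<epsilon> there. The exclusion of z itself is harmless
      because z is not in the open set \<open>\<Omega>\<close>.\<close>
    have bd: "\<exists>T. openin Xstar T \<and> z \<in> T \<and> (\<forall>y\<in>K. Some y \<notin> T)" if z: "z \<in> boundary \<Omega>" for z
    proof -
      have "ereal (f z - \<epsilon> / 2) < ereal (f z)" using \<epsilon> by simp
      then have "eventually (\<lambda>y. ereal (f z - \<epsilon> / 2) < u y) (approach \<Omega> z)"
        using f(1)[OF z] by (intro less_LiminfD) (rule less_le_trans)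
      moreover have "ereal (- f z - \<epsilon> / 2) < ereal (- f z)" using \<epsilon> by simp
      then have "eventually (\<lambda>y. ereal (- f z - \<epsilon> / 2) < w y) (approach \<Omega> z)"
        using f(2)[OF z] by (intro less_LiminfD) (rule less_le_trans)
      ultimately have "eventually (\<lambda>y. ereal (- \<epsilon>) < u y + w y) (approach \<Omega> z)"
      proof eventually_elim
        case (elim y)
        have "ereal (f z - \<epsilon> / 2) + ereal (- f z - \<epsilon> / 2) < u y + w y" using elim by (intro ereal_add_strict_mono2)
        then show ?case by simp
      qed
      then obtain T where T: "openin Xstar T" "z \<in> T" "\<And>y. y \<in> \<Omega> ==> Some y \<in> T ==> Some y \<noteq> z ==> ereal (- \<epsilon>) < u y + w y"
        unfolding eventually_approach by blast
      have "Some y \<noteq> z" if "y \<in> \<Omega>" for y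
        using z \<Omega> that by (auto simp: boundary_def frontier_def interior_open split: if_splits)
      then have "Some y \<notin> T" if "y \<in> K" for y using T(3)[of y] that by (auto simp: K_def not_less)
      then show ?thesis using T by blast
    qed
    have "\<exists>d>0. ball y d \<subseteq> - K" if y: "y \<notin> K" for y
    proof -
      consider "y \<in> \<Omega>" | "y \<in> frontier \<Omega>" | "y \<in> - closure \<Omega>" using frontier_def \<Omega> interior_open by blast
      then show ?thesis
      proof cases
        case 1
        then have "ereal (- \<epsilon>) < u y + w y" using y by (simp add: K_def not_le)
        from loc[OF 1 this] obtain c d where d: "0 < d" "\<forall>z\<in>ball y d. ereal c < u z \<and> ereal (- c - \<epsilon>) < w z" by blast
        have "z \<notin> K" if "z \<in> ball y d" for z
        proof -
          have "ereal c + ereal (- c - \<epsilon>) < u z + w z" using d(2) that by (intro ereal_add_strict_mono2) auto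
          then show ?thesis by (simp add: K_def not_le)
        qed
        then show ?thesis using d(1) by blast
      next
        case 2
        then obtain T where T: "openin Xstar T" "Some y \<in> T" "\<forall>y\<in>K. Some y \<notin> T" using bd[of "Some y"] by (auto simp: boundary_def)
        have "y \<in> Some -` T" using T(2) by simp
        then obtain d where "d > 0" "ball y d \<subseteq> Some -` T" using openin_Xstar_Some[OF T(1)] by (meson openE)
        then show ?thesis using T(3) by blast
      next
        case 3
        then obtain d where "d > 0" "ball y d \<subseteq> - closure \<Omega>" by (meson openE closed_closure open_Compl)
        then show ?thesis using closure_subset[of \<Omega>] by (auto simp: K_def)
      qed
    qed
    then have clK: "closed K" unfolding closed_def by (auto simp: open_contains_ball)
    have bK: "bounded K"
    proof (cases "bounded \<Omega>")
      case True then show ?thesis by (rule bounded_subset) (auto simp: K_def)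
    next
      case False
      then obtain T where T: "openin Xstar T" "None \<in> T" "\<forall>y\<in>K. Some y \<notin> T" using bd[of None] by (auto simp: boundary_def)
      obtain C where C: "compact C" "T = insert None (Some ` (- C))" using openin_Xstar_None[OF T(1,2)] by blast
      have "K \<subseteq> C" using T(3) C(2) by auto
      then show ?thesis using compact_imp_bounded[OF C(1)] bounded_subset by blast
    qed
    have cK: "compact K" by (rule closed_bounded_compact[OF clK bK])
    have "\<exists>e>0. cball y e \<subseteq> \<Omega>" if "y \<in> K" for y using \<Omega> that by (simp add: open_contains_cball K_def)
    then obtain e where e: "\<And>y. y \<in> K ==> 0 < e y" "\<And>y. y \<in> K ==> cball y (e y) \<subseteq> \<Omega>" by metis
    have "K \<subseteq> (\<Union>y\<in>K. ball y (e y))" using e(1) by force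
    then obtain I where I: "I \<subseteq> K" "finite I" "K \<subseteq> (\<Union>y\<in>I. ball y (e y))"
      by (rule compactE_image[OF cK, rotated]) auto
    \<comment> \<open>Finitely many balls about points of \<open>K\<close> give an open set with
      compact closure in \<open>\<Omega>\<close> that contains \<open>K\<close>; the union
      \<open>Q\<close> of the closed balls controls its closure.\<close>
    define V where "V = (\<Union>y\<in>I. ball y (e y))"
    define Q where "Q = (\<Union>y\<in>I. cball y (e y))"
    have cQ: "compact Q" unfolding Q_def using I(2) by (intro compact_UN compact_cball_mm)
    have Q\<Omega>: "Q \<subseteq> \<Omega>" unfolding Q_def using I(1) e(2) by blast
    have oV: "open V" by (auto simp: V_def)
    have "V \<subseteq> Q" unfolding V_def Q_def by (intro UN_mono) auto
    then have clV: "closure V \<subseteq> Q" using compact_imp_closed[OF cQ] by (rule closure_minimal)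
    have cV: "compact (closure V)" using compact_Int_closed[OF cQ closed_closure[of V]] clV by (simp add: Int_absorb1)
    have V\<Omega>: "closure V \<subseteq> \<Omega>" using clV Q\<Omega> by blast
    have KV: "K \<subseteq> V" using I(3) by (simp add: V_def)
    have V0: "V \<noteq> {}" using KV xK by blast
    have Sc: "compact (frontier V)" unfolding frontier_def by (intro compact_diff cV) auto
    have S\<Omega>: "frontier V \<subseteq> \<Omega> - K" using V\<Omega> KV oV by (auto simp: frontier_def interior_open)
    have mS: "ereal m \<le> u y" if "y \<in> frontier V" for y using m S\<Omega> that by blast
    have locS: "\<exists>c d. 0 < d \<and> (\<forall>y\<in>frontier V \<inter> ball z d. ereal c < u y \<and> ereal (- c - \<epsilon>) < w y)" if z: "z \<in> frontier V" for z
    proof -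
      have "z \<in> \<Omega>" "ereal (- \<epsilon>) < u z + w z" using S\<Omega> z by (auto simp: K_def not_le)
      from loc[OF this] show ?thesis by blast
    qed
    obtain L \<phi> where \<phi>: "L-lipschitz_on UNIV \<phi>" "\<forall>y\<in>frontier V. ereal (\<phi> y) \<le> u y" "\<forall>y\<in>frontier V. ereal (- \<phi> y - \<epsilon>) \<le> w y"
      using lipschitz_between[OF Sc mS locS] by blast
    have Lc: "L-lipschitz_on (closure V) \<phi>" using \<phi>(1) by (rule lipschitz_on_subset) auto
    have H: "Hdom V \<phi>" by (rule Hdom_inside[OF cap oV cV V\<Omega> Lc])
    have "L-lipschitz_on (closure V) (\<lambda>y. - 1 * \<phi> y + - \<epsilon>)"
    proof (rule lipschitz_onI)
      show "dist (- 1 * \<phi> y + - \<epsilon>) (- 1 * \<phi> z + - \<epsilon>) \<le> L * dist y z" if "y \<in> closure V" "z \<in> closure V" for y z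
        using lipschitz_onD[OF Lc that] by (simp add: dist_real_def abs_minus_commute)
    qed (rule lipschitz_on_nonneg[OF Lc])
    moreover have "\<forall>y\<in>frontier V. ereal (- 1 * \<phi> y + - \<epsilon>) \<le> w y" using \<phi>(3) by simp
    ultimately have 2: "ereal (Hext V (\<lambda>y. - 1 * \<phi> y + - \<epsilon>) x) \<le> w x"
      by (rule superharmonicD(4)[OF w oV V0 cV V\<Omega>]) (use xK KV in blast)
    have xV: "x \<in> V" using xK KV by blast
    have 1: "ereal (Hext V \<phi> x) \<le> u x"
      by (rule superharmonicD(4)[OF u oV V0 cV V\<Omega> Lc \<phi>(2) xV])
    define t where "t = Hext V \<phi> x"
    have "Hext V (\<lambda>y. - 1 * \<phi> y + - \<epsilon>) x = - t - \<epsilon>"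
      unfolding t_def by (subst harmonic_extension_affine[OF H _ xV]) auto
    then have "ereal t + ereal (- t - \<epsilon>) \<le> u x + w x" using 1 2 by (intro add_mono) (auto simp: t_def)
    then show False using neg by simp
  qed
  show ?thesis
  proof (rule ccontr)
    assume "\<not> ?thesis"
    then have "u x + w x < ereal 0" by (simp add: not_le zero_ereal_def[symmetric])
    then obtain r where r: "u x + w x < ereal r" "ereal r < ereal 0" using ereal_dense2 by blast
    have "ereal (- (- r)) \<le> u x + w x" using r(2) by (intro \<open>\<And>\<epsilon>. 0 < \<epsilon> ==> ereal (- \<epsilon>) \<le> u x + w x\<close>) simp
    then show False using r(1) by simp
  qed
qed

text \<open>If \<open>u\<close> competes in the upper Perron solution of \<open>d\<close>, then a u
  + c competes in that of \<open>f\<close>.\<close>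

lemma upper_Perron_affine_le:
  assumes cap: "0 < capacity p \<mu> (- \<Omega>)" and a: "0 < a"
    and fd: "\<And>z. z \<in> boundary \<Omega> ==> f z \<le> ereal a * d z + ereal c"
  shows "upper_Perron p \<mu> \<Omega> f y \<le> ereal a * upper_Perron p \<mu> \<Omega> d y + ereal c"
proof -
  have le: "upper_Perron p \<mu> \<Omega> f y \<le> ereal a * u y + ereal c"
    if u: "superharmonic p \<mu> \<Omega> u" "\<forall>y\<in>\<Omega>. ereal m \<le> u y" "\<forall>z\<in>boundary \<Omega>. d z \<le> Liminf (approach \<Omega> z) u" for u m
    unfolding upper_Perron_def
  proof (rule INF_lower, safe)
    show "superharmonic p \<mu> \<Omega> (\<lambda>x. ereal a * u x + ereal c)" by (rule superharmonic_affine[OF cap u(1) a])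
    have "ereal (a * m + c) \<le> ereal a * u y + ereal c" if "y \<in> \<Omega>" for y
      using u(2) that a by (subst ereal_affine_le_iff[OF a]) (simp add: add_divide_distrib[symmetric] diff_divide_distrib[symmetric])
    then show "\<exists>m. \<forall>y\<in>\<Omega>. ereal m \<le> ereal a * u y + ereal c" by blast
    show "f z \<le> Liminf (approach \<Omega> z) (\<lambda>x. ereal a * u x + ereal c)" if z: "z \<in> boundary \<Omega>" for z
      using fd[OF z] Liminf_affine_le[OF a u(3)[rule_format, OF z], of c] by (rule order_trans)
  qed
  \<comment> \<open>Moves the affine map to the other side, so that the infimum over all
    \<open>u\<close> can be taken by \<open>INF_greatest\<close>.\<close>
  have inv: "upper_Perron p \<mu> \<Omega> f y \<le> ereal a * t + ereal c \<longleftrightarrow> ereal (1 / a) * upper_Perron p \<mu> \<Omega> f y + ereal (- c / a) \<le> t" for t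
    using a by (cases t; cases "upper_Perron p \<mu> \<Omega> f y") (auto simp: field_simps)
  have "ereal (1 / a) * upper_Perron p \<mu> \<Omega> f y + ereal (- c / a) \<le> upper_Perron p \<mu> \<Omega> d y"
    unfolding upper_Perron_def[of p \<mu> \<Omega> d]
  proof (rule INF_greatest, safe)
    fix u m assume "superharmonic p \<mu> \<Omega> u" "\<forall>y\<in>\<Omega>. ereal m \<le> u y" "\<forall>z\<in>boundary \<Omega>. d z \<le> Liminf (approach \<Omega> z) u"
    from le[OF this] show "ereal (1 / a) * upper_Perron p \<mu> \<Omega> f y + ereal (- c / a) \<le> u y" unfolding inv .
  qed
  then show ?thesis unfolding inv .
qed

text \<open>The left side is the lower Perron solution of \<open>f\<close>; the comparison of each
  pair of competitors yields the inequality of the infima.\<close>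

lemma upper_Perron_ge:
  assumes \<Omega>: "open \<Omega>" and cap: "0 < capacity p \<mu> (- \<Omega>)" and y: "y \<in> \<Omega>"
  shows "- upper_Perron p \<mu> \<Omega> (\<lambda>z. ereal (- f z)) y \<le> upper_Perron p \<mu> \<Omega> (\<lambda>z. ereal (f z)) y"
  unfolding upper_Perron_def[of p \<mu> \<Omega> "\<lambda>z. ereal (f z)"]
proof (rule INF_greatest, safe)
  fix u m assume u: "superharmonic p \<mu> \<Omega> u" "\<forall>y\<in>\<Omega>. ereal m \<le> u y" "\<forall>z\<in>boundary \<Omega>. ereal (f z) \<le> Liminf (approach \<Omega> z) u"
  have "- u y \<le> upper_Perron p \<mu> \<Omega> (\<lambda>z. ereal (- f z)) y"
    unfolding upper_Perron_def
  proof (rule INF_greatest, safe)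
    fix w m' assume w: "superharmonic p \<mu> \<Omega> w" "\<forall>y\<in>\<Omega>. ereal m' \<le> w y" "\<forall>z\<in>boundary \<Omega>. ereal (- f z) \<le> Liminf (approach \<Omega> z) w"
    have "0 \<le> u y + w y"
      by (rule superharmonic_comparison[OF \<Omega> cap u(1) w(1), of m f]) (use u w y in auto)
    then show "- u y \<le> w y"
      using superharmonicD(1)[OF u(1) y] superharmonicD(1)[OF w(1) y] by (cases "u y"; cases "w y") auto
  qed
  then show "- upper_Perron p \<mu> \<Omega> (\<lambda>z. ereal (- f z)) y \<le> u y" by (simp add: ereal_uminus_le_reorder)
qed

lemma eventually_approach_in: "z \<in> boundary \<Omega> ==> eventually (\<lambda>y. y \<in> \<Omega>) (approach \<Omega> z)"
  unfolding eventually_approach 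
  by (intro exI[of _ "topspace Xstar"] conjI openin_topspace) (cases z, auto)

lemma upper_Perron_tendsto:
  assumes \<Omega>: "open \<Omega>" and cap: "0 < capacity p \<mu> (- \<Omega>)" and x0: "x0 \<in> boundary \<Omega>"
    and 1: "Limsup (approach \<Omega> x0) (upper_Perron p \<mu> \<Omega> (\<lambda>z. ereal (f z))) \<le> ereal (f x0)"
    and 2: "Limsup (approach \<Omega> x0) (upper_Perron p \<mu> \<Omega> (\<lambda>z. ereal (- f z))) \<le> ereal (- f x0)"
  shows "(upper_Perron p \<mu> \<Omega> (\<lambda>z. ereal (f z)) \<longlongrightarrow> ereal (f x0)) (approach \<Omega> x0)"
proof (rule order_tendstoI)
  fix t assume t: "ereal (f x0) < t"
  then show "eventually (\<lambda>y. upper_Perron p \<mu> \<Omega> (\<lambda>z. ereal (f z)) y < t) (approach \<Omega> x0)"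
    using 1 by (intro Limsup_lessD) (rule le_less_trans)
next
  fix t assume "t < ereal (f x0)"
  then have "ereal (- f x0) < - t" by (cases t) auto
  then have "eventually (\<lambda>y. upper_Perron p \<mu> \<Omega> (\<lambda>z. ereal (- f z)) y < - t) (approach \<Omega> x0)"
    using 2 by (intro Limsup_lessD) (rule le_less_trans)
  then show "eventually (\<lambda>y. t < upper_Perron p \<mu> \<Omega> (\<lambda>z. ereal (f z)) y) (approach \<Omega> x0)"
    using eventually_approach_in[OF x0]
  proof eventually_elim
    case (elim y)
    then have "t < - upper_Perron p \<mu> \<Omega> (\<lambda>z. ereal (- f z)) y" by (simp add: ereal_less_uminus_reorder)
    then show ?case using upper_Perron_ge[OF \<Omega> cap elim(2), of f] by (rule less_le_trans)
  qed
qed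

end

section \<open>The function \<open>dist_fun\<close> as test function, and the equivalences\<close>

lemma dist_fun_self: "dist_fun x1 x0 x0 = 0"
  by (cases x0) auto

lemma dist_fun_bounds: "0 \<le> dist_fun x1 x0 z" "dist_fun x1 x0 z \<le> 1"
  by (cases x0; cases z; auto)+

text \<open>At a finite point a neighbourhood contains a metric ball; at infinity its complement is
  compact, so the distance to \<open>x1\<close> is bounded by some r on it and exp(- r)
  serves.\<close>

lemma dist_fun_off_nhd:
  assumes T: "openin Xstar T" "x0 \<in> T"
  shows "\<exists>\<delta>>0. \<forall>z. z \<notin> T --> \<delta> \<le> dist_fun x1 x0 z"
proof (cases x0)
  case (Some a)
  then have "a \<in> Some -` T" using T(2) by simp
  then obtain d where d: "d > 0" "ball a d \<subseteq> Some -` T" using openin_Xstar_Some[OF T(1)] by (meson openE)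
  have "min d 1 \<le> dist_fun x1 x0 z" if "z \<notin> T" for z
  proof (cases z)
    case None then show ?thesis using Some by simp
  next
    case (Some y)
    then have "y \<notin> ball a d" using d(2) that by auto
    then show ?thesis using Some \<open>x0 = Some a\<close> by (auto simp: dist_commute)
  qed
  then show ?thesis using d(1) by (intro exI[of _ "min d 1"]) auto
next
  case None
  then obtain C where C: "compact C" "T = insert None (Some ` (- C))" using openin_Xstar_None T by blast
  obtain r where r: "\<forall>y\<in>C. dist x1 y \<le> r" using compact_imp_bounded[OF C(1)] bounded_any_center[of C x1] by auto
  have "exp (- r) \<le> dist_fun x1 x0 z" if "z \<notin> T" for z
    using that C(2) r None by (cases z) (auto simp: dist_commute)
  then show ?thesis by (intro exI[of _ "exp (- r)"]) auto
qed

context pi_space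
begin

text \<open>Neighbourhoods of infinity are complements of compact sets, so the preimage of
  \<open>W\<close> must have compact complement if it contains infinity. The values force this
  complement to be bounded, and closed bounded sets are compact.\<close>

lemma continuous_map_dist_fun: "continuous_map Xstar euclideanreal (dist_fun (x1::'a) x0)"
  unfolding continuous_map_def
proof (intro conjI allI impI)
  show "dist_fun x1 x0 \<in> topspace Xstar \<rightarrow> topspace euclideanreal" by simp
  fix W :: "real set" assume "openin euclideanreal W"
  then have W: "open W" by simp
  have c: "continuous_on UNIV (\<lambda>y. dist_fun x1 x0 (Some y))"
    by (cases x0) (auto intro!: continuous_intros)
  define U where "U = (\<lambda>y. dist_fun x1 x0 (Some y)) -` W"
  have oU: "open U" using open_vimage[OF W c] by (simp add: U_def)
  have S: "{z \<in> topspace Xstar. dist_fun x1 x0 z \<in> W} = (if dist_fun x1 x0 None \<in> W then insert None (Some ` U) else Some ` U)"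
    by (auto simp: U_def image_iff)
  show "openin Xstar {z \<in> topspace Xstar. dist_fun x1 x0 z \<in> W}"
  proof (cases "dist_fun x1 x0 None \<in> W")
    case False
    then show ?thesis unfolding S using oU by simp
  next
    case True
    then obtain e where e: "e > 0" "ball (dist_fun x1 x0 None) e \<subseteq> W" using W by (meson openE)
    have "\<exists>b r. \<forall>y. y \<notin> U --> dist b y \<le> r"
    proof (cases x0)
      case (Some b)
      have "dist b y \<le> 1" if "y \<notin> U" for y
      proof (rule ccontr)
        assume "\<not> ?thesis"
        then have "dist_fun x1 x0 (Some y) = 1" using Some by (simp add: dist_commute)
        then show False using that True Some by (simp add: U_def)
      qed
      then show ?thesis by blast
    next
      case None
      have "dist x1 y \<le> - ln e" if "y \<notin> U" for y
      proof (rule ccontr)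
        assume "\<not> ?thesis"
        then have "- dist x1 y < ln e" by simp
        then have "exp (- dist x1 y) < exp (ln e)" by (rule exp_less_mono)
        then have "exp (- dist x1 y) < e" using e(1) by simp
        then have "dist_fun x1 x0 (Some y) \<in> ball (dist_fun x1 x0 None) e" using None by (simp add: dist_commute)
        then show False using that e(2) by (auto simp: U_def)
      qed
      then show ?thesis by blast
    qed
    then have "bounded (- U)" unfolding bounded_def by auto
    then have "compact (- U)" using oU by (intro closed_bounded_compact) auto
    moreover have "insert None (Some ` U) = insert None (Some ` (topspace euclidean - (- U)))" by auto
    ultimately show ?thesis unfolding S openin_Alexandroff_compactification using True oU
      by (intro disjI2 exI[of _ "- U"]) auto
  qed
qed

lemma continuous_on_boundary_dist_fun: "continuous_on_boundary \<Omega> (dist_fun (x1::'a) x0)"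
  unfolding continuous_on_boundary_def by (rule continuous_map_from_subtopology[OF continuous_map_dist_fun])

end

lemma Limsup_le_tendsto:
  fixes f :: "'b => ereal" assumes "(f \<longlongrightarrow> l) F" shows "Limsup F f \<le> l"
proof (rule dense_ge)
  fix x assume "l < x"
  then have "eventually (\<lambda>y. f y < x) F" by (rule order_tendstoD[OF assms])
  then have "eventually (\<lambda>y. f y \<le> x) F" by eventually_elim simp
  then show "Limsup F f \<le> x" by (rule Limsup_bounded)
qed

lemma continuous_on_boundary_uminus: "continuous_on_boundary \<Omega> f ==> continuous_on_boundary \<Omega> (\<lambda>z. - f z)"
  unfolding continuous_on_boundary_def by (rule continuous_map_minus)

lemma continuous_on_boundary_tendsto:
  assumes "continuous_on_boundary \<Omega> f" "x0 \<in> boundary \<Omega>"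
  shows "(f \<longlongrightarrow> f x0) (atin_within Xstar x0 (boundary \<Omega>))"
proof -
  have "x0 \<in> topspace (subtopology Xstar (boundary \<Omega>))" using assms(2) by (cases x0) auto
  then have "limitin euclideanreal f (f x0) (atin (subtopology Xstar (boundary \<Omega>)) x0)"
    using assms(1) unfolding continuous_on_boundary_def continuous_map_atin by blast
  then show ?thesis using assms(2) by (simp add: atin_subtopology_within)
qed

context pi_space
begin

text \<open>Makes continuous boundary functions bounded, so that they belong to the class of
  functions in (d).\<close>

lemma compactin_boundary: "compactin Xstar (boundary (\<Omega>::'a set))"
proof (rule closedin_compact_space)
  show "compact_space (Xstar :: 'a option topology)" by simp
  show "closedin Xstar (boundary \<Omega>)"
  proof (cases "bounded \<Omega>")
    case True
    then have "bounded (frontier \<Omega>)"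
      unfolding frontier_def by (intro bounded_diff bounded_closure)
    then have "compact (frontier \<Omega>)" by (intro closed_bounded_compact frontier_closed)
    moreover have "boundary \<Omega> = Some ` frontier \<Omega>" using True by (simp add: boundary_def)
    ultimately show ?thesis by (simp add: frontier_closed)
  next
    case False
    have "boundary \<Omega> = topspace Xstar - Some ` (- frontier \<Omega>)" using False by (auto simp: boundary_def image_iff)
    moreover have "open (- frontier \<Omega>)" by (simp add: frontier_closed open_Compl)
    ultimately show ?thesis unfolding closedin_Alexandroff_compactification by auto
  qed
qed

lemma continuous_on_boundary_bounded:
  assumes "continuous_on_boundary (\<Omega>::'a set) f" shows "bounded (f ` boundary \<Omega>)"
proof -
  have "compactin (subtopology Xstar (boundary \<Omega>)) (boundary \<Omega>)"
    using compactin_boundary by (simp add: compactin_subtopology)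
  then have "compactin euclideanreal (f ` boundary \<Omega>)"
    using assms unfolding continuous_on_boundary_def by (rule image_compactin)
  then show ?thesis by (simp add: compact_imp_bounded)
qed

lemma barrier_Limsup_le:
  assumes cap: "0 < capacity p \<mu> (- \<Omega>)" and x0: "x0 \<in> boundary \<Omega>"
    and b: "(upper_Perron p \<mu> \<Omega> (\<lambda>z. ereal (dist_fun x1 x0 z)) \<longlongrightarrow> 0) (approach \<Omega> x0)"
    and M: "\<And>z. z \<in> boundary \<Omega> ==> f z \<le> ereal M"
    and usc: "Limsup (atin_within Xstar x0 (boundary \<Omega>)) f \<le> f x0"
  shows "Limsup (approach \<Omega> x0) (upper_Perron p \<mu> \<Omega> f) \<le> f x0"
proof (rule dense_ge)
  fix x assume x: "f x0 < x"
  then obtain \<beta> where \<beta>: "f x0 < ereal \<beta>" "ereal \<beta> < x" using ereal_dense2 by blast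
  \<comment> \<open>\<open>\<alpha>\<close> bounds \<open>f\<close> near \<open>x0\<close>; the gap
    between \<open>\<alpha>\<close> and \<open>\<beta>\<close> is left for the multiple of the
    Perron solution of \<open>dist_fun\<close>.\<close>
  then obtain \<alpha> where \<alpha>: "f x0 < ereal \<alpha>" "ereal \<alpha> < ereal \<beta>" using ereal_dense2 by blast
  have "eventually (\<lambda>z. f z < ereal \<alpha>) (atin_within Xstar x0 (boundary \<Omega>))"
    using usc \<alpha>(1) by (intro Limsup_lessD) (rule le_less_trans)
  moreover have "x0 \<in> topspace Xstar" by (cases x0) auto
  ultimately obtain T where T: "openin Xstar T" "x0 \<in> T" "\<And>z. z \<in> T ==> z \<in> boundary \<Omega> ==> z \<noteq> x0 ==> f z < ereal \<alpha>"
    unfolding eventually_atin_within by blast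
  obtain \<delta> where \<delta>: "\<delta> > 0" "\<And>z. z \<notin> T ==> \<delta> \<le> dist_fun x1 x0 z" using dist_fun_off_nhd[OF T(1,2), of x1] by blast
  \<comment> \<open>Chosen so that a \<delta> exceeds M - \<alpha>: outside \<open>T\<close> the
    multiple of \<open>dist_fun\<close> alone lifts \<open>\<alpha>\<close> above the global bound
    \<open>M\<close>. The maximum with 0 and the summand 1 keep \<open>a\<close> positive.\<close>
  define a where "a = (max (M - \<alpha>) 0 + 1) / \<delta>"
  have a: "0 < a" "max (M - \<alpha>) 0 + 1 = a * \<delta>" using \<delta>(1) by (auto simp: a_def add_nonneg_pos)
  have fd: "f z \<le> ereal a * ereal (dist_fun x1 x0 z) + ereal \<alpha>" if z: "z \<in> boundary \<Omega>" for z
  proof (cases "z \<in> T")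
    case True
    then have "f z \<le> ereal \<alpha>" using T(3)[OF _ z] \<alpha>(1) by (cases "z = x0") auto
    moreover have "0 \<le> a * dist_fun x1 x0 z" using a(1) dist_fun_bounds(1)[of x1 x0 z] by simp
    then have "ereal \<alpha> \<le> ereal (a * dist_fun x1 x0 z + \<alpha>)" by simp
    ultimately have "f z \<le> ereal (a * dist_fun x1 x0 z + \<alpha>)" by (rule order_trans)
    then show ?thesis by simp
  next
    case False
    have "a * \<delta> \<le> a * dist_fun x1 x0 z" using \<delta>(2)[OF False] a(1) by (intro mult_left_mono) auto
    then have "M \<le> a * dist_fun x1 x0 z + \<alpha>" unfolding a(2)[symmetric] by linarith
    then have "ereal M \<le> ereal (a * dist_fun x1 x0 z + \<alpha>)" by simp
    with M[OF z] have "f z \<le> ereal (a * dist_fun x1 x0 z + \<alpha>)" by (rule order_trans)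
    then show ?thesis by simp
  qed
  have "eventually (\<lambda>y. upper_Perron p \<mu> \<Omega> (\<lambda>z. ereal (dist_fun x1 x0 z)) y < ereal ((\<beta> - \<alpha>) / a)) (approach \<Omega> x0)"
    using \<alpha>(2) a(1) by (intro order_tendstoD(2)[OF b]) simp
  then have "eventually (\<lambda>y. upper_Perron p \<mu> \<Omega> f y \<le> x) (approach \<Omega> x0)"
  proof eventually_elim
    case (elim y)
    have "upper_Perron p \<mu> \<Omega> f y \<le> ereal a * upper_Perron p \<mu> \<Omega> (\<lambda>z. ereal (dist_fun x1 x0 z)) y + ereal \<alpha>"
      by (rule upper_Perron_affine_le[OF cap a(1) fd])
    also have "\<dots> \<le> ereal a * ereal ((\<beta> - \<alpha>) / a) + ereal \<alpha>"
      using elim a(1) by (intro add_right_mono ereal_mult_left_mono) auto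
    also have "\<dots> \<le> x" using a(1) \<beta>(2) by simp
    finally show ?case .
  qed
  then show "Limsup (approach \<Omega> x0) (upper_Perron p \<mu> \<Omega> f) \<le> x" by (rule Limsup_bounded)
qed

text \<open>The implications run a, b, c, d, a in a cycle, and between a and e in both directions.
  The steps from c to d and from e to a apply the one-sided estimate to both \<open>f\<close> and
  \<open>- f\<close>.\<close>

lemma boundary_regularity_characterization:
  fixes x1 :: 'a
  assumes \<Omega>: "open \<Omega>" and cap: "0 < capacity p \<mu> (- \<Omega>)" and x0: "x0 \<in> boundary \<Omega>"
  defines "P \<equiv> upper_Perron p \<mu> \<Omega>"
  defines "a \<equiv> regular_point p \<mu> \<Omega> x0"
    and "b \<equiv> (P (\<lambda>z. ereal (dist_fun x1 x0 z)) \<longlongrightarrow> 0) (approach \<Omega> x0)"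
    and "c \<equiv> (\<forall>f :: 'a option => ereal. (\<forall>z\<in>boundary \<Omega>. f z \<noteq> \<infinity>) \<and> (\<exists>M::real. \<forall>z\<in>boundary \<Omega>. f z \<le> ereal M) \<and>
           Limsup (atin_within Xstar x0 (boundary \<Omega>)) f \<le> f x0 --> Limsup (approach \<Omega> x0) (P f) \<le> f x0)"
    and "d \<equiv> (\<forall>f :: 'a option => real. bounded (f ` boundary \<Omega>) \<and> (f \<longlongrightarrow> f x0) (atin_within Xstar x0 (boundary \<Omega>)) -->
           (P (\<lambda>z. ereal (f z)) \<longlongrightarrow> ereal (f x0)) (approach \<Omega> x0))"
    and "e \<equiv> (\<forall>f :: 'a option => real. continuous_on_boundary \<Omega> f -->
           Limsup (approach \<Omega> x0) (P (\<lambda>z. ereal (f z))) \<le> ereal (f x0))"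
  shows "(a \<longleftrightarrow> b) \<and> (a \<longleftrightarrow> c) \<and> (a \<longleftrightarrow> d) \<and> (a \<longleftrightarrow> e)"
proof -
  have ab: b if a
  proof -
    have "(P (\<lambda>z. ereal (dist_fun x1 x0 z)) \<longlongrightarrow> ereal (dist_fun x1 x0 x0)) (approach \<Omega> x0)"
      using that continuous_on_boundary_dist_fun unfolding a_def regular_point_def P_def by blast
    then show b unfolding b_def dist_fun_self zero_ereal_def .
  qed
  have bc: c if b
  proof -
    have "Limsup (approach \<Omega> x0) (P f) \<le> f x0"
      if f: "\<forall>z\<in>boundary \<Omega>. f z \<le> ereal M" "Limsup (atin_within Xstar x0 (boundary \<Omega>)) f \<le> f x0" for f M
      unfolding P_def
      by (rule barrier_Limsup_le[OF cap x0 \<open>b\<close>[unfolded b_def P_def], of f M]) (use f in auto)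
    then show c unfolding c_def by blast
  qed
  have cd: d if c
    unfolding d_def P_def
  proof (intro allI impI, elim conjE)
    fix f :: "'a option => real"
    assume bd: "bounded (f ` boundary \<Omega>)" and lim: "(f \<longlongrightarrow> f x0) (atin_within Xstar x0 (boundary \<Omega>))"
    obtain M where M: "\<And>z. z \<in> boundary \<Omega> ==> \<bar>f z\<bar> \<le> M" using bd unfolding bounded_iff by auto
    have *: "Limsup (approach \<Omega> x0) (P (\<lambda>z. ereal (g z))) \<le> ereal (g x0)"
      if "\<And>z. z \<in> boundary \<Omega> ==> g z \<le> M" "(g \<longlongrightarrow> g x0) (atin_within Xstar x0 (boundary \<Omega>))" for g
    proof -
      have "Limsup (atin_within Xstar x0 (boundary \<Omega>)) (\<lambda>z. ereal (g z)) \<le> ereal (g x0)"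
        by (rule Limsup_le_tendsto) (use that(2) in simp)
      moreover have "\<forall>z\<in>boundary \<Omega>. ereal (g z) \<le> ereal M" using that(1) by simp
      ultimately show ?thesis using \<open>c\<close>[unfolded c_def, rule_format, of "\<lambda>z. ereal (g z)"] by auto
    qed
    show "(upper_Perron p \<mu> \<Omega> (\<lambda>z. ereal (f z)) \<longlongrightarrow> ereal (f x0)) (approach \<Omega> x0)"
    proof (rule upper_Perron_tendsto[OF \<Omega> cap x0])
      show "Limsup (approach \<Omega> x0) (upper_Perron p \<mu> \<Omega> (\<lambda>z. ereal (f z))) \<le> ereal (f x0)"
        using *[OF _ lim] M unfolding P_def by (meson abs_le_D1)
      show "Limsup (approach \<Omega> x0) (upper_Perron p \<mu> \<Omega> (\<lambda>z. ereal (- f z))) \<le> ereal (- f x0)"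
        using *[of "\<lambda>z. - f z"] M tendsto_minus[OF lim] unfolding P_def by (meson abs_le_D2)
    qed
  qed
  have da: a if d
    using that continuous_on_boundary_bounded continuous_on_boundary_tendsto[OF _ x0]
    unfolding a_def d_def regular_point_def P_def by blast
  have ae: e if a
    using that Limsup_le_tendsto unfolding a_def e_def regular_point_def P_def by blast
  have ea: a if e
    unfolding a_def regular_point_def
  proof (intro allI impI)
    fix f :: "'a option => real" assume f: "continuous_on_boundary \<Omega> f"
    show "(upper_Perron p \<mu> \<Omega> (\<lambda>z. ereal (f z)) \<longlongrightarrow> ereal (f x0)) (approach \<Omega> x0)"
      using that f continuous_on_boundary_uminus[OF f] unfolding e_def P_def
      by (intro upper_Perron_tendsto[OF \<Omega> cap x0]) blast+
  qed
  show ?thesis using ab bc cd da ae ea by blast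
qed

end

theorem theorem5p1:
  fixes p :: real
    and \<mu> :: "'a::complete_space measure"
    and \<Omega> :: "'a set"
    and x0 :: "'a option"
    and x1 :: 'a
  assumes "1 < p"
    and "complete_borel_measure \<mu>"
    and "positive_finite_on_balls \<mu>"
    and "doubling_measure \<mu>"
    and "supports_Poincare p \<mu>"
    and "open \<Omega>"
    and "\<Omega> \<noteq> {}"
    and "0 < capacity p \<mu> (- \<Omega>)"
    and "x0 \<in> boundary \<Omega>"
  shows
    "(regular_point p \<mu> \<Omega> x0 \<longleftrightarrow>
        (upper_Perron p \<mu> \<Omega> (\<lambda>z. ereal (dist_fun x1 x0 z)) \<longlongrightarrow> 0) (approach \<Omega> x0)) \<and>
     (regular_point p \<mu> \<Omega> x0 \<longleftrightarrow>
        (\<forall>f :: 'a option \<Rightarrow> ereal.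
           (\<forall>z\<in>boundary \<Omega>. f z \<noteq> \<infinity>) \<and>
           (\<exists>M::real. \<forall>z\<in>boundary \<Omega>. f z \<le> ereal M) \<and>
           Limsup (atin_within Xstar x0 (boundary \<Omega>)) f \<le> f x0 \<longrightarrow>
           Limsup (approach \<Omega> x0) (upper_Perron p \<mu> \<Omega> f) \<le> f x0)) \<and>
     (regular_point p \<mu> \<Omega> x0 \<longleftrightarrow>
        (\<forall>f :: 'a option \<Rightarrow> real.
           bounded (f ` boundary \<Omega>) \<and>
           (f \<longlongrightarrow> f x0) (atin_within Xstar x0 (boundary \<Omega>)) \<longrightarrow>
           (upper_Perron p \<mu> \<Omega> (\<lambda>z. ereal (f z)) \<longlongrightarrow> ereal (f x0)) (approach \<Omega> x0))) \<and>
     (regular_point p \<mu> \<Omega> x0 \<longleftrightarrow>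
        (\<forall>f :: 'a option \<Rightarrow> real.
           continuous_on_boundary \<Omega> f \<longrightarrow>
           Limsup (approach \<Omega> x0) (upper_Perron p \<mu> \<Omega> (\<lambda>z. ereal (f z))) \<le> ereal (f x0)))"
proof -
  obtain C where C: "1 \<le> C"
    "\<And>x r. 0 < r ==> emeasure \<mu> (ball x (2 * r)) \<le> ennreal C * emeasure \<mu> (ball x r)"
    using assms(4) unfolding doubling_measure_def by blast
  have C2: "emeasure \<mu> (ball x (2 * r)) \<le> ennreal (max 2 C) * emeasure \<mu> (ball x r)" if "0 < r" for x r
  proof -
    note C(2)[OF that, of x]
    also have "ennreal C * emeasure \<mu> (ball x r) \<le> ennreal (max 2 C) * emeasure \<mu> (ball x r)"
      by (intro mult_right_mono ennreal_leI) auto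
    finally show ?thesis .
  qed
  obtain CP \<tau> where P: "0 < CP" "1 \<le> \<tau>" "\<And>x r f g. 0 < r ==> f \<in> borel_measurable \<mu> ==>
      (\<integral>\<^sup>+y. e2ennreal \<bar>f y\<bar> \<partial>\<mu>) < \<infinity> ==> weak_upper_gradient p \<mu> UNIV f g ==>
      (\<integral>\<^sup>+y\<in>ball x r. e2ennreal \<bar>f y - ereal (mean_value \<mu> (ball x r) f)\<bar> \<partial>\<mu>) / emeasure \<mu> (ball x r)
        \<le> ennreal (CP * diameter (ball x r)) *
          epowr ((\<integral>\<^sup>+y\<in>ball x (\<tau> * r). epowr (g y) p \<partial>\<mu>) / emeasure \<mu> (ball x (\<tau> * r))) (1 / p)"
    using assms(5) unfolding supports_Poincare_def by blast
  interpret pi_space p \<mu> "max 2 C" CP \<tau>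
  proof
    show "0 < emeasure \<mu> (ball x r) \<and> emeasure \<mu> (ball x r) < \<infinity>" if "0 < r" for x r
      using assms(3) that unfolding positive_finite_on_balls_def by blast
  qed (use assms(1,2) C2 P in auto)
  show ?thesis by (rule boundary_regularity_characterization[OF assms(6,8,9)])
qed

end
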